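(* Let $\epsilon\in(0,1/2]$. Given $n$ points in $\ell_2^d$ with $(\tau,c)$-expansion rate, for some constant $c$, there exists a randomized data structure which requires $O(dn)$ space and reports a $(1+\epsilon)^3$-approximate nearest neighbor of a query point in time $$O\!\left(\left(c^{\log(\log c/\epsilon)}+\tau\cdot c^2\right)d\,\log n\right).$$ The preprocessing time is $O(dn\log n)$. For each query $q\in\mathbb{R}^d$, the preprocessing phase succeeds with constant probability.
   Context: $\ell_2^d$ is $\mathbb{R}^d$ with the Euclidean norm. Expansion rate: let $M$ be a metric space (here $M=\ell_2^d$), $X\subseteq M$ a finite point set, and let $B_p(r)\subseteq X$ be the set of points of $X$ lying in the closed ball with center $p$ and radius $r$. $X$ has $(\tau,c)$-expansion rate iff for all $p\in M$ and $r>0$: $|B_p(r)|\ge\tau\implies|B_p(2r)|\le c\cdot|B_p(r)|$. For $a\ge1$, an $a$-approximate nearest neighbor of $q$ in $X$ is a point $p\in X$ with $\|q-p\|\le a\,\|q-p'\|$ for all $p'\in X$. The data structure is built in a randomized preprocessing phase, before the query is known; "the preprocessing phase succeeds for $q$" means that, with the random choices made during preprocessing, the query algorithm on input $q$ returns a correct answer. *)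

theory Defs
  imports "HOL-Probability.Probability"
begin

section \<open>Euclidean space, expansion rate and approximate nearest neighbours\<close>

text \<open>The dimension is a natural number that is quantified inside the statement, so \<open>\<real>\<^sup>d\<close> is
  represented by the functions \<open>nat \<Rightarrow> real\<close> that vanish from index \<open>d\<close> on.\<close>

definition l2_space :: "nat \<Rightarrow> (nat \<Rightarrow> real) set" where
  "l2_space d = {x. \<forall>i\<ge>d. x i = 0}"

definition l2_dist :: "nat \<Rightarrow> (nat \<Rightarrow> real) \<Rightarrow> (nat \<Rightarrow> real) \<Rightarrow> real" where
  "l2_dist d x y = L2_set (\<lambda>i. x i - y i) {..<d}"

lemma Metric_space_l2: "Metric_space (l2_space d) (l2_dist d)"
proof
  fix x y z :: "nat \<Rightarrow> real"
  show "0 \<le> l2_dist d x y"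
    by (simp add: l2_dist_def)
  show "l2_dist d x y = l2_dist d y x"
    by (simp add: l2_dist_def L2_set_def power2_commute)
  assume xy: "x \<in> l2_space d" "y \<in> l2_space d"
  show "l2_dist d x y = 0 \<longleftrightarrow> x = y"
  proof
    assume "l2_dist d x y = 0"
    then have "\<forall>i<d. x i = y i"
      by (simp add: l2_dist_def L2_set_eq_0_iff)
    moreover have "\<forall>i\<ge>d. x i = y i"
      using xy by (simp add: l2_space_def)
    ultimately show "x = y"
      by (metis ext linorder_not_less)
  qed (simp add: l2_dist_def L2_set_eq_0_iff)
  assume "z \<in> l2_space d"
  show "l2_dist d x z \<le> l2_dist d x y + l2_dist d y z"
    using L2_set_triangle_ineq[of "\<lambda>i. x i - y i" "\<lambda>i. y i - z i" "{..<d}"]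
    by (simp add: l2_dist_def)
qed

definition expansion_rate ::
    "'a set \<Rightarrow> ('a \<Rightarrow> 'a \<Rightarrow> real) \<Rightarrow> 'a set \<Rightarrow> real \<Rightarrow> real \<Rightarrow> bool" where
  "expansion_rate M dst X \<tau> c \<longleftrightarrow>
     finite X \<and> X \<subseteq> M \<and>
     (\<forall>p\<in>M. \<forall>r>0. real (card (X \<inter> Metric_space.mcball M dst p r)) \<ge> \<tau> \<longrightarrow>
        real (card (X \<inter> Metric_space.mcball M dst p (2 * r)))
          \<le> c * real (card (X \<inter> Metric_space.mcball M dst p r)))"

definition approx_nn ::
    "('a \<Rightarrow> 'a \<Rightarrow> real) \<Rightarrow> real \<Rightarrow> 'a set \<Rightarrow> 'a \<Rightarrow> 'a \<Rightarrow> bool" where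
  "approx_nn dst a X q p \<longleftrightarrow> p \<in> X \<and> (\<forall>p'\<in>X. dst q p \<le> a * dst q p')"

section \<open>A randomized real RAM\<close>

text \<open>The unit-cost model is the real RAM: a memory of natural-number words (used for addresses and
  counters) and a memory of real numbers, with exact real arithmetic and comparisons but without
  rounding, so a real cannot be turned into a word.  Operands of an instruction are constant
  addresses; the load, store and input instructions take an address from a word.  The
  instruction \<open>RNormal\<close> consumes the next entry of a tape of random reals, and \<open>RInput\<close> reads a
  read-only input array, which does not belong to the memory.\<close>

datatype instr =
    WConst nat nat
  | WAdd nat nat nat
  | WSub nat nat nat
  | WMul nat nat nat
  | WDiv nat nat nat
  | WLoad nat nat
  | WStore nat nat
  | WJumpLe nat nat nat
  | ROfWord nat nat
  | RAdd nat nat nat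
  | RSub nat nat nat
  | RMul nat nat nat
  | RDiv nat nat nat
  | RLoad nat nat
  | RStore nat nat
  | RJumpLe nat nat nat
  | RInput nat nat
  | RNormal nat

type_synonym program = "instr list"

record config =
  pc :: nat
  words :: "nat \<Rightarrow> nat"
  reals :: "nat \<Rightarrow> real"
  tape_pos :: nat

definition set_word :: "nat \<Rightarrow> nat \<Rightarrow> config \<Rightarrow> config" where
  "set_word i v s = s\<lparr>pc := Suc (pc s), words := (words s)(i := v)\<rparr>"

definition set_real :: "nat \<Rightarrow> real \<Rightarrow> config \<Rightarrow> config" where
  "set_real i v s = s\<lparr>pc := Suc (pc s), reals := (reals s)(i := v)\<rparr>"

definition jump_if :: "bool \<Rightarrow> nat \<Rightarrow> config \<Rightarrow> config" where
  "jump_if b l s = s\<lparr>pc := (if b then l else Suc (pc s))\<rparr>"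

fun exec_instr :: "(nat \<Rightarrow> real) \<Rightarrow> (nat \<Rightarrow> real) \<Rightarrow> instr \<Rightarrow> config \<Rightarrow> config" where
  "exec_instr inp \<omega> (WConst i k) s = set_word i k s"
| "exec_instr inp \<omega> (WAdd i j k) s = set_word i (words s j + words s k) s"
| "exec_instr inp \<omega> (WSub i j k) s = set_word i (words s j - words s k) s"
| "exec_instr inp \<omega> (WMul i j k) s = set_word i (words s j * words s k) s"
| "exec_instr inp \<omega> (WDiv i j k) s = set_word i (words s j div words s k) s"
| "exec_instr inp \<omega> (WLoad i j) s = set_word i (words s (words s j)) s"
| "exec_instr inp \<omega> (WStore i j) s = set_word (words s i) (words s j) s"
| "exec_instr inp \<omega> (WJumpLe i j l) s = jump_if (words s i \<le> words s j) l s"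
| "exec_instr inp \<omega> (ROfWord i j) s = set_real i (real (words s j)) s"
| "exec_instr inp \<omega> (RAdd i j k) s = set_real i (reals s j + reals s k) s"
| "exec_instr inp \<omega> (RSub i j k) s = set_real i (reals s j - reals s k) s"
| "exec_instr inp \<omega> (RMul i j k) s = set_real i (reals s j * reals s k) s"
| "exec_instr inp \<omega> (RDiv i j k) s = set_real i (reals s j / reals s k) s"
| "exec_instr inp \<omega> (RLoad i j) s = set_real i (reals s (words s j)) s"
| "exec_instr inp \<omega> (RStore i j) s = set_real (words s i) (reals s j) s"
| "exec_instr inp \<omega> (RJumpLe i j l) s = jump_if (reals s i \<le> reals s j) l s"
| "exec_instr inp \<omega> (RInput i j) s = set_real i (inp (words s j)) s"
| "exec_instr inp \<omega> (RNormal i) s = set_real i (\<omega> (tape_pos s)) (s\<lparr>tape_pos := Suc (tape_pos s)\<rparr>)"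

definition halted :: "program \<Rightarrow> config \<Rightarrow> bool" where
  "halted P s \<longleftrightarrow> length P \<le> pc s"

definition step :: "program \<Rightarrow> (nat \<Rightarrow> real) \<Rightarrow> (nat \<Rightarrow> real) \<Rightarrow> config \<Rightarrow> config" where
  "step P inp \<omega> s = (if halted P s then s else exec_instr inp \<omega> (P ! pc s) s)"

definition steps :: "program \<Rightarrow> (nat \<Rightarrow> real) \<Rightarrow> (nat \<Rightarrow> real) \<Rightarrow> nat \<Rightarrow> config \<Rightarrow> config" where
  "steps P inp \<omega> t = (step P inp \<omega> ^^ t)"

text \<open>Space is the length of an initial segment of each of the two memories outside of which
  everything is unused (zero).  Words are also bounded by the space, i.e. they have
  logarithmically many bits, so that large amounts of data cannot be packed into one word.\<close>

definition fits :: "nat \<Rightarrow> config \<Rightarrow> bool" where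
  "fits S s \<longleftrightarrow> (\<forall>a\<ge>S. words s a = 0 \<and> reals s a = 0) \<and> (\<forall>a. words s a \<le> S)"

definition runs_within ::
    "program \<Rightarrow> (nat \<Rightarrow> real) \<Rightarrow> (nat \<Rightarrow> real) \<Rightarrow> config \<Rightarrow> real \<Rightarrow> nat \<Rightarrow> bool" where
  "runs_within P inp \<omega> s T S \<longleftrightarrow>
     (\<exists>t. real t \<le> T \<and> halted P (steps P inp \<omega> t s) \<and> (\<forall>u\<le>t. fits S (steps P inp \<omega> u s)))"

text \<open>Meaningful only for runs that halt.\<close>

definition final :: "program \<Rightarrow> (nat \<Rightarrow> real) \<Rightarrow> (nat \<Rightarrow> real) \<Rightarrow> config \<Rightarrow> config" where
  "final P inp \<omega> s = steps P inp \<omega> (LEAST t. halted P (steps P inp \<omega> t s)) s"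

definition deterministic :: "program \<Rightarrow> bool" where
  "deterministic P \<longleftrightarrow> (\<forall>i. RNormal i \<notin> set P)"

text \<open>The random choices are independent standard Gaussians (the sign of an entry is a fair coin).\<close>

definition random_tape :: "(nat \<Rightarrow> real) measure" where
  "random_tape = (\<Pi>\<^sub>M i\<in>UNIV. density lborel std_normal_density)"

section \<open>Data structures: a preprocessing program and a query program\<close>

definition prep_input ::
    "nat \<Rightarrow> real \<Rightarrow> real \<Rightarrow> real \<Rightarrow> (nat \<Rightarrow> nat \<Rightarrow> real) \<Rightarrow> nat \<Rightarrow> real" where
  "prep_input d \<epsilon> \<tau> c x k =
     (if k = 0 then \<epsilon> else if k = 1 then \<tau> else if k = 2 then c
      else x ((k - 3) div d) ((k - 3) mod d))"

definition prep_start :: "nat \<Rightarrow> nat \<Rightarrow> config" where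
  "prep_start d n =
     \<lparr>pc = 0, words = (\<lambda>_. 0)(0 := d, 1 := n), reals = (\<lambda>_. 0), tape_pos = 0\<rparr>"

text \<open>The configuration after preprocessing. Its memory contents are the data structure.\<close>

definition preprocessed ::
    "program \<Rightarrow> nat \<Rightarrow> nat \<Rightarrow> real \<Rightarrow> real \<Rightarrow> real \<Rightarrow> (nat \<Rightarrow> nat \<Rightarrow> real) \<Rightarrow> (nat \<Rightarrow> real) \<Rightarrow> config"
  where
  "preprocessed prep d n \<epsilon> \<tau> c x \<omega> = final prep (prep_input d \<epsilon> \<tau> c x) \<omega> (prep_start d n)"

definition query_start :: "config \<Rightarrow> config" where
  "query_start s = s\<lparr>pc := 0\<rparr>"

text \<open>The query program finds the coordinates of the query point in its input array, and
  reports a point of the data set by leaving its index in word \<open>0\<close>.\<close>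

definition query_answer :: "program \<Rightarrow> (nat \<Rightarrow> real) \<Rightarrow> (nat \<Rightarrow> real) \<Rightarrow> config \<Rightarrow> nat" where
  "query_answer qry q \<omega> s = words (final qry q \<omega> (query_start s)) 0"

definition prep_succeeds ::
    "program \<Rightarrow> program \<Rightarrow> nat \<Rightarrow> nat \<Rightarrow> real \<Rightarrow> real \<Rightarrow> real \<Rightarrow> (nat \<Rightarrow> nat \<Rightarrow> real)
      \<Rightarrow> real \<Rightarrow> (nat \<Rightarrow> real) \<Rightarrow> (nat \<Rightarrow> real) \<Rightarrow> bool" where
  "prep_succeeds prep qry d n \<epsilon> \<tau> c x a q \<omega> \<longleftrightarrow>
     (let i = query_answer qry q \<omega> (preprocessed prep d n \<epsilon> \<tau> c x \<omega>)
      in i < n \<and> approx_nn (l2_dist d) a (x ` {..<n}) q (x i))"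

end

theory Submission
  imports Defs
begin

text \<open>The data structure is a random binary tree. A cell, initially the whole point set, is split at
  the hyperplane that is orthogonal to a Gaussian direction and contains a random point of the cell,
  the pivot. A query searches the tree best-first: entering the side of a hyperplane that does not
  contain the query point adds \<open>t ^ 16\<close> to the key of a subtree, where \<open>t\<close> is the distance of the query
  from the hyperplane. The answer is the nearest pivot that is seen.

  Let \<open>\<rho>\<close> be the distance from the query to its \<open>k\<close>-th nearest point, where \<open>k \<approx> \<tau>\<close>; the ball of
  radius \<open>2 ^ j * \<rho>\<close> then contains at most \<open>c ^ j * k\<close> points. In a cell with \<open>k * (2 * c ^ 18) ^ i\<close>
  points almost all pivots have distance at least \<open>2 ^ (18 * i) * \<rho>\<close>. So the hyperplane rarely separates
  the query from its nearest neighbor, and it rarely is so close that the other side has to be searched.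
  It follows that the expected key of the nearest neighbor is at most \<open>\<rho> ^ 16\<close> times a multiple of
  \<open>ln k + 39 * ln (2 * c ^ 18)\<close>, and the expected number of tips whose keys are below twice this bound is
  \<open>O (\<tau> * c\<^sup>2 + c ^ A)\<close> for a constant \<open>A\<close>. By Markov's inequality, this number of rounds reaches the
  nearest neighbor with constant probability.

  Finally, \<open>c ^ A\<close> is bounded by a multiple of \<open>c powr log 2 (log 2 c / \<epsilon>)\<close>: with \<open>u = log 2 c\<close> the
  exponents to base 2 are \<open>u * A\<close> and at least \<open>u * (1 + log 2 u)\<close>, whose difference is bounded above.\<close>

section \<open>Structured programs for the random access machine\<close>

text \<open>The number of tips must be linear in \<tau>, with higher powers of \<open>c\<close> in a
  separate summand, whereas the recursive estimate yields a product of a power of \<open>k\<close>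
  and a power of \<open>D = 2 * c ^ 18\<close>. The weighted arithmetic-geometric mean inequality
  splits this product because the exponent of \<open>k\<close> stays below 1: cells of any size give
  999/1000, and the threshold for the key adds less than 6/10000. The power 16 in the keys serves
  this purpose: twice the bound on the key carries 8 times the 16th Gaussian moment, which is tiny
  against \<open>(9 / 2) ^ 16\<close>. The other obstacle is to lose no power of \<open>n\<close>. A
  bound with a fixed exponent is therefore improved again and again: each step halves the exponent
  at the price of a factor in \<open>k\<close> and \<open>D\<close>, and the product of all these
  factors stays bounded. The number 18 in \<open>D\<close> is 1 + 16 + 1: in powers of
  \<open>2 ^ i\<close>, one for the width of a slab around the query, 16 for the cost of crossing
  inside it and one for the gain. All cells of a level share one direction; the resulting dependence
  between subtrees is harmless, as only expectations are added.\<close>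

datatype cond = WLe nat nat | RLe nat nat

fun holds :: "cond \<Rightarrow> config \<Rightarrow> bool" where
  "holds (WLe i j) s \<longleftrightarrow> words s i \<le> words s j"
| "holds (RLe i j) s \<longleftrightarrow> reals s i \<le> reals s j"

fun jump :: "cond \<Rightarrow> nat \<Rightarrow> instr" where
  "jump (WLe i j) l = WJumpLe i j l"
| "jump (RLe i j) l = RJumpLe i j l"

text \<open>\<open>Until b c\<close> tests \<open>b\<close> before each pass and stops as soon as it
  holds, so a loop may run zero times; the guards below are exit conditions.\<close>

datatype cmd =
    Block "instr list"
  | Seq cmd cmd (infixr \<open>;;\<close> 60)
  | IfC cond cmd cmd
  | Until cond cmd

fun clen :: "cmd \<Rightarrow> nat" where
  "clen (Block is) = length is"
| "clen (c1 ;; c2) = clen c1 + clen c2"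
| "clen (IfC b c1 c2) = clen c1 + clen c2 + 2"
| "clen (Until b c) = clen c + 2"

text \<open>Jump targets of the machine are absolute, hence the start address \<open>a\<close>. In a
  conditional the branch for a false test comes first and ends with a jump over the other one;
  \<open>WJumpLe 0 0\<close> always jumps, since a word is at most itself.\<close>

fun assemble :: "nat \<Rightarrow> cmd \<Rightarrow> program" where
  "assemble a (Block is) = is"
| "assemble a (c1 ;; c2) = assemble a c1 @ assemble (a + clen c1) c2"
| "assemble a (IfC b c1 c2) =
     [jump b (a + clen c2 + 2)] @ assemble (a + 1) c2 @ [WJumpLe 0 0 (a + clen c1 + clen c2 + 2)]
     @ assemble (a + clen c2 + 2) c1"
| "assemble a (Until b c) = [jump b (a + clen c + 2)] @ assemble (a + 1) c @ [WJumpLe 0 0 a]"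

lemma length_assemble [simp]: "length (assemble a c) = clen c"
  by (induction c arbitrary: a) auto

fun no_jump :: "instr \<Rightarrow> bool" where
  "no_jump (WJumpLe i j l) \<longleftrightarrow> False"
| "no_jump (RJumpLe i j l) \<longleftrightarrow> False"
| "no_jump _ \<longleftrightarrow> True"

text \<open>The effect of an instruction on everything but the program counter. Within a block the
  position is determined by the number of executed instructions.\<close>

definition eff :: "(nat \<Rightarrow> real) \<Rightarrow> (nat \<Rightarrow> real) \<Rightarrow> instr \<Rightarrow> config \<Rightarrow> config" where
  "eff inp \<omega> i s = (exec_instr inp \<omega> i s)\<lparr>pc := pc s\<rparr>"

lemma words_eff [simp]:
  "words (eff inp \<omega> (WConst i k) s) = (words s)(i := k)"
  "words (eff inp \<omega> (WAdd i j k) s) = (words s)(i := words s j + words s k)"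
  "words (eff inp \<omega> (WSub i j k) s) = (words s)(i := words s j - words s k)"
  "words (eff inp \<omega> (WMul i j k) s) = (words s)(i := words s j * words s k)"
  "words (eff inp \<omega> (WDiv i j k) s) = (words s)(i := words s j div words s k)"
  "words (eff inp \<omega> (WLoad i j) s) = (words s)(i := words s (words s j))"
  "words (eff inp \<omega> (WStore i j) s) = (words s)(words s i := words s j)"
  "words (eff inp \<omega> (ROfWord i j) s) = words s"
  "words (eff inp \<omega> (RAdd i j k) s) = words s"
  "words (eff inp \<omega> (RSub i j k) s) = words s"
  "words (eff inp \<omega> (RMul i j k) s) = words s"
  "words (eff inp \<omega> (RDiv i j k) s) = words s"
  "words (eff inp \<omega> (RLoad i j) s) = words s"
  "words (eff inp \<omega> (RStore i j) s) = words s"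
  "words (eff inp \<omega> (RInput i j) s) = words s"
  "words (eff inp \<omega> (RNormal i) s) = words s"
  by (auto simp: eff_def set_word_def set_real_def)

lemma reals_eff [simp]:
  "reals (eff inp \<omega> (WConst i k) s) = reals s"
  "reals (eff inp \<omega> (WAdd i j k) s) = reals s"
  "reals (eff inp \<omega> (WSub i j k) s) = reals s"
  "reals (eff inp \<omega> (WMul i j k) s) = reals s"
  "reals (eff inp \<omega> (WDiv i j k) s) = reals s"
  "reals (eff inp \<omega> (WLoad i j) s) = reals s"
  "reals (eff inp \<omega> (WStore i j) s) = reals s"
  "reals (eff inp \<omega> (ROfWord i j) s) = (reals s)(i := real (words s j))"
  "reals (eff inp \<omega> (RAdd i j k) s) = (reals s)(i := reals s j + reals s k)"
  "reals (eff inp \<omega> (RSub i j k) s) = (reals s)(i := reals s j - reals s k)"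
  "reals (eff inp \<omega> (RMul i j k) s) = (reals s)(i := reals s j * reals s k)"
  "reals (eff inp \<omega> (RDiv i j k) s) = (reals s)(i := reals s j / reals s k)"
  "reals (eff inp \<omega> (RLoad i j) s) = (reals s)(i := reals s (words s j))"
  "reals (eff inp \<omega> (RStore i j) s) = (reals s)(words s i := reals s j)"
  "reals (eff inp \<omega> (RInput i j) s) = (reals s)(i := inp (words s j))"
  "reals (eff inp \<omega> (RNormal i) s) = (reals s)(i := \<omega> (tape_pos s))"
  by (auto simp: eff_def set_word_def set_real_def)

lemma tape_pos_eff [simp]:
  "tape_pos (eff inp \<omega> (WConst i k) s) = tape_pos s"
  "tape_pos (eff inp \<omega> (WAdd i j k) s) = tape_pos s"
  "tape_pos (eff inp \<omega> (WSub i j k) s) = tape_pos s"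
  "tape_pos (eff inp \<omega> (WMul i j k) s) = tape_pos s"
  "tape_pos (eff inp \<omega> (WDiv i j k) s) = tape_pos s"
  "tape_pos (eff inp \<omega> (WLoad i j) s) = tape_pos s"
  "tape_pos (eff inp \<omega> (WStore i j) s) = tape_pos s"
  "tape_pos (eff inp \<omega> (ROfWord i j) s) = tape_pos s"
  "tape_pos (eff inp \<omega> (RAdd i j k) s) = tape_pos s"
  "tape_pos (eff inp \<omega> (RSub i j k) s) = tape_pos s"
  "tape_pos (eff inp \<omega> (RMul i j k) s) = tape_pos s"
  "tape_pos (eff inp \<omega> (RDiv i j k) s) = tape_pos s"
  "tape_pos (eff inp \<omega> (RLoad i j) s) = tape_pos s"
  "tape_pos (eff inp \<omega> (RStore i j) s) = tape_pos s"
  "tape_pos (eff inp \<omega> (RInput i j) s) = tape_pos s"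
  "tape_pos (eff inp \<omega> (RNormal i) s) = Suc (tape_pos s)"
  by (auto simp: eff_def set_word_def set_real_def)

text \<open>The local condition under which an instruction preserves \<open>fits S\<close>: its
  target lies below \<open>S\<close>, and a newly computed word is at most \<open>S\<close>. Loaded
  and stored words already occur in a fitting configuration and thus are bounded. Jumps are
  excluded, so that blocks are straight-line code.\<close>

fun safe :: "nat \<Rightarrow> instr \<Rightarrow> config \<Rightarrow> bool" where
  "safe S (WConst i k) s \<longleftrightarrow> i < S \<and> k \<le> S"
| "safe S (WAdd i j k) s \<longleftrightarrow> i < S \<and> words s j + words s k \<le> S"
| "safe S (WSub i j k) s \<longleftrightarrow> i < S \<and> words s j - words s k \<le> S"
| "safe S (WMul i j k) s \<longleftrightarrow> i < S \<and> words s j * words s k \<le> S"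
| "safe S (WDiv i j k) s \<longleftrightarrow> i < S \<and> words s j div words s k \<le> S"
| "safe S (WLoad i j) s \<longleftrightarrow> i < S"
| "safe S (WStore i j) s \<longleftrightarrow> words s i < S"
| "safe S (WJumpLe i j l) s \<longleftrightarrow> False"
| "safe S (RJumpLe i j l) s \<longleftrightarrow> False"
| "safe S (ROfWord i j) s \<longleftrightarrow> i < S"
| "safe S (RAdd i j k) s \<longleftrightarrow> i < S"
| "safe S (RSub i j k) s \<longleftrightarrow> i < S"
| "safe S (RMul i j k) s \<longleftrightarrow> i < S"
| "safe S (RDiv i j k) s \<longleftrightarrow> i < S"
| "safe S (RLoad i j) s \<longleftrightarrow> i < S"
| "safe S (RStore i j) s \<longleftrightarrow> words s i < S"
| "safe S (RInput i j) s \<longleftrightarrow> i < S"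
| "safe S (RNormal i) s \<longleftrightarrow> i < S"

lemma fits_pc [simp]: "fits S (s\<lparr>pc := k\<rparr>) = fits S s"
  by (simp add: fits_def)

lemma fits_eff: "fits S s \<Longrightarrow> safe S i s \<Longrightarrow> fits S (eff inp \<omega> i s)"
  by (cases i) (auto simp: fits_def)

lemma exec_instr_pc: "safe S i s \<Longrightarrow> exec_instr inp \<omega> i (s\<lparr>pc := a\<rparr>) = (eff inp \<omega> i s)\<lparr>pc := Suc a\<rparr>"
  by (cases i) (auto simp: eff_def set_word_def set_real_def)

fun effs :: "(nat \<Rightarrow> real) \<Rightarrow> (nat \<Rightarrow> real) \<Rightarrow> instr list \<Rightarrow> config \<Rightarrow> config" where
  "effs inp \<omega> [] s = s"
| "effs inp \<omega> (i # is) s = effs inp \<omega> is (eff inp \<omega> i s)"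

fun safes :: "nat \<Rightarrow> (nat \<Rightarrow> real) \<Rightarrow> (nat \<Rightarrow> real) \<Rightarrow> instr list \<Rightarrow> config \<Rightarrow> bool" where
  "safes S inp \<omega> [] s \<longleftrightarrow> True"
| "safes S inp \<omega> (i # is) s \<longleftrightarrow> safe S i s \<and> safes S inp \<omega> is (eff inp \<omega> i s)"

text \<open>A big-step semantics with exact machine time: every test costs one step, and so do the
  jump behind the branch of a false test and the jump back at the end of a loop body. As
  \<open>safes\<close> is a premise for blocks, an execution also certifies the space bound.\<close>

inductive exec :: "nat \<Rightarrow> (nat \<Rightarrow> real) \<Rightarrow> (nat \<Rightarrow> real) \<Rightarrow> cmd \<Rightarrow> config \<Rightarrow> nat \<Rightarrow> config \<Rightarrow> bool"
  for S inp \<omega> where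
  Block: "safes S inp \<omega> is s \<Longrightarrow> exec S inp \<omega> (Block is) s (length is) (effs inp \<omega> is s)"
| Seq: "exec S inp \<omega> c1 s t1 s1 \<Longrightarrow> exec S inp \<omega> c2 s1 t2 s2 \<Longrightarrow> exec S inp \<omega> (c1 ;; c2) s (t1 + t2) s2"
| IfT: "holds b s \<Longrightarrow> exec S inp \<omega> c1 s t s' \<Longrightarrow> exec S inp \<omega> (IfC b c1 c2) s (Suc t) s'"
| IfF: "\<not> holds b s \<Longrightarrow> exec S inp \<omega> c2 s t s' \<Longrightarrow> exec S inp \<omega> (IfC b c1 c2) s (Suc t + 1) s'"
| UntilT: "holds b s \<Longrightarrow> exec S inp \<omega> (Until b c) s 1 s"
| UntilF: "\<not> holds b s \<Longrightarrow> exec S inp \<omega> c s t s1 \<Longrightarrow> exec S inp \<omega> (Until b c) s1 t' s2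
     \<Longrightarrow> exec S inp \<omega> (Until b c) s (Suc t + (1 + t')) s2"

lemma fits_effs: "fits S s \<Longrightarrow> safes S inp \<omega> is s \<Longrightarrow> fits S (effs inp \<omega> is s)"
  by (induction "is" arbitrary: s) (auto intro: fits_eff)

lemma fits_exec: "exec S inp \<omega> c s t s' \<Longrightarrow> fits S s \<Longrightarrow> fits S s'"
  by (induction rule: exec.induct) (auto intro: fits_effs)

section \<open>Placement of code and correctness of the assembler\<close>

definition code_at :: "program \<Rightarrow> nat \<Rightarrow> program \<Rightarrow> bool" where
  "code_at P a is \<longleftrightarrow> (\<exists>xs ys. P = xs @ is @ ys \<and> length xs = a)"

lemma code_at_append: "code_at P a (xs @ ys) \<Longrightarrow> code_at P a xs \<and> code_at P (a + length xs) ys"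
  unfolding code_at_def
proof (elim exE conjE)
  fix us vs assume "P = us @ (xs @ ys) @ vs" "length us = a"
  then have "P = us @ xs @ (ys @ vs) \<and> length us = a"
    "P = (us @ xs) @ ys @ vs \<and> length (us @ xs) = a + length xs"
    by simp_all
  then show "(\<exists>us vs. P = us @ xs @ vs \<and> length us = a) \<and>
      (\<exists>us vs. P = us @ ys @ vs \<and> length us = a + length xs)"
    by blast
qed

lemma code_at_Cons: "code_at P a (i # is) \<Longrightarrow> a < length P \<and> P ! a = i \<and> code_at P (Suc a) is"
proof -
  assume c: "code_at P a (i # is)"
  then obtain us vs where "P = us @ (i # is) @ vs" "length us = a"
    unfolding code_at_def by blast
  then have "a < length P" "P ! a = i"
    by (auto simp: nth_append)
  then show ?thesis
    using code_at_append[of P a "[i]" "is"] c by simp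
qed

text \<open>Besides the result it records that all intermediate configurations fit, as
  \<open>runs_within\<close> demands.\<close>

definition leads :: "nat \<Rightarrow> program \<Rightarrow> (nat \<Rightarrow> real) \<Rightarrow> (nat \<Rightarrow> real) \<Rightarrow> nat \<Rightarrow> config \<Rightarrow> config \<Rightarrow> bool" where
  "leads S P inp \<omega> t s s' \<longleftrightarrow>
     steps P inp \<omega> t s = s' \<and> (\<forall>u\<le>t. fits S (steps P inp \<omega> u s))"

lemma steps_add: "steps P inp \<omega> (t + u) s = steps P inp \<omega> u (steps P inp \<omega> t s)"
  unfolding steps_def by (metis add.commute comp_apply funpow_add)

lemma leads_0: "fits S s \<Longrightarrow> leads S P inp \<omega> 0 s s"
  by (simp add: leads_def steps_def)

lemma leads_trans:
  assumes "leads S P inp \<omega> t s s1" "leads S P inp \<omega> u s1 s2"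
  shows "leads S P inp \<omega> (t + u) s s2"
proof -
  have "fits S (steps P inp \<omega> v s)" if "v \<le> t + u" for v
  proof (cases "v \<le> t")
    case False
    then have "v = t + (v - t)" "v - t \<le> u"
      using that by auto
    then show ?thesis
      using assms steps_add[of P inp \<omega> t "v - t" s] unfolding leads_def by metis
  qed (use assms in \<open>auto simp: leads_def\<close>)
  then show ?thesis
    using assms by (auto simp: leads_def steps_add)
qed

lemma leads_step:
  assumes "a < length P" "exec_instr inp \<omega> (P ! a) (s\<lparr>pc := a\<rparr>) = s'" "fits S s" "fits S s'"
  shows "leads S P inp \<omega> 1 (s\<lparr>pc := a\<rparr>) s'"
proof -
  have *: "u = 0 \<or> u = 1" if "u \<le> 1" for u :: nat
    using that by auto
  have "steps P inp \<omega> 1 (s\<lparr>pc := a\<rparr>) = s'"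
    using assms by (simp add: steps_def step_def halted_def)
  then show ?thesis
    using assms * unfolding leads_def by (metis fits_pc funpow_0 steps_def)
qed

lemma exec_jump: "exec_instr inp \<omega> (jump b l) (s\<lparr>pc := a\<rparr>) = s\<lparr>pc := (if holds b s then l else Suc a)\<rparr>"
  by (cases b) (auto simp: jump_if_def)

lemma exec_goto: "exec_instr inp \<omega> (WJumpLe 0 0 l) (s\<lparr>pc := a\<rparr>) = s\<lparr>pc := l\<rparr>"
  by (auto simp: jump_if_def)

lemma leads_block:
  "safes S inp \<omega> is s \<Longrightarrow> fits S s \<Longrightarrow> code_at P a is \<Longrightarrow>
   leads S P inp \<omega> (length is) (s\<lparr>pc := a\<rparr>) ((effs inp \<omega> is s)\<lparr>pc := a + length is\<rparr>)"
proof (induction "is" arbitrary: s a)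
  case (Cons i "is")
  have *: "a < length P" "P ! a = i" "code_at P (Suc a) is"
    using code_at_Cons[OF Cons.prems(3)] by auto
  have 1: "leads S P inp \<omega> 1 (s\<lparr>pc := a\<rparr>) ((eff inp \<omega> i s)\<lparr>pc := Suc a\<rparr>)"
    by (rule leads_step) (use * Cons.prems exec_instr_pc fits_eff in auto)
  show ?case
    using leads_trans[OF 1 Cons.IH[of "eff inp \<omega> i s" "Suc a"]] Cons.prems * fits_eff by auto
qed (simp add: leads_0)

text \<open>The induction follows the execution and not the command, because a loop executes the
  same code at the same address again. \<open>pc\<close> is overwritten on both sides, since
  \<open>exec\<close> pays no attention to it.\<close>

lemma leads_exec:
  "exec S inp \<omega> c s t s' \<Longrightarrow> fits S s \<Longrightarrow> code_at P a (assemble a c) \<Longrightarrow>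
   leads S P inp \<omega> t (s\<lparr>pc := a\<rparr>) (s'\<lparr>pc := a + clen c\<rparr>)"
proof (induction arbitrary: a rule: exec.induct)
  case (Block "is" s)
  then show ?case
    using leads_block by auto
next
  case (Seq c1 s t1 s1 c2 t2 s2)
  have "code_at P a (assemble a c1)" "code_at P (a + clen c1) (assemble (a + clen c1) c2)"
    using code_at_append[of P a "assemble a c1" "assemble (a + clen c1) c2"] Seq.prems by auto
  then show ?case
    using Seq leads_trans fits_exec by (metis clen.simps(2) group_cancel.add1)
next
  case (IfT b s c1 t s' c2)
  let ?l = "a + clen c2 + 2"
  have *: "a < length P" "P ! a = jump b ?l"
    using IfT.prems code_at_Cons by auto
  have "code_at P ?l (assemble ?l c1)"
    using code_at_append[of P a "[jump b ?l] @ assemble (a + 1) c2 @ [WJumpLe 0 0 (a + clen c1 + clen c2 + 2)]" "assemble ?l c1"]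
      IfT.prems by simp
  then have 2: "leads S P inp \<omega> t (s\<lparr>pc := ?l\<rparr>) (s'\<lparr>pc := ?l + clen c1\<rparr>)"
    using IfT by blast
  have 1: "leads S P inp \<omega> 1 (s\<lparr>pc := a\<rparr>) (s\<lparr>pc := ?l\<rparr>)"
    by (rule leads_step) (use * IfT exec_jump in auto)
  show ?case
    using leads_trans[OF 1 2] by (simp add: algebra_simps)
next
  case (IfF b s c2 t s' c1)
  let ?l = "a + clen c2 + 2" and ?g = "WJumpLe 0 0 (a + clen c1 + clen c2 + 2)"
  have *: "a < length P" "P ! a = jump b ?l"
    using IfF.prems code_at_Cons by auto
  have c: "code_at P (a + 1) (assemble (a + 1) c2)" "code_at P (a + clen c2 + 1) (?g # assemble ?l c1)"
    using code_at_append[of P a "[jump b ?l]" "assemble (a + 1) c2 @ ?g # assemble ?l c1"]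
      code_at_append[of P "a + 1" "assemble (a + 1) c2" "?g # assemble ?l c1"] IfF.prems by auto
  have 1: "leads S P inp \<omega> 1 (s\<lparr>pc := a\<rparr>) (s\<lparr>pc := a + 1\<rparr>)"
    by (rule leads_step) (use * IfF exec_jump in auto)
  have 2: "leads S P inp \<omega> t (s\<lparr>pc := a + 1\<rparr>) (s'\<lparr>pc := a + 1 + clen c2\<rparr>)"
    using IfF c by blast
  have 3: "leads S P inp \<omega> 1 (s'\<lparr>pc := a + 1 + clen c2\<rparr>) (s'\<lparr>pc := a + clen c1 + clen c2 + 2\<rparr>)"
    by (rule leads_step) (use code_at_Cons[OF c(2)] IfF fits_exec exec_goto in auto)
  show ?case
    using leads_trans[OF leads_trans[OF 1 2] 3] by (simp add: algebra_simps)
next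
  case (UntilT b s c)
  have *: "a < length P" "P ! a = jump b (a + clen c + 2)"
    using UntilT.prems code_at_Cons by auto
  have 1: "leads S P inp \<omega> 1 (s\<lparr>pc := a\<rparr>) (s\<lparr>pc := a + clen c + 2\<rparr>)"
    by (rule leads_step) (use * UntilT exec_jump in auto)
  then show ?case
    by (simp add: algebra_simps)
next
  case (UntilF b s c t s1 t' s2)
  let ?g = "WJumpLe 0 0 a"
  have *: "a < length P" "P ! a = jump b (a + clen c + 2)"
    using UntilF.prems code_at_Cons by auto
  have c: "code_at P (a + 1) (assemble (a + 1) c)" "code_at P (a + clen c + 1) [?g]"
    using code_at_append[of P a "[jump b (a + clen c + 2)]" "assemble (a + 1) c @ [?g]"]
      code_at_append[of P "a + 1" "assemble (a + 1) c" "[?g]"] UntilF.prems by auto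
  have f1: "fits S s1"
    using UntilF fits_exec by blast
  have 1: "leads S P inp \<omega> 1 (s\<lparr>pc := a\<rparr>) (s\<lparr>pc := a + 1\<rparr>)"
    by (rule leads_step) (use * UntilF exec_jump in auto)
  have 2: "leads S P inp \<omega> t (s\<lparr>pc := a + 1\<rparr>) (s1\<lparr>pc := a + 1 + clen c\<rparr>)"
    using UntilF c by blast
  have 3: "leads S P inp \<omega> 1 (s1\<lparr>pc := a + 1 + clen c\<rparr>) (s1\<lparr>pc := a\<rparr>)"
    by (rule leads_step) (use code_at_Cons[OF c(2)] f1 exec_goto in auto)
  have 4: "leads S P inp \<omega> t' (s1\<lparr>pc := a\<rparr>) (s2\<lparr>pc := a + clen (Until b c)\<rparr>)"
    using UntilF f1 by blast
  show ?case
    using leads_trans[OF leads_trans[OF leads_trans[OF 1 2] 3] 4] by (simp add: algebra_simps)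
qed

lemma steps_halted: "halted P s \<Longrightarrow> steps P inp \<omega> t s = s"
  by (induction t) (auto simp: steps_def step_def)

text \<open>A halted machine stays put, so the least halting time and any other halting time lead to
  the same configuration.\<close>

lemma final_eq:
  assumes "halted P (steps P inp \<omega> t s)"
  shows "final P inp \<omega> s = steps P inp \<omega> t s"
proof -
  let ?l = "LEAST t. halted P (steps P inp \<omega> t s)"
  have "halted P (steps P inp \<omega> ?l s)" "?l \<le> t"
    using assms by (auto intro: LeastI Least_le)
  then show ?thesis
    unfolding final_def using steps_add[of P inp \<omega> ?l "t - ?l" s] by (simp add: steps_halted)
qed

section \<open>Total correctness with time bounds\<close>

text \<open>\<open>fits S\<close> belongs to every precondition but is never restated in a
  postcondition: executions preserve it, so the rules for composition supply it.\<close>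

definition hoare :: "nat \<Rightarrow> (nat \<Rightarrow> real) \<Rightarrow> (nat \<Rightarrow> real) \<Rightarrow> (config \<Rightarrow> bool) \<Rightarrow> cmd \<Rightarrow> nat
    \<Rightarrow> (config \<Rightarrow> bool) \<Rightarrow> bool" where
  "hoare S inp \<omega> P c T Q \<longleftrightarrow>
     (\<forall>s. P s \<and> fits S s \<longrightarrow> (\<exists>t s'. exec S inp \<omega> c s t s' \<and> t \<le> T \<and> Q s'))"

lemma pc_self: "pc s = k \<Longrightarrow> s\<lparr>pc := k\<rparr> = s"
  by auto

lemma hoare_run:
  assumes "hoare S inp \<omega> P c T Q" "P s" "fits S s" "pc s = 0" "real T \<le> T'"
  shows "runs_within (assemble 0 c) inp \<omega> s T' S \<and>
    (\<exists>s'. Q s' \<and> fits S s' \<and> final (assemble 0 c) inp \<omega> s = s'\<lparr>pc := clen c\<rparr>)"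
proof -
  let ?P = "assemble 0 c"
  obtain t s' where e: "exec S inp \<omega> c s t s'" "t \<le> T" "Q s'"
    using assms unfolding hoare_def by blast
  have "code_at ?P 0 ?P"
    unfolding code_at_def by (metis append.left_neutral append.right_neutral list.size(3))
  then have l: "leads S ?P inp \<omega> t s (s'\<lparr>pc := clen c\<rparr>)"
    using leads_exec[OF e(1) assms(3), of ?P 0] assms(4) by (metis add_0 pc_self)
  then have h: "halted ?P (steps ?P inp \<omega> t s)"
    by (simp add: leads_def halted_def)
  have "real t \<le> T'"
    using e(2) assms(5) by linarith
  then show ?thesis
    using l h e final_eq[OF h] fits_exec[OF e(1) assms(3)] unfolding runs_within_def leads_def by auto
qed

lemma hoare_block:
  assumes "\<And>s. P s \<Longrightarrow> fits S s \<Longrightarrow> safes S inp \<omega> is s \<and> Q (effs inp \<omega> is s)" "length is \<le> T"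
  shows "hoare S inp \<omega> P (Block is) T Q"
  using assms exec.Block unfolding hoare_def by blast

lemma hoare_seq:
  assumes 1: "hoare S inp \<omega> P c1 T1 R" and 2: "hoare S inp \<omega> R c2 T2 Q" and T: "T1 + T2 \<le> T"
  shows "hoare S inp \<omega> P (c1 ;; c2) T Q"
  unfolding hoare_def
proof (intro allI impI)
  fix s assume "P s \<and> fits S s"
  then obtain t1 s1 where e1: "exec S inp \<omega> c1 s t1 s1" "t1 \<le> T1" "R s1" "fits S s1"
    using 1 fits_exec unfolding hoare_def by metis
  then obtain t2 s2 where "exec S inp \<omega> c2 s1 t2 s2" "t2 \<le> T2" "Q s2"
    using 2 unfolding hoare_def by metis
  then show "\<exists>t s'. exec S inp \<omega> (c1 ;; c2) s t s' \<and> t \<le> T \<and> Q s'"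
    using e1 T exec.Seq by (meson add_mono le_trans)
qed

lemma hoare_if:
  assumes 1: "hoare S inp \<omega> (\<lambda>s. P s \<and> holds b s) c1 T1 Q"
    and 2: "hoare S inp \<omega> (\<lambda>s. P s \<and> \<not> holds b s) c2 T1 Q" and T: "T1 + 2 \<le> T"
  shows "hoare S inp \<omega> P (IfC b c1 c2) T Q"
  unfolding hoare_def
proof (intro allI impI)
  fix s assume P: "P s \<and> fits S s"
  show "\<exists>t s'. exec S inp \<omega> (IfC b c1 c2) s t s' \<and> t \<le> T \<and> Q s'"
  proof (cases "holds b s")
    case True
    then obtain t s' where "exec S inp \<omega> c1 s t s'" "t \<le> T1" "Q s'"
      using 1 P unfolding hoare_def by metis
    then show ?thesis
      using exec.IfT[OF True, of S inp \<omega> c1 t s' c2] T by (intro exI[of _ "Suc t"] exI[of _ s']) auto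
  next
    case False
    then obtain t s' where "exec S inp \<omega> c2 s t s'" "t \<le> T1" "Q s'"
      using 2 P unfolding hoare_def by metis
    then show ?thesis
      using exec.IfF[OF False, of S inp \<omega> c2 t s' c1] T
      by (intro exI[of _ "Suc t + 1"] exI[of _ s']) auto
  qed
qed

lemma hoare_conseq:
  assumes "hoare S inp \<omega> P c T Q" "\<And>s. P' s \<Longrightarrow> P s" "\<And>s. Q s \<Longrightarrow> Q' s" "T \<le> T'"
  shows "hoare S inp \<omega> P' c T' Q'"
  using assms unfolding hoare_def by (meson order_trans)

lemma hoare_ex:
  assumes "\<And>x. hoare S inp \<omega> (P x) c T Q"
  shows "hoare S inp \<omega> (\<lambda>s. \<exists>x. P x s) c T Q"
  using assms unfolding hoare_def by blast

lemma hoare_pure: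
  assumes "A \<Longrightarrow> hoare S inp \<omega> P c T Q"
  shows "hoare S inp \<omega> (\<lambda>s. A \<and> P s) c T Q"
  using assms unfolding hoare_def by blast

text \<open>For loops whose number of passes is only bounded, such as walks in a tree. The index may
  fall by more than one, and its value on exit is left open.\<close>

lemma hoare_until_down:
  assumes body: "\<And>k. hoare S inp \<omega> (\<lambda>s. I (Suc k) s \<and> \<not> holds b s) c T1 (\<lambda>s. \<exists>j\<le>k. I j s)"
    and end0: "\<And>s. I 0 s \<Longrightarrow> holds b s"
    and T: "N * (T1 + 2) + 1 \<le> T"
  shows "hoare S inp \<omega> (I N) (Until b c) T (\<lambda>s. holds b s \<and> (\<exists>k. I k s))"
proof -
  have *: "\<exists>t s'. exec S inp \<omega> (Until b c) s t s' \<and> t \<le> k * (T1 + 2) + 1 \<and> (holds b s' \<and> (\<exists>k. I k s'))"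
    if "I k s" "fits S s" for k s
    using that
  proof (induction k arbitrary: s rule: less_induct)
    case (less k)
    show ?case
    proof (cases "holds b s")
      case True
      then show ?thesis
        using exec.UntilT[OF True] less.prems by (intro exI[of _ 1] exI[of _ s]) auto
    next
      case False
      then obtain k' where k: "k = Suc k'"
        using less.prems end0 by (cases k) auto
      obtain t1 s1 j where 1: "exec S inp \<omega> c s t1 s1" "t1 \<le> T1" "j \<le> k'" "I j s1"
        using body[of k'] False less.prems unfolding hoare_def k by metis
      then obtain t s' where 2: "exec S inp \<omega> (Until b c) s1 t s'" "t \<le> j * (T1 + 2) + 1"
          "holds b s' \<and> (\<exists>k. I k s')"
        using less.IH[of j s1] less.prems fits_exec k by (metis le_imp_less_Suc)
      have "j * (T1 + 2) \<le> k' * (T1 + 2)"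
        using 1(3) by (rule mult_right_mono) simp
      then have "Suc t1 + (1 + t) \<le> k * (T1 + 2) + 1"
        using 1(2) 2(2) unfolding k by simp
      then show ?thesis
        using exec.UntilF[OF False 1(1) 2(1)] 2(3) by blast
    qed
  qed
  show ?thesis
    unfolding hoare_def using *[of N] T by (meson order_trans)
qed

text \<open>For counted loops. The index is reflected to \<open>N - k\<close> in order to reuse the
  rule for decreasing indices; since the guard is false for all indices below \<open>N\<close>, the
  exit determines the index.\<close>

lemma hoare_until:
  assumes body: "\<And>k. k < N \<Longrightarrow> hoare S inp \<omega> (I k) c T1 (I (Suc k))"
    and cont: "\<And>k s. k < N \<Longrightarrow> I k s \<Longrightarrow> \<not> holds b s"
    and stop: "\<And>s. I N s \<Longrightarrow> holds b s"
    and T: "N * (T1 + 2) + 1 \<le> T"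
  shows "hoare S inp \<omega> (I 0) (Until b c) T (I N)"
proof -
  have *: "hoare S inp \<omega> (\<lambda>s. N \<le> N \<and> I (N - N) s) (Until b c) T
     (\<lambda>s. holds b s \<and> (\<exists>k. k \<le> N \<and> I (N - k) s))"
  proof (rule hoare_until_down[where I = "\<lambda>k s. k \<le> N \<and> I (N - k) s"])
    fix k
    show "hoare S inp \<omega> (\<lambda>s. (Suc k \<le> N \<and> I (N - Suc k) s) \<and> \<not> holds b s) c T1
        (\<lambda>s. \<exists>j\<le>k. j \<le> N \<and> I (N - j) s)"
    proof (cases "Suc k \<le> N")
      case True
      then have "Suc (N - Suc k) = N - k" "N - Suc k < N"
        by auto
      then show ?thesis
        using body[of "N - Suc k"] True by (auto elim!: hoare_conseq)
    qed (simp add: hoare_def)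
  qed (use stop T in auto)
  show ?thesis
  proof (rule hoare_conseq[OF *])
    fix s assume "holds b s \<and> (\<exists>k\<le>N. I (N - k) s)"
    then obtain k where "k \<le> N" "I (N - k) s" "holds b s"
      by blast
    then have "N - k = N"
      using cont[of "N - k" s] by (metis diff_le_self le_neq_implies_less)
    then show "I N s"
      using \<open>I (N - k) s\<close> by simp
  qed simp_all
qed

fun randomness_free :: "cmd \<Rightarrow> bool" where
  "randomness_free (Block is) \<longleftrightarrow> (\<forall>i. RNormal i \<notin> set is)"
| "randomness_free (c1 ;; c2) \<longleftrightarrow> randomness_free c1 \<and> randomness_free c2"
| "randomness_free (IfC b c1 c2) \<longleftrightarrow> randomness_free c1 \<and> randomness_free c2"
| "randomness_free (Until b c) \<longleftrightarrow> randomness_free c"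

lemma deterministic_assemble: "randomness_free c \<Longrightarrow> deterministic (assemble a c)"
proof (induction c arbitrary: a)
  case (IfC b c1 c2)
  then show ?case
    by (cases b) (auto simp: deterministic_def)
next
  case (Until b c)
  then show ?case
    by (cases b) (auto simp: deterministic_def)
qed (auto simp: deterministic_def)

section \<open>Measurability of runs\<close>

text \<open>Measurability is stated componentwise, which avoids a sigma-algebra on configurations.
  Words, \<open>pc\<close> and \<open>tape_pos\<close> have countably many values, so indirect
  addressing amounts to a countable case distinction.\<close>

definition measurable_config :: "((nat \<Rightarrow> real) \<Rightarrow> config) \<Rightarrow> bool" where
  "measurable_config f \<longleftrightarrow>
     (\<lambda>\<omega>. pc (f \<omega>)) \<in> measurable random_tape (count_space UNIV) \<and>
     (\<forall>a. (\<lambda>\<omega>. words (f \<omega>) a) \<in> measurable random_tape (count_space UNIV)) \<and>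
     (\<forall>a. (\<lambda>\<omega>. reals (f \<omega>) a) \<in> borel_measurable random_tape) \<and>
     (\<lambda>\<omega>. tape_pos (f \<omega>)) \<in> measurable random_tape (count_space UNIV)"

lemma measurable_tape [measurable]: "(\<lambda>\<omega>. \<omega> k) \<in> borel_measurable random_tape"
proof -
  have "(\<lambda>\<omega>. \<omega> k) \<in> measurable random_tape (density lborel std_normal_density)"
    unfolding random_tape_def by (rule measurable_component_singleton) simp
  then show ?thesis
    by (simp cong: measurable_cong_sets)
qed

lemma measurable_config_exec:
  assumes "measurable_config f"
  shows "measurable_config (\<lambda>\<omega>. exec_instr inp \<omega> i (f \<omega>))"
proof -
  have [measurable]: "(\<lambda>\<omega>. pc (f \<omega>)) \<in> measurable random_tape (count_space UNIV)"
    "\<And>a. (\<lambda>\<omega>. words (f \<omega>) a) \<in> measurable random_tape (count_space UNIV)"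
    "\<And>a. (\<lambda>\<omega>. reals (f \<omega>) a) \<in> borel_measurable random_tape"
    "(\<lambda>\<omega>. tape_pos (f \<omega>)) \<in> measurable random_tape (count_space UNIV)"
    using assms by (auto simp: measurable_config_def)
  have [measurable]: "(\<lambda>\<omega>. words (f \<omega>) (words (f \<omega>) j)) \<in> measurable random_tape (count_space UNIV)" for j
    by (rule measurable_compose_countable[where f = "\<lambda>a \<omega>. words (f \<omega>) a"]) measurable
  have [measurable]: "(\<lambda>\<omega>. reals (f \<omega>) (words (f \<omega>) j)) \<in> borel_measurable random_tape" for j
    by (rule measurable_compose_countable[where f = "\<lambda>a \<omega>. reals (f \<omega>) a"]) measurable
  have [measurable]: "(\<lambda>\<omega>. inp (words (f \<omega>) j)) \<in> borel_measurable random_tape" for j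
    by (rule measurable_compose_countable[where f = "\<lambda>a \<omega>. inp a"]) measurable
  have [measurable]: "(\<lambda>\<omega>. \<omega> (tape_pos (f \<omega>))) \<in> borel_measurable random_tape"
    by (rule measurable_compose_countable[where f = "\<lambda>a \<omega>. \<omega> a"]) measurable
  have [measurable]: "(\<lambda>\<omega>. real (words (f \<omega>) j)) \<in> borel_measurable random_tape" for j
    by (rule measurable_compose_countable[where f = "\<lambda>a \<omega>. real a"]) measurable
  have le: "Measurable.pred random_tape (\<lambda>\<omega>. g \<omega> \<le> h \<omega>)"
    if [measurable]: "g \<in> measurable random_tape (count_space UNIV)"
      "h \<in> measurable random_tape (count_space UNIV)" for g h :: "(nat \<Rightarrow> real) \<Rightarrow> nat"
    by measurable
  have [measurable]: "Measurable.pred random_tape (\<lambda>\<omega>. words (f \<omega>) j \<le> words (f \<omega>) k)" for j k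
    using assms by (intro le) (auto simp: measurable_config_def)
  show ?thesis
    by (cases i; simp add: measurable_config_def set_word_def set_real_def jump_if_def fun_upd_def; measurable)
qed

lemma measurable_config_step:
  assumes "measurable_config f"
  shows "measurable_config (\<lambda>\<omega>. step P inp \<omega> (f \<omega>))"
proof -
  have f [measurable]: "(\<lambda>\<omega>. pc (f \<omega>)) \<in> measurable random_tape (count_space UNIV)"
    "\<And>a. (\<lambda>\<omega>. words (f \<omega>) a) \<in> measurable random_tape (count_space UNIV)"
    "\<And>a. (\<lambda>\<omega>. reals (f \<omega>) a) \<in> borel_measurable random_tape"
    "(\<lambda>\<omega>. tape_pos (f \<omega>)) \<in> measurable random_tape (count_space UNIV)"
    using assms by (auto simp: measurable_config_def)
  have e: "measurable_config (\<lambda>\<omega>. exec_instr inp \<omega> (P ! k) (f \<omega>))" for k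
    using assms by (rule measurable_config_exec)
  have [measurable]: "(\<lambda>\<omega>. pc (exec_instr inp \<omega> (P ! pc (f \<omega>)) (f \<omega>))) \<in> measurable random_tape (count_space UNIV)"
    by (rule measurable_compose_countable[where f = "\<lambda>k \<omega>. pc (exec_instr inp \<omega> (P ! k) (f \<omega>))"])
      (use e in \<open>auto simp: measurable_config_def\<close>)
  have [measurable]: "(\<lambda>\<omega>. words (exec_instr inp \<omega> (P ! pc (f \<omega>)) (f \<omega>)) a) \<in> measurable random_tape (count_space UNIV)" for a
    by (rule measurable_compose_countable[where f = "\<lambda>k \<omega>. words (exec_instr inp \<omega> (P ! k) (f \<omega>)) a"])
      (use e in \<open>auto simp: measurable_config_def\<close>)
  have [measurable]: "(\<lambda>\<omega>. reals (exec_instr inp \<omega> (P ! pc (f \<omega>)) (f \<omega>)) a) \<in> borel_measurable random_tape" for a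
    by (rule measurable_compose_countable[where f = "\<lambda>k \<omega>. reals (exec_instr inp \<omega> (P ! k) (f \<omega>)) a"])
      (use e in \<open>auto simp: measurable_config_def\<close>)
  have [measurable]: "(\<lambda>\<omega>. tape_pos (exec_instr inp \<omega> (P ! pc (f \<omega>)) (f \<omega>))) \<in> measurable random_tape (count_space UNIV)"
    by (rule measurable_compose_countable[where f = "\<lambda>k \<omega>. tape_pos (exec_instr inp \<omega> (P ! k) (f \<omega>))"])
      (use e in \<open>auto simp: measurable_config_def\<close>)
  show ?thesis
    unfolding measurable_config_def step_def halted_def
    by (simp add: if_distrib[of pc] if_distrib[of words] if_distrib[of reals] if_distrib[of tape_pos]
        if_distribR cong: if_cong)
qed

lemma measurable_config_steps:
  "measurable_config f \<Longrightarrow> measurable_config (\<lambda>\<omega>. steps P inp \<omega> t (f \<omega>))"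
proof (induction t)
  case (Suc t)
  then show ?case
    using measurable_config_step[of "\<lambda>\<omega>. steps P inp \<omega> t (f \<omega>)"] by (simp add: steps_def)
qed (simp add: steps_def)

lemma measurable_config_final:
  assumes "measurable_config f"
  shows "measurable_config (\<lambda>\<omega>. final P inp \<omega> (f \<omega>))"
proof -
  let ?l = "\<lambda>\<omega>. LEAST t. halted P (steps P inp \<omega> t (f \<omega>))"
  note s = measurable_config_steps[OF assms, of P inp]
  have [measurable]: "(\<lambda>\<omega>. pc (steps P inp \<omega> t (f \<omega>))) \<in> measurable random_tape (count_space UNIV)"
     "(\<lambda>\<omega>. words (steps P inp \<omega> t (f \<omega>)) a) \<in> measurable random_tape (count_space UNIV)"
     "(\<lambda>\<omega>. reals (steps P inp \<omega> t (f \<omega>)) a) \<in> borel_measurable random_tape"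
     "(\<lambda>\<omega>. tape_pos (steps P inp \<omega> t (f \<omega>))) \<in> measurable random_tape (count_space UNIV)" for t a
    using s by (auto simp: measurable_config_def)
  have [measurable]: "?l \<in> measurable random_tape (count_space UNIV)"
    unfolding halted_def by measurable
  have "(\<lambda>\<omega>. pc (steps P inp \<omega> (?l \<omega>) (f \<omega>))) \<in> measurable random_tape (count_space UNIV)"
    by (rule measurable_compose_countable[where f = "\<lambda>t \<omega>. pc (steps P inp \<omega> t (f \<omega>))"]) measurable
  moreover have "(\<lambda>\<omega>. words (steps P inp \<omega> (?l \<omega>) (f \<omega>)) a) \<in> measurable random_tape (count_space UNIV)" for a
    by (rule measurable_compose_countable[where f = "\<lambda>t \<omega>. words (steps P inp \<omega> t (f \<omega>)) a"]) measurable
  moreover have "(\<lambda>\<omega>. reals (steps P inp \<omega> (?l \<omega>) (f \<omega>)) a) \<in> borel_measurable random_tape" for a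
    by (rule measurable_compose_countable[where f = "\<lambda>t \<omega>. reals (steps P inp \<omega> t (f \<omega>)) a"]) measurable
  moreover have "(\<lambda>\<omega>. tape_pos (steps P inp \<omega> (?l \<omega>) (f \<omega>))) \<in> measurable random_tape (count_space UNIV)"
    by (rule measurable_compose_countable[where f = "\<lambda>t \<omega>. tape_pos (steps P inp \<omega> t (f \<omega>))"]) measurable
  ultimately show ?thesis
    unfolding final_def measurable_config_def by blast
qed

text \<open>The measure of the success event will be bounded below by that of a smaller event, and
  monotonicity asks for the larger event to be measurable.\<close>

lemma sets_prep_succeeds:
  "{\<omega> \<in> space random_tape. prep_succeeds prep qry d n \<epsilon> \<tau> c x a q \<omega>} \<in> sets random_tape"
proof -
  let ?g = "\<lambda>\<omega>. preprocessed prep d n \<epsilon> \<tau> c x \<omega>"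
  have "measurable_config ?g"
    unfolding preprocessed_def
    by (rule measurable_config_final) (simp add: measurable_config_def)
  then have "measurable_config (\<lambda>\<omega>. query_start (?g \<omega>))"
    by (simp add: measurable_config_def query_start_def)
  from measurable_config_final[OF this, of qry q]
  have [measurable]: "(\<lambda>\<omega>. query_answer qry q \<omega> (?g \<omega>)) \<in> measurable random_tape (count_space UNIV)"
    unfolding query_answer_def measurable_config_def by blast
  show ?thesis
    unfolding prep_succeeds_def Let_def by measurable
qed

section \<open>Random projection trees\<close>

datatype tree = Tip | Node tree nat tree

text \<open>Quantities that depend on the random tree can be treated by cases over countably many
  trees.\<close>

instance tree :: countable
  by countable_datatype

fun nodes :: "tree \<Rightarrow> nat set" where
  "nodes Tip = {}"
| "nodes (Node l p r) = insert p (nodes l \<union> nodes r)"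

fun height :: "tree \<Rightarrow> nat" where
  "height Tip = 0"
| "height (Node l p r) = Suc (max (height l) (height r))"

fun wf_tree :: "tree \<Rightarrow> bool" where
  "wf_tree Tip \<longleftrightarrow> True"
| "wf_tree (Node l p r) \<longleftrightarrow> p \<notin> nodes l \<and> p \<notin> nodes r \<and> nodes l \<inter> nodes r = {} \<and> wf_tree l \<and> wf_tree r"

definition dot :: "nat \<Rightarrow> (nat \<Rightarrow> real) \<Rightarrow> (nat \<Rightarrow> real) \<Rightarrow> real" where
  "dot d a v = (\<Sum>k<d. a k * v k)"

definition shift :: "nat \<Rightarrow> (nat \<Rightarrow> real) \<Rightarrow> nat \<Rightarrow> real" where
  "shift m \<omega> = (\<lambda>i. \<omega> (m + i))"

text \<open>The tie-break by the least index matches a scan that replaces its candidate only by a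
  strictly smaller key.\<close>

definition pivot :: "nat set \<Rightarrow> (nat \<Rightarrow> real) \<Rightarrow> nat" where
  "pivot S \<kappa> = (LEAST p. p \<in> S \<and> (\<forall>i\<in>S. \<kappa> p \<le> \<kappa> i))"

lemma pivot_props:
  assumes "finite S" "S \<noteq> {}"
  shows "pivot S \<kappa> \<in> S" "i \<in> S \<Longrightarrow> \<kappa> (pivot S \<kappa>) \<le> \<kappa> i"
proof -
  have "Min (\<kappa> ` S) \<in> \<kappa> ` S"
    using assms by (intro Min_in) auto
  then obtain p where "p \<in> S" "\<kappa> p = Min (\<kappa> ` S)"
    by (metis imageE)
  then have "p \<in> S \<and> (\<forall>i\<in>S. \<kappa> p \<le> \<kappa> i)"
    using assms by auto
  from LeastI[of "\<lambda>p. p \<in> S \<and> (\<forall>i\<in>S. \<kappa> p \<le> \<kappa> i)", OF this]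
  show "pivot S \<kappa> \<in> S" "i \<in> S \<Longrightarrow> \<kappa> (pivot S \<kappa>) \<le> \<kappa> i"
    by (auto simp: pivot_def)
qed

lemma pivot_eqI:
  assumes "p \<in> S" "\<And>i. i \<in> S \<Longrightarrow> \<kappa> p \<le> \<kappa> i" "\<And>i. i \<in> S \<Longrightarrow> i < p \<Longrightarrow> \<kappa> p < \<kappa> i"
  shows "pivot S \<kappa> = p"
  unfolding pivot_def using assms
  by (intro Least_equality) (auto simp: not_less[symmetric])

locale points =
  fixes d n :: nat and x :: "nat \<Rightarrow> nat \<Rightarrow> real"
begin

text \<open>Each level of the tree consumes \<open>d\<close> random numbers for a direction and \<open>n\<close> for the keys
  that determine the pivots.\<close>

abbreviation next_level :: "(nat \<Rightarrow> real) \<Rightarrow> nat \<Rightarrow> real" where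
  "next_level \<equiv> shift (d + n)"

definition proj :: "(nat \<Rightarrow> real) \<Rightarrow> nat \<Rightarrow> nat \<Rightarrow> real" where
  "proj \<omega> p i = dot d \<omega> (\<lambda>k. x i k - x p k)"

text \<open>\<open>L\<close> limits the height: the points of cells that are left after
  \<open>L\<close> levels do not enter the tree. All cells of a level read the same direction and
  the same table of keys, since the tape is shifted once per level.\<close>

fun build :: "nat \<Rightarrow> nat set \<Rightarrow> (nat \<Rightarrow> real) \<Rightarrow> tree" where
  "build 0 S \<omega> = Tip"
| "build (Suc L) S \<omega> =
     (if S = {} then Tip
      else let p = pivot S (shift d \<omega>)
        in Node (build L {i \<in> S - {p}. proj \<omega> p i < 0} (next_level \<omega>)) p
             (build L {i \<in> S - {p}. \<not> proj \<omega> p i < 0} (next_level \<omega>)))"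

lemma nodes_build: "finite S \<Longrightarrow> nodes (build L S \<omega>) \<subseteq> S"
proof (induction L arbitrary: S \<omega>)
  case (Suc L)
  show ?case
    using Suc.prems pivot_props(1)[of S "shift d \<omega>"]
      Suc.IH[of "{i \<in> S - {pivot S (shift d \<omega>)}. proj \<omega> (pivot S (shift d \<omega>)) i < 0}" "next_level \<omega>"]
      Suc.IH[of "{i \<in> S - {pivot S (shift d \<omega>)}. \<not> proj \<omega> (pivot S (shift d \<omega>)) i < 0}" "next_level \<omega>"]
    by (auto simp: Let_def)
qed simp

lemma wf_build: "finite S \<Longrightarrow> wf_tree (build L S \<omega>)"
proof (induction L arbitrary: S \<omega>)
  case (Suc L)
  let ?p = "pivot S (shift d \<omega>)"
  show ?case
    using Suc nodes_build[of "{i \<in> S - {?p}. proj \<omega> ?p i < 0}" L "next_level \<omega>"]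
      nodes_build[of "{i \<in> S - {?p}. \<not> proj \<omega> ?p i < 0}" L "next_level \<omega>"]
    by (fastforce simp: Let_def)
qed simp

lemma height_build: "height (build L S \<omega>) \<le> L"
  by (induction L arbitrary: S \<omega>) (auto simp: Let_def)

text \<open>The record of point \<open>i\<close> starts at \<open>addr i\<close>; the words at offsets 1 and 2 are the
  pointers to the left and the right subtree, and slot 39 is the pointer to the root.\<close>

definition addr :: "nat \<Rightarrow> nat" where
  "addr i = 40 + i * (d + 3)"

lemma addr_eq_iff [simp]: "addr i = addr j \<longleftrightarrow> i = j"
  by (simp add: addr_def)

lemma addr_ge: "40 \<le> addr i"
  by (simp add: addr_def)

lemma addr_mono: "i < j \<Longrightarrow> addr i + (d + 3) \<le> addr j"
proof -
  assume "i < j"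
  then have "(i + 1) * (d + 3) \<le> j * (d + 3)"
    by (intro mult_right_mono) auto
  then show ?thesis
    by (simp add: addr_def algebra_simps)
qed

lemma addr_add_eq_iff:
  assumes "a < d + 3" "b < d + 3"
  shows "addr i + a = addr j + b \<longleftrightarrow> i = j \<and> a = b"
proof -
  have "addr i + a \<noteq> addr j + b" if "i \<noteq> j"
    using addr_mono[of i j] addr_mono[of j i] assms that by (cases "i < j") auto
  then show ?thesis
    by (cases "i = j") auto
qed

lemma addr_neq [simp]:
  "addr i \<noteq> Suc (addr j)" "Suc (addr j) \<noteq> addr i"
  "addr i \<noteq> Suc (Suc (addr j))" "Suc (Suc (addr j)) \<noteq> addr i"
  using addr_add_eq_iff[of 0 1 i j] addr_add_eq_iff[of 0 2 i j] by auto

text \<open>The first word of a record points back to the slot that holds the node, so a search can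
  climb without a stack.\<close>

fun represents :: "(nat \<Rightarrow> nat) \<Rightarrow> nat \<Rightarrow> tree \<Rightarrow> bool" where
  "represents W s Tip \<longleftrightarrow> W s = 0"
| "represents W s (Node l p r) \<longleftrightarrow> W s = addr p \<and> W (addr p) = s \<and> p < n
     \<and> represents W (addr p + 1) l \<and> represents W (addr p + 2) r"

fun slots :: "tree \<Rightarrow> nat \<Rightarrow> nat set" where
  "slots Tip s = {s}"
| "slots (Node l p r) s = insert s (slots l (addr p + 1) \<union> slots r (addr p + 2))"

fun tip_slots :: "tree \<Rightarrow> nat \<Rightarrow> nat set" where
  "tip_slots Tip s = {s}"
| "tip_slots (Node l p r) s = tip_slots l (addr p + 1) \<union> tip_slots r (addr p + 2)"

lemma slots_subset: "slots T s \<subseteq> insert s (\<Union>p\<in>nodes T. {addr p + 1, addr p + 2})"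
proof (induction T arbitrary: s)
  case (Node l p r)
  show ?case
    using Node[of "addr p + 1"] Node[of "addr p + 2"] by auto
qed simp

lemma tip_slots_subset: "tip_slots T s \<subseteq> slots T s"
  by (induction T arbitrary: s) auto

text \<open>Child slots of distinct nodes are distinct; freshness of the slot of the root extends
  this to all slots of the tree.\<close>

definition fresh :: "nat \<Rightarrow> tree \<Rightarrow> bool" where
  "fresh s T \<longleftrightarrow> (\<forall>p\<in>nodes T. s \<noteq> addr p + 1 \<and> s \<noteq> addr p + 2)"

lemma slots_disjoint:
  assumes "wf_tree (Node l p r)" "fresh s (Node l p r)"
  shows "slots l (addr p + 1) \<inter> slots r (addr p + 2) = {}"
    "s \<notin> slots l (addr p + 1)" "s \<notin> slots r (addr p + 2)"
    "fresh (addr p + 1) l" "fresh (addr p + 2) r"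
    "fresh (addr p + 1) r" "fresh (addr p + 2) l" "addr p + 1 \<notin> slots r (addr p + 2)"
    "addr p + 2 \<notin> slots l (addr p + 1)"
proof -
  have l: "u = Suc (addr p) \<or> (\<exists>i\<in>nodes l. u = Suc (addr i) \<or> u = Suc (Suc (addr i)))"
    if "u \<in> slots l (addr p + 1)" for u
    using slots_subset[of l "addr p + 1"] that by auto
  have r: "u = Suc (Suc (addr p)) \<or> (\<exists>i\<in>nodes r. u = Suc (addr i) \<or> u = Suc (Suc (addr i)))"
    if "u \<in> slots r (addr p + 2)" for u
    using slots_subset[of r "addr p + 2"] that by auto
  have w: "p \<notin> nodes l" "p \<notin> nodes r" "nodes l \<inter> nodes r = {}"
    using assms(1) by auto
  have f: "s \<noteq> Suc (addr i) \<and> s \<noteq> Suc (Suc (addr i))" if "i \<in> insert p (nodes l \<union> nodes r)" for i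
    using assms(2) that by (auto simp: fresh_def)
  show "slots l (addr p + 1) \<inter> slots r (addr p + 2) = {}"
  proof (rule equals0I)
    fix u assume "u \<in> slots l (addr p + 1) \<inter> slots r (addr p + 2)"
    then show False
      using l[of u] r[of u] w by auto
  qed
  show "s \<notin> slots l (addr p + 1)"
    using l[of s] f by blast
  show "s \<notin> slots r (addr p + 2)"
    using r[of s] f by blast
  show "fresh (addr p + 1) l" "fresh (addr p + 2) r" "fresh (addr p + 1) r" "fresh (addr p + 2) l"
    using w by (auto simp: fresh_def)
  show "addr p + 1 \<notin> slots r (addr p + 2)"
    using r[of "addr p + 1"] w by auto
  show "addr p + 2 \<notin> slots l (addr p + 1)"
    using l[of "addr p + 2"] w by auto
qed

end

section \<open>Best-first search\<close>

text \<open>Keys \<open>K \<ge> 0\<close> are stored as \<open>K / (1 + K)\<close>, so that 1 represents an exhausted subtree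
  and 0 an untouched one.\<close>

definition code :: "real \<Rightarrow> real" where
  "code K = K / (1 + K)"

lemma code_le_iff: "0 \<le> K \<Longrightarrow> 0 \<le> K' \<Longrightarrow> code K \<le> code K' \<longleftrightarrow> K \<le> K'"
  by (simp add: code_def field_simps)

lemma code_bounds: "0 \<le> K \<Longrightarrow> 0 \<le> code K" "0 \<le> K \<Longrightarrow> code K < 1"
  by (auto simp: code_def field_simps)

locale query = points +
  fixes q :: "nat \<Rightarrow> real"
begin

text \<open>The projection of the query relative to the pivot. Points of negative relative
  projection go left, so the child on the side of the query is the one that inherits the key
  unchanged.\<close>

definition gap :: "(nat \<Rightarrow> real) \<Rightarrow> nat \<Rightarrow> real" where
  "gap \<omega> p = dot d \<omega> (\<lambda>k. q k - x p k)"

definition lkey :: "(nat \<Rightarrow> real) \<Rightarrow> nat \<Rightarrow> real \<Rightarrow> real" where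
  "lkey \<omega> p K = (if gap \<omega> p < 0 then K else K + gap \<omega> p ^ 16)"

definition rkey :: "(nat \<Rightarrow> real) \<Rightarrow> nat \<Rightarrow> real \<Rightarrow> real" where
  "rkey \<omega> p K = (if gap \<omega> p < 0 then K + gap \<omega> p ^ 16 else K)"

lemma key_ge: "K \<le> lkey \<omega> p K" "K \<le> rkey \<omega> p K" "min (lkey \<omega> p K) (rkey \<omega> p K) = K"
  by (auto simp: lkey_def rkey_def)

fun tips_upto :: "tree \<Rightarrow> nat \<Rightarrow> real \<Rightarrow> (nat \<Rightarrow> real) \<Rightarrow> real \<Rightarrow> nat set" where
  "tips_upto Tip s K \<omega> W = (if K \<le> W then {s} else {})"
| "tips_upto (Node l p r) s K \<omega> W =
     tips_upto l (addr p + 1) (lkey \<omega> p K) (next_level \<omega>) W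
     \<union> tips_upto r (addr p + 2) (rkey \<omega> p K) (next_level \<omega>) W"

fun count_upto :: "tree \<Rightarrow> real \<Rightarrow> (nat \<Rightarrow> real) \<Rightarrow> real \<Rightarrow> nat" where
  "count_upto Tip K \<omega> W = (if K \<le> W then 1 else 0)"
| "count_upto (Node l p r) K \<omega> W =
     count_upto l (lkey \<omega> p K) (next_level \<omega>) W + count_upto r (rkey \<omega> p K) (next_level \<omega>) W"

lemma card_tips_upto: "card (tips_upto T s K \<omega> W) \<le> count_upto T K \<omega> W"
proof (induction T arbitrary: s K \<omega>)
  case (Node l p r)
  show ?case
    using card_Un_le[of "tips_upto l (addr p + 1) (lkey \<omega> p K) (next_level \<omega>) W"
        "tips_upto r (addr p + 2) (rkey \<omega> p K) (next_level \<omega>) W"]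
      Node(1)[of "addr p + 1" "lkey \<omega> p K" "next_level \<omega>"]
      Node(2)[of "addr p + 2" "rkey \<omega> p K" "next_level \<omega>"] by simp
qed simp

lemma finite_tips_upto: "finite (tips_upto T s K \<omega> W)"
  by (induction T arbitrary: s K \<omega>) auto

lemma tips_upto_subset: "tips_upto T s K \<omega> W \<subseteq> tip_slots T s"
proof (induction T arbitrary: s K \<omega>)
  case (Node l p r)
  show ?case
    using Node(1)[of "addr p + 1" "lkey \<omega> p K" "next_level \<omega>"]
      Node(2)[of "addr p + 2" "rkey \<omega> p K" "next_level \<omega>"] by auto
qed simp

fun node_key :: "tree \<Rightarrow> real \<Rightarrow> (nat \<Rightarrow> real) \<Rightarrow> nat \<Rightarrow> real" where
  "node_key Tip K \<omega> i = K"
| "node_key (Node l p r) K \<omega> i =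
     (if i = p then K
      else if i \<in> nodes l then node_key l (lkey \<omega> p K) (next_level \<omega>) i
      else node_key r (rkey \<omega> p K) (next_level \<omega>) i)"

text \<open>The least coded key of an unexplored tip. \<open>D\<close> holds the slots of the
  explored tips, which count as 1 and thereby exceed every code.\<close>

fun best :: "tree \<Rightarrow> nat \<Rightarrow> real \<Rightarrow> (nat \<Rightarrow> real) \<Rightarrow> nat set \<Rightarrow> real" where
  "best Tip s K \<omega> D = (if s \<in> D then 1 else code K)"
| "best (Node l p r) s K \<omega> D =
     min (best l (addr p + 1) (lkey \<omega> p K) (next_level \<omega>) D)
         (best r (addr p + 2) (rkey \<omega> p K) (next_level \<omega>) D)"

lemma best_empty: "0 \<le> K \<Longrightarrow> best T s K \<omega> {} = code K"
proof (induction T arbitrary: s K \<omega>)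
  case (Node l p r)
  have "0 \<le> lkey \<omega> p K" "0 \<le> rkey \<omega> p K"
    using Node.prems by (auto simp: lkey_def rkey_def)
  moreover from this have "min (code (lkey \<omega> p K)) (code (rkey \<omega> p K)) = code K"
    using Node.prems code_le_iff[of K "K + gap \<omega> p ^ 16"] by (auto simp: lkey_def rkey_def min_def)
  ultimately show ?case
    using Node by simp
qed simp

lemma best_cong: "D \<inter> tip_slots T s = D' \<inter> tip_slots T s \<Longrightarrow> best T s K \<omega> D = best T s K \<omega> D'"
proof (induction T arbitrary: s K \<omega>)
  case (Node l p r)
  have "D \<inter> tip_slots l (addr p + 1) = D' \<inter> tip_slots l (addr p + 1)"
    "D \<inter> tip_slots r (addr p + 2) = D' \<inter> tip_slots r (addr p + 2)"
    using Node.prems by auto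
  then show ?case
    using Node.IH by simp
qed auto

lemma best_le:
  "0 \<le> K \<Longrightarrow> u \<in> tips_upto T s K \<omega> W \<Longrightarrow> u \<notin> D \<Longrightarrow> best T s K \<omega> D \<le> code W"
proof (induction T arbitrary: s K \<omega>)
  case Tip
  then show ?case
    by (auto simp: code_le_iff split: if_splits)
next
  case (Node l p r)
  then have "0 \<le> lkey \<omega> p K" "0 \<le> rkey \<omega> p K"
    by (auto simp: lkey_def rkey_def)
  then show ?case
    using Node by (auto simp: min_le_iff_disj)
qed

text \<open>An entry may still be 0 although the key of its subtree is positive, because nothing is
  initialised for a query. The correct value is the maximum of the entry and the coded key, and the
  key is known on the way down.\<close>

fun good :: "(nat \<Rightarrow> real) \<Rightarrow> nat set \<Rightarrow> tree \<Rightarrow> nat \<Rightarrow> real \<Rightarrow> (nat \<Rightarrow> real) \<Rightarrow> bool" where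
  "good R D Tip s K \<omega> \<longleftrightarrow> max (R s) (code K) = best Tip s K \<omega> D"
| "good R D (Node l p r) s K \<omega> \<longleftrightarrow> max (R s) (code K) = best (Node l p r) s K \<omega> D
     \<and> good R D l (addr p + 1) (lkey \<omega> p K) (next_level \<omega>)
     \<and> good R D r (addr p + 2) (rkey \<omega> p K) (next_level \<omega>)"

lemma good_top: "good R D T s K \<omega> \<Longrightarrow> max (R s) (code K) = best T s K \<omega> D"
  by (cases T) auto

lemma good_cong:
  "(\<And>u. u \<in> slots T s \<Longrightarrow> R u = R' u) \<Longrightarrow> D \<inter> slots T s = D' \<inter> slots T s \<Longrightarrow>
   good R D T s K \<omega> \<longleftrightarrow> good R' D' T s K \<omega>"
proof (induction T arbitrary: s K \<omega>)
  case Tip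
  then show ?case
    by auto
next
  case (Node l p r)
  have D: "D \<inter> slots l (addr p + 1) = D' \<inter> slots l (addr p + 1)"
    "D \<inter> slots r (addr p + 2) = D' \<inter> slots r (addr p + 2)"
    using Node.prems(2) by auto
  have "D \<inter> tip_slots (Node l p r) s = D' \<inter> tip_slots (Node l p r) s"
    using tip_slots_subset[of "Node l p r" s] Node.prems(2) by blast
  from best_cong[OF this] D Node show ?case
    by auto
qed

lemma good_init:
  "0 \<le> K \<Longrightarrow> (\<And>u. u \<in> slots T s \<Longrightarrow> R u = 0) \<Longrightarrow> good R {} T s K \<omega>"
proof (induction T arbitrary: s K \<omega>)
  case Tip
  then show ?case
    using code_bounds(1) by auto
next
  case (Node l p r s K \<omega>)
  have "0 \<le> lkey \<omega> p K" "0 \<le> rkey \<omega> p K"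
    using Node.prems(1) by (auto simp: lkey_def rkey_def)
  moreover have "max (R s) (code K) = best (Node l p r) s K \<omega> {}"
    unfolding best_empty[OF Node.prems(1)] using Node.prems code_bounds(1)[of K] by auto
  ultimately show ?case
    using Node by auto
qed

text \<open>A path is a list of directions from the root, where \<open>True\<close> means left.\<close>

fun go :: "bool list \<Rightarrow> tree \<times> nat \<times> real \<times> (nat \<Rightarrow> real) \<Rightarrow> tree \<times> nat \<times> real \<times> (nat \<Rightarrow> real)" where
  "go [] st = st"
| "go (b # \<pi>) (Tip, s, K, \<omega>) = (Tip, s, K, \<omega>)"
| "go (b # \<pi>) (Node l p r, s, K, \<omega>) =
     go \<pi> (if b then (l, addr p + 1, lkey \<omega> p K, next_level \<omega>)
            else (r, addr p + 2, rkey \<omega> p K, next_level \<omega>))"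

fun is_path :: "bool list \<Rightarrow> tree \<Rightarrow> bool" where
  "is_path [] T \<longleftrightarrow> True"
| "is_path (b # \<pi>) Tip \<longleftrightarrow> False"
| "is_path (b # \<pi>) (Node l p r) \<longleftrightarrow> is_path \<pi> (if b then l else r)"

fun path_nodes :: "bool list \<Rightarrow> tree \<Rightarrow> nat set" where
  "path_nodes (b # \<pi>) (Node l p r) = insert p (path_nodes \<pi> (if b then l else r))"
| "path_nodes _ _ = {}"

text \<open>While the search is below the end of a path, the values of the nodes strictly above it
  need not be up to date.\<close>

fun good_path :: "(nat \<Rightarrow> real) \<Rightarrow> nat set \<Rightarrow> bool list \<Rightarrow> tree \<Rightarrow> nat \<Rightarrow> real \<Rightarrow> (nat \<Rightarrow> real) \<Rightarrow> bool" where
  "good_path R D [] T s K \<omega> \<longleftrightarrow> good R D T s K \<omega>"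
| "good_path R D (b # \<pi>) Tip s K \<omega> \<longleftrightarrow> False"
| "good_path R D (b # \<pi>) (Node l p r) s K \<omega> \<longleftrightarrow>
     code (lkey \<omega> p K) \<le> R (addr p + 1) \<and> code (rkey \<omega> p K) \<le> R (addr p + 2) \<and>
     (if b then good_path R D \<pi> l (addr p + 1) (lkey \<omega> p K) (next_level \<omega>)
         \<and> good R D r (addr p + 2) (rkey \<omega> p K) (next_level \<omega>)
      else good R D l (addr p + 1) (lkey \<omega> p K) (next_level \<omega>)
         \<and> good_path R D \<pi> r (addr p + 2) (rkey \<omega> p K) (next_level \<omega>))"

lemma go_snoc:
  "go \<pi> (T, s, K, \<omega>) = (Node l p r, s', K', \<omega>') \<Longrightarrow>
   go (\<pi> @ [b]) (T, s, K, \<omega>) = (if b then (l, addr p + 1, lkey \<omega>' p K', next_level \<omega>')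
            else (r, addr p + 2, rkey \<omega>' p K', next_level \<omega>'))"
proof (induction \<pi> arbitrary: T s K \<omega>)
  case (Cons a \<pi>)
  then show ?case
    by (cases T) (auto split: if_splits)
qed simp

lemma is_path_snoc:
  "is_path \<pi> T \<Longrightarrow> go \<pi> (T, s, K, \<omega>) = (Node l p r, s', K', \<omega>') \<Longrightarrow> is_path (\<pi> @ [b]) T"
proof (induction \<pi> arbitrary: T s K \<omega>)
  case (Cons a \<pi>)
  then show ?case
    by (cases T) (auto split: if_splits)
qed auto

lemma is_path_butlast:
  "is_path (\<pi> @ [b]) T \<Longrightarrow> is_path \<pi> T \<and> (\<exists>l p r s' K' \<omega>'. go \<pi> (T, s, K, \<omega>) = (Node l p r, s', K', \<omega>'))"
proof (induction \<pi> arbitrary: T s K \<omega>)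
  case Nil
  then show ?case
    by (cases T) auto
next
  case (Cons a \<pi>)
  then show ?case
    by (cases T) (auto split: if_splits)
qed

lemma length_path: "is_path \<pi> T \<Longrightarrow> go \<pi> (T, s, K, \<omega>) = (T', s', K', \<omega>') \<Longrightarrow> length \<pi> + height T' \<le> height T"
proof (induction \<pi> arbitrary: T s K \<omega>)
  case (Cons a \<pi>)
  then show ?case
    by (cases T) (fastforce split: if_splits)+
qed auto

lemma go_slots: "is_path \<pi> T \<Longrightarrow> go \<pi> (T, s, K, \<omega>) = (T', s', K', \<omega>') \<Longrightarrow>
    slots T' s' \<subseteq> slots T s \<and> nodes T' \<subseteq> nodes T \<and> (0 \<le> K \<longrightarrow> 0 \<le> K') \<and> \<omega>' = shift (length \<pi> * (d + n)) \<omega>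
    \<and> tip_slots T' s' \<subseteq> tip_slots T s"
proof (induction \<pi> arbitrary: T s K \<omega>)
  case (Cons a \<pi>)
  obtain l p r where T: "T = Node l p r"
    using Cons.prems by (cases T) auto
  have "shift (length \<pi> * (d + n)) (next_level \<omega>) = shift (length (a # \<pi>) * (d + n)) \<omega>"
    by (simp add: shift_def fun_eq_iff algebra_simps)
  moreover have "0 \<le> lkey \<omega> p K" "0 \<le> rkey \<omega> p K" if "0 \<le> K"
    using that by (auto simp: lkey_def rkey_def)
  ultimately show ?case
    using Cons.prems Cons.IH[of l "addr p + 1" "lkey \<omega> p K" "next_level \<omega>"]
      Cons.IH[of r "addr p + 2" "rkey \<omega> p K" "next_level \<omega>"] unfolding T
    by (auto split: if_splits)
qed (auto simp: shift_def)

lemma go_represents: "represents W s T \<Longrightarrow> is_path \<pi> T \<Longrightarrow> go \<pi> (T, s, K, \<omega>) = (T', s', K', \<omega>') \<Longrightarrow>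
    represents W s' T'"
proof (induction \<pi> arbitrary: T s K \<omega>)
  case (Cons a \<pi>)
  then show ?case
    by (cases T) (auto split: if_splits)
qed auto

lemma good_path_cong:
  "(\<And>u. u \<in> slots T s \<Longrightarrow> R u = R' u) \<Longrightarrow> D \<inter> slots T s = D' \<inter> slots T s \<Longrightarrow>
   good_path R D \<pi> T s K \<omega> \<longleftrightarrow> good_path R' D' \<pi> T s K \<omega>"
proof (induction \<pi> arbitrary: T s K \<omega>)
  case Nil
  show ?case
    using good_cong[OF Nil] by simp
next
  case (Cons b \<pi>)
  show ?case
  proof (cases T)
    case (Node l p r)
    have "addr p + 1 \<in> slots l (addr p + 1)" "addr p + 2 \<in> slots r (addr p + 2)"
      by (cases l; auto) (cases r; auto)
    then have "R (addr p + 1) = R' (addr p + 1)" "R (addr p + 2) = R' (addr p + 2)"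
      using Cons.prems(1) unfolding Node by auto
    moreover have "good_path R D \<pi> l (addr p + 1) K1 \<omega>1 \<longleftrightarrow> good_path R' D' \<pi> l (addr p + 1) K1 \<omega>1"
      "good_path R D \<pi> r (addr p + 2) K1 \<omega>1 \<longleftrightarrow> good_path R' D' \<pi> r (addr p + 2) K1 \<omega>1"
      "good R D l (addr p + 1) K1 \<omega>1 \<longleftrightarrow> good R' D' l (addr p + 1) K1 \<omega>1"
      "good R D r (addr p + 2) K1 \<omega>1 \<longleftrightarrow> good R' D' r (addr p + 2) K1 \<omega>1" for K1 \<omega>1
      using Cons.prems unfolding Node by (intro Cons.IH good_cong; auto)+
    ultimately show ?thesis
      unfolding Node by simp
  qed simp
qed

lemma slot_in_slots [simp]: "s \<in> slots T s"
  by (cases T) auto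

text \<open>Taking the maximum with the coded keys makes the entries of both children exact. Their
  minimum is the value of the node, so the child with the smaller entry leads to a best tip.\<close>

lemma good_path_down:
  assumes "wf_tree T" "fresh s T" "0 \<le> K" "is_path \<pi> T" "good_path R D \<pi> T s K \<omega>"
    "go \<pi> (T, s, K, \<omega>) = (Node l p r, s', K', \<omega>')"
    "R' = R(addr p + 1 := max (R (addr p + 1)) (code (lkey \<omega>' p K')),
            addr p + 2 := max (R (addr p + 2)) (code (rkey \<omega>' p K')))"
  shows "good_path R' D (\<pi> @ [b]) T s K \<omega> \<and>
    R' (addr p + 1) = best l (addr p + 1) (lkey \<omega>' p K') (next_level \<omega>') D \<and>
    R' (addr p + 2) = best r (addr p + 2) (rkey \<omega>' p K') (next_level \<omega>') D \<and>
    best (Node l p r) s' K' \<omega>' D = min (R' (addr p + 1)) (R' (addr p + 2))"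
  using assms
proof (induction \<pi> arbitrary: T s K \<omega>)
  case Nil
  then have T: "T = Node l p r" "s' = s" "K' = K" "\<omega>' = \<omega>"
    by auto
  note sd = slots_disjoint[OF Nil(1,2)[unfolded T]]
  have g: "good R D l (addr p + 1) (lkey \<omega> p K) (next_level \<omega>)"
    "good R D r (addr p + 2) (rkey \<omega> p K) (next_level \<omega>)"
    using Nil(5) unfolding T by auto
  have R1: "R' (addr p + 1) = best l (addr p + 1) (lkey \<omega> p K) (next_level \<omega>) D"
    "R' (addr p + 2) = best r (addr p + 2) (rkey \<omega> p K) (next_level \<omega>) D"
    using good_top[OF g(1)] good_top[OF g(2)] Nil(7) T by auto
  have "good R' D l (addr p + 1) (lkey \<omega> p K) (next_level \<omega>)"
  proof -
    have "R' u = R u" if "u \<in> slots l (addr p + 1) - {addr p + 1}" for u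
      using that sd Nil(7) by auto
    moreover have "max (R' (addr p + 1)) (code (lkey \<omega> p K)) = max (R (addr p + 1)) (code (lkey \<omega> p K))"
      using Nil(7) T by auto
    moreover have "good R' D l1 u K1 \<omega>1 = good R D l1 u K1 \<omega>1"
      if "slots l1 u \<subseteq> slots l (addr p + 1) - {addr p + 1}" for l1 u K1 \<omega>1
      using that calculation(1) by (intro good_cong) auto
    ultimately show ?thesis
    proof (cases l)
      case (Node l1 p1 r1)
      have "fresh (addr p + 1) (Node l1 p1 r1)" "wf_tree (Node l1 p1 r1)"
        using sd(4) Node Nil(1) T by auto
      note sd1 = slots_disjoint[OF this(2,1)]
      show ?thesis
        using g(1) \<open>max (R' (addr p + 1)) _ = _\<close> sd1
          \<open>\<And>l1 u K1 \<omega>1. slots l1 u \<subseteq> slots l (addr p + 1) - {addr p + 1} \<Longrightarrow> good R' D l1 u K1 \<omega>1 = good R D l1 u K1 \<omega>1\<close>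
        unfolding Node by auto
    qed (use g(1) in simp)
  qed
  moreover have "good R' D r (addr p + 2) (rkey \<omega> p K) (next_level \<omega>)"
  proof -
    have 1: "R' u = R u" if "u \<in> slots r (addr p + 2) - {addr p + 2}" for u
      using that sd Nil(7) by auto
    have 2: "max (R' (addr p + 2)) (code (rkey \<omega> p K)) = max (R (addr p + 2)) (code (rkey \<omega> p K))"
      using Nil(7) T by auto
    have 3: "good R' D l1 u K1 \<omega>1 = good R D l1 u K1 \<omega>1"
      if "slots l1 u \<subseteq> slots r (addr p + 2) - {addr p + 2}" for l1 u K1 \<omega>1
      using that 1 by (intro good_cong) auto
    show ?thesis
    proof (cases r)
      case (Node l1 p1 r1)
      have "fresh (addr p + 2) (Node l1 p1 r1)" "wf_tree (Node l1 p1 r1)"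
        using sd(5) Node Nil(1) T by auto
      note sd1 = slots_disjoint[OF this(2,1)]
      show ?thesis
        using g(2) 2 sd1 3 unfolding Node by auto
    qed (use g(2) 2 in simp)
  qed
  moreover have "code (lkey \<omega> p K) \<le> R' (addr p + 1)" "code (rkey \<omega> p K) \<le> R' (addr p + 2)"
    using Nil(7) T by auto
  ultimately show ?case
    using R1 unfolding T by auto
next
  case (Cons a \<pi>)
  obtain l1 p1 r1 where T: "T = Node l1 p1 r1"
    using Cons.prems by (cases T) auto
  note sd = slots_disjoint[OF Cons.prems(1,2)[unfolded T]]
  have K: "0 \<le> lkey \<omega> p1 K" "0 \<le> rkey \<omega> p1 K"
    using Cons.prems(3) by (auto simp: lkey_def rkey_def)
  let ?T1 = "if a then l1 else r1" and ?s1 = "if a then addr p1 + 1 else addr p1 + 2"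
  let ?K1 = "if a then lkey \<omega> p1 K else rkey \<omega> p1 K"
  have go: "go \<pi> (?T1, ?s1, ?K1, next_level \<omega>) = (Node l p r, s', K', \<omega>')" "is_path \<pi> ?T1"
    using Cons.prems unfolding T by (auto split: if_splits)
  have IH: "good_path R' D (\<pi> @ [b]) ?T1 ?s1 ?K1 (next_level \<omega>) \<and>
    R' (addr p + 1) = best l (addr p + 1) (lkey \<omega>' p K') (next_level \<omega>') D \<and>
    R' (addr p + 2) = best r (addr p + 2) (rkey \<omega>' p K') (next_level \<omega>') D \<and>
    best (Node l p r) s' K' \<omega>' D = min (R' (addr p + 1)) (R' (addr p + 2))"
    using Cons.prems sd K go unfolding T by (intro Cons.IH) auto
  have "{addr p + 1, addr p + 2} \<subseteq> slots (Node l p r) s'"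
    using slot_in_slots[of "addr p + 1" l] slot_in_slots[of "addr p + 2" r] by auto
  then have sub: "{addr p + 1, addr p + 2} \<subseteq> slots ?T1 ?s1"
    using go_slots[OF go(2,1)] by blast
  let ?T2 = "if a then r1 else l1" and ?s2 = "if a then addr p1 + 2 else addr p1 + 1"
  have disj: "slots ?T1 ?s1 \<inter> slots ?T2 ?s2 = {}"
    using sd(1) by auto
  have other: "good R' D ?T2 ?s2 K2 \<omega>2 = good R D ?T2 ?s2 K2 \<omega>2" for K2 \<omega>2
    using sub disj Cons.prems(7) by (intro good_cong) auto
  have mono: "R u \<le> R' u" for u
    using Cons.prems(7) by auto
  have m: "code (lkey \<omega> p1 K) \<le> R' (addr p1 + 1)" "code (rkey \<omega> p1 K) \<le> R' (addr p1 + 2)"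
    using Cons.prems(5) mono[of "addr p1 + 1"] mono[of "addr p1 + 2"] unfolding T by simp_all
  have "good_path R' D (a # \<pi> @ [b]) T s K \<omega>"
    using IH[THEN conjunct1] other Cons.prems(5) m unfolding T by (cases a) simp_all
  then show ?case
    unfolding append_Cons using IH by blast
qed

text \<open>Only the entry of the tip changes, and subtrees off the path have other slots. The
  entries above become stale, which \<open>good_path\<close> permits.\<close>

lemma good_path_tip:
  assumes "wf_tree T" "fresh s T" "0 \<le> K" "good_path R D \<pi> T s K \<omega>"
    "go \<pi> (T, s, K, \<omega>) = (Tip, s', K', \<omega>')"
    "is_path \<pi> T" "R' = R(s' := 1)"
  shows "good_path R' (insert s' D) \<pi> T s K \<omega>"
  using assms
proof (induction \<pi> arbitrary: T s K \<omega>)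
  case Nil
  then show ?case
    using code_bounds(2)[of K] by auto
next
  case (Cons a \<pi>)
  obtain l1 p1 r1 where T: "T = Node l1 p1 r1"
    using Cons.prems by (cases T) auto
  note sd = slots_disjoint[OF Cons.prems(1,2)[unfolded T]]
  have K: "0 \<le> lkey \<omega> p1 K" "0 \<le> rkey \<omega> p1 K"
    using Cons.prems(3) by (auto simp: lkey_def rkey_def)
  let ?T1 = "if a then l1 else r1" and ?s1 = "if a then addr p1 + 1 else addr p1 + 2"
  let ?K1 = "if a then lkey \<omega> p1 K else rkey \<omega> p1 K"
  have go: "go \<pi> (?T1, ?s1, ?K1, next_level \<omega>) = (Tip, s', K', \<omega>')" "is_path \<pi> ?T1"
    using Cons.prems unfolding T by (auto split: if_splits)
  have IH: "good_path R' (insert s' D) \<pi> ?T1 ?s1 ?K1 (next_level \<omega>)"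
    using Cons.prems sd K go unfolding T by (intro Cons.IH) auto
  have sub: "s' \<in> slots ?T1 ?s1"
    using go_slots[OF go(2,1)] by auto
  let ?T2 = "if a then r1 else l1" and ?s2 = "if a then addr p1 + 2 else addr p1 + 1"
  have disj: "slots ?T1 ?s1 \<inter> slots ?T2 ?s2 = {}"
    using sd(1) by auto
  have other: "good R' (insert s' D) ?T2 ?s2 K2 \<omega>2 = good R D ?T2 ?s2 K2 \<omega>2" for K2 \<omega>2
    using sub disj Cons.prems(7) by (intro good_cong) auto
  have le1: "code (lkey \<omega> p1 K) \<le> 1" "code (rkey \<omega> p1 K) \<le> 1"
    using K code_bounds(2) less_imp_le by blast+
  have m: "code (lkey \<omega> p1 K) \<le> R' (addr p1 + 1)" "code (rkey \<omega> p1 K) \<le> R' (addr p1 + 2)"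
    using Cons.prems(4,7) le1 unfolding T by simp_all
  show ?case
    using IH other Cons.prems(4) m unfolding T by (cases a) auto
qed

text \<open>When both children are exact, their minimum makes the node exact, and the stale part of
  the path becomes shorter by one.\<close>

lemma good_path_up:
  assumes "wf_tree T" "fresh s T" "0 \<le> K" "good_path R D (\<pi> @ [b]) T s K \<omega>"
    "go \<pi> (T, s, K, \<omega>) = (Node l p r, s', K', \<omega>')" "is_path \<pi> T"
    "R' = R(s' := min (R (addr p + 1)) (R (addr p + 2)))"
  shows "good_path R' D \<pi> T s K \<omega>"
proof -
  \<comment> \<open>The second conjunct strengthens the induction: \<open>good_path\<close> asks for
    a lower bound on the entries along the path, and one of these entries may be the one just
    written.\<close>
  have "good_path R' D \<pi> T s K \<omega> \<and> code K' \<le> R' s'"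
    using assms
  proof (induction \<pi> arbitrary: T s K \<omega>)
    case Nil
    then have T: "T = Node l p r" "s' = s" "K' = K" "\<omega>' = \<omega>"
      by auto
    note sd = slots_disjoint[OF Nil(1,2)[unfolded T]]
    have g: "good R D l (addr p + 1) (lkey \<omega> p K) (next_level \<omega>)"
      "good R D r (addr p + 2) (rkey \<omega> p K) (next_level \<omega>)"
      "code (lkey \<omega> p K) \<le> R (addr p + 1)" "code (rkey \<omega> p K) \<le> R (addr p + 2)"
      using Nil(4) unfolding T by (auto split: if_splits)
    have ne: "R' u = R u" if "u \<noteq> s" for u
      using Nil(7) T that by simp
    have "R' u = R u" if "u \<in> slots l (addr p + 1)" for u
      using that sd(2) by (intro ne) blast
    from good_cong[OF this refl] g(1)
    have "good R' D l (addr p + 1) (lkey \<omega> p K) (next_level \<omega>)"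
      by simp
    moreover have "R' u = R u" if "u \<in> slots r (addr p + 2)" for u
      using that sd(3) by (intro ne) blast
    from good_cong[OF this refl] g(2)
    have "good R' D r (addr p + 2) (rkey \<omega> p K) (next_level \<omega>)"
      by simp
    moreover have "R (addr p + 1) = best l (addr p + 1) (lkey \<omega> p K) (next_level \<omega>) D"
      "R (addr p + 2) = best r (addr p + 2) (rkey \<omega> p K) (next_level \<omega>) D"
      using good_top[OF g(1)] good_top[OF g(2)] g(3,4) by auto
    moreover have "code K \<le> code (lkey \<omega> p K)" "code K \<le> code (rkey \<omega> p K)"
      using Nil(3) by (auto simp: code_le_iff lkey_def rkey_def)
    moreover have "R' s = min (R (addr p + 1)) (R (addr p + 2))"
      using Nil(7) T by simp
    ultimately show ?case
      using g(3,4) unfolding T by auto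
  next
    case (Cons a \<pi>)
    obtain l1 p1 r1 where T: "T = Node l1 p1 r1"
      using Cons.prems by (cases T) auto
    note sd = slots_disjoint[OF Cons.prems(1,2)[unfolded T]]
    have K: "0 \<le> lkey \<omega> p1 K" "0 \<le> rkey \<omega> p1 K"
      using Cons.prems(3) by (auto simp: lkey_def rkey_def)
    let ?T1 = "if a then l1 else r1" and ?s1 = "if a then addr p1 + 1 else addr p1 + 2"
    let ?K1 = "if a then lkey \<omega> p1 K else rkey \<omega> p1 K"
    have go: "go \<pi> (?T1, ?s1, ?K1, next_level \<omega>) = (Node l p r, s', K', \<omega>')" "is_path \<pi> ?T1"
      using Cons.prems unfolding T by (auto split: if_splits)
    have IH: "good_path R' D \<pi> ?T1 ?s1 ?K1 (next_level \<omega>) \<and> code K' \<le> R' s'"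
      using Cons.prems sd K go unfolding T by (intro Cons.IH) auto
    have sub: "s' \<in> slots ?T1 ?s1"
      using go_slots[OF go(2,1)] by auto
    let ?T2 = "if a then r1 else l1" and ?s2 = "if a then addr p1 + 2 else addr p1 + 1"
    have disj: "slots ?T1 ?s1 \<inter> slots ?T2 ?s2 = {}"
      using sd(1) by auto
    have other: "good R' D ?T2 ?s2 K2 \<omega>2 = good R D ?T2 ?s2 K2 \<omega>2" for K2 \<omega>2
      using sub disj Cons.prems(7) by (intro good_cong) auto
    have s2: "R' ?s2 = R ?s2"
    proof -
      have "?s2 \<notin> slots ?T1 ?s1"
        using disj slot_in_slots[of ?s2 ?T2] by blast
      then show ?thesis
        using sub Cons.prems(7) by auto
    qed
    have s1: "code ?K1 \<le> R' ?s1"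
    proof (cases "s' = ?s1")
      case True
      \<comment> \<open>A path that goes on below the child ends in one of the slots below it, and
        these differ from the slot of the child.\<close>
      have "\<pi> = []"
      proof (rule ccontr)
        assume "\<pi> \<noteq> []"
        then obtain a' \<pi>' where \<pi>: "\<pi> = a' # \<pi>'"
          by (cases \<pi>) auto
        obtain l2 p2 r2 where T2: "?T1 = Node l2 p2 r2"
          using go(2) \<pi> by (cases ?T1) auto
        have "fresh ?s1 ?T1" "wf_tree ?T1"
          using sd Cons.prems(1) unfolding T by auto
        note sd2 = slots_disjoint[OF this(2,1)[unfolded T2]]
        have "s' \<in> slots l2 (addr p2 + 1) \<union> slots r2 (addr p2 + 2)"
          using go_slots[of \<pi>' l2 "addr p2 + 1" "lkey (next_level \<omega>) p2 ?K1" "next_level (next_level \<omega>)"]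
            go_slots[of \<pi>' r2 "addr p2 + 2" "rkey (next_level \<omega>) p2 ?K1" "next_level (next_level \<omega>)"]
            go unfolding \<pi> T2 by (auto split: if_splits)
        then show False
          using sd2 True by auto
      qed
      then show ?thesis
        using IH go(1) True by auto
    next
      case False
      then show ?thesis
        using Cons.prems(4,7) unfolding T by (auto split: if_splits)
    qed
    show ?case
      using IH other Cons.prems(4) s1 s2 unfolding T by (cases a) auto
  qed
  then show ?thesis
    by blast
qed

text \<open>A round computes the distances of all nodes on its path, so the pivots that have been
  seen are those with an explored tip below them.\<close>

fun visited :: "nat set \<Rightarrow> tree \<Rightarrow> nat \<Rightarrow> nat set" where
  "visited D Tip s = {}"
| "visited D (Node l p r) s = (if D \<inter> tip_slots (Node l p r) s = {} then {} else {p})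
     \<union> visited D l (addr p + 1) \<union> visited D r (addr p + 2)"

lemma visited_none: "D \<inter> tip_slots T s = {} \<Longrightarrow> visited D T s = {}"
proof (induction T arbitrary: s)
  case (Node l p r)
  have "D \<inter> tip_slots l (addr p + 1) = {}" "D \<inter> tip_slots r (addr p + 2) = {}"
    using Node.prems by auto
  then show ?case
    using Node by auto
qed simp

lemma visited_insert_notin: "u \<notin> tip_slots T s \<Longrightarrow> visited (insert u D) T s = visited D T s"
  by (induction T arbitrary: s) auto

lemma visited_insert:
  assumes "wf_tree T" "fresh s T" "is_path \<pi> T" "go \<pi> (T, s, K, \<omega>) = (Tip, s', K', \<omega>')"
  shows "visited (insert s' D) T s \<subseteq> visited D T s \<union> path_nodes \<pi> T"
  using assms
proof (induction \<pi> arbitrary: T s K \<omega>)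
  case (Cons a \<pi>)
  obtain l1 p1 r1 where T: "T = Node l1 p1 r1"
    using Cons.prems by (cases T) auto
  note sd = slots_disjoint[OF Cons.prems(1,2)[unfolded T]]
  let ?T1 = "if a then l1 else r1" and ?s1 = "if a then addr p1 + 1 else addr p1 + 2"
  let ?K1 = "if a then lkey \<omega> p1 K else rkey \<omega> p1 K"
  have go: "go \<pi> (?T1, ?s1, ?K1, next_level \<omega>) = (Tip, s', K', \<omega>')" "is_path \<pi> ?T1"
    using Cons.prems unfolding T by (auto split: if_splits)
  have IH: "visited (insert s' D) ?T1 ?s1 \<subseteq> visited D ?T1 ?s1 \<union> path_nodes \<pi> ?T1"
    using Cons.prems sd go unfolding T by (intro Cons.IH) auto
  let ?T2 = "if a then r1 else l1" and ?s2 = "if a then addr p1 + 2 else addr p1 + 1"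
  have "s' \<in> slots ?T1 ?s1"
    using go_slots[OF go(2,1)] by auto
  moreover have "slots ?T1 ?s1 \<inter> slots ?T2 ?s2 = {}"
    using sd(1) by auto
  ultimately have "s' \<notin> tip_slots ?T2 ?s2"
    using tip_slots_subset[of ?T2 ?s2] by blast
  then have "visited (insert s' D) ?T2 ?s2 = visited D ?T2 ?s2"
    by (rule visited_insert_notin)
  then show ?case
    using IH unfolding T by (cases a) auto
qed simp

lemma path_nodes_snoc:
  "go \<pi> (T, s, K, \<omega>) = (Node l p r, s', K', \<omega>') \<Longrightarrow> path_nodes (\<pi> @ [b]) T = insert p (path_nodes \<pi> T)"
proof (induction \<pi> arbitrary: T s K \<omega>)
  case (Cons a \<pi>)
  then show ?case
    by (cases T) (auto split: if_splits)
qed auto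

lemma tip_of_path:
  assumes "is_path \<pi> T" "go \<pi> (T, s, K, \<omega>) = (Tip, s', K', \<omega>')" "K' \<le> W"
  shows "s' \<in> tips_upto T s K \<omega> W"
  using assms
proof (induction \<pi> arbitrary: T s K \<omega>)
  case (Cons a \<pi>)
  then show ?case
    by (cases T) (auto split: if_splits)
qed auto

text \<open>After \<open>j\<close> rounds the explored tips have the least keys. Stated by
  thresholds, this requires no order of the tips and tolerates ties.\<close>

definition explored_least :: "tree \<Rightarrow> nat \<Rightarrow> (nat \<Rightarrow> real) \<Rightarrow> nat \<Rightarrow> nat set \<Rightarrow> bool" where
  "explored_least T s \<omega> j D \<longleftrightarrow>
     (\<forall>W. tips_upto T s 0 \<omega> W \<subseteq> D \<or> j \<le> card (D \<inter> tips_upto T s 0 \<omega> W))"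

text \<open>If an unexplored tip has a key of at most \<open>W\<close>, then the chosen tip, which
  attains the minimum, is new and also has a key of at most \<open>W\<close>.\<close>

lemma explored_least_step:
  assumes e: "explored_least T s \<omega> j D" and p: "is_path \<pi> T" "go \<pi> (T, s, 0, \<omega>) = (Tip, s', K', \<omega>')"
    and m: "best Tip s' K' \<omega>' D = best T s 0 \<omega> D"
  shows "explored_least T s \<omega> (Suc j) (insert s' D)"
  unfolding explored_least_def
proof (intro allI disjCI)
  fix W assume "\<not> Suc j \<le> card (insert s' D \<inter> tips_upto T s 0 \<omega> W)"
  then have c: "card (insert s' D \<inter> tips_upto T s 0 \<omega> W) < Suc j"
    by simp
  show "tips_upto T s 0 \<omega> W \<subseteq> insert s' D"
  proof (rule ccontr)
    assume "\<not> tips_upto T s 0 \<omega> W \<subseteq> insert s' D"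
    then obtain u where u: "u \<in> tips_upto T s 0 \<omega> W" "u \<notin> D"
      by blast
    have W: "0 \<le> W"
    proof -
      have "K \<le> W" if "u \<in> tips_upto T s K \<omega> W" for T s K \<omega>
        using that
      proof (induction T arbitrary: s K \<omega>)
        case (Node l p r)
        then show ?case
          using key_ge(1,2)[of K \<omega> p] by fastforce
      qed (auto split: if_splits)
      then show ?thesis
        using u by blast
    qed
    have K': "0 \<le> K'"
      using go_slots[OF p] by simp
    have "best Tip s' K' \<omega>' D \<le> code W"
      unfolding m using best_le[OF _ u] by simp
    then have "s' \<notin> D" "K' \<le> W"
      using W K' code_bounds(2)[of W] code_le_iff[of K' W] by (auto split: if_splits)
    then have "s' \<in> tips_upto T s 0 \<omega> W" "s' \<notin> D \<inter> tips_upto T s 0 \<omega> W"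
      using tip_of_path[OF p] by auto
    moreover have "j \<le> card (D \<inter> tips_upto T s 0 \<omega> W)"
      using e u unfolding explored_least_def by blast
    ultimately show False
      using c finite_tips_upto[of T s 0 \<omega> W] by simp
  qed
qed

text \<open>One child always inherits the key, hence below every node there is a tip with the same
  key as the node.\<close>

lemma node_key_tip:
  assumes "i \<in> nodes T" "0 \<le> K" "node_key T K \<omega> i \<le> W" "tips_upto T s K \<omega> W \<subseteq> D"
  shows "i \<in> visited D T s"
proof -
  have ne: "tips_upto T s K \<omega> W \<noteq> {}" if "K \<le> W" for T s K \<omega>
    using that
  proof (induction T arbitrary: s K \<omega>)
    case (Node l p r)
    then show ?case
      by (cases "gap \<omega> p < 0") (auto simp: lkey_def rkey_def)
  qed simp
  show ?thesis
    using assms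
  proof (induction T arbitrary: s K \<omega>)
    case (Node l p r)
    show ?case
    proof (cases "i = p")
      case True
      then have "tips_upto (Node l p r) s K \<omega> W \<noteq> {}"
        using ne[of K "Node l p r" s \<omega>] Node.prems by simp
      then show ?thesis
        using True Node.prems(4) tips_upto_subset[of "Node l p r" s K \<omega> W] by auto
    next
      case False
      have "0 \<le> lkey \<omega> p K" "0 \<le> rkey \<omega> p K"
        using Node.prems(2) by (auto simp: lkey_def rkey_def)
      then show ?thesis
        using Node False by (auto split: if_splits)
    qed
  qed simp
qed

text \<open>If a tip with key up to \<open>W\<close> were unexplored, then the explored ones among
  them, at least \<open>j\<close> in number, would form a proper subset of a set of at most
  \<open>j\<close> tips.\<close>

lemma visited_complete:
  assumes "explored_least T s \<omega> j D" "count_upto T 0 \<omega> W \<le> j" "i \<in> nodes T" "node_key T 0 \<omega> i \<le> W"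
  shows "i \<in> visited D T s"
proof -
  have "tips_upto T s 0 \<omega> W \<subseteq> D"
  proof (rule ccontr)
    assume "\<not> tips_upto T s 0 \<omega> W \<subseteq> D"
    then have "j \<le> card (D \<inter> tips_upto T s 0 \<omega> W)" "D \<inter> tips_upto T s 0 \<omega> W \<subset> tips_upto T s 0 \<omega> W"
      using assms(1) by (auto simp: explored_least_def)
    then show False
      using psubset_card_mono[OF finite_tips_upto[of T s 0 \<omega> W], of "D \<inter> tips_upto T s 0 \<omega> W"]
        card_tips_upto[of T s 0 \<omega> W] assms(2) by linarith
  qed
  then show ?thesis
    using node_key_tip[of i T 0 \<omega> W s D] assms by simp
qed

end

section \<open>Preprocessing\<close>

context points
begin

definition slot :: "nat \<Rightarrow> bool" where
  "slot a \<longleftrightarrow> a = 39 \<or> (\<exists>i<n. a = addr i + 1 \<or> a = addr i + 2)"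

text \<open>The state of the construction: \<open>\<sigma> i\<close> is the slot below which point \<open>i\<close> will be placed
  (or has been placed), and \<open>C a\<close> is the pointer stored in slot \<open>a\<close>.\<close>

definition pass1 :: "(nat \<Rightarrow> real) \<Rightarrow> nat \<Rightarrow> (nat \<Rightarrow> nat) \<Rightarrow> (nat \<Rightarrow> nat) \<Rightarrow> nat \<Rightarrow> nat" where
  "pass1 \<kappa> i \<sigma> C a =
     (if C a \<noteq> 0 then C a
      else if {j. j < i \<and> \<sigma> j = a} = {} then 0 else addr (pivot {j. j < i \<and> \<sigma> j = a} \<kappa>))"

definition pass2 :: "(nat \<Rightarrow> real) \<Rightarrow> (nat \<Rightarrow> nat) \<Rightarrow> (nat \<Rightarrow> nat) \<Rightarrow> nat \<Rightarrow> nat" where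
  "pass2 \<omega> \<sigma> C j =
     (if C (\<sigma> j) = addr j then \<sigma> j
      else C (\<sigma> j) + (if proj \<omega> ((C (\<sigma> j) - 40) div (d + 3)) j < 0 then 1 else 2))"

text \<open>A whole level is built by two scans over all points: one chooses a pivot for each open
  slot, the other moves the remaining points to child slots. Neither recursion nor lists of cells
  are stored, and the time per level is linear in the input size.\<close>

definition level :: "(nat \<Rightarrow> real) \<Rightarrow> (nat \<Rightarrow> nat) \<times> (nat \<Rightarrow> nat) \<Rightarrow> (nat \<Rightarrow> nat) \<times> (nat \<Rightarrow> nat)" where
  "level \<omega> st = (let C = pass1 (shift d \<omega>) n (fst st) (snd st) in (pass2 \<omega> (fst st) C, C))"

fun levels :: "nat \<Rightarrow> (nat \<Rightarrow> real) \<Rightarrow> (nat \<Rightarrow> nat) \<times> (nat \<Rightarrow> nat) \<Rightarrow> (nat \<Rightarrow> nat) \<times> (nat \<Rightarrow> nat)" where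
  "levels 0 \<omega> st = st"
| "levels (Suc L) \<omega> st = levels L (next_level \<omega>) (level \<omega> st)"

lemma shift_shift: "shift a (shift b \<omega>) = shift (b + a) \<omega>"
  by (simp add: shift_def fun_eq_iff ac_simps)

lemma shift_0 [simp]: "shift 0 \<omega> = \<omega>"
  by (simp add: shift_def)

lemma levels_Suc: "levels (Suc L) \<omega> st = level (shift (L * (d + n)) \<omega>) (levels L \<omega> st)"
proof (induction L arbitrary: \<omega> st)
  case (Suc L)
  have "levels (Suc (Suc L)) \<omega> st = level (shift (L * (d + n)) (next_level \<omega>)) (levels (Suc L) \<omega> st)"
    using Suc.IH[of "next_level \<omega>" "level \<omega> st"] by simp
  then show ?case
    by (simp add: shift_shift ac_simps)
qed simp

text \<open>Between levels only its owner refers to an occupied slot. The last conjunct ensures that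
  a point which becomes a node starts with two clean child slots.\<close>

definition consistent :: "(nat \<Rightarrow> nat) \<times> (nat \<Rightarrow> nat) \<Rightarrow> bool" where
  "consistent st \<longleftrightarrow> (\<forall>i<n. (snd st (fst st i) = 0 \<or> snd st (fst st i) = addr i) \<and> slot (fst st i) \<and>
     (snd st (fst st i) = 0 \<longrightarrow> (\<forall>u\<in>{addr i + 1, addr i + 2}. snd st u = 0 \<and> (\<forall>j<n. fst st j \<noteq> u))))"

lemma owner_addr [simp]: "(addr p - 40) div (d + 3) = p"
  by (simp add: addr_def)

lemma pass1_cases:
  assumes "consistent (\<sigma>, C)" "i < n" and C': "C' = pass1 \<kappa> n \<sigma> C"
  shows "C (\<sigma> i) = addr i \<and> C' (\<sigma> i) = addr i
    \<or> C (\<sigma> i) = 0 \<and> C' (\<sigma> i) = addr (pivot {j. j < n \<and> \<sigma> j = \<sigma> i} \<kappa>)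
      \<and> pivot {j. j < n \<and> \<sigma> j = \<sigma> i} \<kappa> < n \<and> \<sigma> (pivot {j. j < n \<and> \<sigma> j = \<sigma> i} \<kappa>) = \<sigma> i"
proof -
  have "{j. j < n \<and> \<sigma> j = \<sigma> i} \<noteq> {}" "finite {j. j < n \<and> \<sigma> j = \<sigma> i}"
    using assms(2) by auto
  then show ?thesis
    using assms pivot_props(1)[of "{j. j < n \<and> \<sigma> j = \<sigma> i}" \<kappa>] addr_ge[of i]
    by (auto simp: consistent_def pass1_def)
qed

lemma level_stable:
  assumes "consistent (\<sigma>, C)" "level \<omega> (\<sigma>, C) = (\<sigma>', C')"
  shows "C a \<noteq> 0 \<Longrightarrow> C' a = C a" "i < n \<Longrightarrow> C' (\<sigma> i) = addr i \<Longrightarrow> \<sigma>' i = \<sigma> i"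
    "i < n \<Longrightarrow> C' (\<sigma> i) \<noteq> addr i \<Longrightarrow> \<exists>p<n. p \<noteq> i \<and> \<sigma> p = \<sigma> i \<and> C (\<sigma> i) = 0 \<and> C' (\<sigma> i) = addr p
       \<and> p = pivot {j. j < n \<and> \<sigma> j = \<sigma> i} (shift d \<omega>)
       \<and> \<sigma>' i = addr p + (if proj \<omega> p i < 0 then 1 else 2)"
proof -
  have C': "C' = pass1 (shift d \<omega>) n \<sigma> C" and \<sigma>': "\<sigma>' = pass2 \<omega> \<sigma> C'"
    using assms(2) by (auto simp: level_def Let_def)
  show "C a \<noteq> 0 \<Longrightarrow> C' a = C a"
    by (simp add: C' pass1_def)
  show "i < n \<Longrightarrow> C' (\<sigma> i) = addr i \<Longrightarrow> \<sigma>' i = \<sigma> i"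
    by (simp add: \<sigma>' pass2_def)
  assume i: "i < n" "C' (\<sigma> i) \<noteq> addr i"
  let ?p = "pivot {j. j < n \<and> \<sigma> j = \<sigma> i} (shift d \<omega>)"
  have p: "C (\<sigma> i) = 0" "C' (\<sigma> i) = addr ?p" "?p < n" "\<sigma> ?p = \<sigma> i"
    using pass1_cases[OF assms(1) i(1) C'] i(2) by auto
  then have "\<sigma>' i = addr ?p + (if proj \<omega> ?p i < 0 then 1 else 2)"
    using i(2) by (simp add: \<sigma>' pass2_def)
  then show "\<exists>p<n. p \<noteq> i \<and> \<sigma> p = \<sigma> i \<and> C (\<sigma> i) = 0 \<and> C' (\<sigma> i) = addr p \<and> p = ?p
       \<and> \<sigma>' i = addr p + (if proj \<omega> p i < 0 then 1 else 2)"
    using p i by metis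
qed

lemma level_slot:
  assumes "consistent (\<sigma>, C)" "level \<omega> (\<sigma>, C) = (\<sigma>', C')" "C a = 0"
  shows "C' a = (if {j. j < n \<and> \<sigma> j = a} = {} then 0 else addr (pivot {j. j < n \<and> \<sigma> j = a} (shift d \<omega>)))"
  using assms by (auto simp: level_def Let_def pass1_def)

text \<open>A child slot of \<open>p\<close> gains points only when \<open>p\<close> wins the slot
  at which they waited together. Any other point found there was there before, which presupposes
  that \<open>p\<close> had been placed.\<close>

lemma level_moved:
  assumes c: "consistent (\<sigma>, C)" and l: "level \<omega> (\<sigma>, C) = (\<sigma>', C')"
    and u: "u = addr p + 1 \<or> u = addr p + 2" and j: "j < n" "\<sigma>' j = u" and p: "p < n"
    and np: "C (\<sigma> p) \<noteq> addr p \<Longrightarrow> \<forall>j<n. \<sigma> j \<noteq> u"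
  shows "\<sigma> j = u \<and> C (\<sigma> p) = addr p \<or>
    j \<noteq> p \<and> \<sigma> j = \<sigma> p \<and> C (\<sigma> p) = 0 \<and> C' (\<sigma> p) = addr p \<and> u = addr p + (if proj \<omega> p j < 0 then 1 else 2)"
proof (cases "C' (\<sigma> j) = addr j")
  case True
  then have "\<sigma> j = u"
    using level_stable(2)[OF c l j(1)] j by simp
  then show ?thesis
    using np j by blast
next
  case False
  then obtain p' where p': "p' < n" "p' \<noteq> j" "\<sigma> p' = \<sigma> j" "C (\<sigma> j) = 0" "C' (\<sigma> j) = addr p'"
      "\<sigma>' j = addr p' + (if proj \<omega> p' j < 0 then 1 else 2)"
    using level_stable(3)[OF c l j(1)] by blast
  then have "p' = p"
    using u j(2) by (auto split: if_splits)
  then show ?thesis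
    using p' j by metis
qed

lemma consistent_level:
  assumes c: "consistent (\<sigma>, C)" and l: "level \<omega> (\<sigma>, C) = (\<sigma>', C')"
  shows "consistent (\<sigma>', C')"
  unfolding consistent_def fst_conv snd_conv
proof (intro allI impI conjI)
  fix i assume i: "i < n"
  have c': "C (\<sigma> i) = 0 \<or> C (\<sigma> i) = addr i" "slot (\<sigma> i)"
    "C (\<sigma> i) = 0 \<Longrightarrow> u \<in> {addr i + 1, addr i + 2} \<Longrightarrow> C u = 0 \<and> (\<forall>j<n. \<sigma> j \<noteq> u)" for u
    using c i unfolding consistent_def by auto
  show "C' (\<sigma>' i) = 0 \<or> C' (\<sigma>' i) = addr i"
  proof (cases "C' (\<sigma> i) = addr i")
    case False
    then obtain p where p: "p < n" "p \<noteq> i" "\<sigma> p = \<sigma> i" "C (\<sigma> i) = 0" "C' (\<sigma> i) = addr p"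
      "\<sigma>' i = addr p + (if proj \<omega> p i < 0 then 1 else 2)"
      using level_stable(3)[OF c l i] by blast
    have "C (\<sigma>' i) = 0 \<and> (\<forall>j<n. \<sigma> j \<noteq> \<sigma>' i)"
      using c p(1,3,4,6) unfolding consistent_def by (auto split: if_splits)
    then show ?thesis
      using level_slot[OF c l, of "\<sigma>' i"] by auto
  qed (use level_stable(2)[OF c l i] in auto)
  show "slot (\<sigma>' i)"
  proof (cases "C' (\<sigma> i) = addr i")
    case False
    then show ?thesis
      using level_stable(3)[OF c l i] unfolding slot_def by fastforce
  qed (use level_stable(2)[OF c l i] c'(2) in auto)
  assume 0: "C' (\<sigma>' i) = 0"
  have ne: "C' (\<sigma> i) \<noteq> addr i"
    using 0 level_stable(2)[OF c l i] addr_ge[of i] by auto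
  then have C0: "C (\<sigma> i) = 0"
    using level_stable(3)[OF c l i] by blast
  show "\<forall>u\<in>{addr i + 1, addr i + 2}. C' u = 0 \<and> (\<forall>j<n. \<sigma>' j \<noteq> u)"
  proof
    fix u assume u: "u \<in> {addr i + 1, addr i + 2}"
    have cu: "C u = 0" "\<forall>j<n. \<sigma> j \<noteq> u"
      using c'(3)[OF C0 u] by auto
    then have "C' u = 0"
      using level_slot[OF c l] by auto
    moreover have "\<sigma>' j \<noteq> u" if "j < n" for j
    proof
      assume "\<sigma>' j = u"
      then show False
        using level_moved[OF c l _ that _ i, of u] u cu C0 ne that by auto
    qed
    ultimately show "C' u = 0 \<and> (\<forall>j<n. \<sigma>' j \<noteq> u)"
      by blast
  qed
qed

lemma levels_stable:
  assumes "consistent (\<sigma>, C)" "levels L \<omega> (\<sigma>, C) = (\<sigma>', C')" "p < n" "C (\<sigma> p) = addr p"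
  shows "\<sigma>' p = \<sigma> p \<and> C' (\<sigma> p) = addr p"
  using assms
proof (induction L arbitrary: \<omega> \<sigma> C)
  case (Suc L)
  obtain \<sigma>1 C1 where 1: "level \<omega> (\<sigma>, C) = (\<sigma>1, C1)"
    by fastforce
  have "C1 (\<sigma> p) = addr p"
    using level_stable(1)[OF Suc.prems(1) 1, of "\<sigma> p"] Suc.prems(4) addr_ge[of p] by simp
  moreover from this have "\<sigma>1 p = \<sigma> p"
    using level_stable(2)[OF Suc.prems(1) 1] Suc.prems by blast
  ultimately show ?case
    using Suc.IH[of \<sigma>1 C1 "next_level \<omega>"] Suc.prems 1 consistent_level[OF Suc.prems(1) 1] by simp
qed simp

text \<open>The slots at which subtrees can grow: the root slot and those of placed nodes. Later
  levels send no further points to such a slot.\<close>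

definition active :: "(nat \<Rightarrow> nat) \<times> (nat \<Rightarrow> nat) \<Rightarrow> nat \<Rightarrow> bool" where
  "active st s \<longleftrightarrow> s = 39 \<or> (\<exists>i<n. snd st (fst st i) = addr i \<and> (s = addr i + 1 \<or> s = addr i + 2))"

lemma active_level:
  assumes c: "consistent (\<sigma>, C)" and l: "level \<omega> (\<sigma>, C) = (\<sigma>', C')" and a: "active (\<sigma>, C) s"
  shows "active (\<sigma>', C') s" "j < n \<Longrightarrow> \<sigma>' j = s \<Longrightarrow> \<sigma> j = s"
proof -
  have placed: "C' (\<sigma> i) = addr i \<and> \<sigma>' i = \<sigma> i" if "i < n" "C (\<sigma> i) = addr i" for i
    using level_stable(1)[OF c l, of "\<sigma> i"] level_stable(2)[OF c l, of i] addr_ge[of i] that by simp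
  then show "active (\<sigma>', C') s"
    using a unfolding active_def by fastforce
  assume j: "j < n" "\<sigma>' j = s"
  show "\<sigma> j = s"
  proof (cases "C' (\<sigma> j) = addr j")
    case True
    then show ?thesis
      using level_stable(2)[OF c l j(1)] j by simp
  next
    case False
    then obtain p where p: "p < n" "p \<noteq> j" "\<sigma> p = \<sigma> j" "C (\<sigma> j) = 0"
      "\<sigma>' j = addr p + (if proj \<omega> p j < 0 then 1 else 2)"
      using level_stable(3)[OF c l j(1)] by blast
    have "s \<noteq> 39"
      using p(5) j(2) addr_ge[of p] by (auto split: if_splits)
    then obtain i where "i < n" "C (\<sigma> i) = addr i" "s = addr i + 1 \<or> s = addr i + 2"
      using a unfolding active_def by auto
    then have "C (\<sigma> p) = addr p"
      using p(5) j(2) by (auto split: if_splits)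
    then show ?thesis
      using p addr_ge[of p] by simp
  qed
qed

text \<open>The points that wait at an open slot evolve independently of all other slots. Hence the
  levelwise construction agrees with the recursion of \<open>build\<close>, and the final memory
  holds the subtree of every open slot.\<close>

lemma levels_build:
  assumes "consistent (\<sigma>, C)" "active (\<sigma>, C) s" "C s = 0" "levels L \<omega> (\<sigma>, C) = (\<sigma>', C')"
    "S = {i. i < n \<and> \<sigma> i = s}" "\<And>a. slot a \<Longrightarrow> W a = C' a" "\<And>i. i < n \<Longrightarrow> W (addr i) = \<sigma>' i"
  shows "represents W s (build L S \<omega>)"
  using assms(1-5)
proof (induction L arbitrary: \<omega> \<sigma> C s S)
  case 0
  then have "slot s"
    unfolding active_def slot_def by auto
  then show ?case
    using 0 assms(6) by simp
next
  case (Suc L)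
  note c = Suc.prems(1)
  obtain \<sigma>1 C1 where l: "level \<omega> (\<sigma>, C) = (\<sigma>1, C1)"
    by fastforce
  have lv: "levels L (next_level \<omega>) (\<sigma>1, C1) = (\<sigma>', C')"
    using Suc.prems(4) l by simp
  note c1 = consistent_level[OF c l]
  note a1 = active_level[OF c l Suc.prems(2)]
  have s: "slot s"
    using Suc.prems(2) unfolding active_def slot_def by auto
  show ?case
  proof (cases "S = {}")
    case True
    have "C1 s = 0"
      using level_slot[OF c l Suc.prems(3)] True Suc.prems(5) by simp
    moreover have "{} = {i. i < n \<and> \<sigma>1 i = s}"
      using a1(2) True Suc.prems(5) by auto
    ultimately have "represents W s (build L {} (next_level \<omega>))"
      using Suc.IH[OF c1 a1(1) _ lv] by blast
    then show ?thesis
      using True by (cases L) auto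
  next
    case False
    define p where "p = pivot S (shift d \<omega>)"
    have "p \<in> S"
      unfolding p_def using False Suc.prems(5) by (intro pivot_props) auto
    then have p: "p < n" "\<sigma> p = s" "C (\<sigma> p) = 0"
      using Suc.prems(3,5) by auto
    have C1s: "C1 s = addr p"
      using level_slot[OF c l Suc.prems(3)] False unfolding p_def Suc.prems(5) by metis
    then have placed: "C1 (\<sigma> p) = addr p" "\<sigma>1 p = s"
      using p level_stable(2)[OF c l p(1)] by auto
    have fin: "\<sigma>' p = s" "C' s = addr p"
      using levels_stable[OF c1 lv p(1)] placed p by auto
    have u0: "C u = 0" "\<forall>j<n. \<sigma> j \<noteq> u" if "u = addr p + 1 \<or> u = addr p + 2" for u
      using c p that unfolding consistent_def by auto
    have child: "represents W u (build L {i \<in> S - {p}. u = addr p + (if proj \<omega> p i < 0 then 1 else 2)} (next_level \<omega>))"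
      if u: "u = addr p + 1 \<or> u = addr p + 2" for u
    proof (rule Suc.IH[OF c1 _ _ lv])
      show "active (\<sigma>1, C1) u"
        unfolding active_def using placed p u by auto
      show "C1 u = 0"
        using level_slot[OF c l u0(1)[OF u]] u0(2)[OF u] by simp
      show "{i \<in> S - {p}. u = addr p + (if proj \<omega> p i < 0 then 1 else 2)} = {i. i < n \<and> \<sigma>1 i = u}"
      proof (intro set_eqI iffI)
        fix i assume "i \<in> {i \<in> S - {p}. u = addr p + (if proj \<omega> p i < 0 then 1 else 2)}"
        then have i: "i < n" "\<sigma> i = s" "i \<noteq> p" "u = addr p + (if proj \<omega> p i < 0 then 1 else 2)"
          using Suc.prems(5) by auto
        have "C1 (\<sigma> i) \<noteq> addr i"
          using C1s i by simp
        then obtain p' where "C1 (\<sigma> i) = addr p'" "\<sigma>1 i = addr p' + (if proj \<omega> p' i < 0 then 1 else 2)"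
          using level_stable(3)[OF c l i(1)] by blast
        then show "i \<in> {i. i < n \<and> \<sigma>1 i = u}"
          using i C1s by simp
      next
        fix i assume "i \<in> {i. i < n \<and> \<sigma>1 i = u}"
        then show "i \<in> {i \<in> S - {p}. u = addr p + (if proj \<omega> p i < 0 then 1 else 2)}"
          using level_moved[OF c l u, of i] u0(2)[OF u] p Suc.prems(5) addr_ge[of p] by auto
      qed
    qed
    have "{i \<in> S - {p}. addr p + 1 = addr p + (if proj \<omega> p i < 0 then 1 else 2)} = {i \<in> S - {p}. proj \<omega> p i < 0}"
      "{i \<in> S - {p}. addr p + 2 = addr p + (if proj \<omega> p i < 0 then 1 else 2)} = {i \<in> S - {p}. \<not> proj \<omega> p i < 0}"
      by auto
    then have "represents W (addr p + 1) (build L {i \<in> S - {p}. proj \<omega> p i < 0} (next_level \<omega>))"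
      "represents W (addr p + 2) (build L {i \<in> S - {p}. \<not> proj \<omega> p i < 0} (next_level \<omega>))"
      using child[of "addr p + 1"] child[of "addr p + 2"] by auto
    then show ?thesis
      using False p fin s assms(6)[OF s] assms(7)[OF p(1)] unfolding p_def by (simp add: Let_def)
  qed
qed

lemma consistent_init: "consistent (\<lambda>_. 39, \<lambda>_. 0)"
proof -
  have "(39::nat) \<noteq> addr i + 1" "(39::nat) \<noteq> addr i + 2" for i
    using addr_ge[of i] by linarith+
  then show ?thesis
    by (simp add: consistent_def slot_def)
qed

end

definition lg :: "nat \<Rightarrow> nat" where
  "lg n = (LEAST l. n \<le> 2 ^ l)"

lemma lg_ge: "n \<le> 2 ^ lg n"
  unfolding lg_def by (rule LeastI[of "\<lambda>l. n \<le> 2 ^ l" n]) (simp add: less_imp_le)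

lemma lg_less: "k < lg n \<Longrightarrow> 2 ^ k < n"
  unfolding lg_def using not_less_Least[of k "\<lambda>l. n \<le> 2 ^ l"] by auto

lemma lg_le: "1 \<le> n \<Longrightarrow> lg n \<le> n"
  unfolding lg_def by (rule Least_le) (simp add: less_imp_le)

text \<open>Word registers: 1: \<open>n\<close>, 2: one, 3: \<open>d\<close>, 4: zero, 5: record size, 6: first record,
  7: end of the records, 8: number of levels, 9: level, 10: current record, 15: three,
  16: current direction.  Real registers: 0: \<open>\<tau>\<close>, 1: \<open>c\<close>, 5: zero.\<close>

definition prep_init :: cmd where
  "prep_init = Block [WConst 2 1, WAdd 3 0 4, WConst 15 3, WAdd 5 3 15, WConst 6 40, WMul 7 1 5,
     WAdd 7 7 6, RInput 0 2, WConst 20 2, RInput 1 20, WConst 8 10, WConst 20 1]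
   ;; Until (WLe 1 20) (Block [WAdd 20 20 20, WAdd 8 8 15])"

definition prep_copy :: cmd where
  "prep_copy = Block [WAdd 10 6 4, WConst 19 3, WConst 21 39]
   ;; Until (WLe 7 10)
     (Block [WStore 10 21, WAdd 11 10 15, WAdd 12 10 5]
      ;; Until (WLe 12 11) (Block [RInput 2 19, RStore 11 2, WAdd 19 19 2, WAdd 11 11 2])
      ;; Block [WAdd 10 12 4])"

text \<open>Each point draws a key in each level, even if it has been placed, so the position on the
  tape is determined by the level and the index.\<close>

definition prep_pass1 :: cmd where
  "prep_pass1 = Block [RNormal 2, RStore 10 2, WLoad 13 10, WLoad 14 13]
   ;; IfC (WLe 14 4) (Block [WStore 13 10])
        (Block [RLoad 3 14] ;; IfC (RLe 3 2) (Block []) (Block [WStore 13 10]))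
   ;; Block [WAdd 10 10 5]"

definition prep_pass2 :: cmd where
  "prep_pass2 = Block [WLoad 13 10, WLoad 14 13, RSub 4 5 5, WAdd 11 16 4, WAdd 17 10 15, WAdd 18 14 15]
   ;; Until (WLe 12 11)
     (Block [RLoad 2 17, RLoad 3 18, RSub 2 2 3, RLoad 3 11, RMul 2 3 2, RAdd 4 4 2,
        WAdd 11 11 2, WAdd 17 17 2, WAdd 18 18 2])
   ;; IfC (RLe 5 4) (Block [WAdd 20 14 2, WAdd 20 20 2]) (Block [WAdd 20 14 2])
   ;; IfC (WLe 14 10) (IfC (WLe 10 14) (Block [WAdd 20 13 4]) (Block [])) (Block [])
   ;; Block [WStore 10 20, WAdd 10 10 5]"

definition prep_level :: cmd where
  "prep_level = Block [WAdd 12 16 3, WAdd 11 16 4]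
   ;; Until (WLe 12 11) (Block [RNormal 2, RStore 11 2, WAdd 11 11 2])
   ;; Block [WAdd 10 6 4] ;; Until (WLe 7 10) prep_pass1
   ;; Block [WAdd 10 6 4] ;; Until (WLe 7 10) prep_pass2
   ;; Block [WAdd 16 12 4, WAdd 9 9 2]"

definition prep_code :: cmd where
  "prep_code = prep_init ;; prep_copy
   ;; Block [WAdd 16 7 4, WConst 9 0] ;; Until (WLe 8 9) prep_level"

section \<open>Memory layout and invariants of the preprocessing\<close>

context points
begin

text \<open>The expected size of the cell of a point shrinks by 3/4 per level. Since
  \<open>2 * (3 / 4) ^ 3 < 1\<close>, three levels per factor 2 compensate for \<open>n\<close>, and
  ten more bring the failure probability below 1/10.\<close>

definition depth :: nat where
  "depth = 10 + 3 * lg n"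

definition regs :: "(nat \<Rightarrow> nat) \<Rightarrow> bool" where
  "regs W \<longleftrightarrow> W 1 = n \<and> W 2 = 1 \<and> W 3 = d \<and> W 4 = 0 \<and> W 5 = d + 3 \<and> W 6 = 40 \<and> W 7 = addr n \<and> W 15 = 3"

definition table :: "(nat \<Rightarrow> nat) \<Rightarrow> (nat \<Rightarrow> nat) \<Rightarrow> (nat \<Rightarrow> nat) \<Rightarrow> bool" where
  "table \<sigma> C W \<longleftrightarrow> (\<forall>i<n. W (addr i) = \<sigma> i) \<and> (\<forall>a. slot a \<longrightarrow> W a = C a)"

definition coords_upto :: "nat \<Rightarrow> nat \<Rightarrow> (nat \<Rightarrow> real) \<Rightarrow> bool" where
  "coords_upto i k r \<longleftrightarrow>
     (\<forall>j k'. k' < d \<longrightarrow> j < i \<or> j = i \<and> k' < k \<longrightarrow> r (addr j + 3 + k') = x j k')"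

definition dirs_upto :: "(nat \<Rightarrow> real) \<Rightarrow> nat \<Rightarrow> nat \<Rightarrow> (nat \<Rightarrow> real) \<Rightarrow> bool" where
  "dirs_upto \<omega> l k r \<longleftrightarrow> (\<forall>l' k'. k' < d \<longrightarrow> l' < l \<or> l' = l \<and> k' < k \<longrightarrow>
     r (addr n + l' * d + k') = \<omega> (l' * (d + n) + k'))"

text \<open>Entry 0 of a slot means that nothing below it is explored, so this is the state from
  which a query can start.\<close>

definition untouched :: "(nat \<Rightarrow> real) \<Rightarrow> bool" where
  "untouched r \<longleftrightarrow> (\<forall>a. slot a \<longrightarrow> r a = 0)"

lemma addr_less: "i < n \<Longrightarrow> a < d + 3 \<Longrightarrow> addr i + a < addr n"
  using addr_mono[of i n] by linarith

lemma addr_less' [simp]: "i < n \<Longrightarrow> addr i < addr n"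
  using addr_less[of i 0] by simp

lemma addr_Suc: "addr (Suc i) = addr i + (d + 3)"
  by (simp add: addr_def)

lemma addr_le_iff [simp]: "addr i \<le> addr j \<longleftrightarrow> i \<le> j"
  by (auto simp: addr_def)

lemma slot_bounds: "slot a \<Longrightarrow> 39 \<le> a \<and> a < addr n"
proof -
  assume "slot a"
  then consider "a = 39" | i where "i < n" "a = addr i + 1 \<or> a = addr i + 2"
    by (auto simp: slot_def)
  then show ?thesis
  proof cases
    case (2 i)
    then show ?thesis
      using addr_less[of i 1] addr_less[of i 2] addr_ge[of i] by auto
  qed (use addr_ge[of n] in simp)
qed

lemma slot_neq: "slot a \<Longrightarrow> a \<noteq> addr i" "slot a \<Longrightarrow> a \<noteq> addr i + 3 + k \<or> \<not> k < d"
proof -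
  show "slot a \<Longrightarrow> a \<noteq> addr i"
    using addr_ge[of i] by (auto simp: slot_def)
  have "addr i + 3 + k \<noteq> addr j + 1" "addr i + 3 + k \<noteq> addr j + 2" if "k < d" for j
    using addr_add_eq_iff[of "3 + k" 1 i j] addr_add_eq_iff[of "3 + k" 2 i j] that by (simp_all add: add.assoc)
  then show "slot a \<Longrightarrow> a \<noteq> addr i + 3 + k \<or> \<not> k < d"
    using addr_ge[of i] unfolding slot_def by auto
qed

lemma regs_upd [simp]:
  "9 \<le> a \<Longrightarrow> a \<noteq> 15 \<Longrightarrow> regs (W(a := v)) = regs W" "regs (W(8 := v)) = regs W"
  by (auto simp: regs_def)

lemma table_upd_reg [simp]: "a < 39 \<Longrightarrow> table \<sigma> C (W(a := v)) = table \<sigma> C W"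
proof -
  assume "a < 39"
  then have "a \<noteq> addr i" "slot b \<Longrightarrow> a \<noteq> b" for i b
    using addr_ge[of i] slot_bounds[of b] by auto
  then show ?thesis
    unfolding table_def by auto
qed

lemma table_upd_rec: "table \<sigma> C W \<Longrightarrow> table (\<sigma>(i := v)) C (W(addr i := v))"
  using slot_neq(1) by (auto simp: table_def)

lemma table_upd_slot: "table \<sigma> C W \<Longrightarrow> slot a \<Longrightarrow> table \<sigma> (C(a := v)) (W(a := v))"
  using slot_neq(1) by (auto simp: table_def)

lemma coords_neq:
  assumes "k' < d" "i < n" "a < 39 \<or> a = addr j \<or> addr n \<le> a \<or> slot a"
  shows "addr i + 3 + k' \<noteq> a"
proof -
  have "addr i + 3 + k' < addr n" "40 \<le> addr i"
    using addr_less[of i "3 + k'"] assms addr_ge by (auto simp: add.assoc)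
  moreover have "addr i + 3 + k' \<noteq> addr j"
    using addr_add_eq_iff[of "3 + k'" 0 i j] assms(1) by (auto simp: add.assoc)
  ultimately show ?thesis
    using assms slot_neq(2)[of a i k'] by auto
qed

lemma coords_upd [simp]:
  assumes "i \<le> n" "k = 0 \<or> i < n" "a < 39 \<or> a = addr j \<or> addr n \<le> a \<or> slot a"
  shows "coords_upto i k (r(a := v)) = coords_upto i k r"
proof -
  have "addr i' + 3 + k' \<noteq> a" if "k' < d" "i' < i \<or> i' = i \<and> k' < k" for i' k'
  proof -
    have "i' < n"
      using that(2) assms(1,2) by auto
    then show ?thesis
      using coords_neq[OF that(1) _ assms(3)] by blast
  qed
  then show ?thesis
    unfolding coords_upto_def by auto
qed

lemma dirs_upd [simp]: "a < addr n \<Longrightarrow> dirs_upto \<omega> l k (r(a := v)) = dirs_upto \<omega> l k r"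
  by (auto simp: dirs_upto_def)

lemma untouched_upd [simp]:
  assumes "a < 39 \<or> a = addr j \<or> addr n \<le> a \<or> (\<exists>i k. a = addr i + 3 + k \<and> k < d)"
  shows "untouched (r(a := v)) = untouched r"
  using assms slot_bounds slot_neq unfolding untouched_def by (metis fun_upd_apply not_le)

lemma coords_Suc: "coords_upto (Suc i) 0 = coords_upto i d"
  by (auto simp: coords_upto_def fun_eq_iff less_Suc_eq)

lemma coords_step:
  assumes "coords_upto i k r" "k < d"
  shows "coords_upto i (Suc k) (r(addr i + 3 + k := x i k))"
proof -
  have "addr i + 3 + k \<noteq> addr j + 3 + k'" if "k' < d" "j \<noteq> i \<or> k' \<noteq> k" for j k'
    using addr_add_eq_iff[of "3 + k" "3 + k'" i j] assms that by (auto simp: add.assoc)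
  then show ?thesis
    using assms unfolding coords_upto_def fun_upd_def by (metis less_Suc_eq)
qed

lemma dirs_Suc: "dirs_upto \<omega> (Suc l) 0 = dirs_upto \<omega> l d"
  by (auto simp: dirs_upto_def fun_eq_iff less_Suc_eq)

lemma dirs_step:
  assumes "dirs_upto \<omega> l k r" "k < d"
  shows "dirs_upto \<omega> l (Suc k) (r(addr n + l * d + k := \<omega> (l * (d + n) + k)))"
proof -
  have "l' * d + k' < l * d + k" if "k' < d" "l' < l \<or> l' = l \<and> k' < k" for l' k'
  proof (cases "l' < l")
    case True
    then have "Suc l' * d \<le> l * d"
      by (intro mult_right_mono) auto
    then show ?thesis
      using that by simp
  qed (use that in auto)
  then have "addr n + l' * d + k' \<noteq> addr n + l * d + k" if "k' < d" "l' < l \<or> l' = l \<and> k' < k" for l' k'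
    using that by fastforce
  then show ?thesis
    using assms unfolding dirs_upto_def fun_upd_def by (metis less_Suc_eq)
qed

text \<open>The candidate for the slot of \<open>i\<close> is replaced if there is none or if the
  key of \<open>i\<close> is strictly smaller. If the slot already holds \<open>i\<close> itself,
  the point was placed in an earlier level and nothing happens.\<close>

lemma pass1_Suc:
  assumes "consistent (\<sigma>, C)" "i < n"
  shows "pass1 \<kappa> (Suc i) \<sigma> C =
    (let c = pass1 \<kappa> i \<sigma> C (\<sigma> i)
     in if c = 0 \<or> (c \<noteq> addr i \<and> \<kappa> i < \<kappa> ((c - 40) div (d + 3))) then (pass1 \<kappa> i \<sigma> C)(\<sigma> i := addr i)
        else pass1 \<kappa> i \<sigma> C)" (is "_ = ?rhs")
proof
  fix a
  let ?S = "\<lambda>i. {j. j < i \<and> \<sigma> j = \<sigma> i}" and ?S' = "{j. j < Suc i \<and> \<sigma> j = \<sigma> i}"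
  have SS: "?S' = insert i (?S i)"
    by auto
  have a40: "addr p \<noteq> 0" for p
    using addr_ge[of p] by linarith
  show "pass1 \<kappa> (Suc i) \<sigma> C a = ?rhs a"
  proof (cases "a = \<sigma> i")
    case False
    then have "{j. j < Suc i \<and> \<sigma> j = a} = {j. j < i \<and> \<sigma> j = a}"
      by (auto simp: less_Suc_eq)
    then show ?thesis
      using False by (auto simp: pass1_def Let_def)
  next
    case True
    have "C (\<sigma> i) = 0 \<or> C (\<sigma> i) = addr i"
      using assms unfolding consistent_def by auto
    then show ?thesis
    proof
      assume C: "C (\<sigma> i) = addr i"
      then show ?thesis
        using True a40 by (simp add: pass1_def Let_def)
    next
      assume C: "C (\<sigma> i) = 0"
      show ?thesis
      proof (cases "?S i = {}")
        case S0: True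
        have "pivot ?S' \<kappa> = i"
          unfolding SS S0 by (rule pivot_eqI) auto
        moreover have "pass1 \<kappa> i \<sigma> C (\<sigma> i) = 0"
          using C S0 by (simp add: pass1_def)
        moreover have "pass1 \<kappa> (Suc i) \<sigma> C (\<sigma> i) = addr (pivot ?S' \<kappa>)"
          using C by (auto simp: pass1_def)
        ultimately show ?thesis
          using True by (simp add: Let_def)
      next
        case S1: False
        define p where "p = pivot (?S i) \<kappa>"
        have fin: "finite (?S i)"
          by simp
        note pp = pivot_props[OF fin S1, where \<kappa> = \<kappa>, folded p_def]
        have pl: "pass1 \<kappa> i \<sigma> C (\<sigma> i) = addr p"
          using C S1 unfolding pass1_def p_def by auto
        have lt: "\<kappa> p < \<kappa> j" if "j \<in> ?S i" "j < p" for j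
        proof (rule ccontr)
          assume "\<not> \<kappa> p < \<kappa> j"
          then have "\<forall>k\<in>?S i. \<kappa> j \<le> \<kappa> k"
            using pp(2) by (meson not_less order_trans)
          then have "p \<le> j"
            unfolding p_def pivot_def using that(1) by (intro Least_le) blast
          then show False
            using that(2) by simp
        qed
        have "pivot ?S' \<kappa> = (if \<kappa> i < \<kappa> p then i else p)"
        proof (cases "\<kappa> i < \<kappa> p")
          case True
          have "\<kappa> i < \<kappa> j" if "j \<in> ?S i" for j
            using True pp(2)[OF that] by linarith
          then show ?thesis
            unfolding SS using True by (intro pivot_eqI[THEN trans]) (auto simp: less_imp_le)
        next
          case False
          then show ?thesis
            unfolding SS using pp lt by (intro pivot_eqI[THEN trans]) (auto simp: not_less)
        qed
        moreover have "p \<noteq> i"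
          using pp(1) by auto
        moreover have "pass1 \<kappa> (Suc i) \<sigma> C (\<sigma> i) = addr (pivot ?S' \<kappa>)"
          using C by (auto simp: pass1_def)
        ultimately show ?thesis
          using True pl a40[of p] by (simp add: Let_def)
      qed
    qed
  qed
qed

lemma pass1_0: "pass1 \<kappa> 0 \<sigma> C = C"
  by (auto simp: pass1_def)

lemma pass1_index:
  assumes "consistent (\<sigma>, C)" "i \<le> n" "j < n"
  shows "pass1 \<kappa> i \<sigma> C (\<sigma> j) = 0 \<or> pass1 \<kappa> i \<sigma> C (\<sigma> j) = addr j
    \<or> (\<exists>p<i. pass1 \<kappa> i \<sigma> C (\<sigma> j) = addr p)"
proof -
  have "C (\<sigma> j) = 0 \<or> C (\<sigma> j) = addr j"
    using assms unfolding consistent_def by auto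
  moreover have "pivot {k. k < i \<and> \<sigma> k = \<sigma> j} \<kappa> < i" if "{k. k < i \<and> \<sigma> k = \<sigma> j} \<noteq> {}"
    using pivot_props(1)[OF _ that, of \<kappa>] by auto
  ultimately show ?thesis
    unfolding pass1_def by auto
qed

end

text \<open>The memory consists of the registers and the root slot, the records up to
  \<open>addr n\<close>, and then one direction for each level.\<close>

locale prep_run = points +
  fixes \<epsilon> \<tau> c :: real and \<omega> :: "nat \<Rightarrow> real" and S :: nat
  assumes d_pos: "1 \<le> d" and n_ge: "2 \<le> n" and S_ge: "addr n + depth * d \<le> S"
begin

abbreviation "inp \<equiv> prep_input d \<epsilon> \<tau> c x"
abbreviation "hoare' \<equiv> hoare S inp \<omega>"

lemma bounds:
  shows "40 \<le> S" "40 \<le> addr n" "addr n \<le> S" "2 * n \<le> S" "n * d + 3 \<le> S" "depth \<le> S"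
    and dir_bound: "l \<le> depth \<Longrightarrow> addr n + l * d \<le> S"
proof -
  have "2 * n \<le> addr n" "n * d + 3 \<le> addr n"
    by (simp_all add: addr_def algebra_simps)
  moreover have "depth \<le> depth * d" "l \<le> depth \<Longrightarrow> l * d \<le> depth * d"
    using d_pos by simp_all
  ultimately show "40 \<le> S" "40 \<le> addr n" "addr n \<le> S" "2 * n \<le> S" "n * d + 3 \<le> S" "depth \<le> S"
    "l \<le> depth \<Longrightarrow> addr n + l * d \<le> S"
    using S_ge addr_ge[of n] by linarith+
qed

definition rregs :: "(nat \<Rightarrow> real) \<Rightarrow> bool" where
  "rregs r \<longleftrightarrow> r 0 = \<tau> \<and> r 1 = c \<and> r 5 = 0"

lemma rregs_upd [simp]: "2 \<le> a \<Longrightarrow> a \<noteq> 5 \<Longrightarrow> rregs (r(a := v)) = rregs r"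
  by (auto simp: rregs_def)

definition I_init :: "nat \<Rightarrow> config \<Rightarrow> bool" where
  "I_init k s \<longleftrightarrow> regs (words s) \<and> words s 8 = 10 + 3 * k \<and> words s 20 = 2 ^ k \<and> k \<le> lg n \<and>
     (\<forall>a\<ge>39. words s a = 0) \<and> rregs (reals s) \<and> (\<forall>a\<ge>39. reals s a = 0) \<and> tape_pos s = 0"

lemma init_block:
  "hoare' (\<lambda>s. words s = (\<lambda>_. 0)(0 := d, 1 := n) \<and> reals s = (\<lambda>_. 0) \<and> tape_pos s = 0)
    (Block [WConst 2 1, WAdd 3 0 4, WConst 15 3, WAdd 5 3 15, WConst 6 40, WMul 7 1 5,
     WAdd 7 7 6, RInput 0 2, WConst 20 2, RInput 1 20, WConst 8 10, WConst 20 1]) 12 (I_init 0)"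
proof (rule hoare_block)
  have "d \<le> S" "d + 3 \<le> S" "n * (d + 3) \<le> S" "n * (d + 3) + 40 \<le> S"
  proof -
    have "d + 3 \<le> n * (d + 3)"
      using n_ge by simp
    moreover have "n * (d + 3) + 40 \<le> S"
      using bounds(3) by (simp add: addr_def)
    ultimately show "d \<le> S" "d + 3 \<le> S" "n * (d + 3) \<le> S" "n * (d + 3) + 40 \<le> S"
      by linarith+
  qed
  moreover note bounds(1)
  moreover fix s :: config
  assume "words s = (\<lambda>_. 0)(0 := d, 1 := n) \<and> reals s = (\<lambda>_. 0) \<and> tape_pos s = 0"
  ultimately show "safes S inp \<omega> [WConst 2 1, WAdd 3 0 4, WConst 15 3, WAdd 5 3 15, WConst 6 40, WMul 7 1 5,
     WAdd 7 7 6, RInput 0 2, WConst 20 2, RInput 1 20, WConst 8 10, WConst 20 1] s \<and>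
    I_init 0 (effs inp \<omega> [WConst 2 1, WAdd 3 0 4, WConst 15 3, WAdd 5 3 15, WConst 6 40, WMul 7 1 5,
     WAdd 7 7 6, RInput 0 2, WConst 20 2, RInput 1 20, WConst 8 10, WConst 20 1] s)"
    by (simp add: I_init_def regs_def rregs_def addr_def prep_input_def)
qed simp

lemma init_loop:
  "hoare' (I_init 0) (Until (WLe 1 20) (Block [WAdd 20 20 20, WAdd 8 8 15])) (lg n * 4 + 1) (I_init (lg n))"
proof (rule hoare_until[where I = I_init and N = "lg n" and ?T1.0 = 2])
  fix k assume k: "k < lg n"
  have "2 * 2 ^ k \<le> S" "13 + 3 * k \<le> S"
    using lg_less[OF k] bounds(4,6) k by (auto simp: depth_def)
  then show "hoare' (I_init k) (Block [WAdd 20 20 20, WAdd 8 8 15]) 2 (I_init (Suc k))"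
    using bounds(1) k by (intro hoare_block) (auto simp: I_init_def regs_def)
next
  fix k s assume "k < lg n" "I_init k s"
  then show "\<not> holds (WLe 1 20) s"
    using lg_less[of k n] by (simp add: I_init_def regs_def)
next
  fix s assume "I_init (lg n) s"
  then show "holds (WLe 1 20) s"
    using lg_ge[of n] by (simp add: I_init_def regs_def)
qed simp

section \<open>Copying the input into records\<close>

definition I_copy :: "nat \<Rightarrow> config \<Rightarrow> bool" where
  "I_copy i s \<longleftrightarrow> regs (words s) \<and> words s 8 = depth \<and> words s 10 = addr i \<and> words s 19 = 3 + i * d \<and>
     words s 21 = 39 \<and> i \<le> n \<and> (\<forall>j<i. words s (addr j) = 39) \<and> (\<forall>a. slot a \<longrightarrow> words s a = 0) \<and>
     rregs (reals s) \<and> coords_upto i 0 (reals s) \<and> untouched (reals s) \<and> tape_pos s = 0"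

definition J_copy :: "nat \<Rightarrow> nat \<Rightarrow> config \<Rightarrow> bool" where
  "J_copy i k s \<longleftrightarrow> regs (words s) \<and> words s 8 = depth \<and> words s 12 = addr (Suc i) \<and>
     words s 11 = addr i + 3 + k \<and> words s 19 = 3 + i * d + k \<and>
     words s 21 = 39 \<and> (\<forall>j<Suc i. words s (addr j) = 39) \<and> (\<forall>a. slot a \<longrightarrow> words s a = 0) \<and>
     rregs (reals s) \<and> coords_upto i k (reals s) \<and> untouched (reals s) \<and> tape_pos s = 0"

lemma reg_neq [simp]: "a < 39 \<Longrightarrow> addr j \<noteq> a" "a < 39 \<Longrightarrow> a \<noteq> addr j"
  using addr_ge[of j] by auto

lemma slot_reg: "slot b \<Longrightarrow> a < 39 \<Longrightarrow> b \<noteq> a"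
  using slot_bounds[of b] by auto

lemma words_reg_slots:
  "a < 39 \<Longrightarrow> (\<forall>b. slot b \<longrightarrow> (W(a := v)) b = 0) \<longleftrightarrow> (\<forall>b. slot b \<longrightarrow> W b = 0)"
  using slot_reg[of _ a] by auto

lemma words_rec_slots:
  "(\<forall>b. slot b \<longrightarrow> (W(addr i := v)) b = 0) \<longleftrightarrow> (\<forall>b. slot b \<longrightarrow> W b = 0)"
  using slot_neq(1) by auto

lemma regs_rec [simp]: "regs (W(addr i := v)) = regs W"
  using addr_ge[of i] by (intro regs_upd) auto

lemma prep_input_coord: "k < d \<Longrightarrow> inp (3 + i * d + k) = x i k"
proof -
  assume "k < d"
  then have "(i * d + k) div d = i" "(i * d + k) mod d = k"
    by (simp_all add: div_add1_eq)
  then show ?thesis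
    by (simp add: prep_input_def)
qed

lemma copy_inner:
  assumes i: "i < n"
  shows "hoare' (J_copy i 0) (Until (WLe 12 11) (Block [RInput 2 19, RStore 11 2, WAdd 19 19 2, WAdd 11 11 2]))
    (d * 6 + 1) (J_copy i d)"
proof (rule hoare_until[where I = "J_copy i" and N = d and ?T1.0 = 4])
  fix k assume k: "k < d"
  have a: "addr i + 3 + k < addr n"
    using addr_less[OF i, of "3 + k"] k by simp
  have "i * d + d \<le> n * d"
    using mult_right_mono[of "Suc i" n d] i by simp
  then have b: "Suc (3 + i * d + k) \<le> S" "Suc (addr i + 3 + k) \<le> S" "39 < addr i + 3 + k"
    using bounds(3,5) k a addr_ge[of i] by linarith+
  have ex: "\<exists>i' k'. addr i + 3 + k = addr i' + 3 + k' \<and> k' < d"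
    using k by blast
  show "hoare' (J_copy i k) (Block [RInput 2 19, RStore 11 2, WAdd 19 19 2, WAdd 11 11 2]) 4 (J_copy i (Suc k))"
  proof (rule hoare_block)
    fix s assume J: "J_copy i k s"
    have r: "rregs ((reals s)(2 := x i k, addr i + 3 + k := x i k))"
      using J b(3) by (auto simp: J_copy_def rregs_def)
    have co: "coords_upto i (Suc k) ((reals s)(2 := x i k, addr i + 3 + k := x i k))"
      using J i k by (intro coords_step) (auto simp: J_copy_def)
    have un: "untouched ((reals s)(2 := x i k, addr i + 3 + k := x i k))"
      using J untouched_upd[of "addr i + 3 + k"] ex by (auto simp: J_copy_def)
    show "safes S inp \<omega> [RInput 2 19, RStore 11 2, WAdd 19 19 2, WAdd 11 11 2] s \<and>
        J_copy i (Suc k) (effs inp \<omega> [RInput 2 19, RStore 11 2, WAdd 19 19 2, WAdd 11 11 2] s)"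
      using J b bounds(1) r co un prep_input_coord[OF k, of i]
      by (simp add: J_copy_def regs_def words_reg_slots del: fun_upd_apply) (simp add: add.commute)
  qed simp
qed (use i in \<open>auto simp: J_copy_def addr_Suc\<close>)

lemma copy_loop: "hoare' (I_copy 0) (Until (WLe 7 10)
     (Block [WStore 10 21, WAdd 11 10 15, WAdd 12 10 5]
      ;; Until (WLe 12 11) (Block [RInput 2 19, RStore 11 2, WAdd 19 19 2, WAdd 11 11 2])
      ;; Block [WAdd 10 12 4])) (n * (d * 6 + 7) + 1) (I_copy n)"
proof (rule hoare_until[where I = I_copy and N = n and ?T1.0 = "d * 6 + 5"])
  fix i assume i: "i < n"
  have a: "addr (Suc i) \<le> addr n"
    using i by simp
  have 1: "hoare' (I_copy i) (Block [WStore 10 21, WAdd 11 10 15, WAdd 12 10 5]) 3 (J_copy i 0)"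
  proof (rule hoare_block)
    fix s assume I: "I_copy i s"
    let ?is = "[WStore 10 21, WAdd 11 10 15, WAdd 12 10 5]"
    let ?W = "(words s)(addr i := 39, 11 := addr i + 3, 12 := addr (Suc i))"
    have R: "regs (words s)" "words s 10 = addr i" "words s 21 = 39"
      using I by (auto simp: I_copy_def)
    have e: "words (effs inp \<omega> ?is s) = ?W" "reals (effs inp \<omega> ?is s) = reals s"
      "tape_pos (effs inp \<omega> ?is s) = tape_pos s"
      using R by (simp_all add: regs_def addr_Suc)
    have "Suc (addr i) + d \<le> S" "addr i + 3 \<le> S" "addr i < S" "addr i + (d + 3) \<le> S"
      using a bounds(3) by (auto simp: addr_Suc)
    then have safe: "safes S inp \<omega> ?is s"
      using R bounds(1) by (simp add: regs_def)
    have f1: "\<forall>j<Suc i. ?W (addr j) = 39"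
      using I by (auto simp: I_copy_def less_Suc_eq)
    have f2: "\<forall>a. slot a \<longrightarrow> ?W a = 0"
      using I by (simp add: I_copy_def words_reg_slots words_rec_slots del: fun_upd_apply)
    have f3: "words s 8 = depth" "words s 19 = 3 + i * d" "rregs (reals s)" "coords_upto i 0 (reals s)"
      "untouched (reals s)" "tape_pos s = 0"
      using I unfolding I_copy_def by blast+
    have f4: "regs ?W" "?W 8 = depth" "?W 12 = addr (Suc i)" "?W 11 = addr i + 3 + 0"
      "?W 19 = 3 + i * d + 0" "?W 21 = 39"
      using R f3 by simp_all
    show "safes S inp \<omega> ?is s \<and> J_copy i 0 (effs inp \<omega> ?is s)"
      unfolding J_copy_def e by (intro conjI safe f1 f2 f3 f4)
  qed simp
  have 2: "hoare' (J_copy i d) (Block [WAdd 10 12 4]) 1 (I_copy (Suc i))"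
  proof (rule hoare_block)
    fix s assume J: "J_copy i d s"
    let ?W = "(words s)(10 := addr (Suc i))"
    have R: "regs (words s)" "words s 12 = addr (Suc i)" "words s 8 = depth" "words s 19 = 3 + i * d + d"
      "words s 21 = 39" "\<forall>j<Suc i. words s (addr j) = 39" "\<forall>a. slot a \<longrightarrow> words s a = 0"
      "rregs (reals s)" "coords_upto i d (reals s)" "untouched (reals s)" "tape_pos s = 0"
      using J unfolding J_copy_def by blast+
    have e: "words (effs inp \<omega> [WAdd 10 12 4] s) = ?W" "reals (effs inp \<omega> [WAdd 10 12 4] s) = reals s"
      "tape_pos (effs inp \<omega> [WAdd 10 12 4] s) = tape_pos s"
      using R(1,2) by (simp_all add: regs_def)
    have safe: "safes S inp \<omega> [WAdd 10 12 4] s"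
      using R(1,2) bounds(1) order_trans[OF a bounds(3)] by (simp add: regs_def)
    have f: "regs ?W" "?W 8 = depth" "?W 10 = addr (Suc i)" "?W 19 = 3 + Suc i * d" "?W 21 = 39" "Suc i \<le> n"
      using R(1,3-5) i by simp_all
    have f1: "\<forall>j<Suc i. ?W (addr j) = 39"
      using R(6) by simp
    have f2: "\<forall>a. slot a \<longrightarrow> ?W a = 0"
      using R(7) by (simp add: words_reg_slots del: fun_upd_apply)
    show "safes S inp \<omega> [WAdd 10 12 4] s \<and> I_copy (Suc i) (effs inp \<omega> [WAdd 10 12 4] s)"
      unfolding I_copy_def e coords_Suc by (intro conjI safe f f1 f2 R)
  qed simp
  show "hoare' (I_copy i) (Block [WStore 10 21, WAdd 11 10 15, WAdd 12 10 5]
      ;; Until (WLe 12 11) (Block [RInput 2 19, RStore 11 2, WAdd 19 19 2, WAdd 11 11 2])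
      ;; Block [WAdd 10 12 4]) (d * 6 + 5) (I_copy (Suc i))"
    by (rule hoare_seq[OF 1 hoare_seq[OF copy_inner[OF i] 2]]) auto
qed (auto simp: I_copy_def regs_def)

section \<open>The first scan of a level: choice of the pivots\<close>

abbreviation st :: "nat \<Rightarrow> (nat \<Rightarrow> nat) \<times> (nat \<Rightarrow> nat)" where
  "st l \<equiv> levels l \<omega> (\<lambda>_. 39, \<lambda>_. 0)"

abbreviation keys :: "nat \<Rightarrow> nat \<Rightarrow> real" where
  "keys l \<equiv> shift (l * (d + n) + d) \<omega>"

definition mid :: "nat \<Rightarrow> nat \<Rightarrow> nat" where
  "mid l = pass1 (keys l) n (fst (st l)) (snd (st l))"

lemma consistent_st: "consistent (st l)"
proof (induction l)
  case (Suc l)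
  then show ?case
    using consistent_level[of "fst (st l)" "snd (st l)" "shift (l * (d + n)) \<omega>" "fst (st (Suc l))" "snd (st (Suc l))"]
    by (simp add: levels_Suc del: levels.simps(2))
qed (simp add: consistent_init)

lemma st_Suc: "st (Suc l) = (pass2 (shift (l * (d + n)) \<omega>) (fst (st l)) (mid l), mid l)"
  by (simp add: levels_Suc level_def Let_def mid_def shift_shift del: levels.simps(2))

definition base :: "nat \<Rightarrow> config \<Rightarrow> bool" where
  "base l s \<longleftrightarrow> regs (words s) \<and> words s 8 = depth \<and> words s 9 = l \<and> words s 16 = addr n + l * d \<and>
     rregs (reals s) \<and> coords_upto n 0 (reals s) \<and> untouched (reals s)"

definition I_level :: "nat \<Rightarrow> config \<Rightarrow> bool" where
  "I_level l s \<longleftrightarrow> base l s \<and> dirs_upto \<omega> l 0 (reals s) \<and> tape_pos s = l * (d + n) \<and>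
     table (fst (st l)) (snd (st l)) (words s)"

definition I_dir :: "nat \<Rightarrow> nat \<Rightarrow> config \<Rightarrow> bool" where
  "I_dir l k s \<longleftrightarrow> base l s \<and> dirs_upto \<omega> l k (reals s) \<and> tape_pos s = l * (d + n) + k \<and>
     table (fst (st l)) (snd (st l)) (words s) \<and> words s 12 = addr n + l * d + d \<and>
     words s 11 = addr n + l * d + k"

definition I_pass1 :: "nat \<Rightarrow> nat \<Rightarrow> config \<Rightarrow> bool" where
  "I_pass1 l i s \<longleftrightarrow> base l s \<and> dirs_upto \<omega> (Suc l) 0 (reals s) \<and> tape_pos s = l * (d + n) + d + i \<and>
     table (fst (st l)) (pass1 (keys l) i (fst (st l)) (snd (st l))) (words s) \<and>
     words s 12 = addr n + l * d + d \<and> words s 10 = addr i \<and> (\<forall>j<i. reals s (addr j) = keys l j)"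

text \<open>The second scan works in place: points before \<open>i\<close> are already in the state
  of the next level.\<close>

definition partial2 :: "nat \<Rightarrow> nat \<Rightarrow> nat \<Rightarrow> nat" where
  "partial2 l i j = (if j < i then fst (st (Suc l)) j else fst (st l) j)"

definition I_pass2 :: "nat \<Rightarrow> nat \<Rightarrow> config \<Rightarrow> bool" where
  "I_pass2 l i s \<longleftrightarrow> base l s \<and> dirs_upto \<omega> (Suc l) 0 (reals s) \<and> tape_pos s = Suc l * (d + n) \<and>
     table (partial2 l i) (mid l) (words s) \<and> words s 12 = addr n + l * d + d \<and> words s 10 = addr i"

definition lvl_regs :: "nat \<Rightarrow> (nat \<Rightarrow> nat) \<Rightarrow> bool" where
  "lvl_regs l W \<longleftrightarrow> regs W \<and> W 8 = depth \<and> W 9 = l \<and> W 16 = addr n + l * d"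

definition lvl_reals :: "nat \<Rightarrow> (nat \<Rightarrow> real) \<Rightarrow> bool" where
  "lvl_reals l r \<longleftrightarrow> rregs r \<and> coords_upto n 0 r \<and> untouched r"

lemma base_alt: "base l s \<longleftrightarrow> lvl_regs l (words s) \<and> lvl_reals l (reals s)"
  by (auto simp: base_def lvl_regs_def lvl_reals_def)

lemma lvl_regs_upd [simp]: "10 \<le> a \<Longrightarrow> a \<noteq> 15 \<Longrightarrow> a \<noteq> 16 \<Longrightarrow> lvl_regs l (W(a := v)) = lvl_regs l W"
  by (auto simp: lvl_regs_def)

lemma lvl_reals_upd [simp]:
  "2 \<le> a \<Longrightarrow> a \<noteq> 5 \<Longrightarrow> a < 39 \<Longrightarrow> lvl_reals l (r(a := v)) = lvl_reals l r"
  "lvl_reals l (r(addr i := v)) = lvl_reals l r"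
  "addr n \<le> a \<Longrightarrow> lvl_reals l (r(a := v)) = lvl_reals l r"
proof -
  show "2 \<le> a \<Longrightarrow> a \<noteq> 5 \<Longrightarrow> a < 39 \<Longrightarrow> lvl_reals l (r(a := v)) = lvl_reals l r"
    by (simp add: lvl_reals_def)
  show "lvl_reals l (r(addr i := v)) = lvl_reals l r"
    using addr_ge[of i] unfolding lvl_reals_def
    by (subst rregs_upd, simp, simp, subst coords_upd[where j = i], simp, simp, simp,
        subst untouched_upd[where j = i], simp, simp)
  show "addr n \<le> a \<Longrightarrow> lvl_reals l (r(a := v)) = lvl_reals l r"
    using addr_ge[of n] unfolding lvl_reals_def by (simp add: le_trans)
qed

lemma lvl_regsD: "lvl_regs l W \<Longrightarrow> W 1 = n \<and> W 2 = 1 \<and> W 3 = d \<and> W 4 = 0 \<and> W 5 = d + 3 \<and> W 6 = 40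
    \<and> W 7 = addr n \<and> W 15 = 3 \<and> W 8 = depth \<and> W 9 = l \<and> W 16 = addr n + l * d"
  by (auto simp: lvl_regs_def regs_def)

lemma dir_loop:
  assumes l: "l < depth"
  shows "hoare' (I_dir l 0) (Until (WLe 12 11) (Block [RNormal 2, RStore 11 2, WAdd 11 11 2])) (d * 5 + 1) (I_dir l d)"
proof (rule hoare_until[where I = "I_dir l" and N = d and ?T1.0 = 3])
  fix k assume k: "k < d"
  have b: "addr n + l * d + d \<le> S"
    using dir_bound[of "Suc l"] l by simp
  let ?is = "[RNormal 2, RStore 11 2, WAdd 11 11 2]"
  show "hoare' (I_dir l k) (Block ?is) 3 (I_dir l (Suc k))"
  proof (rule hoare_block)
    fix s assume I: "I_dir l k s"
    have R: "lvl_regs l (words s)" "lvl_reals l (reals s)" "dirs_upto \<omega> l k (reals s)"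
      "tape_pos s = l * (d + n) + k" "table (fst (st l)) (snd (st l)) (words s)"
      "words s 12 = addr n + l * d + d" "words s 11 = addr n + l * d + k"
      using I unfolding I_dir_def base_alt by blast+
    note W = lvl_regsD[OF R(1)]
    let ?r = "(reals s)(2 := \<omega> (l * (d + n) + k), addr n + l * d + k := \<omega> (l * (d + n) + k))"
    have e: "words (effs inp \<omega> ?is s) = (words s)(11 := addr n + l * d + Suc k)"
      "reals (effs inp \<omega> ?is s) = ?r" "tape_pos (effs inp \<omega> ?is s) = l * (d + n) + Suc k"
      using W R by simp_all
    have safe: "safes S inp \<omega> ?is s"
      using W R b k bounds(1) by simp
    have "2 < addr n"
      using addr_ge[of n] by linarith
    then have d: "dirs_upto \<omega> l (Suc k) ?r"
      using R(3) k by (intro dirs_step) simp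
    show "safes S inp \<omega> ?is s \<and> I_dir l (Suc k) (effs inp \<omega> ?is s)"
      unfolding I_dir_def base_alt e using safe d R by simp
  qed simp
qed (auto simp: I_dir_def)

lemma tableD:
  assumes "table \<sigma> C W"
  shows "i < n \<Longrightarrow> W (addr i) = \<sigma> i" "slot a \<Longrightarrow> W a = C a"
  using assms by (auto simp: table_def)

lemma slot_st: "i < n \<Longrightarrow> slot (fst (st l) i)"
  using consistent_st[of l] by (auto simp: consistent_def)

lemma pass1_body:
  assumes l: "l < depth" and i: "i < n"
  shows "hoare' (I_pass1 l i) prep_pass1 11 (I_pass1 l (Suc i))"
proof -
  define \<sigma> where "\<sigma> = fst (st l)"
  define C where "C = snd (st l)"
  have cons: "consistent (\<sigma>, C)"
    using consistent_st[of l] by (simp add: \<sigma>_def C_def)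
  define \<kappa> where "\<kappa> = keys l"
  define C1 where "C1 = pass1 \<kappa> i \<sigma> C"
  \<comment> \<open>The content of the slot when the scan reaches \<open>i\<close>: 0, or
    \<open>addr i\<close> if \<open>i\<close> was placed earlier, or the candidate among the points
    before \<open>i\<close>.\<close>
  define cc where "cc = C1 (\<sigma> i)"
  have ccx: "cc = 0 \<or> cc = addr i \<or> (\<exists>p<i. cc = addr p)"
    unfolding cc_def C1_def using pass1_index[OF cons _ i] i by simp
  have cc_le: "cc < addr n"
    using ccx i addr_less'[of i] addr_less' addr_ge[of n] by (metis less_trans not_less order_less_le_trans zero_less_numeral)
  have C2: "pass1 \<kappa> (Suc i) \<sigma> C = (if cc = 0 \<or> (cc \<noteq> addr i \<and> \<kappa> i < \<kappa> ((cc - 40) div (d + 3)))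
      then C1(\<sigma> i := addr i) else C1)"
    unfolding pass1_Suc[OF cons i] Let_def C1_def cc_def ..
  have si: "slot (\<sigma> i)"
    unfolding \<sigma>_def using slot_st[OF i] .
  note sib = slot_bounds[OF si]
  define M where "M s \<longleftrightarrow> base l s \<and> dirs_upto \<omega> (Suc l) 0 (reals s) \<and> tape_pos s = l * (d + n) + d + Suc i \<and>
     words s 12 = addr n + l * d + d \<and> words s 10 = addr i \<and> (\<forall>j<Suc i. reals s (addr j) = \<kappa> j)" for s :: config
  define M1 where "M1 s \<longleftrightarrow> M s \<and> table \<sigma> C1 (words s) \<and> words s 13 = \<sigma> i \<and> words s 14 = cc \<and> reals s 2 = \<kappa> i" for s :: config
  define M2 where "M2 s \<longleftrightarrow> M s \<and> table \<sigma> (pass1 \<kappa> (Suc i) \<sigma> C) (words s)" for s :: config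
  have 1: "hoare' (I_pass1 l i) (Block [RNormal 2, RStore 10 2, WLoad 13 10, WLoad 14 13]) 4 M1"
  proof (rule hoare_block)
    let ?is = "[RNormal 2, RStore 10 2, WLoad 13 10, WLoad 14 13]"
    fix s assume I: "I_pass1 l i s"
    have R: "lvl_regs l (words s)" "lvl_reals l (reals s)" "dirs_upto \<omega> (Suc l) 0 (reals s)"
      "tape_pos s = l * (d + n) + d + i" "table \<sigma> C1 (words s)"
      "words s 12 = addr n + l * d + d" "words s 10 = addr i" "\<forall>j<i. reals s (addr j) = \<kappa> j"
      using I unfolding I_pass1_def base_alt \<sigma>_def C_def \<kappa>_def C1_def by blast+
    note W = lvl_regsD[OF R(1)]
    have k: "\<omega> (l * (d + n) + d + i) = \<kappa> i"
      by (simp add: \<kappa>_def shift_def)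
    have ws: "words s (addr i) = \<sigma> i" "words s (\<sigma> i) = cc"
      using tableD[OF R(5)] i si by (auto simp: cc_def)
    have ne: "\<sigma> i \<noteq> 13"
      using sib by auto
    have e: "words (effs inp \<omega> ?is s) = (words s)(13 := \<sigma> i, 14 := cc)"
      "reals (effs inp \<omega> ?is s) = (reals s)(2 := \<kappa> i, addr i := \<kappa> i)"
      "tape_pos (effs inp \<omega> ?is s) = l * (d + n) + d + Suc i"
      using W R ws ne k by simp_all
    have safe: "safes S inp \<omega> ?is s"
      using W R bounds(1,3) addr_less'[OF i] ws sib cc_le by simp
    have f: "\<forall>j<Suc i. ((reals s)(2 := \<kappa> i, addr i := \<kappa> i)) (addr j) = \<kappa> j"
      using R(8) by (auto simp: less_Suc_eq)
    have t: "table \<sigma> C1 ((words s)(13 := \<sigma> i, 14 := cc))"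
      using R(5) by simp
    have d: "dirs_upto \<omega> (Suc l) 0 ((reals s)(2 := \<kappa> i, addr i := \<kappa> i))"
      using R(3) addr_less'[OF i] addr_ge[of n] by simp
    show "safes S inp \<omega> ?is s \<and> M1 (effs inp \<omega> ?is s)"
      unfolding M1_def M_def base_alt e using safe f t d R by simp
  qed simp
  have store: "hoare' (\<lambda>s. M1 s \<and> (cc = 0 \<or> (cc \<noteq> addr i \<and> \<kappa> i < \<kappa> ((cc - 40) div (d + 3))))) (Block [WStore 13 10]) 1 M2"
  proof (rule hoare_block)
    fix s assume "M1 s \<and> (cc = 0 \<or> (cc \<noteq> addr i \<and> \<kappa> i < \<kappa> ((cc - 40) div (d + 3))))"
    then have M: "M s" "table \<sigma> C1 (words s)" "words s 13 = \<sigma> i"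
      and C2': "pass1 \<kappa> (Suc i) \<sigma> C = C1(\<sigma> i := addr i)"
      unfolding M1_def C2 by auto
    have R: "lvl_regs l (words s)" "words s 10 = addr i"
      using M(1) unfolding M_def base_alt by auto
    have e: "words (effs inp \<omega> [WStore 13 10] s) = (words s)(\<sigma> i := addr i)"
      "reals (effs inp \<omega> [WStore 13 10] s) = reals s" "tape_pos (effs inp \<omega> [WStore 13 10] s) = tape_pos s"
      using M R by simp_all
    have t: "table \<sigma> (C1(\<sigma> i := addr i)) ((words s)(\<sigma> i := addr i))"
      using M si by (intro table_upd_slot)
    have r: "lvl_regs l ((words s)(\<sigma> i := addr i)) = lvl_regs l (words s)" "\<sigma> i \<noteq> 10" "\<sigma> i \<noteq> 12"
      using sib by (auto intro: lvl_regs_upd)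
    show "safes S inp \<omega> [WStore 13 10] s \<and> M2 (effs inp \<omega> [WStore 13 10] s)"
      unfolding M2_def C2' M_def base_alt e using M t r sib bounds(3) by (simp add: M_def base_alt)
  qed simp
  have skip: "hoare' (\<lambda>s. M1 s \<and> \<not> (cc = 0 \<or> (cc \<noteq> addr i \<and> \<kappa> i < \<kappa> ((cc - 40) div (d + 3))))) (Block []) 1 M2"
    by (rule hoare_block) (auto simp: M1_def M2_def C2)
  let ?M1 = "\<lambda>s. M1 s \<and> cc \<noteq> 0 \<and> reals s 3 = reals s cc"
  have 2: "hoare' (\<lambda>s. M1 s \<and> \<not> holds (WLe 14 4) s) (Block [RLoad 3 14]) 1 ?M1"
  proof (rule hoare_block)
    fix s assume h: "M1 s \<and> \<not> holds (WLe 14 4) s"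
    have R: "lvl_regs l (words s)" "lvl_reals l (reals s)" "words s 14 = cc" "dirs_upto \<omega> (Suc l) 0 (reals s)"
      using h unfolding M1_def M_def base_alt by auto
    have "cc \<noteq> 0"
      using h lvl_regsD[OF R(1)] R(3) by auto
    then have "3 \<noteq> cc"
      using ccx by auto
    moreover have "dirs_upto \<omega> (Suc l) 0 ((reals s)(3 := reals s cc))"
      using R(4) addr_ge[of n] by simp
    ultimately show "safes S inp \<omega> [RLoad 3 14] s \<and> ?M1 (effs inp \<omega> [RLoad 3 14] s)"
      using h \<open>cc \<noteq> 0\<close> R bounds(1) unfolding M1_def M_def base_alt by simp
  qed simp
  \<comment> \<open>The candidate is \<open>i\<close> or precedes \<open>i\<close>, so its key in
    this level has been written. If it is \<open>i\<close> itself, both sides of the comparison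
    agree and nothing is stored.\<close>
  have key: "(RLe_cond \<longleftrightarrow> \<not> (cc \<noteq> addr i \<and> \<kappa> i < \<kappa> ((cc - 40) div (d + 3))))"
    if "?M1 s" "RLe_cond = holds (RLe 3 2) s" for s :: config and RLe_cond
  proof -
    have M: "\<forall>j<Suc i. reals s (addr j) = \<kappa> j" "reals s 2 = \<kappa> i" "cc \<noteq> 0" "reals s 3 = reals s cc"
      using that(1) unfolding M1_def M_def by auto
    from ccx M(3) obtain p where p: "p \<le> i" "cc = addr p"
      by (metis less_imp_le order_refl)
    then show ?thesis
      using M that(2) by (auto simp: less_Suc_eq_le)
  qed
  have 3: "hoare' ?M1 (IfC (RLe 3 2) (Block []) (Block [WStore 13 10])) 3 M2"
  proof (rule hoare_if[where ?T1.0 = 1])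
    show "hoare' (\<lambda>s. ?M1 s \<and> holds (RLe 3 2) s) (Block []) 1 M2"
      by (rule hoare_conseq[OF skip]) (use key in blast)+
    show "hoare' (\<lambda>s. ?M1 s \<and> \<not> holds (RLe 3 2) s) (Block [WStore 13 10]) 1 M2"
      by (rule hoare_conseq[OF store]) (use key in blast)+
  qed simp
  have 4: "hoare' M1 (IfC (WLe 14 4) (Block [WStore 13 10])
      (Block [RLoad 3 14] ;; IfC (RLe 3 2) (Block []) (Block [WStore 13 10]))) 6 M2"
  proof (rule hoare_if[where ?T1.0 = 4])
    have "cc = 0" if "M1 s" "holds (WLe 14 4) s" for s :: config
    proof -
      have "lvl_regs l (words s)" "words s 14 = cc"
        using that(1) unfolding M1_def M_def base_alt by auto
      then show ?thesis
        using lvl_regsD[of l "words s"] that(2) by simp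
    qed
    then show "hoare' (\<lambda>s. M1 s \<and> holds (WLe 14 4) s) (Block [WStore 13 10]) 4 M2"
      by (intro hoare_conseq[OF store]) auto
    show "hoare' (\<lambda>s. M1 s \<and> \<not> holds (WLe 14 4) s)
        (Block [RLoad 3 14] ;; IfC (RLe 3 2) (Block []) (Block [WStore 13 10])) 4 M2"
      by (rule hoare_seq[OF 2 3]) simp
  qed simp
  have 5: "hoare' M2 (Block [WAdd 10 10 5]) 1 (I_pass1 l (Suc i))"
  proof (rule hoare_block)
    fix s assume M: "M2 s"
    have R: "lvl_regs l (words s)" "words s 10 = addr i"
      using M unfolding M2_def M_def base_alt by auto
    have "addr (Suc i) \<le> S"
      using order_trans[OF _ bounds(3), of "addr (Suc i)"] i by simp
    moreover have "\<forall>j<Suc i. P j" if "\<forall>j<Suc i. Q j \<and> P j" for P Q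
      using that by blast
    ultimately show "safes S inp \<omega> [WAdd 10 10 5] s \<and> I_pass1 l (Suc i) (effs inp \<omega> [WAdd 10 10 5] s)"
      using M lvl_regsD[OF R(1)] R bounds(1)
      unfolding M2_def M_def base_alt I_pass1_def \<sigma>_def C_def \<kappa>_def by (simp add: addr_Suc)
  qed simp
  show ?thesis
    unfolding prep_pass1_def by (rule hoare_seq[OF 1 hoare_seq[OF 4 5]]) auto
qed

lemma pass1_loop:
  assumes l: "l < depth"
  shows "hoare' (I_pass1 l 0) (Until (WLe 7 10) prep_pass1) (n * 13 + 1) (I_pass1 l n)"
proof (rule hoare_until[where I = "I_pass1 l" and N = n and ?T1.0 = 11])
  fix k s assume "k < n" "I_pass1 l k s"
  then show "\<not> holds (WLe 7 10) s"
    using lvl_regsD[of l "words s"] by (auto simp: I_pass1_def base_alt)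
next
  fix s assume "I_pass1 l n s"
  then show "holds (WLe 7 10) s"
    using lvl_regsD[of l "words s"] by (auto simp: I_pass1_def base_alt)
qed (use pass1_body[OF l] in auto)

end

section \<open>The second scan of a level: projections and new slots\<close>

context prep_run
begin

definition I_dot :: "nat \<Rightarrow> nat \<Rightarrow> nat \<Rightarrow> nat \<Rightarrow> config \<Rightarrow> bool" where
  "I_dot l i p k s \<longleftrightarrow> I_pass2 l i s \<and> words s 13 = fst (st l) i \<and> words s 14 = addr p \<and>
     words s 11 = addr n + l * d + k \<and> words s 17 = addr i + 3 + k \<and> words s 18 = addr p + 3 + k \<and>
     reals s 4 = (\<Sum>k'<k. \<omega> (l * (d + n) + k') * (x i k' - x p k'))"

lemma dot_loop:
  assumes l: "l < depth" and i: "i < n" and p: "p < n"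
  shows "hoare' (I_dot l i p 0) (Until (WLe 12 11)
     (Block [RLoad 2 17, RLoad 3 18, RSub 2 2 3, RLoad 3 11, RMul 2 3 2, RAdd 4 4 2,
        WAdd 11 11 2, WAdd 17 17 2, WAdd 18 18 2])) (d * 11 + 1) (I_dot l i p d)"
proof (rule hoare_until[where I = "I_dot l i p" and N = d and ?T1.0 = 9])
  fix k assume k: "k < d"
  let ?is = "[RLoad 2 17, RLoad 3 18, RSub 2 2 3, RLoad 3 11, RMul 2 3 2, RAdd 4 4 2,
        WAdd 11 11 2, WAdd 17 17 2, WAdd 18 18 2]"
  have b: "addr n + l * d + d \<le> S"
    using dir_bound[of "Suc l"] l by simp
  have b2: "Suc (addr j + 3 + k) \<le> S" if "j < n" for j
    using addr_less[OF that, of "3 + k"] k bounds(3) by simp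
  show "hoare' (I_dot l i p k) (Block ?is) 9 (I_dot l i p (Suc k))"
  proof (rule hoare_block)
    fix s assume I: "I_dot l i p k s"
    have R: "lvl_regs l (words s)" "lvl_reals l (reals s)" "dirs_upto \<omega> (Suc l) 0 (reals s)"
      "tape_pos s = Suc l * (d + n)" "table (partial2 l i) (mid l) (words s)"
      "words s 12 = addr n + l * d + d" "words s 10 = addr i"
      "words s 13 = fst (st l) i" "words s 14 = addr p"
      "words s 11 = addr n + l * d + k" "words s 17 = addr i + 3 + k" "words s 18 = addr p + 3 + k"
      "reals s 4 = (\<Sum>k'<k. \<omega> (l * (d + n) + k') * (x i k' - x p k'))"
      using I unfolding I_dot_def I_pass2_def base_alt by blast+
    note W = lvl_regsD[OF R(1)]
    have v: "reals s (addr i + 3 + k) = x i k" "reals s (addr p + 3 + k) = x p k"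
      "reals s (addr n + l * d + k) = \<omega> (l * (d + n) + k)"
      using R(2,3) k i p unfolding lvl_reals_def coords_upto_def dirs_upto_def by auto
    have ne: "addr i + 3 + k \<noteq> 2" "addr p + 3 + k \<noteq> 2" "addr n + l * d + k \<noteq> 2"
       "addr n + l * d + k \<noteq> 3"
      using addr_ge[of i] addr_ge[of p] addr_ge[of n] by linarith+
    let ?f = "\<omega> (l * (d + n) + k) * (x i k - x p k)"
    have e: "words (effs inp \<omega> ?is s) = (words s)(11 := addr n + l * d + Suc k,
          17 := addr i + 3 + Suc k, 18 := addr p + 3 + Suc k)"
      "reals (effs inp \<omega> ?is s) = (reals s)(2 := ?f, 3 := \<omega> (l * (d + n) + k), 4 := reals s 4 + ?f)"
      "tape_pos (effs inp \<omega> ?is s) = tape_pos s"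
      using W R(10-12) v ne by (simp_all add: fun_upd_twist fun_eq_iff)
    have safe: "safes S inp \<omega> ?is s"
      using W R(10-12) b b2[OF i] b2[OF p] k bounds(1) by simp
    have d: "dirs_upto \<omega> (Suc l) 0 ((reals s)(2 := ?f, 3 := \<omega> (l * (d + n) + k), 4 := reals s 4 + ?f))"
      using R(3) addr_ge[of n] by simp
    show "safes S inp \<omega> ?is s \<and> I_dot l i p (Suc k) (effs inp \<omega> ?is s)"
      unfolding I_dot_def I_pass2_def base_alt e using safe d R by simp
  qed simp
qed (auto simp: I_dot_def I_pass2_def)

lemma pass2_body:
  assumes l: "l < depth" and i: "i < n"
  shows "hoare' (I_pass2 l i) prep_pass2 (d * 11 + 18) (I_pass2 l (Suc i))"
proof -
  define \<sigma> where "\<sigma> = fst (st l)"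
  define C where "C = snd (st l)"
  have cons: "consistent (\<sigma>, C)"
    using consistent_st[of l] by (simp add: \<sigma>_def C_def)
  have "mid l = pass1 (keys l) n \<sigma> C"
    by (simp add: mid_def \<sigma>_def C_def)
  from pass1_cases[OF cons i this] obtain p where p: "p < n" "mid l (\<sigma> i) = addr p"
    using i by auto
  let ?pr = "proj (shift (l * (d + n)) \<omega>) p i"
  define u where "u = (if addr p = addr i then \<sigma> i else addr p + (if ?pr < 0 then 1 else 2))"
  have new: "fst (st (Suc l)) i = u"
    unfolding st_Suc u_def fst_conv pass2_def \<sigma>_def[symmetric] p(2) owner_addr ..
  have si: "slot (\<sigma> i)"
    unfolding \<sigma>_def using slot_st[OF i] .
  note sib = slot_bounds[OF si]
  have pb: "addr p + 2 < addr n" "addr i + (d + 3) \<le> addr n" "addr p + (d + 3) \<le> addr n"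
    using addr_less[OF p(1), of 2] addr_mono[OF i] addr_mono[OF p(1)] by auto
  have ub: "u \<le> S"
    using sib pb(1) bounds(3) unfolding u_def by auto
  have b: "addr n + l * d + d \<le> S"
    using dir_bound[of "Suc l"] l by simp
  let ?is1 = "[WLoad 13 10, WLoad 14 13, RSub 4 5 5, WAdd 11 16 4, WAdd 17 10 15, WAdd 18 14 15]"
  have 1: "hoare' (I_pass2 l i) (Block ?is1) 6 (I_dot l i p 0)"
  proof (rule hoare_block)
    fix s assume I: "I_pass2 l i s"
    have R: "lvl_regs l (words s)" "lvl_reals l (reals s)" "dirs_upto \<omega> (Suc l) 0 (reals s)"
      "tape_pos s = Suc l * (d + n)" "table (partial2 l i) (mid l) (words s)"
      "words s 12 = addr n + l * d + d" "words s 10 = addr i"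
      using I unfolding I_pass2_def base_alt by blast+
    note W = lvl_regsD[OF R(1)]
    have ws: "words s (addr i) = \<sigma> i" "words s (\<sigma> i) = addr p"
      using tableD[OF R(5)] i si p(2) by (auto simp: partial2_def \<sigma>_def)
    have ne: "\<sigma> i \<noteq> 13"
      using sib by auto
    have e: "words (effs inp \<omega> ?is1 s) = (words s)(13 := \<sigma> i, 14 := addr p, 11 := addr n + l * d,
        17 := addr i + 3, 18 := addr p + 3)"
      "reals (effs inp \<omega> ?is1 s) = (reals s)(4 := 0)" "tape_pos (effs inp \<omega> ?is1 s) = tape_pos s"
      using W R(7) ws ne by simp_all
    have safe: "safes S inp \<omega> ?is1 s"
      using W R(7) ws ne bounds(1,3) pb b sib by simp
    have d: "dirs_upto \<omega> (Suc l) 0 ((reals s)(4 := 0))"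
      using R(3) addr_ge[of n] by simp
    show "safes S inp \<omega> ?is1 s \<and> I_dot l i p 0 (effs inp \<omega> ?is1 s)"
      unfolding I_dot_def I_pass2_def base_alt e using safe d R by (simp add: \<sigma>_def)
  qed simp
  let ?P = "\<lambda>s. I_pass2 l i s \<and> words s 13 = \<sigma> i \<and> words s 14 = addr p"
  let ?v = "if ?pr < 0 then addr p + 1 else addr p + 2"
  have upd20: "I_pass2 l i s'"
    if "I_pass2 l i s" "words s' = (words s)(20 := w)" "reals s' = reals s" "tape_pos s' = tape_pos s" for s s' w
    using that unfolding I_pass2_def base_alt by simp
  have 2: "hoare' (I_dot l i p d) (IfC (RLe 5 4) (Block [WAdd 20 14 2, WAdd 20 20 2]) (Block [WAdd 20 14 2])) 4
     (\<lambda>s. ?P s \<and> words s 20 = ?v)"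
  proof (rule hoare_if[where ?T1.0 = 2])
    have pr: "?pr = reals s 4 \<and> reals s 5 = 0 \<and> words s 2 = 1 \<and> ?P s" if "I_dot l i p d s" for s
      using that lvl_regsD[of l "words s"]
      unfolding I_dot_def I_pass2_def base_alt lvl_reals_def rregs_def proj_def dot_def shift_def \<sigma>_def by simp
    show "hoare' (\<lambda>s. I_dot l i p d s \<and> holds (RLe 5 4) s) (Block [WAdd 20 14 2, WAdd 20 20 2]) 2
     (\<lambda>s. ?P s \<and> words s 20 = ?v)"
    proof (rule hoare_block)
      fix s assume h: "I_dot l i p d s \<and> holds (RLe 5 4) s"
      note q = pr[OF h[THEN conjunct1]]
      have "I_pass2 l i (effs inp \<omega> [WAdd 20 14 2, WAdd 20 20 2] s)"
        by (rule upd20[of s _ "addr p + 2"]; use q in simp)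
      moreover have "\<not> ?pr < 0"
        using q h[THEN conjunct2] by simp
      ultimately show "safes S inp \<omega> [WAdd 20 14 2, WAdd 20 20 2] s \<and> ?P (effs inp \<omega> [WAdd 20 14 2, WAdd 20 20 2] s)
          \<and> words (effs inp \<omega> [WAdd 20 14 2, WAdd 20 20 2] s) 20 = ?v"
        using q pb(1) bounds(1,3) by simp
    qed simp
    show "hoare' (\<lambda>s. I_dot l i p d s \<and> \<not> holds (RLe 5 4) s) (Block [WAdd 20 14 2]) 2
     (\<lambda>s. ?P s \<and> words s 20 = ?v)"
    proof (rule hoare_block)
      fix s assume h: "I_dot l i p d s \<and> \<not> holds (RLe 5 4) s"
      note q = pr[OF h[THEN conjunct1]]
      have "I_pass2 l i (effs inp \<omega> [WAdd 20 14 2] s)"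
        by (rule upd20[of s _ "addr p + 1"]; use q in simp)
      moreover have "?pr < 0"
        using q h[THEN conjunct2] by simp
      ultimately show "safes S inp \<omega> [WAdd 20 14 2] s \<and> ?P (effs inp \<omega> [WAdd 20 14 2] s)
          \<and> words (effs inp \<omega> [WAdd 20 14 2] s) 20 = ?v"
        using q pb(1) bounds(1,3) by simp
    qed simp
  qed simp
  have P: "words s 10 = addr i \<and> words s 4 = 0" if "?P s" for s
    using that lvl_regsD[of l "words s"] unfolding I_pass2_def base_alt by auto
  let ?Q = "\<lambda>s. I_pass2 l i s \<and> words s 20 = u"
  \<comment> \<open>Two comparisons test whether the point is the node of its own slot. If so, it
    keeps its slot, and the tentative child slot in word 20 is overwritten.\<close>
  have 3: "hoare' (\<lambda>s. ?P s \<and> words s 20 = ?v)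
      (IfC (WLe 14 10) (IfC (WLe 10 14) (Block [WAdd 20 13 4]) (Block [])) (Block [])) 5 ?Q"
  proof (rule hoare_if[where ?T1.0 = 3])
    show "hoare' (\<lambda>s. (?P s \<and> words s 20 = ?v) \<and> holds (WLe 14 10) s)
      (IfC (WLe 10 14) (Block [WAdd 20 13 4]) (Block [])) 3 ?Q"
    proof (rule hoare_if[where ?T1.0 = 1])
      show "hoare' (\<lambda>s. ((?P s \<and> words s 20 = ?v) \<and> holds (WLe 14 10) s) \<and> holds (WLe 10 14) s)
         (Block [WAdd 20 13 4]) 1 ?Q"
      proof (rule hoare_block)
        fix s assume h: "((?P s \<and> words s 20 = ?v) \<and> holds (WLe 14 10) s) \<and> holds (WLe 10 14) s"
        have h1: "?P s"
          using h by blast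
        note q = P[OF h1]
        have "addr p = addr i"
          using h[THEN conjunct1, THEN conjunct2] h[THEN conjunct2] h1 q by simp
        moreover have "I_pass2 l i (effs inp \<omega> [WAdd 20 13 4] s)"
          by (rule upd20[of s _ "\<sigma> i"]; use q h1 in simp)
        ultimately show "safes S inp \<omega> [WAdd 20 13 4] s \<and> ?Q (effs inp \<omega> [WAdd 20 13 4] s)"
          using h1 q bounds(1,3) sib by (simp add: u_def)
      qed simp
      show "hoare' (\<lambda>s. ((?P s \<and> words s 20 = ?v) \<and> holds (WLe 14 10) s) \<and> \<not> holds (WLe 10 14) s)
         (Block []) 1 ?Q"
      proof (rule hoare_block)
        fix s assume h: "((?P s \<and> words s 20 = ?v) \<and> holds (WLe 14 10) s) \<and> \<not> holds (WLe 10 14) s"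
        then have "addr p \<noteq> addr i"
          using P[of s] by auto
        then show "safes S inp \<omega> [] s \<and> ?Q (effs inp \<omega> [] s)"
          using h by (auto simp: u_def)
      qed simp
    qed simp
    show "hoare' (\<lambda>s. (?P s \<and> words s 20 = ?v) \<and> \<not> holds (WLe 14 10) s) (Block []) 3 ?Q"
    proof (rule hoare_block)
      fix s assume h: "(?P s \<and> words s 20 = ?v) \<and> \<not> holds (WLe 14 10) s"
      then have "addr p \<noteq> addr i"
        using P[of s] by auto
      then show "safes S inp \<omega> [] s \<and> ?Q (effs inp \<omega> [] s)"
        using h by (auto simp: u_def)
    qed simp
  qed simp
  have 4: "hoare' ?Q (Block [WStore 10 20, WAdd 10 10 5]) 2 (I_pass2 l (Suc i))"
  proof (rule hoare_block)
    let ?is = "[WStore 10 20, WAdd 10 10 5]"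
    fix s assume Q: "?Q s"
    have R: "lvl_regs l (words s)" "lvl_reals l (reals s)" "dirs_upto \<omega> (Suc l) 0 (reals s)"
      "tape_pos s = Suc l * (d + n)" "table (partial2 l i) (mid l) (words s)"
      "words s 12 = addr n + l * d + d" "words s 10 = addr i" "words s 20 = u"
      using Q unfolding I_pass2_def base_alt by blast+
    note W = lvl_regsD[OF R(1)]
    have e: "words (effs inp \<omega> ?is s) = (words s)(addr i := u, 10 := addr (Suc i))"
      "reals (effs inp \<omega> ?is s) = reals s" "tape_pos (effs inp \<omega> ?is s) = tape_pos s"
      using W R(7,8) by (simp_all add: addr_Suc)
    have safe: "safes S inp \<omega> ?is s"
      using W R(7,8) bounds(1,3) pb addr_less'[OF i] by simp
    have "partial2 l (Suc i) = (partial2 l i)(i := u)"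
      using new by (auto simp: partial2_def fun_eq_iff less_Suc_eq)
    then have t: "table (partial2 l (Suc i)) (mid l) ((words s)(addr i := u, 10 := addr (Suc i)))"
      using table_upd_rec[OF R(5), of i u] by simp
    have r: "lvl_regs l ((words s)(addr i := u, 10 := addr (Suc i)))"
      using R(1) addr_ge[of i] by simp
    show "safes S inp \<omega> ?is s \<and> I_pass2 l (Suc i) (effs inp \<omega> ?is s)"
      unfolding I_pass2_def base_alt e using safe t r R by simp
  qed simp
  show ?thesis
    unfolding prep_pass2_def
    by (rule hoare_seq[OF 1 hoare_seq[OF dot_loop[OF l i p(1)] hoare_seq[OF 2 hoare_seq[OF 3 4]]]]) auto
qed

lemma pass2_loop:
  assumes l: "l < depth"
  shows "hoare' (I_pass2 l 0) (Until (WLe 7 10) prep_pass2) (n * (d * 11 + 20) + 1) (I_pass2 l n)"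
proof (rule hoare_until[where I = "I_pass2 l" and N = n and ?T1.0 = "d * 11 + 18"])
  fix k s assume "k < n" "I_pass2 l k s"
  then show "\<not> holds (WLe 7 10) s"
    using lvl_regsD[of l "words s"] by (auto simp: I_pass2_def base_alt)
next
  fix s assume "I_pass2 l n s"
  then show "holds (WLe 7 10) s"
    using lvl_regsD[of l "words s"] by (auto simp: I_pass2_def base_alt)
qed (use pass2_body[OF l] in auto)

abbreviation "level_time \<equiv> 9 + 5 * d + 13 * n + n * (d * 11 + 20)"

lemma level_body:
  assumes l: "l < depth"
  shows "hoare' (I_level l) prep_level level_time (I_level (Suc l))"
proof -
  have b: "addr n + l * d + d \<le> S"
    using dir_bound[of "Suc l"] l by simp
  have 1: "hoare' (I_level l) (Block [WAdd 12 16 3, WAdd 11 16 4]) 2 (I_dir l 0)"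
  proof (rule hoare_block)
    fix s assume I: "I_level l s"
    then have "lvl_regs l (words s)"
      by (auto simp: I_level_def base_alt)
    from lvl_regsD[OF this] I b bounds(1)
    show "safes S inp \<omega> [WAdd 12 16 3, WAdd 11 16 4] s \<and> I_dir l 0 (effs inp \<omega> [WAdd 12 16 3, WAdd 11 16 4] s)"
      by (simp add: I_level_def I_dir_def base_alt)
  qed simp
  have 2: "hoare' (I_dir l d) (Block [WAdd 10 6 4]) 1 (I_pass1 l 0)"
  proof (rule hoare_block)
    fix s assume I: "I_dir l d s"
    then have "lvl_regs l (words s)"
      by (auto simp: I_dir_def base_alt)
    from lvl_regsD[OF this] I b bounds(1)
    show "safes S inp \<omega> [WAdd 10 6 4] s \<and> I_pass1 l 0 (effs inp \<omega> [WAdd 10 6 4] s)"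
      by (simp add: I_pass1_def I_dir_def base_alt pass1_0 dirs_Suc addr_def)
  qed simp
  have 3: "hoare' (I_pass1 l n) (Block [WAdd 10 6 4]) 1 (I_pass2 l 0)"
  proof (rule hoare_block)
    fix s assume I: "I_pass1 l n s"
    then have "lvl_regs l (words s)"
      by (auto simp: I_pass1_def base_alt)
    moreover have "partial2 l 0 = fst (st l)"
      by (simp add: partial2_def fun_eq_iff)
    moreover have "addr 0 = 40"
      by (simp add: addr_def)
    ultimately show "safes S inp \<omega> [WAdd 10 6 4] s \<and> I_pass2 l 0 (effs inp \<omega> [WAdd 10 6 4] s)"
      using lvl_regsD[of l "words s"] I b bounds(1)
      by (simp add: I_pass1_def I_pass2_def base_alt mid_def)
  qed simp
  have 4: "hoare' (I_pass2 l n) (Block [WAdd 16 12 4, WAdd 9 9 2]) 2 (I_level (Suc l))"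
  proof (rule hoare_block)
    let ?is = "[WAdd 16 12 4, WAdd 9 9 2]"
    fix s assume I: "I_pass2 l n s"
    have R: "lvl_regs l (words s)" "lvl_reals l (reals s)" "dirs_upto \<omega> (Suc l) 0 (reals s)"
      "tape_pos s = Suc l * (d + n)" "table (partial2 l n) (mid l) (words s)"
      "words s 12 = addr n + l * d + d"
      using I unfolding I_pass2_def base_alt by blast+
    note W = lvl_regsD[OF R(1)]
    have e: "words (effs inp \<omega> ?is s) = (words s)(16 := addr n + Suc l * d, 9 := Suc l)"
      "reals (effs inp \<omega> ?is s) = reals s" "tape_pos (effs inp \<omega> ?is s) = tape_pos s"
      using W R(6) by (simp_all add: ac_simps)
    have safe: "safes S inp \<omega> ?is s"
      using W R(6) b bounds(1,6) l by simp
    have "table (fst (st (Suc l))) (snd (st (Suc l))) ((words s)(16 := addr n + Suc l * d, 9 := Suc l))"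
      using R(5) by (auto simp: table_def partial2_def st_Suc slot_reg simp del: levels.simps)
    moreover have "lvl_regs (Suc l) ((words s)(16 := addr n + Suc l * d, 9 := Suc l))"
      using R(1) by (simp add: lvl_regs_def)
    ultimately show "safes S inp \<omega> ?is s \<and> I_level (Suc l) (effs inp \<omega> ?is s)"
      unfolding I_level_def base_alt e using safe R by (simp add: lvl_reals_def del: levels.simps)
  qed simp
  show ?thesis
    unfolding prep_level_def
    by (rule hoare_seq[OF 1 hoare_seq[OF dir_loop[OF l] hoare_seq[OF 2 hoare_seq[OF pass1_loop[OF l]
         hoare_seq[OF 3 hoare_seq[OF pass2_loop[OF l] 4]]]]]]) auto
qed

definition prepared :: "config \<Rightarrow> bool" where
  "prepared s \<longleftrightarrow> regs (words s) \<and> rregs (reals s) \<and> coords_upto n 0 (reals s) \<and>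
     dirs_upto \<omega> depth 0 (reals s) \<and> untouched (reals s) \<and>
     represents (words s) 39 (build depth {..<n} \<omega>)"

abbreviation "prep_time \<equiv> 22 + 4 * lg n + n * (d * 6 + 7) + depth * (level_time + 2)"

theorem prep_correct:
  "hoare' (\<lambda>s. words s = (\<lambda>_. 0)(0 := d, 1 := n) \<and> reals s = (\<lambda>_. 0) \<and> tape_pos s = 0)
     prep_code prep_time prepared"
proof -
  have 1: "hoare' (I_init (lg n)) (Block [WAdd 10 6 4, WConst 19 3, WConst 21 39]) 3 (I_copy 0)"
  proof (rule hoare_block)
    let ?is = "[WAdd 10 6 4, WConst 19 3, WConst 21 39]"
    fix s assume I: "I_init (lg n) s"
    have R: "regs (words s)" "words s 8 = depth" "\<forall>a\<ge>39. words s a = 0" "rregs (reals s)"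
      "\<forall>a\<ge>39. reals s a = 0" "tape_pos s = 0"
      using I unfolding I_init_def depth_def by auto
    let ?W = "(words s)(10 := addr 0, 19 := 3, 21 := 39)"
    have e: "words (effs inp \<omega> ?is s) = ?W"
      "reals (effs inp \<omega> ?is s) = reals s" "tape_pos (effs inp \<omega> ?is s) = tape_pos s"
      using R(1) by (simp_all add: regs_def addr_def)
    have safe: "safes S inp \<omega> ?is s"
      using R(1) bounds(1) by (simp add: regs_def)
    have "\<forall>a. slot a \<longrightarrow> ?W a = 0"
      using R(3) slot_bounds slot_reg by auto
    moreover have "untouched (reals s)"
      using R(5) slot_bounds unfolding untouched_def by auto
    moreover have "coords_upto 0 0 (reals s)"
      by (simp add: coords_upto_def)
    moreover have "regs ?W"
      using R(1) by simp
    ultimately show "safes S inp \<omega> ?is s \<and> I_copy 0 (effs inp \<omega> ?is s)"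
      unfolding I_copy_def e using safe R(2,4,6) by simp
  qed simp
  have 2: "hoare' (I_copy n) (Block [WAdd 16 7 4, WConst 9 0]) 2 (I_level 0)"
  proof (rule hoare_block)
    let ?is = "[WAdd 16 7 4, WConst 9 0]"
    fix s assume I: "I_copy n s"
    have R: "regs (words s)" "words s 8 = depth" "\<forall>j<n. words s (addr j) = 39" "\<forall>a. slot a \<longrightarrow> words s a = 0"
      "rregs (reals s)" "coords_upto n 0 (reals s)" "untouched (reals s)" "tape_pos s = 0"
      using I unfolding I_copy_def by blast+
    let ?W = "(words s)(16 := addr n, 9 := 0)"
    have e: "words (effs inp \<omega> ?is s) = ?W"
      "reals (effs inp \<omega> ?is s) = reals s" "tape_pos (effs inp \<omega> ?is s) = tape_pos s"
      using R(1) by (simp_all add: regs_def)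
    have safe: "safes S inp \<omega> ?is s"
      using R(1) bounds(1,3) by (simp add: regs_def)
    have "table (\<lambda>_. 39) (\<lambda>_. 0) ?W"
    proof -
      have "table (\<lambda>_. 39) (\<lambda>_. 0) (words s)"
        using R(3,4) by (simp add: table_def)
      then show ?thesis
        by simp
    qed
    moreover have "dirs_upto \<omega> 0 0 (reals s)"
      by (simp add: dirs_upto_def)
    moreover have "lvl_regs 0 ?W"
      using R(1,2) by (simp add: lvl_regs_def)
    ultimately show "safes S inp \<omega> ?is s \<and> I_level 0 (effs inp \<omega> ?is s)"
      unfolding I_level_def base_alt e using safe R(5-8) by (simp add: lvl_reals_def)
  qed simp
  have 3: "hoare' (I_level 0) (Until (WLe 8 9) prep_level) (depth * (level_time + 2) + 1) (I_level depth)"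
  proof (rule hoare_until[where I = I_level and N = depth])
    show "hoare' (I_level l) prep_level level_time (I_level (Suc l))" if "l < depth" for l
      using level_body[OF that] .
  next
    fix k s assume "k < depth" "I_level k s"
    then show "\<not> holds (WLe 8 9) s"
      using lvl_regsD[of k "words s"] by (auto simp: I_level_def base_alt)
  next
    fix s assume "I_level depth s"
    then show "holds (WLe 8 9) s"
      using lvl_regsD[of depth "words s"] by (auto simp: I_level_def base_alt)
  qed simp
  have fin: "prepared s" if "I_level depth s" for s
  proof -
    have R: "lvl_regs depth (words s)" "lvl_reals depth (reals s)" "dirs_upto \<omega> depth 0 (reals s)"
       "table (fst (st depth)) (snd (st depth)) (words s)"
      using that unfolding I_level_def base_alt by blast+
    have "represents (words s) 39 (build depth {..<n} \<omega>)"
    proof (rule levels_build[OF consistent_init])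
      show "levels depth \<omega> (\<lambda>_. 39, \<lambda>_. 0) = (fst (st depth), snd (st depth))"
        by simp
      show "words s a = snd (st depth) a" if "slot a" for a
        using tableD(2)[OF R(4) that] .
      show "words s (addr i) = fst (st depth) i" if "i < n" for i
        using tableD(1)[OF R(4) that] .
    qed (auto simp: active_def)
    then show ?thesis
      using R unfolding prepared_def lvl_regs_def lvl_reals_def by blast
  qed
  have A: "hoare' (\<lambda>s. words s = (\<lambda>_. 0)(0 := d, 1 := n) \<and> reals s = (\<lambda>_. 0) \<and> tape_pos s = 0) prep_init
     (13 + 4 * lg n) (I_init (lg n))"
    unfolding prep_init_def by (rule hoare_seq[OF init_block init_loop]) simp
  have B: "hoare' (I_init (lg n)) prep_copy (4 + n * (d * 6 + 7)) (I_copy n)"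
    unfolding prep_copy_def by (rule hoare_seq[OF 1 copy_loop]) simp
  have *: "hoare' (\<lambda>s. words s = (\<lambda>_. 0)(0 := d, 1 := n) \<and> reals s = (\<lambda>_. 0) \<and> tape_pos s = 0)
     prep_code prep_time (I_level depth)"
    unfolding prep_code_def by (rule hoare_seq[OF A hoare_seq[OF B hoare_seq[OF 2 3]]]) auto
  show ?thesis
    by (rule hoare_conseq[OF *]) (assumption | rule fin order_refl)+
qed

end

section \<open>Queries\<close>

text \<open>Word registers: 10: current node, 13: current slot, 16: current direction, 22: root slot,
  23: best node so far.  Real registers: 6: bound on the number of rounds, 7: rounds,
  8: one, 9: best score so far, 10: key of the current slot.\<close>

definition query_init :: "nat \<Rightarrow> nat \<Rightarrow> instr list" where
  "query_init K m = [ROfWord 8 2, RAdd 6 1 5] @ replicate m (RMul 6 6 6) @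
     [RMul 7 1 1, RMul 7 0 7, RAdd 6 6 7, WConst 20 K, ROfWord 7 20, RMul 6 6 7, RSub 7 5 5,
      RSub 9 5 5, WConst 22 39, WConst 23 40]"

definition query_dot :: cmd where
  "query_dot = Block [RSub 11 5 5, RSub 12 5 5, WAdd 11 16 4, WAdd 12 16 3, WAdd 17 10 15, WConst 18 0]
   ;; Until (WLe 12 11) (Block [RInput 2 18, RLoad 3 17, RSub 2 2 3, RMul 3 2 2, RAdd 12 12 3,
        RLoad 3 11, RMul 3 3 2, RAdd 11 11 3, WAdd 11 11 2, WAdd 17 17 2, WAdd 18 18 2])"

definition query_score :: cmd where
  "query_score = Block [RAdd 12 12 8, RDiv 12 8 12]
   ;; IfC (RLe 12 9) (Block []) (Block [RAdd 9 12 5, WAdd 23 10 4])"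

definition query_keys :: cmd where
  "query_keys = Block [RMul 15 11 11, RMul 15 15 15, RMul 15 15 15, RMul 15 15 15, RAdd 15 10 15]
   ;; IfC (RLe 5 11) (Block [RAdd 13 15 5, RAdd 14 10 5]) (Block [RAdd 13 10 5, RAdd 14 15 5])
   ;; Block [WAdd 14 10 2, WAdd 20 14 2, RLoad 17 14, RLoad 18 20, RAdd 2 8 13, RDiv 2 13 2,
        RAdd 3 8 14, RDiv 3 14 3]"

definition query_descend :: cmd where
  "query_descend = IfC (RLe 17 2) (Block [RAdd 17 2 5, RStore 14 17]) (Block [])
   ;; IfC (RLe 18 3) (Block [RAdd 18 3 5, RStore 20 18]) (Block [])
   ;; IfC (RLe 17 18) (Block [WAdd 13 14 4, RAdd 10 13 5]) (Block [WAdd 13 20 4, RAdd 10 14 5])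
   ;; Block [WAdd 16 12 4, WLoad 10 13]"

definition query_down :: cmd where
  "query_down = query_dot ;; query_score ;; query_keys ;; query_descend"

text \<open>The record that contains a slot is found by rounding the address down to a record
  boundary; its first word then gives the parent slot.\<close>

definition query_up :: cmd where
  "query_up = Block [WSub 14 13 6, WDiv 14 14 5, WMul 14 14 5, WAdd 10 14 6, WAdd 14 10 2, WAdd 20 14 2,
      RLoad 17 14, RLoad 18 20, WLoad 13 10]
   ;; IfC (RLe 17 18) (Block [RStore 13 17]) (Block [RStore 13 18])"

definition query_round :: cmd where
  "query_round = Block [WAdd 13 22 4, RSub 10 5 5, WAdd 16 7 4, WLoad 10 13]
   ;; Until (WLe 10 4) query_down
   ;; Block [RStore 13 8] ;; Until (WLe 13 22) query_up ;; Block [RAdd 7 7 8]"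

definition query_code :: "nat \<Rightarrow> nat \<Rightarrow> cmd" where
  "query_code K m = Block (query_init K m) ;; Until (RLe 6 7) query_round
   ;; Block [WSub 0 23 6, WDiv 0 0 5]"

lemma query_randomness_free: "randomness_free (query_code K m)"
  by (auto simp: query_code_def query_init_def query_round_def query_down_def query_up_def query_dot_def
      query_score_def query_keys_def query_descend_def)

locale query_run = prep_run d n x \<epsilon> \<tau> c \<omega> S + query d n x q
  for d n x \<epsilon> \<tau> c \<omega> S q +
  fixes K m :: nat
  assumes K_le: "K \<le> S"
begin

abbreviation "hq \<equiv> hoare S q \<omega>"
abbreviation "T \<equiv> build depth {..<n} \<omega>"

text \<open>The power of \<open>c\<close> is computed by \<open>m\<close> squarings, which is why
  its exponent is a power of two.\<close>

definition rounds :: real where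
  "rounds = (c ^ (2 ^ m) + \<tau> * (c * c)) * real K"

text \<open>A decreasing function of the distance with positive values, computed without a square
  root. The initial best score 0 lies below all scores and replaces an infinite distance.\<close>

definition score :: "nat \<Rightarrow> real" where
  "score p = 1 / ((\<Sum>k<d. (q k - x p k) * (q k - x p k)) + 1)"

lemma score_pos: "0 < score p"
proof -
  have "0 \<le> (\<Sum>k<d. (q k - x p k) * (q k - x p k))"
    by (intro sum_nonneg) simp
  then show ?thesis
    by (simp add: score_def)
qed

lemma T_props: "wf_tree T" "fresh 39 T" "height T \<le> depth" "nodes T \<subseteq> {..<n}"
  using wf_build[of "{..<n}" depth \<omega>] height_build[of depth "{..<n}" \<omega>] nodes_build[of "{..<n}" depth \<omega>]
    addr_ge by (auto simp: fresh_def)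

lemma slots_T: "u \<in> slots T 39 \<Longrightarrow> slot u"
  using slots_subset[of T 39] T_props(4) by (auto simp: slot_def)

lemma good_path_agree:
  "(\<And>u. slot u \<Longrightarrow> r u = r' u) \<Longrightarrow> good_path r D \<pi> T 39 K0 \<omega>0 \<longleftrightarrow> good_path r' D \<pi> T 39 K0 \<omega>0"
  using slots_T by (intro good_path_cong) auto

lemma good_path_reg [simp]: "a < 39 \<Longrightarrow> good_path (r(a := v)) D \<pi> T 39 K0 \<omega>0 \<longleftrightarrow> good_path r D \<pi> T 39 K0 \<omega>0"
  using slot_reg by (intro good_path_agree) auto

lemma represents_reg [simp]: "a < 39 \<Longrightarrow> 39 \<le> s \<Longrightarrow> represents (W(a := v)) s T' \<longleftrightarrow> represents W s T'"
proof (induction T' arbitrary: s)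
  case (Node l p r)
  have "39 \<le> addr p + 1" "39 \<le> addr p + 2"
    using addr_ge[of p] by auto
  then show ?case
    using Node by auto
qed auto

definition q_regs :: "(nat \<Rightarrow> nat) \<Rightarrow> bool" where
  "q_regs W \<longleftrightarrow> regs W \<and> W 22 = 39 \<and> represents W 39 T"

definition q_reals :: "(nat \<Rightarrow> real) \<Rightarrow> bool" where
  "q_reals r \<longleftrightarrow> r 5 = 0 \<and> r 8 = 1 \<and> r 6 = rounds \<and> coords_upto n 0 r \<and> dirs_upto \<omega> depth 0 r"

lemma q_regs_upd [simp]: "9 \<le> a \<Longrightarrow> a < 39 \<Longrightarrow> a \<noteq> 15 \<Longrightarrow> a \<noteq> 22 \<Longrightarrow> q_regs (W(a := v)) = q_regs W"
  by (simp add: q_regs_def)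

lemma q_reals_upd [simp]: "2 \<le> a \<Longrightarrow> a < 39 \<Longrightarrow> a \<notin> {5, 6, 8} \<Longrightarrow> q_reals (r(a := v)) = q_reals r"
  using addr_ge[of n] by (simp add: q_reals_def)

lemma q_reals_slot: "slot a \<Longrightarrow> q_reals (r(a := v)) = q_reals r"
  using slot_bounds[of a] by (auto simp: q_reals_def)

lemma q_regsD: "q_regs W \<Longrightarrow> W 1 = n \<and> W 2 = 1 \<and> W 3 = d \<and> W 4 = 0 \<and> W 5 = d + 3 \<and> W 6 = 40
    \<and> W 7 = addr n \<and> W 15 = 3 \<and> W 22 = 39"
  by (auto simp: q_regs_def regs_def)

lemma q_realsD: "q_reals r \<Longrightarrow> r 5 = 0 \<and> r 8 = 1 \<and> r 6 = rounds"
  by (auto simp: q_reals_def)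

text \<open>The case \<open>b = 0\<close> is the initial state: word 23 then refers to point 0
  although no pivot has been seen.\<close>

definition best_inv :: "nat set \<Rightarrow> real \<Rightarrow> nat \<Rightarrow> bool" where
  "best_inv V b w \<longleftrightarrow> (\<forall>p\<in>V. score p \<le> b) \<and> (\<exists>p<n. w = addr p \<and> (b = score p \<or> b = 0))"

definition at_path :: "nat \<Rightarrow> nat set \<Rightarrow> bool list \<Rightarrow> nat set \<Rightarrow> config \<Rightarrow> bool" where
  "at_path j D \<pi> V s \<longleftrightarrow> q_regs (words s) \<and> q_reals (reals s) \<and> reals s 7 = real j \<and>
     best_inv V (reals s 9) (words s 23) \<and> good_path (reals s) D \<pi> T 39 0 \<omega>"

section \<open>One step down the tree\<close>

context
  fixes j :: nat and D :: "nat set" and \<pi> :: "bool list" and l p r s' K' \<omega>' and V :: "nat set"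
  assumes path: "is_path \<pi> T" and go: "go \<pi> (T, 39, 0, \<omega>) = (Node l p r, s', K', \<omega>')"
begin

lemma len: "length \<pi> < depth" "\<omega>' = shift (length \<pi> * (d + n)) \<omega>" "p < n" "0 \<le> K'"
  using length_path[OF path go] T_props(3,4) go_slots[OF path go] by auto

lemma dir_end: "addr n + length \<pi> * d + d \<le> S"
  using dir_bound[of "Suc (length \<pi>)"] len by simp

lemma rec_end: "addr p + 3 + d \<le> addr n"
  using addr_mono[OF len(3)] by simp

definition at_node :: "config \<Rightarrow> bool" where
  "at_node s \<longleftrightarrow> at_path j D \<pi> V s \<and> words s 10 = addr p \<and> words s 16 = addr n + length \<pi> * d \<and>
     reals s 10 = K'"

definition in_dot :: "nat \<Rightarrow> config \<Rightarrow> bool" where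
  "in_dot k s \<longleftrightarrow> at_node s \<and> words s 11 = addr n + length \<pi> * d + k \<and> words s 12 = addr n + length \<pi> * d + d \<and>
     words s 17 = addr p + 3 + k \<and> words s 18 = k \<and>
     reals s 11 = (\<Sum>k'<k. \<omega>' k' * (q k' - x p k')) \<and>
     reals s 12 = (\<Sum>k'<k. (q k' - x p k') * (q k' - x p k'))"

lemma dot_correct: "hq at_node query_dot (d * 13 + 7) (in_dot d)"
proof -
  let ?is1 = "[RSub 11 5 5, RSub 12 5 5, WAdd 11 16 4, WAdd 12 16 3, WAdd 17 10 15, WConst 18 0]"
  let ?is2 = "[RInput 2 18, RLoad 3 17, RSub 2 2 3, RMul 3 2 2, RAdd 12 12 3,
        RLoad 3 11, RMul 3 3 2, RAdd 11 11 3, WAdd 11 11 2, WAdd 17 17 2, WAdd 18 18 2]"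
  have 1: "hq at_node (Block ?is1) 6 (in_dot 0)"
  proof (rule hoare_block)
    fix s assume a: "at_node s"
    note b = a[unfolded at_node_def at_path_def]
    have W: "q_regs (words s)" and r: "q_reals (reals s)"
      using b by blast+
    have safe: "safes S q \<omega> ?is1 s"
      using b q_regsD[OF W] dir_end rec_end bounds(1,3) d_pos by simp
    have "in_dot 0 (effs q \<omega> ?is1 s)"
      unfolding in_dot_def at_node_def at_path_def using b q_regsD[OF W] q_realsD[OF r] by simp
    then show "safes S q \<omega> ?is1 s \<and> in_dot 0 (effs q \<omega> ?is1 s)"
      using safe by blast
  qed simp
  have 2: "hq (in_dot 0) (Until (WLe 12 11) (Block ?is2)) (d * 13 + 1) (in_dot d)"
  proof (rule hoare_until[where I = in_dot and N = d and ?T1.0 = 11])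
    fix k assume k: "k < d"
    show "hq (in_dot k) (Block ?is2) 11 (in_dot (Suc k))"
    proof (rule hoare_block)
      fix s assume a: "in_dot k s"
      note b = a[unfolded in_dot_def at_node_def at_path_def]
      have W: "q_regs (words s)" and r: "q_reals (reals s)"
        using b by blast+
      have v: "reals s (addr p + 3 + k) = x p k" "reals s (addr n + length \<pi> * d + k) = \<omega>' k"
        using r k len unfolding q_reals_def coords_upto_def dirs_upto_def by (auto simp: shift_def)
      have ne: "addr p + 3 + k \<noteq> 2" "addr n + length \<pi> * d + k \<noteq> 2" "addr n + length \<pi> * d + k \<noteq> 3"
        "addr n + length \<pi> * d + k \<noteq> 12"
        using addr_ge[of p] addr_ge[of n] by linarith+
      have safe: "safes S q \<omega> ?is2 s"
        using b q_regsD[OF W] dir_end rec_end bounds(1,3) k by simp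
      let ?q = "q k - x p k"
      have e: "words (effs q \<omega> ?is2 s) = (words s)(11 := addr n + length \<pi> * d + Suc k,
           17 := addr p + 3 + Suc k, 18 := Suc k)"
        "reals (effs q \<omega> ?is2 s) = (reals s)(2 := ?q, 3 := \<omega>' k * ?q, 12 := reals s 12 + ?q * ?q,
           11 := reals s 11 + \<omega>' k * ?q)"
        using b q_regsD[OF W] v ne by (simp_all add: fun_eq_iff)
      have "in_dot (Suc k) (effs q \<omega> ?is2 s)"
        unfolding in_dot_def at_node_def at_path_def e using b by simp
      then show "safes S q \<omega> ?is2 s \<and> in_dot (Suc k) (effs q \<omega> ?is2 s)"
        using safe by blast
    qed simp
  qed (auto simp: in_dot_def)
  show ?thesis
    unfolding query_dot_def by (rule hoare_seq[OF 1 2]) simp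
qed

definition at_node' :: "config \<Rightarrow> bool" where
  "at_node' s \<longleftrightarrow> at_path j D \<pi> (insert p V) s \<and> words s 10 = addr p \<and>
     words s 12 = addr n + length \<pi> * d + d \<and> reals s 10 = K'"

lemma score_correct:
  "hq (in_dot d) query_score 6 (\<lambda>s. at_node' s \<and> reals s 11 = gap \<omega>' p)"
proof -
  let ?M = "\<lambda>s. at_node s \<and> words s 12 = addr n + length \<pi> * d + d \<and> reals s 11 = gap \<omega>' p \<and> reals s 12 = score p"
  let ?Q = "\<lambda>s. at_node' s \<and> reals s 11 = gap \<omega>' p"
  have 1: "hq (in_dot d) (Block [RAdd 12 12 8, RDiv 12 8 12]) 2 ?M"
  proof (rule hoare_block)
    fix s assume a: "in_dot d s"
    note b = a[unfolded in_dot_def at_node_def at_path_def]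
    have r: "q_reals (reals s)"
      using b by blast
    show "safes S q \<omega> [RAdd 12 12 8, RDiv 12 8 12] s \<and> ?M (effs q \<omega> [RAdd 12 12 8, RDiv 12 8 12] s)"
      unfolding at_node_def at_path_def using b q_realsD[OF r] bounds(1)
      by (simp add: gap_def dot_def score_def)
  qed simp
  have 2: "hq ?M (IfC (RLe 12 9) (Block []) (Block [RAdd 9 12 5, WAdd 23 10 4])) 4 ?Q"
  proof (rule hoare_if[where ?T1.0 = 2])
    show "hq (\<lambda>s. ?M s \<and> holds (RLe 12 9) s) (Block []) 2 ?Q"
    proof (rule hoare_block)
      fix s assume "?M s \<and> holds (RLe 12 9) s"
      then show "safes S q \<omega> [] s \<and> ?Q (effs q \<omega> [] s)"
        unfolding at_node'_def at_node_def at_path_def best_inv_def by auto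
    qed simp
    show "hq (\<lambda>s. ?M s \<and> \<not> holds (RLe 12 9) s) (Block [RAdd 9 12 5, WAdd 23 10 4]) 2 ?Q"
    proof (rule hoare_block)
      fix s assume a: "?M s \<and> \<not> holds (RLe 12 9) s"
      note b = a[unfolded at_node_def at_path_def]
      have W: "q_regs (words s)" and r: "q_reals (reals s)"
        using b by blast+
      have "best_inv (insert p V) (score p) (addr p)"
      proof -
        have "reals s 9 < score p"
          using b by simp
        moreover have "\<forall>p\<in>V. score p \<le> reals s 9"
          using b unfolding best_inv_def by blast
        ultimately show ?thesis
          using len(3) unfolding best_inv_def by force
      qed
      moreover have "addr p \<le> S"
        using rec_end bounds(3) by simp
      ultimately show "safes S q \<omega> [RAdd 9 12 5, WAdd 23 10 4] s \<and> ?Q (effs q \<omega> [RAdd 9 12 5, WAdd 23 10 4] s)"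
        unfolding at_node'_def at_path_def using b q_regsD[OF W] q_realsD[OF r] bounds(1) by simp
    qed simp
  qed simp
  show ?thesis
    unfolding query_score_def by (rule hoare_seq[OF 1 2]) simp
qed

definition with_keys :: "config \<Rightarrow> bool" where
  "with_keys s \<longleftrightarrow> q_regs (words s) \<and> q_reals (reals s) \<and> reals s 7 = real j \<and>
     best_inv (insert p V) (reals s 9) (words s 23) \<and>
     words s 12 = addr n + length \<pi> * d + d \<and> words s 14 = addr p + 1 \<and> words s 20 = addr p + 2 \<and>
     reals s 13 = lkey \<omega>' p K' \<and> reals s 14 = rkey \<omega>' p K' \<and>
     reals s 2 = code (lkey \<omega>' p K') \<and> reals s 3 = code (rkey \<omega>' p K') \<and>
     reals s 17 = reals s (addr p + 1) \<and> reals s 18 = reals s (addr p + 2)"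

lemma keys_correct:
  "hq (\<lambda>s. at_node' s \<and> reals s 11 = gap \<omega>' p) query_keys 17
     (\<lambda>s. with_keys s \<and> good_path (reals s) D \<pi> T 39 0 \<omega>)"
proof -
  let ?g = "gap \<omega>' p"
  let ?is1 = "[RMul 15 11 11, RMul 15 15 15, RMul 15 15 15, RMul 15 15 15, RAdd 15 10 15]"
  let ?is2 = "[WAdd 14 10 2, WAdd 20 14 2, RLoad 17 14, RLoad 18 20, RAdd 2 8 13, RDiv 2 13 2,
        RAdd 3 8 14, RDiv 3 14 3]"
  have p16: "t ^ 16 = (t * t) * (t * t) * ((t * t) * (t * t)) * ((t * t) * (t * t) * ((t * t) * (t * t)))" for t :: real
    by (simp add: numeral_eq_Suc mult_ac)
  have 1: "hq (\<lambda>s. at_node' s \<and> reals s 11 = ?g) (Block ?is1) 5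
      (\<lambda>s. at_node' s \<and> reals s 11 = ?g \<and> reals s 15 = K' + ?g ^ 16)"
    by (rule hoare_block) (use bounds(1) in \<open>simp_all add: at_node'_def at_path_def p16\<close>)
  let ?M = "\<lambda>s. at_node' s \<and> reals s 13 = lkey \<omega>' p K' \<and> reals s 14 = rkey \<omega>' p K'"
  have 2: "hq (\<lambda>s. at_node' s \<and> reals s 11 = ?g \<and> reals s 15 = K' + ?g ^ 16)
      (IfC (RLe 5 11) (Block [RAdd 13 15 5, RAdd 14 10 5]) (Block [RAdd 13 10 5, RAdd 14 15 5])) 4 ?M"
  proof (rule hoare_if[where ?T1.0 = 2])
    show "hq (\<lambda>s. (at_node' s \<and> reals s 11 = ?g \<and> reals s 15 = K' + ?g ^ 16) \<and> holds (RLe 5 11) s)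
       (Block [RAdd 13 15 5, RAdd 14 10 5]) 2 ?M"
    proof (rule hoare_block)
      fix s assume a: "(at_node' s \<and> reals s 11 = ?g \<and> reals s 15 = K' + ?g ^ 16) \<and> holds (RLe 5 11) s"
      note b = a[unfolded at_node'_def at_path_def]
      have r: "q_reals (reals s)"
        using b by blast
      show "safes S q \<omega> [RAdd 13 15 5, RAdd 14 10 5] s \<and> ?M (effs q \<omega> [RAdd 13 15 5, RAdd 14 10 5] s)"
        unfolding at_node'_def at_path_def using b q_realsD[OF r] bounds(1) by (simp add: lkey_def rkey_def)
    qed simp
    show "hq (\<lambda>s. (at_node' s \<and> reals s 11 = ?g \<and> reals s 15 = K' + ?g ^ 16) \<and> \<not> holds (RLe 5 11) s)
       (Block [RAdd 13 10 5, RAdd 14 15 5]) 2 ?M"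
    proof (rule hoare_block)
      fix s assume a: "(at_node' s \<and> reals s 11 = ?g \<and> reals s 15 = K' + ?g ^ 16) \<and> \<not> holds (RLe 5 11) s"
      note b = a[unfolded at_node'_def at_path_def]
      have r: "q_reals (reals s)"
        using b by blast
      show "safes S q \<omega> [RAdd 13 10 5, RAdd 14 15 5] s \<and> ?M (effs q \<omega> [RAdd 13 10 5, RAdd 14 15 5] s)"
        unfolding at_node'_def at_path_def using b q_realsD[OF r] bounds(1) by (simp add: lkey_def rkey_def)
    qed simp
  qed simp
  have 3: "hq ?M (Block ?is2) 8 (\<lambda>s. with_keys s \<and> good_path (reals s) D \<pi> T 39 0 \<omega>)"
  proof (rule hoare_block)
    fix s assume a: "?M s"
    note b = a[unfolded at_node'_def at_path_def]
    have W: "q_regs (words s)" and r: "q_reals (reals s)"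
      using b by blast+
    have ne: "addr p + 1 \<noteq> 17" "addr p + 2 \<noteq> 17" "addr p + 1 \<noteq> 18" "addr p + 2 \<noteq> 18"
       "addr p + 1 \<noteq> 2" "addr p + 2 \<noteq> 2" "addr p + 1 \<noteq> 3" "addr p + 2 \<noteq> 3"
      using addr_ge[of p] by linarith+
    have safe: "safes S q \<omega> ?is2 s"
      using b q_regsD[OF W] rec_end bounds(1,3) by simp
    let ?a = "reals s (addr p + 1)" and ?b = "reals s (addr p + 2)"
    have e: "words (effs q \<omega> ?is2 s) = (words s)(14 := addr p + 1, 20 := addr p + 2)"
      "reals (effs q \<omega> ?is2 s) = (reals s)(17 := ?a, 18 := ?b, 2 := code (lkey \<omega>' p K'), 3 := code (rkey \<omega>' p K'))"
      using b q_regsD[OF W] q_realsD[OF r] ne by (simp_all add: code_def fun_eq_iff)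
    have "with_keys (effs q \<omega> ?is2 s) \<and> good_path (reals (effs q \<omega> ?is2 s)) D \<pi> T 39 0 \<omega>"
      unfolding with_keys_def e using b ne by simp
    then show "safes S q \<omega> ?is2 s \<and> with_keys (effs q \<omega> ?is2 s) \<and> good_path (reals (effs q \<omega> ?is2 s)) D \<pi> T 39 0 \<omega>"
      using safe by blast
  qed simp
  show ?thesis
    unfolding query_keys_def by (rule hoare_seq[OF 1 hoare_seq[OF 2 3]]) auto
qed

definition at_child :: "config \<Rightarrow> bool" where
  "at_child s \<longleftrightarrow> (\<exists>b T1 s1 K1 \<omega>1. go (\<pi> @ [b]) (T, 39, 0, \<omega>) = (T1, s1, K1, \<omega>1) \<and> is_path (\<pi> @ [b]) T \<and>
     height T1 < height (Node l p r) \<and>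
     at_path j D (\<pi> @ [b]) (insert p V) s \<and> best T1 s1 K1 \<omega>1 D = best (Node l p r) s' K' \<omega>' D \<and>
     words s 13 = s1 \<and> words s 10 = words s s1 \<and> words s 16 = addr n + length (\<pi> @ [b]) * d \<and> reals s 10 = K1)"

lemma descend_correct:
  "hq (\<lambda>s. with_keys s \<and> good_path (reals s) D \<pi> T 39 0 \<omega>) query_descend 14 at_child"
proof -
  let ?a = "addr p + 1" and ?b = "addr p + 2"
  let ?fl = "code (lkey \<omega>' p K')" and ?fr = "code (rkey \<omega>' p K')"
  have sl: "slot ?a" "slot ?b"
    using len(3) by (auto simp: slot_def)
  note sb = slot_bounds[OF sl(1)] slot_bounds[OF sl(2)]
  \<comment> \<open>An entry is written only if the coded key is at least as large. Register 17
    changes as well, so the memory agrees with the abstract update by a maximum on slots, not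
    everywhere.\<close>
  define G1 where "G1 s \<longleftrightarrow> (\<exists>R. good_path R D \<pi> T 39 0 \<omega> \<and>
      (\<forall>u. slot u \<longrightarrow> reals s u = (R(?a := max (R ?a) ?fl)) u))" for s :: config
  define G2 where "G2 s \<longleftrightarrow> (\<exists>R. good_path R D \<pi> T 39 0 \<omega> \<and>
      (\<forall>u. slot u \<longrightarrow> reals s u = (R(?a := max (R ?a) ?fl, ?b := max (R ?b) ?fr)) u))" for s :: config
  have 1: "hq (\<lambda>s. with_keys s \<and> good_path (reals s) D \<pi> T 39 0 \<omega>)
     (IfC (RLe 17 2) (Block [RAdd 17 2 5, RStore 14 17]) (Block [])) 4 (\<lambda>s. with_keys s \<and> G1 s)"
  proof (rule hoare_if[where ?T1.0 = 2])
    let ?is = "[RAdd 17 2 5, RStore 14 17]"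
    show "hq (\<lambda>s. (with_keys s \<and> good_path (reals s) D \<pi> T 39 0 \<omega>) \<and> holds (RLe 17 2) s)
       (Block ?is) 2 (\<lambda>s. with_keys s \<and> G1 s)"
    proof (rule hoare_block)
      fix s assume h: "(with_keys s \<and> good_path (reals s) D \<pi> T 39 0 \<omega>) \<and> holds (RLe 17 2) s"
      note b = h[unfolded with_keys_def]
      have r: "q_reals (reals s)"
        using b by blast
      have e: "words (effs q \<omega> ?is s) = words s" "reals (effs q \<omega> ?is s) = (reals s)(17 := ?fl, ?a := ?fl)"
        using b q_realsD[OF r] by simp_all
      have "reals s ?a \<le> ?fl"
        using b by simp
      then have "\<forall>u. slot u \<longrightarrow> ((reals s)(17 := ?fl, ?a := ?fl)) u = ((reals s)(?a := max (reals s ?a) ?fl)) u"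
        using slot_reg by auto
      then have "G1 (effs q \<omega> ?is s)"
        unfolding G1_def e using h by blast
      moreover have "with_keys (effs q \<omega> ?is s)"
        unfolding with_keys_def e q_reals_slot[OF sl(1)] using b sb by simp
      ultimately show "safes S q \<omega> ?is s \<and> with_keys (effs q \<omega> ?is s) \<and> G1 (effs q \<omega> ?is s)"
        using b sb bounds(1,3) by simp
    qed simp
    show "hq (\<lambda>s. (with_keys s \<and> good_path (reals s) D \<pi> T 39 0 \<omega>) \<and> \<not> holds (RLe 17 2) s)
       (Block []) 2 (\<lambda>s. with_keys s \<and> G1 s)"
    proof (rule hoare_block)
      fix s assume h: "(with_keys s \<and> good_path (reals s) D \<pi> T 39 0 \<omega>) \<and> \<not> holds (RLe 17 2) s"
      then have "?fl < reals s ?a"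
        by (simp add: with_keys_def)
      then have "\<forall>u. slot u \<longrightarrow> reals s u = ((reals s)(?a := max (reals s ?a) ?fl)) u"
        by simp
      then have "G1 s"
        unfolding G1_def using h by blast
      then show "safes S q \<omega> [] s \<and> with_keys (effs q \<omega> [] s) \<and> G1 (effs q \<omega> [] s)"
        using h by simp
    qed simp
  qed simp
  have 2: "hq (\<lambda>s. with_keys s \<and> G1 s)
     (IfC (RLe 18 3) (Block [RAdd 18 3 5, RStore 20 18]) (Block [])) 4 (\<lambda>s. with_keys s \<and> G2 s)"
  proof (rule hoare_if[where ?T1.0 = 2])
    let ?is = "[RAdd 18 3 5, RStore 20 18]"
    show "hq (\<lambda>s. (with_keys s \<and> G1 s) \<and> holds (RLe 18 3) s) (Block ?is) 2 (\<lambda>s. with_keys s \<and> G2 s)"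
    proof (rule hoare_block)
      fix s assume h: "(with_keys s \<and> G1 s) \<and> holds (RLe 18 3) s"
      note b = h[unfolded with_keys_def]
      have r: "q_reals (reals s)"
        using b by blast
      obtain R where R: "good_path R D \<pi> T 39 0 \<omega>" "\<And>u. slot u \<Longrightarrow> reals s u = (R(?a := max (R ?a) ?fl)) u"
        using h unfolding G1_def by blast
      have e: "words (effs q \<omega> ?is s) = words s" "reals (effs q \<omega> ?is s) = (reals s)(18 := ?fr, ?b := ?fr)"
        using b q_realsD[OF r] by simp_all
      have "R ?b \<le> ?fr"
        using b R(2)[OF sl(2)] by simp
      then have "\<forall>u. slot u \<longrightarrow> ((reals s)(18 := ?fr, ?b := ?fr)) u
          = (R(?a := max (R ?a) ?fl, ?b := max (R ?b) ?fr)) u"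
        using slot_reg R(2) by auto
      then have "G2 (effs q \<omega> ?is s)"
        unfolding G2_def e using R(1) by blast
      moreover have "with_keys (effs q \<omega> ?is s)"
        unfolding with_keys_def e q_reals_slot[OF sl(2)] using b sb by simp
      ultimately show "safes S q \<omega> ?is s \<and> with_keys (effs q \<omega> ?is s) \<and> G2 (effs q \<omega> ?is s)"
        using b sb bounds(1,3) by simp
    qed simp
    show "hq (\<lambda>s. (with_keys s \<and> G1 s) \<and> \<not> holds (RLe 18 3) s) (Block []) 2 (\<lambda>s. with_keys s \<and> G2 s)"
    proof (rule hoare_block)
      fix s assume h: "(with_keys s \<and> G1 s) \<and> \<not> holds (RLe 18 3) s"
      obtain R where R: "good_path R D \<pi> T 39 0 \<omega>" "\<And>u. slot u \<Longrightarrow> reals s u = (R(?a := max (R ?a) ?fl)) u"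
        using h unfolding G1_def by blast
      have "?fr < R ?b"
        using h R(2)[OF sl(2)] by (simp add: with_keys_def)
      then have "\<forall>u. slot u \<longrightarrow> reals s u = (R(?a := max (R ?a) ?fl, ?b := max (R ?b) ?fr)) u"
        using R(2) by auto
      then show "safes S q \<omega> [] s \<and> with_keys (effs q \<omega> [] s) \<and> G2 (effs q \<omega> [] s)"
        unfolding G2_def using h R(1) by auto
    qed simp
  qed simp
  have G2D: "good_path (reals s) D (\<pi> @ [b]) T 39 0 \<omega> \<and>
      reals s ?a = best l ?a (lkey \<omega>' p K') (next_level \<omega>') D \<and>
      reals s ?b = best r ?b (rkey \<omega>' p K') (next_level \<omega>') D \<and>
      best (Node l p r) s' K' \<omega>' D = min (reals s ?a) (reals s ?b)" if g2: "G2 s" for s b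
  proof -
    obtain R where R1: "good_path R D \<pi> T 39 0 \<omega>"
      "\<forall>u. slot u \<longrightarrow> reals s u = (R(?a := max (R ?a) ?fl, ?b := max (R ?b) ?fr)) u"
      using g2 unfolding G2_def by blast
    note R = R1(1) R1(2)[rule_format]
    let ?R' = "R(?a := max (R ?a) ?fl, ?b := max (R ?b) ?fr)"
    have "good_path (reals s) D (\<pi> @ [b]) T 39 0 \<omega> \<longleftrightarrow> good_path ?R' D (\<pi> @ [b]) T 39 0 \<omega>"
      by (rule good_path_agree) (rule R(2))
    then show ?thesis
      unfolding R(2)[OF sl(1)] R(2)[OF sl(2)]
      using good_path_down[OF T_props(1,2) order_refl path R(1) go refl, of b] by blast
  qed
  note sn = go_snoc[OF go]
  let ?N = "\<lambda>s b. q_regs (words s) \<and> q_reals (reals s) \<and> reals s 7 = real j \<and>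
     best_inv (insert p V) (reals s 9) (words s 23) \<and> words s 12 = addr n + length \<pi> * d + d \<and>
     good_path (reals s) D (\<pi> @ [b]) T 39 0 \<omega> \<and>
     (if b then words s 13 = ?a \<and> reals s 10 = lkey \<omega>' p K' \<and>
         best l ?a (lkey \<omega>' p K') (next_level \<omega>') D = best (Node l p r) s' K' \<omega>' D
      else words s 13 = ?b \<and> reals s 10 = rkey \<omega>' p K' \<and>
         best r ?b (rkey \<omega>' p K') (next_level \<omega>') D = best (Node l p r) s' K' \<omega>' D)"
  have 3: "hq (\<lambda>s. with_keys s \<and> G2 s)
     (IfC (RLe 17 18) (Block [WAdd 13 14 4, RAdd 10 13 5]) (Block [WAdd 13 20 4, RAdd 10 14 5])) 4 (\<lambda>s. \<exists>b. ?N s b)"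
  proof (rule hoare_if[where ?T1.0 = 2])
    show "hq (\<lambda>s. (with_keys s \<and> G2 s) \<and> holds (RLe 17 18) s) (Block [WAdd 13 14 4, RAdd 10 13 5]) 2 (\<lambda>s. \<exists>b. ?N s b)"
    proof (rule hoare_block)
      let ?is = "[WAdd 13 14 4, RAdd 10 13 5]"
      fix s assume h: "(with_keys s \<and> G2 s) \<and> holds (RLe 17 18) s"
      note b = h[unfolded with_keys_def]
      have W: "q_regs (words s)" and r: "q_reals (reals s)"
        using b by blast+
      have e: "words (effs q \<omega> ?is s) = (words s)(13 := ?a)" "reals (effs q \<omega> ?is s) = (reals s)(10 := lkey \<omega>' p K')"
        using b q_realsD[OF r] q_regsD[OF W] by simp_all
      have g: "G2 s"
        using h by blast
      have "reals s ?a \<le> reals s ?b"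
        using b by simp
      then have "best l ?a (lkey \<omega>' p K') (next_level \<omega>') D = best (Node l p r) s' K' \<omega>' D"
        using G2D[OF g, of True] by (metis min.absorb1)
      then have "?N (effs q \<omega> ?is s) True"
        unfolding e using b G2D[OF g, of True, THEN conjunct1] by simp
      then show "safes S q \<omega> ?is s \<and> (\<exists>b. ?N (effs q \<omega> ?is s) b)"
        using b sb bounds(1,3) q_regsD[OF W] by (intro conjI exI[of _ True]) auto
    qed simp
    show "hq (\<lambda>s. (with_keys s \<and> G2 s) \<and> \<not> holds (RLe 17 18) s) (Block [WAdd 13 20 4, RAdd 10 14 5]) 2 (\<lambda>s. \<exists>b. ?N s b)"
    proof (rule hoare_block)
      let ?is = "[WAdd 13 20 4, RAdd 10 14 5]"
      fix s assume h: "(with_keys s \<and> G2 s) \<and> \<not> holds (RLe 17 18) s"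
      note b = h[unfolded with_keys_def]
      have W: "q_regs (words s)" and r: "q_reals (reals s)"
        using b by blast+
      have e: "words (effs q \<omega> ?is s) = (words s)(13 := ?b)" "reals (effs q \<omega> ?is s) = (reals s)(10 := rkey \<omega>' p K')"
        using b q_realsD[OF r] q_regsD[OF W] by simp_all
      have g: "G2 s"
        using h by blast
      have "reals s ?b \<le> reals s ?a"
        using b by simp
      then have "best r ?b (rkey \<omega>' p K') (next_level \<omega>') D = best (Node l p r) s' K' \<omega>' D"
        using G2D[OF g, of False] by (metis min.absorb2)
      then have "?N (effs q \<omega> ?is s) False"
        unfolding e using b G2D[OF g, of False, THEN conjunct1] by simp
      then show "safes S q \<omega> ?is s \<and> (\<exists>b. ?N (effs q \<omega> ?is s) b)"
        using b sb bounds(1,3) q_regsD[OF W] by (intro conjI exI[of _ False]) auto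
    qed simp
  qed simp
  have 4: "hq (\<lambda>s. \<exists>b. ?N s b) (Block [WAdd 16 12 4, WLoad 10 13]) 2 at_child"
  proof (rule hoare_ex, rule hoare_block)
    fix b and s :: config assume b: "?N s b"
    let ?is = "[WAdd 16 12 4, WLoad 10 13]"
    let ?s1 = "if b then ?a else ?b"
    have W: "q_regs (words s)"
      using b by blast
    have s1: "words s 13 = ?s1" "39 \<le> ?s1" "?s1 < S" "?s1 \<noteq> 16" "?s1 \<noteq> 10"
      using b sb bounds(3) by (auto split: if_splits)
    have "words s ?s1 \<le> S" if "fits S s"
      using that by (simp add: fits_def)
    moreover assume "fits S s"
    ultimately have safe: "safes S q \<omega> ?is s"
      using b q_regsD[OF W] s1 dir_end bounds(1) by simp
    have e: "words (effs q \<omega> ?is s) = (words s)(16 := addr n + length \<pi> * d + d, 10 := words s ?s1)"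
      "reals (effs q \<omega> ?is s) = reals s"
      using b q_regsD[OF W] s1 by simp_all
    let ?T1 = "if b then l else r" and ?K1 = "if b then lkey \<omega>' p K' else rkey \<omega>' p K'"
    have "at_child (effs q \<omega> ?is s)"
      unfolding at_child_def at_path_def e
    proof (intro exI conjI)
      show "go (\<pi> @ [b]) (T, 39, 0, \<omega>) = (?T1, ?s1, ?K1, next_level \<omega>')"
        using sn[of b] by simp
      show "is_path (\<pi> @ [b]) T"
        using is_path_snoc[OF path go] .
      show "best ?T1 ?s1 ?K1 (next_level \<omega>') D = best (Node l p r) s' K' \<omega>' D"
        using b by (cases b) presburger+
      show "height ?T1 < height (Node l p r)"
        by (cases b) auto
    qed (use b s1 in \<open>simp_all del: best.simps\<close>)
    then show "safes S q \<omega> ?is s \<and> at_child (effs q \<omega> ?is s)"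
      using safe by blast
  qed simp
  show ?thesis
    unfolding query_descend_def by (rule hoare_seq[OF 1 hoare_seq[OF 2 hoare_seq[OF 3 4]]]) auto
qed

lemma down_correct: "hq at_node query_down (d * 13 + 44) at_child"
  unfolding query_down_def
  by (rule hoare_seq[OF dot_correct hoare_seq[OF score_correct hoare_seq[OF keys_correct descend_correct]]]) auto

end

section \<open>Complete rounds and the final answer\<close>

definition I_round :: "nat \<Rightarrow> config \<Rightarrow> bool" where
  "I_round j s \<longleftrightarrow> reals s 7 = real j \<and> (\<exists>D. at_path j D [] (visited D T 39) s \<and> explored_least T 39 \<omega> j D)"

definition I_down :: "nat \<Rightarrow> nat \<Rightarrow> config \<Rightarrow> bool" where
  "I_down j k s \<longleftrightarrow> (\<exists>D \<pi> T' s' K' \<omega>'. is_path \<pi> T \<and> go \<pi> (T, 39, 0, \<omega>) = (T', s', K', \<omega>') \<and>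
     explored_least T 39 \<omega> j D \<and> height T' \<le> k \<and>
     at_path j D \<pi> (visited D T 39 \<union> path_nodes \<pi> T) s \<and> best T' s' K' \<omega>' D = best T 39 0 \<omega> D \<and>
     words s 13 = s' \<and> words s 10 = words s s' \<and> words s 16 = addr n + length \<pi> * d \<and> reals s 10 = K')"

lemma at_path_represents:
  assumes "at_path j D \<pi>' V s" "is_path \<pi> T" "go \<pi> (T, 39, 0, \<omega>) = (T', s', K', \<omega>')"
  shows "represents (words s) s' T'"
  using assms go_represents[OF _ assms(2,3), of "words s"] by (simp add: at_path_def q_regs_def)

lemma down_loop: "hq (I_down j depth) (Until (WLe 10 4) query_down) (depth * (d * 13 + 46) + 1)
    (\<lambda>s. holds (WLe 10 4) s \<and> (\<exists>k. I_down j k s))"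
proof (rule hoare_until_down[where I = "I_down j"])
  fix s assume "I_down j 0 s"
  then obtain D \<pi> T' s' K' \<omega>' where h: "is_path \<pi> T" "go \<pi> (T, 39, 0, \<omega>) = (T', s', K', \<omega>')" "height T' \<le> 0"
    "at_path j D \<pi> (visited D T 39 \<union> path_nodes \<pi> T) s" "words s 10 = words s s'"
    unfolding I_down_def by blast
  have "T' = Tip"
    using h(3) by (cases T') auto
  then show "holds (WLe 10 4) s"
    using at_path_represents[OF h(4,1,2)] h(5) by simp
next
  fix k
  have step: "hq (\<lambda>s. explored_least T 39 \<omega> j D \<and> height (Node l p r) \<le> Suc k \<and>
       best (Node l p r) s' K' \<omega>' D = best T 39 0 \<omega> D \<and>
       at_node j D \<pi> p K' (visited D T 39 \<union> path_nodes \<pi> T) s) query_down (d * 13 + 44)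
      (\<lambda>s. \<exists>j'\<le>k. I_down j j' s)"
    if path: "is_path \<pi> T" and go: "go \<pi> (T, 39, 0, \<omega>) = (Node l p r, s', K', \<omega>')" for D \<pi> l p r s' K' \<omega>'
  proof (intro hoare_pure, rule hoare_conseq[OF down_correct[OF path go]])
    assume a: "explored_least T 39 \<omega> j D" "height (Node l p r) \<le> Suc k"
      "best (Node l p r) s' K' \<omega>' D = best T 39 0 \<omega> D"
    fix s assume "at_child j D \<pi> l p r s' K' \<omega>' (visited D T 39 \<union> path_nodes \<pi> T) s"
    then obtain b T1 s1 K1 \<omega>1 where c: "go (\<pi> @ [b]) (T, 39, 0, \<omega>) = (T1, s1, K1, \<omega>1)" "is_path (\<pi> @ [b]) T"
        "height T1 < height (Node l p r)"
        "at_path j D (\<pi> @ [b]) (insert p (visited D T 39 \<union> path_nodes \<pi> T)) s"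
        "best T1 s1 K1 \<omega>1 D = best (Node l p r) s' K' \<omega>' D"
        "words s 13 = s1" "words s 10 = words s s1" "words s 16 = addr n + length (\<pi> @ [b]) * d" "reals s 10 = K1"
      unfolding at_child_def[OF path go] by blast
    have V: "insert p (visited D T 39 \<union> path_nodes \<pi> T) = visited D T 39 \<union> path_nodes (\<pi> @ [b]) T"
      using path_nodes_snoc[OF go] by simp
    have "height T1 \<le> k"
      using a(2) c(3) by linarith
    then have "I_down j k s"
      unfolding I_down_def using a c V by metis
    then show "\<exists>j'\<le>k. I_down j j' s"
      by blast
  qed simp_all
  show "hq (\<lambda>s. I_down j (Suc k) s \<and> \<not> holds (WLe 10 4) s) query_down (d * 13 + 44) (\<lambda>s. \<exists>j'\<le>k. I_down j j' s)"
    unfolding hoare_def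
  proof (intro allI impI, elim conjE)
    fix s assume I: "I_down j (Suc k) s" and nh: "\<not> holds (WLe 10 4) s" and f: "fits S s"
    obtain D \<pi> T' s' K' \<omega>' where h: "is_path \<pi> T" "go \<pi> (T, 39, 0, \<omega>) = (T', s', K', \<omega>')"
      "explored_least T 39 \<omega> j D" "height T' \<le> Suc k"
      "at_path j D \<pi> (visited D T 39 \<union> path_nodes \<pi> T) s" "best T' s' K' \<omega>' D = best T 39 0 \<omega> D"
      "words s 13 = s'" "words s 10 = words s s'" "words s 16 = addr n + length \<pi> * d" "reals s 10 = K'"
      using I unfolding I_down_def by blast
    note rep = at_path_represents[OF h(5,1,2)]
    have "T' \<noteq> Tip"
      using rep nh h(8) by auto
    then obtain l p r where T': "T' = Node l p r"
      by (cases T') auto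
    have go': "go \<pi> (T, 39, 0, \<omega>) = (Node l p r, s', K', \<omega>')"
      using h(2) T' by simp
    have "at_node j D \<pi> p K' (visited D T 39 \<union> path_nodes \<pi> T) s"
      unfolding at_node_def[OF h(1) go'] using h rep T' by simp
    then show "\<exists>t s'. exec S q \<omega> query_down s t s' \<and> t \<le> d * 13 + 44 \<and> (\<exists>j'\<le>k. I_down j j' s')"
      using step[OF h(1) go', of D] h f unfolding hoare_def T' by blast
  qed
qed simp

definition I_up :: "nat \<Rightarrow> nat \<Rightarrow> config \<Rightarrow> bool" where
  "I_up j k s \<longleftrightarrow> reals s 7 = real j \<and> (\<exists>D \<pi> T' s' K' \<omega>'. is_path \<pi> T \<and> go \<pi> (T, 39, 0, \<omega>) = (T', s', K', \<omega>') \<and>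
     explored_least T 39 \<omega> (Suc j) D \<and> length \<pi> \<le> k \<and>
     at_path j D \<pi> (visited D T 39) s \<and> words s 13 = s')"

lemma path_slot: "is_path \<pi> T \<Longrightarrow> go \<pi> (T, 39, 0, \<omega>) = (T', s', K', \<omega>') \<Longrightarrow> slot s'"
  using go_slots[of \<pi> T 39 0 \<omega> T' s' K' \<omega>'] slots_T[of s'] slot_in_slots[of s' T'] by blast

lemma tip_correct:
  "hq (\<lambda>s. holds (WLe 10 4) s \<and> (\<exists>k. I_down j k s)) (Block [RStore 13 8]) 1 (I_up j depth)"
proof (rule hoare_block)
  fix s assume hI: "holds (WLe 10 4) s \<and> (\<exists>k. I_down j k s)"
  then obtain D \<pi> T' s' K' \<omega>' where h: "is_path \<pi> T" "go \<pi> (T, 39, 0, \<omega>) = (T', s', K', \<omega>')"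
      "explored_least T 39 \<omega> j D"
      "at_path j D \<pi> (visited D T 39 \<union> path_nodes \<pi> T) s" "best T' s' K' \<omega>' D = best T 39 0 \<omega> D"
      "words s 13 = s'" "words s 10 = words s s'"
    unfolding I_down_def by blast
  note b = h(4)[unfolded at_path_def]
  have W: "q_regs (words s)" and r: "q_reals (reals s)"
    using b by blast+
  note rep = at_path_represents[OF h(4,1,2)]
  have T': "T' = Tip"
  proof (cases T')
    case (Node l p r)
    then show ?thesis
      using rep hI h(7) q_regsD[OF W] addr_ge[of p] by simp
  qed simp
  note sl = path_slot[OF h(1,2)]
  note sb = slot_bounds[OF sl]
  have e: "words (effs q \<omega> [RStore 13 8] s) = words s" "reals (effs q \<omega> [RStore 13 8] s) = (reals s)(s' := 1)"
    using h(6) q_realsD[OF r] by simp_all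
  have g: "good_path ((reals s)(s' := 1)) (insert s' D) \<pi> T 39 0 \<omega>"
    using b good_path_tip[OF T_props(1,2) _ _ _ h(1) refl, of 0 "reals s" D \<omega> s' K' \<omega>'] h(2) T' by simp
  have el: "explored_least T 39 \<omega> (Suc j) (insert s' D)"
    using explored_least_step[OF h(3,1)] h(2,5) T' by blast
  have "visited (insert s' D) T 39 \<subseteq> visited D T 39 \<union> path_nodes \<pi> T"
    using visited_insert[OF T_props(1,2) h(1)] h(2) T' by blast
  then have "best_inv (visited (insert s' D) T 39) (reals s 9) (words s 23)"
    using b unfolding best_inv_def by blast
  then have "at_path j (insert s' D) \<pi> (visited (insert s' D) T 39) (effs q \<omega> [RStore 13 8] s)"
    unfolding at_path_def e using b g sb q_reals_slot[OF sl] by simp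
  moreover have "length \<pi> \<le> depth"
    using length_path[OF h(1,2)] T_props(3) by simp
  ultimately have "I_up j depth (effs q \<omega> [RStore 13 8] s)"
    unfolding I_up_def using h(1,2,6) el e b sb by fastforce
  then show "safes S q \<omega> [RStore 13 8] s \<and> I_up j depth (effs q \<omega> [RStore 13 8] s)"
    using sb bounds(3) h(6) by simp
qed simp

lemma up_loop: "hq (I_up j depth) (Until (WLe 13 22) query_up) (depth * 14 + 1)
   (\<lambda>s. holds (WLe 13 22) s \<and> (\<exists>k. I_up j k s))"
proof (rule hoare_until_down[where I = "I_up j" and ?T1.0 = 12])
  fix s assume "I_up j 0 s"
  then obtain D \<pi> T' s' K' \<omega>' where h: "is_path \<pi> T" "go \<pi> (T, 39, 0, \<omega>) = (T', s', K', \<omega>')" "length \<pi> \<le> 0"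
      "at_path j D \<pi> (visited D T 39) s" "words s 13 = s'"
    unfolding I_up_def by blast
  have "q_regs (words s)" "s' = 39"
    using h unfolding at_path_def by auto
  then show "holds (WLe 13 22) s"
    using h(5) q_regsD[of "words s"] by simp
next
  fix k
  let ?is = "[WSub 14 13 6, WDiv 14 14 5, WMul 14 14 5, WAdd 10 14 6, WAdd 14 10 2, WAdd 20 14 2,
      RLoad 17 14, RLoad 18 20, WLoad 13 10]"
  let ?pre = "\<lambda>s. I_up j (Suc k) s \<and> \<not> holds (WLe 13 22) s"
  let ?M = "\<lambda>s. reals s 7 = real j \<and> (\<exists>D \<pi> b l p r s0 K0 \<omega>0. is_path \<pi> T \<and>
     go \<pi> (T, 39, 0, \<omega>) = (Node l p r, s0, K0, \<omega>0) \<and>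
     explored_least T 39 \<omega> (Suc j) D \<and> length \<pi> \<le> k \<and>
     at_path j D (\<pi> @ [b]) (visited D T 39) s \<and> words s 13 = s0 \<and>
     reals s 17 = reals s (addr p + 1) \<and> reals s 18 = reals s (addr p + 2))"
  have 1: "hq ?pre (Block ?is) 9 ?M"
  proof (rule hoare_block)
    fix s assume hI: "?pre s" and f: "fits S s"
    then obtain D \<pi>1 T' s' K' \<omega>' where h: "is_path \<pi>1 T" "go \<pi>1 (T, 39, 0, \<omega>) = (T', s', K', \<omega>')" "length \<pi>1 \<le> Suc k"
        "at_path j D \<pi>1 (visited D T 39) s" "words s 13 = s'" "explored_least T 39 \<omega> (Suc j) D"
      unfolding I_up_def by blast
    note b = h(4)[unfolded at_path_def]
    have W: "q_regs (words s)" and r: "q_reals (reals s)"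
      using b by blast+
    have w22: "words s 22 = 39"
      using q_regsD[OF W] by blast
    have "\<pi>1 \<noteq> []"
    proof
      assume "\<pi>1 = []"
      then have "words s 13 = 39"
        using h(2,5) by simp
      then show False
        using hI w22 by simp
    qed
    then obtain \<pi> dir where \<pi>: "\<pi>1 = \<pi> @ [dir]"
      by (metis rev_exhaust)
    obtain l p r s0 K0 \<omega>0 where g: "is_path \<pi> T" "go \<pi> (T, 39, 0, \<omega>) = (Node l p r, s0, K0, \<omega>0)"
      using is_path_butlast[of \<pi> dir T 39 0 \<omega>] h(1) \<pi> by blast
    have s': "s' = (if dir then addr p + 1 else addr p + 2)"
      using go_snoc[OF g(2), of dir] h(2) \<pi> by (auto split: if_splits)
    have rep: "words s (addr p) = s0" "p < n"
      using at_path_represents[OF h(4) g] by auto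
    note sl = path_slot[OF g]
    note sb = slot_bounds[OF sl]
    \<comment> \<open>The offsets 1 and 2 of the child slots are smaller than the record size, so
      division recovers the owner.\<close>
    have "(p * (d + 3) + v) div (d + 3) = p" if "v < d + 3" for v
      using that by simp
    from this[of 1] this[of 2] have dv: "(s' - 40) div (d + 3) = p"
      using d_pos unfolding s' addr_def by simp
    have pb: "addr p + 3 \<le> addr n" "p * (d + 3) \<le> S"
      using addr_mono[OF rep(2)] bounds(3) by (auto simp: addr_def)
    have adp: "p * (d + 3) + 40 = addr p"
      by (simp add: addr_def)
    have ne: "addr p + 2 \<noteq> 17" "addr p \<noteq> 14" "addr p \<noteq> 20" "addr p \<noteq> 10"
      using addr_ge[of p] by linarith+
    let ?a = "reals s (addr p + 1)" and ?b = "reals s (addr p + 2)"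
    have e: "words (effs q \<omega> ?is s) = (words s)(10 := addr p, 14 := addr p + 1, 20 := addr p + 2, 13 := s0)"
      "reals (effs q \<omega> ?is s) = (reals s)(17 := ?a, 18 := ?b)"
      using q_regsD[OF W] h(5) dv adp ne rep(1) by (simp_all add: fun_eq_iff)
    have "s' \<le> S"
      using s' pb bounds(3) by (auto split: if_splits)
    moreover have "p \<le> S"
      using rep(2) bounds(4) by simp
    ultimately have safe: "safes S q \<omega> ?is s"
      using q_regsD[OF W] h(5) dv adp ne rep(1) pb bounds(1,3) sb by simp
    have "at_path j D (\<pi> @ [dir]) (visited D T 39) (effs q \<omega> ?is s)"
      unfolding at_path_def e using b \<pi> by simp
    moreover have "addr p + 1 \<noteq> 17" "addr p + 1 \<noteq> 18" "addr p + 2 \<noteq> 18"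
      using addr_ge[of p] by linarith+
    moreover have "length \<pi> \<le> k"
      using h(3) \<pi> by simp
    ultimately have "?M (effs q \<omega> ?is s)"
      using g h(6) b ne unfolding e by (intro conjI exI[of _ D] exI[of _ \<pi>] exI[of _ dir] exI[of _ l] exI[of _ p]
        exI[of _ r] exI[of _ s0] exI[of _ K0] exI[of _ \<omega>0]) simp_all
    then show "safes S q \<omega> ?is s \<and> ?M (effs q \<omega> ?is s)"
      using safe by blast
  qed simp
  have store: "safes S q \<omega> [RStore 13 v] s \<and> (\<exists>i\<le>k. I_up j i (effs q \<omega> [RStore 13 v] s))"
    if M: "?M s" and v: "reals s v = min (reals s 17) (reals s 18)" for s v
  proof -
    obtain D \<pi> b l p r s0 K0 \<omega>0 where h: "is_path \<pi> T" "go \<pi> (T, 39, 0, \<omega>) = (Node l p r, s0, K0, \<omega>0)"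
       "explored_least T 39 \<omega> (Suc j) D" "length \<pi> \<le> k" "at_path j D (\<pi> @ [b]) (visited D T 39) s"
       "words s 13 = s0" "reals s 17 = reals s (addr p + 1)" "reals s 18 = reals s (addr p + 2)"
      using M by blast
    note b = h(5)[unfolded at_path_def]
    note sl = path_slot[OF h(1,2)]
    note sb = slot_bounds[OF sl]
    have e: "words (effs q \<omega> [RStore 13 v] s) = words s"
      "reals (effs q \<omega> [RStore 13 v] s) = (reals s)(s0 := min (reals s (addr p + 1)) (reals s (addr p + 2)))"
      using h v by simp_all
    have "good_path ((reals s)(s0 := min (reals s (addr p + 1)) (reals s (addr p + 2)))) D \<pi> T 39 0 \<omega>"
      using good_path_up[OF T_props(1,2) _ _ h(2,1) refl, of "reals s" D b] b by simp
    then have "at_path j D \<pi> (visited D T 39) (effs q \<omega> [RStore 13 v] s)"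
      unfolding at_path_def e using b sb q_reals_slot[OF sl] by simp
    then have "I_up j k (effs q \<omega> [RStore 13 v] s)"
      unfolding I_up_def using h(1-4,6) b sb e by fastforce
    then show ?thesis
      using sb bounds(3) h(6) by auto
  qed
  have 2: "hq ?M (IfC (RLe 17 18) (Block [RStore 13 17]) (Block [RStore 13 18])) 3 (\<lambda>s. \<exists>i\<le>k. I_up j i s)"
  proof (rule hoare_if[where ?T1.0 = 1])
    show "hq (\<lambda>s. ?M s \<and> holds (RLe 17 18) s) (Block [RStore 13 17]) 1 (\<lambda>s. \<exists>i\<le>k. I_up j i s)"
    proof (rule hoare_block)
      fix s assume h: "?M s \<and> holds (RLe 17 18) s"
      show "safes S q \<omega> [RStore 13 17] s \<and> (\<exists>i\<le>k. I_up j i (effs q \<omega> [RStore 13 17] s))"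
        by (rule store[OF h[THEN conjunct1]]) (use h[THEN conjunct2] in simp)
    qed simp
    show "hq (\<lambda>s. ?M s \<and> \<not> holds (RLe 17 18) s) (Block [RStore 13 18]) 1 (\<lambda>s. \<exists>i\<le>k. I_up j i s)"
    proof (rule hoare_block)
      fix s assume h: "?M s \<and> \<not> holds (RLe 17 18) s"
      show "safes S q \<omega> [RStore 13 18] s \<and> (\<exists>i\<le>k. I_up j i (effs q \<omega> [RStore 13 18] s))"
        by (rule store[OF h[THEN conjunct1]]) (use h[THEN conjunct2] in simp)
    qed simp
  qed simp
  show "hq ?pre query_up 12 (\<lambda>s. \<exists>i\<le>k. I_up j i s)"
    unfolding query_up_def by (rule hoare_seq[OF 1 2]) simp
qed simp

abbreviation "round_time \<equiv> depth * (d * 13 + 46) + depth * 14 + 8"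

lemma round_correct: "hq (I_round j) query_round round_time (I_round (Suc j))"
proof -
  let ?is = "[WAdd 13 22 4, RSub 10 5 5, WAdd 16 7 4, WLoad 10 13]"
  have 1: "hq (I_round j) (Block ?is) 4 (I_down j depth)"
  proof (rule hoare_block)
    fix s assume I: "I_round j s" and f: "fits S s"
    then obtain D where h: "at_path j D [] (visited D T 39) s" "explored_least T 39 \<omega> j D"
      unfolding I_round_def by blast
    note b = h(1)[unfolded at_path_def]
    have W: "q_regs (words s)" and r: "q_reals (reals s)"
      using b by blast+
    have "words s 39 \<le> S"
      using f by (simp add: fits_def)
    then have safe: "safes S q \<omega> ?is s"
      using q_regsD[OF W] bounds(1,3) by simp
    have e: "words (effs q \<omega> ?is s) = (words s)(13 := 39, 16 := addr n, 10 := words s 39)"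
      "reals (effs q \<omega> ?is s) = (reals s)(10 := 0)"
      using q_regsD[OF W] q_realsD[OF r] by simp_all
    have "at_path j D [] (visited D T 39 \<union> path_nodes [] T) (effs q \<omega> ?is s)"
      unfolding at_path_def e using b good_path_reg[of 10 "reals s" 0 D "[]" 0 \<omega>] by simp
    then have "I_down j depth (effs q \<omega> ?is s)"
      unfolding I_down_def using h(2) T_props(3) e
      by (intro exI[of _ D] exI[of _ "[]"] exI[of _ T] exI[of _ 39] exI[of _ 0] exI[of _ \<omega>] conjI) simp_all
    then show "safes S q \<omega> ?is s \<and> I_down j depth (effs q \<omega> ?is s)"
      using safe by blast
  qed simp
  have 2: "hq (\<lambda>s. holds (WLe 13 22) s \<and> (\<exists>k. I_up j k s)) (Block [RAdd 7 7 8]) 1 (I_round (Suc j))"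
  proof (rule hoare_block)
    fix s assume hI: "holds (WLe 13 22) s \<and> (\<exists>k. I_up j k s)"
    then obtain D \<pi> T' s' K' \<omega>' where h: "is_path \<pi> T" "go \<pi> (T, 39, 0, \<omega>) = (T', s', K', \<omega>')"
        "at_path j D \<pi> (visited D T 39) s" "words s 13 = s'" "explored_least T 39 \<omega> (Suc j) D"
      unfolding I_up_def by blast
    note b = h(3)[unfolded at_path_def]
    have W: "q_regs (words s)" and r: "q_reals (reals s)"
      using b by blast+
    \<comment> \<open>Slot 39 lies below all records, so a path with at least one step cannot end
      there.\<close>
    have "\<pi> = []"
    proof (rule ccontr)
      assume "\<pi> \<noteq> []"
      then obtain \<pi>0 dir where \<pi>: "\<pi> = \<pi>0 @ [dir]"
        by (metis rev_exhaust)
      obtain l p r s0 K0 \<omega>0 where g: "is_path \<pi>0 T" "go \<pi>0 (T, 39, 0, \<omega>) = (Node l p r, s0, K0, \<omega>0)"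
        using is_path_butlast[of \<pi>0 dir T 39 0 \<omega>] h(1) \<pi> by blast
      have "s' = (if dir then addr p + 1 else addr p + 2)"
        using go_snoc[OF g(2), of dir] h(2) \<pi> by (auto split: if_splits)
      then show False
        using hI h(4) q_regsD[OF W] addr_ge[of p] by (auto split: if_splits)
    qed
    then have "at_path (Suc j) D [] (visited D T 39) (effs q \<omega> [RAdd 7 7 8] s)"
      using b q_realsD[OF r] good_path_reg[of 7 "reals s" "real j + 1" D "[]" 0 \<omega>]
      unfolding at_path_def by (simp add: add.commute)
    then show "safes S q \<omega> [RAdd 7 7 8] s \<and> I_round (Suc j) (effs q \<omega> [RAdd 7 7 8] s)"
      unfolding I_round_def using h(5) bounds(1) b q_realsD[OF r] by auto
  qed simp
  show ?thesis
    unfolding query_round_def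
    by (rule hoare_seq[OF 1 hoare_seq[OF down_loop hoare_seq[OF tip_correct hoare_seq[OF up_loop 2]]]]) auto
qed

abbreviation "n_rounds \<equiv> nat \<lceil>rounds\<rceil>"

definition answered :: "config \<Rightarrow> bool" where
  "answered s \<longleftrightarrow> (\<exists>D. explored_least T 39 \<omega> n_rounds D \<and>
     words s 0 < n \<and> (\<forall>p\<in>visited D T 39. score p \<le> score (words s 0)))"

abbreviation "query_time \<equiv> m + 15 + n_rounds * (round_time + 2)"

theorem query_correct:
  assumes root: "T \<noteq> Tip"
  shows "hq prepared (query_code K m) query_time answered"
proof -
  have pow: "words (effs q \<omega> (replicate i (RMul 6 6 6)) s) = words s \<and>
      reals (effs q \<omega> (replicate i (RMul 6 6 6)) s) = (reals s)(6 := reals s 6 ^ (2 ^ i)) \<and>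
      safes S q \<omega> (replicate i (RMul 6 6 6)) s" for i s
  proof (induction i arbitrary: s)
    case (Suc i)
    have "(a * a) ^ (2 ^ i) = a ^ (2 ^ Suc i)" for a :: real
      by (simp add: power_mult_distrib flip: power_add mult_2)
    then show ?case
      using Suc[of "eff q \<omega> (RMul 6 6 6) s"] bounds(1) by (simp add: fun_eq_iff)
  qed simp
  have app: "effs q \<omega> (is @ is') s = effs q \<omega> is' (effs q \<omega> is s)"
    "safes S q \<omega> (is @ is') s \<longleftrightarrow> safes S q \<omega> is s \<and> safes S q \<omega> is' (effs q \<omega> is s)" for "is" is' s
    by (induction "is" arbitrary: s) auto
  have 1: "hq prepared (Block (query_init K m)) (m + 12) (I_round 0)"
  proof (rule hoare_block)
    fix s assume p: "prepared s"
    have R: "regs (words s)" "rregs (reals s)" "coords_upto n 0 (reals s)" "dirs_upto \<omega> depth 0 (reals s)"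
      "untouched (reals s)" "represents (words s) 39 T"
      using p unfolding prepared_def by blast+
    define s1 where "s1 = effs q \<omega> [ROfWord 8 2, RAdd 6 1 5] s"
    have s1: "words s1 = words s" "reals s1 = (reals s)(8 := 1, 6 := c)"
      unfolding s1_def using R(1,2) by (simp_all add: regs_def rregs_def)
    define s2 where "s2 = effs q \<omega> (replicate m (RMul 6 6 6)) s1"
    have s2: "words s2 = words s" "reals s2 = (reals s)(8 := 1, 6 := c ^ (2 ^ m))"
      unfolding s2_def using pow[of m s1] s1 by simp_all
    let ?is = "[RMul 7 1 1, RMul 7 0 7, RAdd 6 6 7, WConst 20 K, ROfWord 7 20, RMul 6 6 7, RSub 7 5 5,
      RSub 9 5 5, WConst 22 39, WConst 23 40]"
    have e: "effs q \<omega> (query_init K m) s = effs q \<omega> ?is s2"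
      unfolding query_init_def app s1_def[symmetric] s2_def[symmetric] ..
    have w: "words (effs q \<omega> ?is s2) = (words s)(20 := K, 22 := 39, 23 := 40)"
      using s2 by simp
    have r: "reals (effs q \<omega> ?is s2) = (reals s)(8 := 1, 6 := rounds, 7 := 0, 9 := 0)"
      using s2 R(2) by (simp add: rregs_def rounds_def fun_eq_iff)
    have safe: "safes S q \<omega> (query_init K m) s"
      unfolding query_init_def app s1_def[symmetric] s2_def[symmetric]
      using pow[of m s1] bounds(1) K_le by simp
    have qr: "q_regs ((words s)(20 := K, 22 := 39, 23 := 40))"
      using R(1,6) by (simp add: q_regs_def)
    have ql: "q_reals ((reals s)(8 := 1, 6 := rounds, 7 := 0, 9 := 0))"
      using R(2,3,4) addr_ge[of n] by (simp add: q_reals_def rregs_def)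
    have "good ((reals s)(8 := 1, 6 := rounds, 7 := 0, 9 := 0)) {} T 39 0 \<omega>"
    proof (rule good_init)
      fix u assume "u \<in> slots T 39"
      then have "slot u"
        by (rule slots_T)
      then show "((reals s)(8 := 1, 6 := rounds, 7 := 0, 9 := 0)) u = 0"
        using R(5) slot_bounds[of u] by (auto simp: untouched_def)
    qed simp
    moreover have "best_inv (visited {} T 39) 0 40"
      using visited_none[of "{}" T 39] n_ge by (auto simp: best_inv_def addr_def intro!: exI[of _ 0])
    ultimately have "at_path 0 {} [] (visited {} T 39) (effs q \<omega> ?is s2)"
      unfolding at_path_def w r using qr ql by simp
    moreover have "explored_least T 39 \<omega> 0 {}"
      by (simp add: explored_least_def)
    moreover have "reals (effs q \<omega> ?is s2) 7 = real 0"
      unfolding r by simp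
    ultimately have "I_round 0 (effs q \<omega> ?is s2)"
      unfolding I_round_def by blast
    then show "safes S q \<omega> (query_init K m) s \<and> I_round 0 (effs q \<omega> (query_init K m) s)"
      unfolding e using safe by blast
  qed (simp add: query_init_def)
  have 2: "hq (I_round 0) (Until (RLe 6 7) query_round) (n_rounds * (round_time + 2) + 1) (I_round n_rounds)"
  proof (rule hoare_until[where I = I_round and N = n_rounds])
    show "hq (I_round k) query_round round_time (I_round (Suc k))" for k
      by (rule round_correct)
  next
    fix k s assume k: "k < n_rounds" "I_round k s"
    then have "reals s 6 = rounds" "reals s 7 = real k"
      unfolding I_round_def at_path_def q_reals_def by blast+
    moreover have "real k < rounds"
      using k(1) by linarith
    ultimately show "\<not> holds (RLe 6 7) s"
      by simp
  next
    fix s assume "I_round n_rounds s"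
    then have "reals s 6 = rounds" "reals s 7 = real n_rounds"
      unfolding I_round_def at_path_def q_reals_def by blast+
    moreover have "rounds \<le> real n_rounds"
      by linarith
    ultimately show "holds (RLe 6 7) s"
      by simp
  qed simp
  have 3: "hq (I_round n_rounds) (Block [WSub 0 23 6, WDiv 0 0 5]) 2 answered"
  proof (rule hoare_block)
    fix s assume I: "I_round n_rounds s" and f: "fits S s"
    then obtain D where h: "at_path n_rounds D [] (visited D T 39) s" "explored_least T 39 \<omega> n_rounds D"
      unfolding I_round_def by blast
    note b = h(1)[unfolded at_path_def]
    have W: "q_regs (words s)"
      using b by blast
    obtain p where p: "p < n" "words s 23 = addr p" "reals s 9 = score p \<or> reals s 9 = 0"
        "\<forall>p\<in>visited D T 39. score p \<le> reals s 9"
      using b unfolding best_inv_def by blast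
    have w0: "words (effs q \<omega> [WSub 0 23 6, WDiv 0 0 5] s) 0 = p"
      using q_regsD[OF W] p(2) owner_addr[of p] by simp
    \<comment> \<open>A best score of 0 means that nothing has been visited, since all scores are
      positive.\<close>
    have "\<forall>p'\<in>visited D T 39. score p' \<le> score p"
      using p(3,4) score_pos by (metis dual_order.strict_trans1 less_le_not_le not_less)
    then have "answered (effs q \<omega> [WSub 0 23 6, WDiv 0 0 5] s)"
      unfolding answered_def w0 using h(2) p(1) by blast
    moreover have "addr p - 40 \<le> S" "(addr p - 40) div (d + 3) \<le> S"
      using addr_less'[OF p(1)] bounds(3,4) p(1) owner_addr[of p] by linarith+
    ultimately show "safes S q \<omega> [WSub 0 23 6, WDiv 0 0 5] s \<and> answered (effs q \<omega> [WSub 0 23 6, WDiv 0 0 5] s)"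
      using q_regsD[OF W] p(2) bounds(1) by simp
  qed simp
  show ?thesis
    unfolding query_code_def by (rule hoare_seq[OF 1 hoare_seq[OF 2 3]]) auto
qed

text \<open>When the number of rounds reaches the number of tips with keys up to \<open>W\<close>,
  all of these tips are explored. The node \<open>i\<close> then has been seen, and the reported
  score is at least as good.\<close>

lemma answered_nearest:
  assumes "answered s" "count_upto T 0 \<omega> W \<le> n_rounds" "i \<in> nodes T" "node_key T 0 \<omega> i \<le> W"
  shows "words s 0 < n \<and> l2_dist d q (x (words s 0)) \<le> l2_dist d q (x i)"
proof -
  obtain D where D: "explored_least T 39 \<omega> n_rounds D" "words s 0 < n"
      "\<forall>p\<in>visited D T 39. score p \<le> score (words s 0)"
    using assms(1) unfolding answered_def by blast
  have le: "score i \<le> score (words s 0)"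
    using visited_complete[OF D(1) assms(2-4)] D(3) by blast
  let ?S = "\<lambda>p. \<Sum>k<d. (q k - x p k) * (q k - x p k)"
  have nn: "0 \<le> ?S p" for p
    by (intro sum_nonneg) simp
  have "1 / (?S i + 1) \<le> 1 / (?S (words s 0) + 1)"
    using le by (simp add: score_def)
  then have "?S (words s 0) \<le> ?S i"
    using nn[of i] nn[of "words s 0"] by (simp add: field_simps)
  then show ?thesis
    using D(2) by (simp add: l2_dist_def L2_set_def power2_eq_square)
qed

end

section \<open>Gaussian directions and random pivots\<close>

lemma prob_space_normal: "prob_space (density lborel std_normal_density)"
  using prob_space_normal_density[of 1 0] by simp

interpretation tape: sequence_space "density lborel std_normal_density"
  rewrites "(\<Pi>\<^sub>M i\<in>(UNIV::nat set). density lborel (\<lambda>x. ennreal (std_normal_density x))) = random_tape"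
proof -
  interpret N: prob_space "density lborel std_normal_density"
    by (rule prob_space_normal)
  show "sequence_space (density lborel std_normal_density)"
    by unfold_locales
qed (simp add: random_tape_def)

lemma space_tape [simp]: "space random_tape = UNIV"
  by (simp add: random_tape_def space_PiM)

lemma measurable_dot [measurable]: "(\<lambda>a. dot d a v) \<in> borel_measurable random_tape"
  unfolding dot_def by measurable

lemma tape_component: "distributed random_tape lborel (\<lambda>a. a k) std_normal_density"
proof -
  have "distr random_tape lborel (\<lambda>a. a k) = distr random_tape (density lborel std_normal_density) (\<lambda>a. a k)"
    by (rule distr_cong) simp_all
  also have "\<dots> = density lborel std_normal_density"
    unfolding random_tape_def by (rule distr_PiM_component) (auto simp: prob_space_normal)
  finally show ?thesis
    unfolding distributed_def by simp
qed

lemma tape_indep: "tape.P.indep_vars (\<lambda>_. borel) (\<lambda>k a. a k) (UNIV :: nat set)"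
proof (subst tape.P.indep_vars_iff_distr_eq_PiM)
  show "distr random_tape (\<Pi>\<^sub>M i\<in>UNIV. borel) (\<lambda>a. \<lambda>i\<in>UNIV. a i) = (\<Pi>\<^sub>M i\<in>UNIV. distr random_tape borel (\<lambda>a. a i))"
  proof -
    have s: "sets (\<Pi>\<^sub>M i\<in>(UNIV :: nat set). (borel :: real measure)) = sets random_tape"
      unfolding random_tape_def by (rule sets_PiM_cong) auto
    have "distr random_tape (\<Pi>\<^sub>M i\<in>UNIV. borel) (\<lambda>a. \<lambda>i\<in>UNIV. a i) = distr random_tape random_tape (\<lambda>a. a)"
      using s by (intro distr_cong) auto
    also have "\<dots> = random_tape"
      by (rule distr_id)
    also have "\<dots> = (\<Pi>\<^sub>M i\<in>UNIV. distr random_tape borel (\<lambda>a. a i))"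
    proof -
      have "distr random_tape borel (\<lambda>a. a i) = density lborel std_normal_density" for i
      proof -
        have "distr random_tape borel (\<lambda>a. a i) = distr random_tape lborel (\<lambda>a. a i)"
          by (rule distr_cong) simp_all
        then show ?thesis
          using tape_component[of i] by (simp add: distributed_def)
      qed
      then show ?thesis
        unfolding random_tape_def by simp
    qed
    finally show ?thesis .
  qed
qed auto

text \<open>A linear combination of independent standard Gaussians is Gaussian, with the length of
  the coefficient vector as standard deviation. Coordinates with coefficient 0 are dropped, as a
  constant has no density.\<close>

lemma dot_distributed:
  assumes "0 < L2_set v {..<d}"
  shows "distributed random_tape lborel (\<lambda>a. dot d a v) (normal_density 0 (L2_set v {..<d}))"
proof -
  let ?I = "{k. k < d \<and> v k \<noteq> 0}"
  have ne: "?I \<noteq> {}"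
  proof
    assume "?I = {}"
    then have "L2_set v {..<d} = 0"
      by (auto simp: L2_set_eq_0_iff)
    then show False
      using assms by simp
  qed
  have 1: "tape.P.indep_vars (\<lambda>_. borel) (\<lambda>k a. 0 + v k * a k) ?I"
    by (rule tape.P.indep_vars_compose2[where Y = "\<lambda>k y. 0 + v k * y" and X = "\<lambda>k a. a k" and M' = "\<lambda>_. borel"])
      (auto intro: tape.P.indep_vars_subset[OF tape_indep])
  have 2: "distributed random_tape lborel (\<lambda>a. 0 + v k * a k) (normal_density (0 + v k * 0) (\<bar>v k\<bar> * 1))" if "k \<in> ?I" for k
    using tape_component[of k] that by (intro tape.P.normal_density_affine) auto
  have "distributed random_tape lborel (\<lambda>a. \<Sum>k\<in>?I. 0 + v k * a k)
      (normal_density (\<Sum>k\<in>?I. 0) (sqrt (\<Sum>k\<in>?I. \<bar>v k\<bar>\<^sup>2)))"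
    by (rule tape.P.sum_indep_normal[OF _ ne 1]) (use 2 in auto)
  moreover have "(\<lambda>a. \<Sum>k\<in>?I. 0 + v k * a k) = (\<lambda>a. dot d a v)"
    unfolding dot_def by (intro ext) (auto intro!: sum.mono_neutral_cong_left)
  moreover have "(\<Sum>k\<in>?I. \<bar>v k\<bar>\<^sup>2) = (\<Sum>k<d. (v k)\<^sup>2)"
    by (auto intro!: sum.mono_neutral_cong_left)
  ultimately show ?thesis
    by (simp add: L2_set_def)
qed

lemma nn_integral_dot:
  assumes "0 < L2_set v {..<d}" "f \<in> borel_measurable borel"
  shows "(\<integral>\<^sup>+ a. f (dot d a v) \<partial>random_tape) = (\<integral>\<^sup>+ t. ennreal (normal_density 0 (L2_set v {..<d}) t) * f t \<partial>lborel)"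
  using distributed_nn_integral[OF dot_distributed[OF assms(1)], of f] assms(2) by simp

text \<open>The density is at most its value at 0, and the interval has length
  \<open>2 * s\<close>.\<close>

lemma dot_small_ball:
  assumes "0 < L2_set v {..<d}" "0 \<le> s"
  shows "(\<integral>\<^sup>+ a. indicator {t. \<bar>t\<bar> \<le> s} (dot d a v) \<partial>random_tape) \<le> ennreal (sqrt (2 / pi) * s / L2_set v {..<d})"
proof -
  let ?\<sigma> = "L2_set v {..<d}" and ?c = "1 / (sqrt (2 * pi) * L2_set v {..<d})"
  have d: "normal_density 0 ?\<sigma> t \<le> ?c" for t
    using assms(1) by (simp add: normal_density_def real_sqrt_mult divide_right_mono)
  have "(\<integral>\<^sup>+ a. indicator {t. \<bar>t\<bar> \<le> s} (dot d a v) \<partial>random_tape)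
      = (\<integral>\<^sup>+ t. ennreal (normal_density 0 ?\<sigma> t) * indicator {t. \<bar>t\<bar> \<le> s} t \<partial>lborel)"
    using assms(1) by (rule nn_integral_dot) measurable
  also have "\<dots> \<le> (\<integral>\<^sup>+ t. ennreal ?c * indicator {-s..s} t \<partial>lborel)"
    using d by (intro nn_integral_mono) (auto simp: indicator_def intro!: ennreal_leI)
  also have "\<dots> = ennreal ?c * ennreal (2 * s)"
    using assms(2) by (subst nn_integral_cmult) auto
  also have "\<dots> = ennreal (?c * (2 * s))"
    using assms by (intro ennreal_mult[symmetric]) auto
  also have "?c * (2 * s) = sqrt (2 / pi) * s / ?\<sigma>"
  proof -
    have "sqrt (2 * pi) * sqrt (2 / pi) = sqrt (2\<^sup>2)"
      unfolding real_sqrt_mult[symmetric] by (simp add: power2_eq_square)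
    then have "2 / sqrt (2 * pi) = sqrt (2 / pi)"
      by (simp add: field_simps)
    then show ?thesis
      by (metis (no_types, opaque_lifting) mult.commute mult.left_neutral times_divide_eq_right
          times_divide_times_eq)
  qed
  finally show ?thesis .
qed

lemma dot_nonzero:
  assumes "0 < L2_set v {..<d}"
  shows "AE a in random_tape. dot d a v \<noteq> 0"
proof -
  have "emeasure random_tape {a. dot d a v = 0} = (\<integral>\<^sup>+ a. indicator {t. \<bar>t\<bar> \<le> 0} (dot d a v) \<partial>random_tape)"
  proof -
    have [measurable]: "{a. dot d a v = 0} \<in> sets random_tape"
      using measurable_sets[OF measurable_dot[of d v], of "{0}"] by (simp add: vimage_def)
    have "emeasure random_tape {a. dot d a v = 0} = (\<integral>\<^sup>+ a. indicator {a. dot d a v = 0} a \<partial>random_tape)"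
      by simp
    then show ?thesis
      by (simp add: indicator_def)
  qed
  also have "\<dots> \<le> 0"
    using dot_small_ball[OF assms, of 0] by simp
  finally show ?thesis
    by (intro AE_I[where N = "{a. dot d a v = 0}"])
      (use measurable_sets[OF measurable_dot[of d v], of "{0}"] in \<open>auto simp: vimage_def\<close>)
qed

text \<open>\<open>fact (2 * k) / (2 ^ k * fact k)\<close> is the double factorial of
  \<open>2 * k - 1\<close>, the moment of order \<open>2 * k\<close> of a standard Gaussian. The
  zero vector has no density and is a case of its own.\<close>

lemma dot_moment:
  assumes "L2_set v {..<d} \<le> \<rho>"
  shows "(\<integral>\<^sup>+ a. ennreal (dot d a v ^ (2 * k)) \<partial>random_tape) \<le> ennreal (fact (2 * k) / (2 ^ k * fact k) * \<rho> ^ (2 * k))"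
proof (cases "0 < L2_set v {..<d}")
  case True
  let ?\<sigma> = "L2_set v {..<d}"
  have "(\<integral>\<^sup>+ a. ennreal (dot d a v ^ (2 * k)) \<partial>random_tape)
      = (\<integral>\<^sup>+ t. ennreal (normal_density 0 ?\<sigma> t) * ennreal (t ^ (2 * k)) \<partial>lborel)"
    using True by (intro nn_integral_dot[where f = "\<lambda>t. ennreal (t ^ (2 * k))"]) measurable
  also have "\<dots> = (\<integral>\<^sup>+ t. ennreal (normal_density 0 ?\<sigma> t * (t - 0) ^ (2 * k)) \<partial>lborel)"
    by (intro nn_integral_cong) (simp add: ennreal_mult power_mult)
  also have "\<dots> = ennreal (fact (2 * k) / ((2 / ?\<sigma>\<^sup>2) ^ k * fact k))"
    using nn_integral_has_integral_lborel normal_moment_even[OF True, of 0 k]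
    by (intro nn_integral_eq_integral[THEN trans])
       (auto simp: has_bochner_integral_iff integral_normal_moment_even[OF True] power_mult)
  also have "fact (2 * k) / ((2 / ?\<sigma>\<^sup>2) ^ k * fact k) = fact (2 * k) / (2 ^ k * fact k) * ?\<sigma> ^ (2 * k)"
    using True by (simp add: power_divide power_mult)
  also have "ennreal \<dots> \<le> ennreal (fact (2 * k) / (2 ^ k * fact k) * \<rho> ^ (2 * k))"
    using True assms by (intro ennreal_leI mult_left_mono power_mono) auto
  finally show ?thesis .
next
  case False
  then have "L2_set v {..<d} = 0"
    using L2_set_nonneg[of v "{..<d}"] by simp
  then have "\<forall>k<d. v k = 0"
    by (simp add: L2_set_eq_0_iff)
  then have 0: "dot d a v = 0" for a
    by (simp add: dot_def)
  show ?thesis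
  proof (cases k)
    case 0
    then show ?thesis
      using tape.P.emeasure_space_1 by simp
  qed (simp add: 0)
qed

lemma pred_tape_le: "Measurable.pred random_tape (\<lambda>b. b p \<le> b i)"
  unfolding pred_def using borel_measurable_le[OF measurable_tape[of p] measurable_tape[of i]] by simp

lemma measurable_pivot [measurable]:
  assumes "finite S"
  shows "(\<lambda>b. pivot S b) \<in> measurable random_tape (count_space UNIV)"
proof -
  have [measurable]: "Measurable.pred random_tape (\<lambda>b. \<forall>i\<in>S. b p \<le> b i)" for p
    using assms pred_tape_le by (intro pred_intros_finite) auto
  show ?thesis
    unfolding pivot_def by measurable
qed

text \<open>By exchangeability: a transposition of coordinates maps the event that \<open>p\<close>
  has a least key to the same event for \<open>r\<close>. These events overlap in null sets only, so
  \<open>card S\<close> times their common probability is at most 1.\<close>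

lemma emeasure_pivot:
  assumes "finite S" "p \<in> S"
  shows "emeasure random_tape {b. pivot S b = p} \<le> ennreal (1 / real (card S))"
proof -
  let ?E = "\<lambda>p. {b :: nat \<Rightarrow> real. \<forall>i\<in>S. b p \<le> b i}"
  have [measurable]: "?E p \<in> sets random_tape" for p
  proof -
    have "Measurable.pred random_tape (\<lambda>b. \<forall>i\<in>S. b p \<le> b i)"
      using assms(1) pred_tape_le by (intro pred_intros_finite) auto
    then show ?thesis
      by (simp add: pred_def)
  qed
  have eq: "emeasure random_tape (?E r) = emeasure random_tape (?E p)" if "r \<in> S" for r
  proof -
    define \<pi> where "\<pi> = (\<lambda>i. if i = p then r else if i = r then p else i)"
    have inj: "inj \<pi>"
      by (auto simp: inj_def \<pi>_def)
    have d: "distr random_tape random_tape (\<lambda>b i. b (\<pi> i)) = random_tape"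
      using distr_PiM_reindex[of UNIV "\<lambda>_. density lborel std_normal_density" \<pi> UNIV]
      by (simp add: random_tape_def prob_space_normal inj restrict_def)
    have m: "(\<lambda>b i. b (\<pi> i)) \<in> measurable random_tape random_tape"
      using measurable_tape unfolding random_tape_def by (intro measurable_PiM_single') (auto simp: space_PiM)
    have "(\<lambda>b i. b (\<pi> i)) -` ?E p \<inter> space random_tape = ?E r"
    proof -
      have "\<pi> ` S = S"
        unfolding \<pi>_def using assms(2) that by (auto split: if_splits)
      then have "(\<forall>i\<in>S. b r \<le> b (\<pi> i)) \<longleftrightarrow> (\<forall>i\<in>S. b r \<le> b i)" for b :: "nat \<Rightarrow> real"
        by (metis imageE imageI)
      then show ?thesis
        by (auto simp: \<pi>_def)
    qed
    then show ?thesis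
      using emeasure_distr[OF m, of "?E p"] d by simp
  qed
  \<comment> \<open>A tie is the vanishing of a linear form with coefficients 1 and -1.\<close>
  have null: "AE b in random_tape. b r \<noteq> b r'" if "r \<noteq> r'" for r r'
  proof -
    let ?v = "\<lambda>k. (if k = r then 1 else if k = r' then -1 else 0) :: real"
    let ?d = "Suc (max r r')"
    have "L2_set ?v {..<?d} \<noteq> 0"
      by (subst L2_set_eq_0_iff) (auto intro!: exI[of _ r])
    then have "0 < L2_set ?v {..<?d}"
      using L2_set_nonneg[of ?v "{..<?d}"] by linarith
    from dot_nonzero[OF this] show ?thesis
    proof eventually_elim
      case (elim b)
      have "dot ?d b ?v = (\<Sum>k\<in>{r, r'}. b k * ?v k)"
        unfolding dot_def by (intro sum.mono_neutral_right) auto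
      then show ?case
        using elim that by simp
    qed
  qed
  have "card S * emeasure random_tape (?E p) = (\<Sum>r\<in>S. emeasure random_tape (?E r))"
    using eq by simp
  also have "\<dots> = (\<integral>\<^sup>+ b. (\<Sum>r\<in>S. indicator (?E r) b) \<partial>random_tape)"
    by (subst nn_integral_sum) auto
  also have "\<dots> \<le> (\<integral>\<^sup>+ b. 1 \<partial>random_tape)"
  proof (rule nn_integral_mono_AE)
    have "AE b in random_tape. \<forall>r\<in>S. \<forall>r'\<in>S. r \<noteq> r' \<longrightarrow> b r \<noteq> b r'"
    proof (intro AE_finite_allI assms(1))
      show "AE b in random_tape. r \<noteq> r' \<longrightarrow> b r \<noteq> b r'" for r r'
        using null[of r r'] by (cases "r = r'") auto
    qed
    then show "AE b in random_tape. (\<Sum>r\<in>S. indicator (?E r) b) \<le> (1 :: ennreal)"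
    proof eventually_elim
      case (elim b)
      have "b r = b r'" if "b \<in> ?E r" "b \<in> ?E r'" "r \<in> S" "r' \<in> S" for r r'
        using that by (auto intro: antisym)
      then have uniq: "r = r'" if "b \<in> ?E r" "b \<in> ?E r'" "r \<in> S" "r' \<in> S" for r r'
        using that elim by blast
      show ?case
      proof (cases "\<exists>r\<in>S. b \<in> ?E r")
        case True
        then obtain r where r: "r \<in> S" "b \<in> ?E r"
          by blast
        have "(\<Sum>r'\<in>S. indicator (?E r') b) = (\<Sum>r'\<in>{r}. indicator (?E r') b :: ennreal)"
          using r uniq assms(1) by (intro sum.mono_neutral_right) (auto simp: indicator_def)
        also have "\<dots> = indicator (?E r) b"
          by simp
        also have "\<dots> \<le> 1"
          by (auto simp: indicator_def)
        finally show ?thesis .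
      next
        case False
        then have "(\<Sum>r'\<in>S. indicator (?E r') b) = (0 :: ennreal)"
          by (intro sum.neutral) (auto simp: indicator_def)
        then show ?thesis
          by simp
      qed
    qed
  qed
  also have "\<dots> = 1"
    using tape.P.emeasure_space_1 by simp
  finally have "ennreal (real (card S) * tape.P.prob (?E p)) \<le> 1"
    by (simp add: tape.P.emeasure_eq_measure ennreal_mult ennreal_of_nat_eq_real_of_nat)
  moreover have "0 < card S"
    using assms card_gt_0_iff by blast
  ultimately have "tape.P.prob (?E p) \<le> 1 / real (card S)"
    by (simp add: field_simps)
  moreover have "{b. pivot S b = p} \<subseteq> ?E p"
    using pivot_props(2)[OF assms(1)] assms(2) by auto
  ultimately show ?thesis
    using emeasure_mono[of "{b. pivot S b = p}" "?E p" random_tape]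
    by (auto simp: tape.P.emeasure_eq_measure intro: order_trans ennreal_leI)
qed

lemma nn_integral_tape_split:
  assumes "f \<in> borel_measurable random_tape"
  shows "(\<integral>\<^sup>+ \<omega>. f \<omega> \<partial>random_tape)
    = (\<integral>\<^sup>+ a. \<integral>\<^sup>+ b. f (comb_seq k a b) \<partial>random_tape \<partial>random_tape)"
proof -
  have m: "(\<lambda>(a, b). comb_seq k a b) \<in> measurable (random_tape \<Otimes>\<^sub>M random_tape) random_tape"
    using measurable_comb_seq[of k "density lborel std_normal_density"] by (simp add: random_tape_def)
  have "(\<integral>\<^sup>+ \<omega>. f \<omega> \<partial>random_tape)
      = (\<integral>\<^sup>+ \<omega>. f \<omega> \<partial>distr (random_tape \<Otimes>\<^sub>M random_tape) random_tape (\<lambda>(a, b). comb_seq k a b))"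
    using tape.PiM_comb_seq[of k] by simp
  also have "\<dots> = (\<integral>\<^sup>+ ab. f (case ab of (a, b) \<Rightarrow> comb_seq k a b) \<partial>(random_tape \<Otimes>\<^sub>M random_tape))"
    using nn_integral_distr[OF m, of f] assms by (simp add: case_prod_beta')
  also have "\<dots> = (\<integral>\<^sup>+ a. \<integral>\<^sup>+ b. f (comb_seq k a b) \<partial>random_tape \<partial>random_tape)"
    using tape.P.nn_integral_fst[of "\<lambda>ab. f (case ab of (a, b) \<Rightarrow> comb_seq k a b)" random_tape]
      measurable_compose[OF m assms] by simp
  finally show ?thesis .
qed

lemma measurable_shift [measurable]: "shift k \<in> measurable random_tape random_tape"
  using measurable_tape unfolding random_tape_def shift_def
  by (intro measurable_PiM_single') (auto simp: space_PiM)

lemma shift_comb_seq [simp]: "shift k (comb_seq k a b) = b"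
  by (auto simp: shift_def comb_seq_def fun_eq_iff)

text \<open>One level of the tree: the direction, the keys and the rest of the tape are independent,
  and the pivot is uniformly distributed.\<close>

lemma nn_integral_level:
  fixes g :: "(nat \<Rightarrow> real) \<Rightarrow> nat \<Rightarrow> (nat \<Rightarrow> real) \<Rightarrow> ennreal"
  assumes S: "finite S" "S \<noteq> {}" "S \<subseteq> {..<n}"
    and f: "f \<in> borel_measurable random_tape" "\<And>\<omega>. f \<omega> \<le> g \<omega> (pivot S (shift d \<omega>)) (shift (d + n) \<omega>)"
    and g: "\<And>a a' p b. (\<And>k. k < d \<Longrightarrow> a k = a' k) \<Longrightarrow> g a p b = g a' p b"
    and h: "\<And>a p. p \<in> S \<Longrightarrow> (\<integral>\<^sup>+ b. g a p b \<partial>random_tape) \<le> h a p"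
  shows "(\<integral>\<^sup>+ \<omega>. f \<omega> \<partial>random_tape) \<le> (\<integral>\<^sup>+ a. (\<Sum>p\<in>S. h a p * ennreal (1 / real (card S))) \<partial>random_tape)"
proof -
  have m: "f \<in> borel_measurable random_tape"
    by (rule f)
  have m2: "(\<lambda>b. f (comb_seq d a b)) \<in> borel_measurable random_tape" for a
  proof -
    have "(\<lambda>b. comb_seq d a b) \<in> measurable random_tape random_tape"
      using measurable_comb_seq'[of "\<lambda>_. a" random_tape "density lborel std_normal_density" "\<lambda>b. b" d]
      by (simp add: random_tape_def space_PiM)
    from measurable_compose[OF this m] show ?thesis .
  qed
  have le: "f (comb_seq d a (comb_seq n b w)) \<le> g a (pivot S b) w" for a b w
  proof -
    have s: "shift (d + n) (comb_seq d a (comb_seq n b w)) = w"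
      by (auto simp: shift_def comb_seq_def fun_eq_iff)
    \<comment> \<open>\<open>S\<close> contains only indices below \<open>n\<close>, and the first
      \<open>n\<close> keys come from \<open>b\<close>.\<close>
    have p: "pivot S (shift d (comb_seq d a (comb_seq n b w))) = pivot S b"
    proof -
      have "comb_seq n b w i = b i" if "i \<in> S" for i
        using that S(3) by (auto simp: comb_seq_def)
      then have "(p \<in> S \<and> (\<forall>i\<in>S. comb_seq n b w p \<le> comb_seq n b w i)) \<longleftrightarrow> (p \<in> S \<and> (\<forall>i\<in>S. b p \<le> b i))" for p
        by auto
      then show ?thesis
        by (simp add: pivot_def)
    qed
    have "g (comb_seq d a (comb_seq n b w)) p' w = g a p' w" for p'
      by (rule g) (simp add: comb_seq_def)
    then show ?thesis
      using f(2)[of "comb_seq d a (comb_seq n b w)"] unfolding s p by simp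
  qed
  have "(\<integral>\<^sup>+ \<omega>. f \<omega> \<partial>random_tape)
      \<le> (\<integral>\<^sup>+ a. \<integral>\<^sup>+ b. \<integral>\<^sup>+ w. g a (pivot S b) w \<partial>random_tape \<partial>random_tape \<partial>random_tape)"
    unfolding nn_integral_tape_split[OF m, where k = d] nn_integral_tape_split[OF m2, where k = n]
    by (intro nn_integral_mono le)
  also have "\<dots> \<le> (\<integral>\<^sup>+ a. (\<Sum>p\<in>S. h a p * ennreal (1 / real (card S))) \<partial>random_tape)"
  proof (rule nn_integral_mono)
    fix a
    have "(\<integral>\<^sup>+ b. \<integral>\<^sup>+ w. g a (pivot S b) w \<partial>random_tape \<partial>random_tape)
        \<le> (\<integral>\<^sup>+ b. (\<Sum>p\<in>S. h a p * indicator {b. pivot S b = p} b) \<partial>random_tape)"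
    proof (rule nn_integral_mono)
      fix b
      have p: "pivot S b \<in> S"
        using pivot_props(1)[OF S(1,2)] .
      have "(\<Sum>p\<in>S. h a p * indicator {b. pivot S b = p} b) = (\<Sum>p\<in>{pivot S b}. h a p * indicator {b. pivot S b = p} b)"
        using p S(1) by (intro sum.mono_neutral_right) (auto simp: indicator_def)
      then show "(\<integral>\<^sup>+ w. g a (pivot S b) w \<partial>random_tape) \<le> (\<Sum>p\<in>S. h a p * indicator {b. pivot S b = p} b)"
        using h[OF p] by simp
    qed
    also have "\<dots> = (\<Sum>p\<in>S. h a p * emeasure random_tape {b. pivot S b = p})"
    proof -
      have "{b. pivot S b = p} \<in> sets random_tape" for p
        using measurable_sets[OF measurable_pivot[OF S(1)], of "{p}"] by (simp add: vimage_def)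
      then show ?thesis
        by (subst nn_integral_sum) (auto simp: nn_integral_cmult)
    qed
    also have "\<dots> \<le> (\<Sum>p\<in>S. h a p * ennreal (1 / real (card S)))"
      using emeasure_pivot[OF S(1)] by (intro sum_mono mult_left_mono) auto
    finally show "(\<integral>\<^sup>+ b. \<integral>\<^sup>+ w. g a (pivot S b) w \<partial>random_tape \<partial>random_tape)
        \<le> (\<Sum>p\<in>S. h a p * ennreal (1 / real (card S)))" .
  qed
  finally show ?thesis .
qed

section \<open>Growth around a query point\<close>

lemma finite_extremal:
  fixes f :: "'a \<Rightarrow> real"
  assumes "finite A" "A \<noteq> {}"
  obtains i where "i \<in> A" "\<And>j. j \<in> A \<Longrightarrow> f i \<le> f j"
  using arg_min_if_finite(1)[OF assms, of f] arg_min_least[OF assms, of _ f] by blast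

text \<open>The value at \<open>i\<close> is the \<open>k\<close>-th smallest one; because of ties
  it is described by two counts instead of one equality.\<close>

lemma order_statistic:
  fixes f :: "'a \<Rightarrow> real"
  assumes "finite I" "1 \<le> k" "k \<le> card I"
  shows "\<exists>i\<in>I. k \<le> card {j \<in> I. f j \<le> f i} \<and> card {j \<in> I. f j < f i} < k"
proof -
  let ?P = "{i \<in> I. k \<le> card {j \<in> I. f j \<le> f i}}"
  have ne: "I \<noteq> {}"
    using assms by auto
  obtain m where m: "m \<in> I" "\<And>j. j \<in> I \<Longrightarrow> f j \<le> f m"
    using finite_extremal[OF assms(1) ne, of "\<lambda>i. - f i"] by auto
  then have "{j \<in> I. f j \<le> f m} = I"
    by auto
  then have "m \<in> ?P"
    using m assms by simp
  then have "finite ?P" "?P \<noteq> {}"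
    using assms(1) by auto
  then obtain i where i: "i \<in> ?P" "\<And>j. j \<in> ?P \<Longrightarrow> f i \<le> f j"
    using finite_extremal[of ?P f] by blast
  have "card {j \<in> I. f j < f i} < k"
  proof (rule ccontr)
    assume "\<not> card {j \<in> I. f j < f i} < k"
    then have k: "k \<le> card {j \<in> I. f j < f i}"
      by simp
    let ?L = "{j \<in> I. f j < f i}"
    have "finite ?L"
      using assms(1) by simp
    moreover have "card ?L \<noteq> 0"
      using assms(2) k by linarith
    ultimately have "finite ?L" "?L \<noteq> {}"
      by auto
    then obtain l where l: "l \<in> ?L" "\<And>j. j \<in> ?L \<Longrightarrow> f j \<le> f l"
      using finite_extremal[of ?L "\<lambda>i. - f i"] by (metis neg_le_iff_le)
    have "j \<in> {j \<in> I. f j \<le> f l} \<longleftrightarrow> j \<in> ?L" for j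
      using l(1) l(2)[of j] by auto
    then have "{j \<in> I. f j \<le> f l} = ?L"
      by blast
    then have "l \<in> ?P"
      using l k by simp
    then show False
      using i(2)[of l] l by simp
  qed
  then show ?thesis
    using i by blast
qed

lemma l2_dist_triangle: "l2_dist d x z \<le> l2_dist d x y + l2_dist d y z"
  using L2_set_triangle_ineq[of "\<lambda>i. x i - y i" "\<lambda>i. y i - z i" "{..<d}"] by (simp add: l2_dist_def)

lemma l2_dist_commute: "l2_dist d x y = l2_dist d y x"
  by (simp add: l2_dist_def L2_set_def power2_commute)

lemma l2_dist_nonneg: "0 \<le> l2_dist d x y"
  by (simp add: l2_dist_def)

locale expanding = points +
  fixes \<tau> c :: real
  assumes inj: "inj_on x {..<n}" and x_in: "x ` {..<n} \<subseteq> l2_space d" and n_ge: "2 \<le> n" and c_gt: "1 < c"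
    and expansion: "expansion_rate (l2_space d) (l2_dist d) (x ` {..<n}) \<tau> c"
begin

definition ball_count :: "(nat \<Rightarrow> real) \<Rightarrow> real \<Rightarrow> nat" where
  "ball_count p r = card {i. i < n \<and> l2_dist d p (x i) \<le> r}"

lemma expand:
  assumes p: "p \<in> l2_space d" "0 < r" "\<tau> \<le> real (ball_count p r)"
  shows "real (ball_count p (2 * r)) \<le> c * real (ball_count p r)"
proof -
  have "card (x ` {..<n} \<inter> Metric_space.mcball (l2_space d) (l2_dist d) p s) = ball_count p s" for s
  proof -
    have "x ` {..<n} \<inter> Metric_space.mcball (l2_space d) (l2_dist d) p s = x ` {i. i < n \<and> l2_dist d p (x i) \<le> s}"
      using x_in p(1) by (auto simp: Metric_space.mcball_def[OF Metric_space_l2])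
    moreover have "inj_on x {i. i < n \<and> l2_dist d p (x i) \<le> s}"
      using inj by (rule inj_on_subset) auto
    ultimately show ?thesis
      by (simp add: ball_count_def card_image)
  qed
  then show ?thesis
    using expansion p unfolding expansion_rate_def by metis
qed

lemma ball_count_mono: "r \<le> s \<Longrightarrow> ball_count p r \<le> ball_count p s"
  unfolding ball_count_def by (intro card_mono) auto

lemma expand_power:
  assumes "p \<in> l2_space d" "0 < r" "\<tau> \<le> real (ball_count p r)"
  shows "real (ball_count p (2 ^ j * r)) \<le> c ^ j * real (ball_count p r)"
proof (induction j)
  case (Suc j)
  have "ball_count p r \<le> ball_count p (2 ^ j * r)"
    using assms by (intro ball_count_mono) simp
  then have "real (ball_count p (2 * (2 ^ j * r))) \<le> c * real (ball_count p (2 ^ j * r))"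
    using assms by (intro expand) auto
  also have "\<dots> \<le> c * (c ^ j * real (ball_count p r))"
    using Suc c_gt by simp
  finally show ?case
    by (simp add: mult_ac)
qed simp

lemma x_space: "i < n \<Longrightarrow> x i \<in> l2_space d"
  using x_in by auto

lemma x_separated:
  assumes "i < n" "j < n" "i \<noteq> j"
  shows "0 < L2_set (\<lambda>k. x i k - x j k) {..<d}"
proof -
  have "x i \<noteq> x j"
    using inj assms by (auto simp: inj_on_def)
  then have "l2_dist d (x i) (x j) \<noteq> 0"
    using Metric_space.zero[OF Metric_space_l2 x_space[OF assms(1)] x_space[OF assms(2)]] by simp
  then show ?thesis
    using l2_dist_nonneg[of d "x i" "x j"] unfolding l2_dist_def by linarith
qed

lemma d_ge: "1 \<le> d"
proof (rule ccontr)
  assume "\<not> 1 \<le> d"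
  then have "d = 0"
    by simp
  then have "{..<d} = {}"
    by simp
  then show False
    using x_separated[of 0 1] n_ge by (simp only: L2_set_empty) simp
qed

lemma nearest_exists: "\<exists>t<n. \<forall>i<n. l2_dist d p (x t) \<le> l2_dist d p (x i)"
proof -
  have "finite {..<n}" "{..<n} \<noteq> {}"
    using n_ge by (auto simp: lessThan_empty_iff)
  from finite_extremal[OF this, of "\<lambda>i. l2_dist d p (x i)"] show ?thesis
    by (metis lessThan_iff)
qed

text \<open>For \<open>\<tau> \<le> 0\<close> the expansion condition would apply to empty balls, but an empty ball around
  a point outside of the set grows into a nonempty one.\<close>

lemma \<tau>_pos: "0 < \<tau>"
proof (rule ccontr)
  assume neg: "\<not> 0 < \<tau>"
  define y :: "nat \<Rightarrow> nat \<Rightarrow> real" where "y m = (\<lambda>k. if k = 0 then real m else 0)" for m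
  have "inj y"
    by (rule injI) (metis y_def of_nat_eq_iff)
  then have "\<not> range y \<subseteq> x ` {..<n}"
    by (meson finite_imageI finite_lessThan finite_subset infinite_UNIV_nat range_inj_infinite)
  then obtain m where m: "y m \<notin> x ` {..<n}"
    by blast
  have y_in: "y m \<in> l2_space d"
    using d_ge by (auto simp: y_def l2_space_def)
  obtain t where t: "t < n" "\<And>i. i < n \<Longrightarrow> l2_dist d (y m) (x t) \<le> l2_dist d (y m) (x i)"
    using nearest_exists[of "y m"] by blast
  let ?r = "l2_dist d (y m) (x t)"
  have "?r \<noteq> 0"
    using Metric_space.zero[OF Metric_space_l2 y_in x_space[OF t(1)]] m t(1) by auto
  then have r: "0 < ?r"
    using l2_dist_nonneg[of d "y m" "x t"] by simp
  \<comment> \<open>A ball whose radius is two thirds of the distance to the nearest point is empty,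
    whereas the doubled ball contains that point.\<close>
  have "{i. i < n \<and> l2_dist d (y m) (x i) \<le> 2 / 3 * ?r} = {}"
    using t r by force
  then have 0: "ball_count (y m) (2 / 3 * ?r) = 0"
    by (simp only: ball_count_def card.empty)
  have "real (ball_count (y m) (2 * (2 / 3 * ?r))) \<le> c * real (ball_count (y m) (2 / 3 * ?r))"
    using y_in r neg by (intro expand) auto
  then have "ball_count (y m) (2 * (2 / 3 * ?r)) = 0"
    unfolding 0 by simp
  then have "{i. i < n \<and> l2_dist d (y m) (x i) \<le> 2 * (2 / 3 * ?r)} = {}"
    unfolding ball_count_def by (subst (asm) card_0_eq) simp_all
  moreover have "t \<in> {i. i < n \<and> l2_dist d (y m) (x i) \<le> 2 * (2 / 3 * ?r)}"
    using t(1) r by simp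
  ultimately show False
    by blast
qed

text \<open>The center moves to \<open>q + s * u\<close>, where no two points have the same
  projection to \<open>u\<close>; a Gaussian vector has this property almost surely. In the
  difference of two squared distances the terms quadratic in \<open>s\<close> cancel, so each pair
  of points ties for one value of \<open>s\<close> only, and all but finitely many small
  \<open>s\<close> are suitable.\<close>

lemma generic_center:
  assumes q: "q \<in> l2_space d" and h: "0 < h"
  shows "\<exists>p\<in>l2_space d. l2_dist d q p \<le> h \<and> inj_on (\<lambda>i. l2_dist d p (x i)) {..<n}"
proof -
  have "AE u in random_tape. \<forall>i\<in>{..<n}. \<forall>j\<in>{..<n}. i \<noteq> j \<longrightarrow> dot d u (\<lambda>k. x i k - x j k) \<noteq> 0"
  proof (intro AE_finite_allI)
    fix i j assume "i \<in> {..<n}" "j \<in> {..<n}"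
    then show "AE u in random_tape. i \<noteq> j \<longrightarrow> dot d u (\<lambda>k. x i k - x j k) \<noteq> 0"
      using dot_nonzero[OF x_separated[of i j]] by (cases "i = j") auto
  qed auto
  moreover have "ae_filter random_tape \<noteq> bot"
    using tape.P.emeasure_space_1 by (simp add: ae_filter_eq_bot_iff)
  ultimately have "\<exists>u. \<forall>i\<in>{..<n}. \<forall>j\<in>{..<n}. i \<noteq> j \<longrightarrow> dot d u (\<lambda>k. x i k - x j k) \<noteq> 0"
    by (intro eventually_happens')
  then obtain u where u: "\<And>i j. i < n \<Longrightarrow> j < n \<Longrightarrow> i \<noteq> j \<Longrightarrow> dot d u (\<lambda>k. x i k - x j k) \<noteq> 0"
    by auto
  define a where "a i = (\<Sum>k<d. (q k - x i k)\<^sup>2)" for i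
  let ?bad = "(\<lambda>(i, j). (a j - a i) / (2 * dot d u (\<lambda>k. x j k - x i k))) ` ({..<n} \<times> {..<n})"
  define w where "w = L2_set u {..<d}"
  have w: "0 \<le> w"
    by (simp add: w_def)
  have "infinite ({0<..<h / (w + 1)} - ?bad)"
    using h w by (intro Diff_infinite_finite) (auto simp: infinite_Ioo)
  then have "{0<..<h / (w + 1)} - ?bad \<noteq> {}"
    by (intro notI) (simp only: finite.emptyI not_True_eq_False)
  then obtain s where "s \<in> {0<..<h / (w + 1)} - ?bad"
    by blast
  then have "s \<in> {0<..<h / (w + 1)}" and s_good: "s \<notin> ?bad"
    by blast+
  then have s: "0 < s" "s < h / (w + 1)"
    by simp_all
  define p where "p = (\<lambda>k. if k < d then q k + s * u k else 0)"
  have "l2_dist d q p = L2_set (\<lambda>k. s * u k) {..<d}"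
    unfolding l2_dist_def p_def L2_set_def by (intro arg_cong[where f = sqrt] sum.cong) auto
  also have "\<dots> = s * w"
    using s L2_set_right_distrib[of s u "{..<d}"] by (simp add: w_def)
  also have "\<dots> \<le> h"
  proof -
    have "s * (w + 1) \<le> h"
      using s w by (simp add: field_simps)
    then show ?thesis
      using s by (simp add: distrib_left)
  qed
  finally have "l2_dist d q p \<le> h" .
  moreover have "p \<in> l2_space d"
    by (simp add: p_def l2_space_def)
  moreover have "inj_on (\<lambda>i. l2_dist d p (x i)) {..<n}"
  proof (rule inj_onI, rule ccontr)
    fix i j assume ij: "i \<in> {..<n}" "j \<in> {..<n}" "l2_dist d p (x i) = l2_dist d p (x j)" "i \<noteq> j"
    define e where "e = (\<Sum>k<d. (s * u k)\<^sup>2)"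
    have sq: "(\<Sum>k<d. (p k - x l k)\<^sup>2) = a l + 2 * s * dot d u (\<lambda>k. q k - x l k) + e" for l
    proof -
      have "(\<Sum>k<d. (p k - x l k)\<^sup>2) = (\<Sum>k<d. (q k - x l k)\<^sup>2 + 2 * s * (u k * (q k - x l k)) + (s * u k)\<^sup>2)"
        by (intro sum.cong refl) (simp add: p_def power2_eq_square algebra_simps)
      then show ?thesis
        by (simp add: sum.distrib a_def e_def dot_def sum_distrib_left)
    qed
    have "(\<Sum>k<d. (p k - x i k)\<^sup>2) = (\<Sum>k<d. (p k - x j k)\<^sup>2)"
      using ij(3) by (simp add: l2_dist_def L2_set_def)
    then have "2 * s * (dot d u (\<lambda>k. q k - x i k) - dot d u (\<lambda>k. q k - x j k)) = a j - a i"
      unfolding sq by (simp add: algebra_simps)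
    moreover have "dot d u (\<lambda>k. q k - x i k) - dot d u (\<lambda>k. q k - x j k) = dot d u (\<lambda>k. x j k - x i k)"
      by (simp add: dot_def sum_subtractf[symmetric] algebra_simps)
    ultimately have "s = (a j - a i) / (2 * dot d u (\<lambda>k. x j k - x i k))"
      using u[of j i] ij by (simp add: field_simps)
    then have "s \<in> ?bad"
      using ij by (intro image_eqI[where x = "(i, j)"]) auto
    then show False
      using s_good by blast
  qed
  ultimately show ?thesis
    by blast
qed

text \<open>All points in a ball may have the same distance from \<open>q\<close>. A small perturbation of the
  center makes the distances distinct, so that there is a ball with exactly \<open>k\<close> points.\<close>

lemma growth_exists:
  assumes q: "q \<in> l2_space d"
  shows "\<exists>\<rho> k t. 0 < \<rho> \<and> 1 \<le> k \<and> real k \<le> \<tau> + 1 \<and> t < n \<and> l2_dist d q (x t) \<le> \<rho>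
    \<and> (\<forall>i<n. l2_dist d q (x t) \<le> l2_dist d q (x i))
    \<and> (\<forall>j. real (card {i. i < n \<and> l2_dist d q (x i) < 2 ^ j * \<rho>}) \<le> c ^ j * real k)"
proof -
  obtain t where t: "t < n" "\<And>i. i < n \<Longrightarrow> l2_dist d q (x t) \<le> l2_dist d q (x i)"
    using nearest_exists[of q] by blast
  define k where "k = nat \<lceil>\<tau>\<rceil>"
  have k: "1 \<le> k" "\<tau> \<le> real k" "real k \<le> \<tau> + 1"
    using \<tau>_pos unfolding k_def by linarith+
  have cj: "1 \<le> c ^ j" for j
    using c_gt by (simp add: one_le_power)
  show ?thesis
  proof (cases "n \<le> k")
    \<comment> \<open>With at most \<open>k\<close> points in total, \<open>n\<close> takes the
      place of \<open>k\<close>, and every radius beyond the nearest point will do.\<close>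
    case True
    have "real (card {i. i < n \<and> l2_dist d q (x i) < 2 ^ j * (l2_dist d q (x t) + 1)}) \<le> c ^ j * real n" for j
    proof -
      have "card {i. i < n \<and> l2_dist d q (x i) < 2 ^ j * (l2_dist d q (x t) + 1)} \<le> card {..<n}"
        by (intro card_mono) auto
      then have "real (card {i. i < n \<and> l2_dist d q (x i) < 2 ^ j * (l2_dist d q (x t) + 1)}) \<le> 1 * real n"
        by simp
      also have "\<dots> \<le> c ^ j * real n"
        using cj by (intro mult_right_mono) auto
      finally show ?thesis .
    qed
    moreover have "real n \<le> \<tau> + 1" "1 \<le> n" "0 < l2_dist d q (x t) + 1"
      using True k n_ge l2_dist_nonneg[of d q "x t"] by linarith+
    ultimately show ?thesis
      using t by (intro exI[of _ "l2_dist d q (x t) + 1"] exI[of _ n] exI[of _ t]) auto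
  next
    case False
    define f where "f i = l2_dist d q (x i)" for i
    obtain i0 where i0: "i0 < n" "k \<le> card {j \<in> {..<n}. f j \<le> f i0}" "card {j \<in> {..<n}. f j < f i0} < k"
      using order_statistic[of "{..<n}" k f] k False by auto
    show ?thesis
    proof (cases "f i0 = 0")
      \<comment> \<open>The points are distinct, so a \<open>k\<close>-th distance of 0 forces
        \<open>k = 1\<close>. As \<rho> must be positive, half of the least distance to another
        point is taken; the ball then contains just one point.\<close>
      case True
      let ?R = "f ` ({..<n} - {i0})"
      have pos: "0 < f i" if "i < n" "i \<noteq> i0" for i
      proof -
        have "q = x i0"
          using True Metric_space.zero[OF Metric_space_l2 q x_space[OF i0(1)]] by (simp add: f_def)
        then show ?thesis
          using x_separated[of i0 i] that i0(1) by (simp add: f_def l2_dist_def)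
      qed
      have "0 \<in> {..<n} - {i0} \<or> 1 \<in> {..<n} - {i0}"
        using n_ge by auto
      then have R: "finite ?R" "?R \<noteq> {}"
        by auto
      define \<rho> where "\<rho> = Min ?R / 2"
      have "0 < Min ?R"
        using R pos by (subst Min_gr_iff) auto
      then have \<rho>: "0 < \<rho>" "\<And>i. i < n \<Longrightarrow> i \<noteq> i0 \<Longrightarrow> \<rho> < f i"
      proof -
        show "0 < \<rho>"
          using \<open>0 < Min ?R\<close> by (simp add: \<rho>_def)
        fix i assume "i < n" "i \<noteq> i0"
        then have "Min ?R \<le> f i"
          using R by (intro Min_le) auto
        then show "\<rho> < f i"
          using \<open>0 < Min ?R\<close> by (simp add: \<rho>_def)
      qed
      have only: "{i. i < n \<and> l2_dist d q (x i) \<le> \<rho>} = {i0}"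
        using \<rho> True i0(1) by (force simp: f_def)
      have one: "ball_count q \<rho> = 1"
        unfolding ball_count_def only by simp
      have "{j \<in> {..<n}. f j \<le> f i0} = {i0}"
        using True pos i0(1) by force
      then have "k = 1"
        using i0(2) k(1) by simp
      have "real (card {i. i < n \<and> l2_dist d q (x i) < 2 ^ j * \<rho>}) \<le> c ^ j * real 1" for j
      proof -
        have "card {i. i < n \<and> l2_dist d q (x i) < 2 ^ j * \<rho>} \<le> ball_count q (2 ^ j * \<rho>)"
          unfolding ball_count_def by (intro card_mono) auto
        moreover have "real (ball_count q (2 ^ j * \<rho>)) \<le> c ^ j * real (ball_count q \<rho>)"
          using q \<rho>(1) k(2) one \<open>k = 1\<close> by (intro expand_power) auto
        ultimately show ?thesis
          using one by simp
      qed
      moreover have "l2_dist d q (x t) \<le> \<rho>"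
        using t(2)[OF i0(1)] True \<rho>(1) by (simp add: f_def)
      ultimately show ?thesis
        using t \<rho>(1) k \<open>k = 1\<close> by (intro exI[of _ \<rho>] exI[of _ 1] exI[of _ t]) auto
    next
      case ne: False
      define \<rho> where "\<rho> = f i0"
      have \<rho>: "0 < \<rho>"
        using ne l2_dist_nonneg[of d q "x i0"] by (simp add: \<rho>_def f_def)
      have "real (card {i. i < n \<and> f i < 2 ^ j * \<rho>}) \<le> c ^ j * real k" for j
      proof -
        let ?A = "{i. i < n \<and> f i < 2 ^ j * \<rho>}"
        have fin: "finite (f ` ?A)"
          by simp
        obtain g where g: "0 < g" "\<And>i. i \<in> ?A \<Longrightarrow> f i \<le> 2 ^ j * \<rho> - g"
        proof (cases "?A = {}")
          case True
          then show ?thesis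
            using that[of 1] by auto
        next
          case False
          then have "Max (f ` ?A) \<in> f ` ?A" "\<And>i. i \<in> ?A \<Longrightarrow> f i \<le> Max (f ` ?A)"
            using fin by (auto intro: Max_in)
          then show ?thesis
            using that[of "2 ^ j * \<rho> - Max (f ` ?A)"] by auto
        qed
        \<comment> \<open>Within the open ball of radius \<open>2 ^ j * \<rho>\<close> all distances
          are smaller than the radius by at least \<open>g\<close>, so a shift of the center by
          \<open>h\<close> keeps these points inside; this is what the strict inequality in the
          count is for. \<open>h\<close> may depend on \<open>j\<close>, as \<rho> and
          \<open>k\<close> do not.\<close>
        define h where "h = min (\<rho> / 2) (g / (2 ^ j + 1))"
        have h: "0 < h" "h < \<rho>" "(2 ^ j + 1) * h \<le> g"
        proof -
          have "h \<le> g / (2 ^ j + 1)"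
            by (simp add: h_def)
          moreover have "0 < (2 :: real) ^ j + 1"
            by (simp add: add_pos_pos)
          ultimately show "(2 ^ j + 1) * h \<le> g"
            by (simp add: pos_le_divide_eq mult.commute)
          show "0 < h" "h < \<rho>"
            using \<rho> g \<open>0 < (2 :: real) ^ j + 1\<close> by (auto simp: h_def)
        qed
        obtain p where p: "p \<in> l2_space d" "l2_dist d q p \<le> h" "inj_on (\<lambda>i. l2_dist d p (x i)) {..<n}"
          using generic_center[OF q h(1)] by blast
        define e where "e i = l2_dist d p (x i)" for i
        obtain i1 where i1: "i1 < n" "k \<le> card {j \<in> {..<n}. e j \<le> e i1}" "card {j \<in> {..<n}. e j < e i1} < k"
          using order_statistic[of "{..<n}" k e] k False by auto
        have iff: "e j = e i1 \<longleftrightarrow> j = i1" if "j < n" for j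
          using inj_on_eq_iff[OF p(3), of j i1] that i1(1) by (simp add: e_def)
        have "j \<in> {j \<in> {..<n}. e j \<le> e i1} \<longleftrightarrow> j \<in> insert i1 {j \<in> {..<n}. e j < e i1}" for j
          using iff[of j] i1(1) by (cases "j < n"; cases "j = i1") (auto simp: order.order_iff_strict)
        then have "{j \<in> {..<n}. e j \<le> e i1} = insert i1 {j \<in> {..<n}. e j < e i1}"
          by blast
        then have "card {j \<in> {..<n}. e j \<le> e i1} \<le> k"
          using i1(3) by simp
        then have "card {j \<in> {..<n}. e j \<le> e i1} = k"
          using i1(2) by simp
        then have count: "ball_count p (e i1) = k"
          by (simp add: ball_count_def e_def)
        have fe: "f i \<le> e i + h" "e i \<le> f i + h" for i
          using l2_dist_triangle[of d q "x i" p] l2_dist_triangle[of d p "x i" q] p(2)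
          unfolding f_def e_def l2_dist_commute[of d p q] by linarith+
        have r: "\<rho> - h \<le> e i1"
        proof (rule ccontr)
          assume "\<not> \<rho> - h \<le> e i1"
          then have "f j < f i0" if "e j \<le> e i1" for j
            using fe(1)[of j] that unfolding \<rho>_def by linarith
          then have "{j \<in> {..<n}. e j \<le> e i1} \<subseteq> {j \<in> {..<n}. f j < f i0}"
            by blast
          then have "card {j \<in> {..<n}. e j \<le> e i1} \<le> card {j \<in> {..<n}. f j < f i0}"
            by (intro card_mono) auto
          then show False
            using i0(3) i1(2) by simp
        qed
        have "?A \<subseteq> {i. i < n \<and> e i \<le> 2 ^ j * e i1}"
        proof
          fix i assume i: "i \<in> ?A"
          have "e i \<le> 2 ^ j * \<rho> - g + h"
            using g(2)[OF i] fe(2)[of i] by linarith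
          also have "\<dots> \<le> 2 ^ j * \<rho> - (2 ^ j + 1) * h + h"
            using h(3) by linarith
          also have "\<dots> = 2 ^ j * (\<rho> - h)"
            by (simp add: algebra_simps)
          also have "\<dots> \<le> 2 ^ j * e i1"
            using r by simp
          finally show "i \<in> {i. i < n \<and> e i \<le> 2 ^ j * e i1}"
            using i by simp
        qed
        then have "card ?A \<le> ball_count p (2 ^ j * e i1)"
          unfolding ball_count_def e_def by (intro card_mono) auto
        moreover have "real (ball_count p (2 ^ j * e i1)) \<le> c ^ j * real (ball_count p (e i1))"
          using p(1) r h(2) count k(2) by (intro expand_power) auto
        ultimately show ?thesis
          unfolding count by linarith
      qed
      moreover have "l2_dist d q (x t) \<le> \<rho>"
        using t(2)[OF i0(1)] by (simp add: \<rho>_def f_def)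
      ultimately show ?thesis
        using t \<rho> k unfolding f_def by (intro exI[of _ \<rho>] exI[of _ k] exI[of _ t]) auto
    qed
  qed
qed

end

section \<open>Splitting a cell at a random pivot\<close>

text \<open>\<open>v\<close> is a projection in which the query has value 0; the near side is the
  one that contains 0.\<close>

definition near_side :: "(nat \<Rightarrow> real) \<Rightarrow> nat set \<Rightarrow> nat \<Rightarrow> nat set" where
  "near_side v S p = (if 0 < v p then {i \<in> S - {p}. v i < v p} else {i \<in> S - {p}. \<not> v i < v p})"

definition far_side :: "(nat \<Rightarrow> real) \<Rightarrow> nat set \<Rightarrow> nat \<Rightarrow> nat set" where
  "far_side v S p = (if 0 < v p then {i \<in> S - {p}. \<not> v i < v p} else {i \<in> S - {p}. v i < v p})"

lemma sides:
  assumes "finite S" "p \<in> S"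
  shows "finite (near_side v S p)" "finite (far_side v S p)" "near_side v S p \<subseteq> S" "far_side v S p \<subseteq> S"
    "card (near_side v S p) + card (far_side v S p) + 1 = card S" "near_side v S p \<inter> far_side v S p = {}"
    "near_side v S p \<union> far_side v S p = S - {p}"
proof -
  have mem: "i \<in> near_side v S p \<longleftrightarrow> i \<in> S \<and> i \<noteq> p \<and> (0 < v p \<longleftrightarrow> v i < v p)"
    "i \<in> far_side v S p \<longleftrightarrow> i \<in> S \<and> i \<noteq> p \<and> (0 < v p \<longleftrightarrow> \<not> v i < v p)" for i
    by (simp_all add: near_side_def far_side_def)
  show d: "near_side v S p \<inter> far_side v S p = {}"
    using mem by blast
  show u: "near_side v S p \<union> far_side v S p = S - {p}"
    using mem by blast
  show sub: "near_side v S p \<subseteq> S" "far_side v S p \<subseteq> S"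
    using mem by blast+
  show f: "finite (near_side v S p)" "finite (far_side v S p)"
    using sub assms(1) by (simp_all only: finite_subset)
  have "card (near_side v S p) + card (far_side v S p) = card (S - {p})"
    using card_Un_disjoint[OF f d] u by simp
  then show "card (near_side v S p) + card (far_side v S p) + 1 = card S"
    using card.remove[OF assms] by linarith
qed

text \<open>By injectivity each pair of distinct points is counted exactly once in either
  sum.\<close>

lemma sum_card_less:
  fixes v :: "nat \<Rightarrow> real"
  assumes "finite A" "inj_on v A"
  shows "(\<Sum>p\<in>A. real (card {i \<in> A. v p < v i})) = real (card A) * (real (card A) - 1) / 2"
    "(\<Sum>p\<in>A. real (card {i \<in> A. v i < v p})) = real (card A) * (real (card A) - 1) / 2"
proof -
  let ?X = "\<Sum>p\<in>A. \<Sum>i\<in>A. if v p < v i then 1 else 0 :: real"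
  let ?Y = "\<Sum>p\<in>A. \<Sum>i\<in>A. if v i < v p then 1 else 0 :: real"
  have X: "(\<Sum>p\<in>A. real (card {i \<in> A. v p < v i})) = ?X"
    using assms(1) by (intro sum.cong refl) (simp add: sum.If_cases Int_def)
  have Y: "(\<Sum>p\<in>A. real (card {i \<in> A. v i < v p})) = ?Y"
    using assms(1) by (intro sum.cong refl) (simp add: sum.If_cases Int_def)
  have eq: "?X = ?Y"
    by (rule sum.swap)
  have "?X + ?Y = (\<Sum>p\<in>A. \<Sum>i\<in>A. if i = p then 0 else 1)"
    unfolding sum.distrib[symmetric]
    by (intro sum.cong refl) (use inj_onD[OF assms(2)] in \<open>auto simp: not_less dest: antisym\<close>)
  also have "\<dots> = (\<Sum>p\<in>A. real (card A) - 1)"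
  proof (rule sum.cong[OF refl])
    fix p assume p: "p \<in> A"
    have "(\<Sum>i\<in>A. if i = p then 0 else 1 :: real) = (\<Sum>i\<in>A. 1 - (if i = p then 1 else 0))"
      by (intro sum.cong) auto
    then show "(\<Sum>i\<in>A. if i = p then 0 else 1 :: real) = real (card A) - 1"
      using p assms(1) by (simp add: sum_subtractf)
  qed
  also have "\<dots> = real (card A) * (real (card A) - 1)"
    by simp
  finally have "?X = real (card A) * (real (card A) - 1) / 2" "?Y = real (card A) * (real (card A) - 1) / 2"
    using eq by auto
  then show "(\<Sum>p\<in>A. real (card {i \<in> A. v p < v i})) = real (card A) * (real (card A) - 1) / 2"
    "(\<Sum>p\<in>A. real (card {i \<in> A. v i < v p})) = real (card A) * (real (card A) - 1) / 2"
    using X Y by simp_all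
qed

text \<open>\<open>O1\<close> and \<open>O2\<close> are the points on the two sides of a center, and
  \<open>F p\<close> contains those that lie further out than \<open>p\<close> on the same side.
  Groups of sizes a and b contribute half of a(a + 1) + b(b + 1), which for a given total is least
  when the groups are equal.\<close>

lemma sum_outer_ge:
  fixes v :: "nat \<Rightarrow> real"
  assumes S: "finite S" "inj_on v S" and O: "O1 \<subseteq> S" "O2 \<subseteq> S" "O1 \<inter> O2 = {}"
    and f: "\<And>p. p \<in> O1 \<Longrightarrow> {i \<in> O1. v p < v i} \<subseteq> F p" "\<And>p. p \<in> O2 \<Longrightarrow> {i \<in> O2. v i < v p} \<subseteq> F p"
      "\<And>p. finite (F p)"
  shows "real (card O1 + card O2) * (real (card O1 + card O2) + 2) / 4 \<le> (\<Sum>p\<in>O1 \<union> O2. real (card (F p)) + 1)"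
proof -
  have fin: "finite O1" "finite O2" "inj_on v O1" "inj_on v O2"
    using S O finite_subset inj_on_subset by blast+
  let ?a = "real (card O1)" and ?b = "real (card O2)"
  have "(?a + ?b) * ((?a + ?b) + 2) / 4 \<le> ?a * (?a - 1) / 2 + ?a + (?b * (?b - 1) / 2 + ?b)"
  proof -
    have "0 \<le> (?a - ?b)\<^sup>2"
      by simp
    then show ?thesis
      by (simp add: power2_eq_square field_simps)
  qed
  also have "?a * (?a - 1) / 2 + ?a \<le> (\<Sum>p\<in>O1. real (card (F p)) + 1)"
    unfolding sum_card_less(1)[OF fin(1,3), symmetric] sum.distrib
    by (intro add_mono sum_mono of_nat_mono card_mono f(1,3)) auto
  also have "?b * (?b - 1) / 2 + ?b \<le> (\<Sum>p\<in>O2. real (card (F p)) + 1)"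
    unfolding sum_card_less(2)[OF fin(2,4), symmetric] sum.distrib
    by (intro add_mono sum_mono of_nat_mono card_mono f(2,3)) auto
  finally show ?thesis
    using sum.union_disjoint[OF fin(1,2) O(3), of "\<lambda>p. real (card (F p)) + 1"] by simp
qed

text \<open>For \<open>A = S\<close>: wherever the query lies, a random pivot puts about a quarter
  of the cell on the far side on average.\<close>

lemma sum_far_ge:
  assumes S: "finite S" "inj_on v S" and O: "A \<subseteq> S"
  shows "real (card A) * (real (card A) + 2) / 4 \<le> (\<Sum>p\<in>A. real (card (far_side v S p)) + 1)"
proof -
  let ?O1 = "{p \<in> A. 0 < v p}" and ?O2 = "{p \<in> A. \<not> 0 < v p}"
  have u: "?O1 \<union> ?O2 = A" "?O1 \<inter> ?O2 = {}"
    by auto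
  have fin: "finite A"
    using S O finite_subset by blast
  have c: "card ?O1 + card ?O2 = card A"
    using card_Un_disjoint[of ?O1 ?O2] fin u by simp
  have "real (card ?O1 + card ?O2) * (real (card ?O1 + card ?O2) + 2) / 4
      \<le> (\<Sum>p\<in>?O1 \<union> ?O2. real (card (far_side v S p)) + 1)"
    by (rule sum_outer_ge[OF S]) (use O S in \<open>auto simp: far_side_def\<close>)
  then show ?thesis
    unfolding c u .
qed

text \<open>The weighted arithmetic-geometric mean inequality. It serves as the tangent bound for a
  power at \<open>u\<close>, and in the end it splits a product of powers into a sum.\<close>

lemma powr_concave:
  fixes t u \<alpha> :: real
  assumes "0 \<le> t" "0 < u" "0 \<le> \<alpha>" "\<alpha> \<le> 1"
  shows "t powr \<alpha> * u powr (1 - \<alpha>) \<le> \<alpha> * t + (1 - \<alpha>) * u"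
proof (cases "t = 0")
  case False
  then show ?thesis
    using Youngs_inequality_0[of \<alpha> "1 - \<alpha>" t u] assms by simp
qed (use assms in simp)

text \<open>The potential of a cell with \<open>m\<close> points is \<open>(m + 1) powr \<alpha>\<close>. The first bound on its change is
  for cells that are so large that few of their points are close to the query, the second one for
  arbitrary cells in which most points are far from the query.\<close>

lemma split_potential_large:
  assumes S: "finite S" "inj_on v S" "S \<noteq> {}" and \<alpha>: "0 \<le> \<alpha>" "\<alpha> \<le> 1"
    and \<phi>: "\<And>p. 0 \<le> \<phi> p"
  shows "(\<Sum>p\<in>S. ((card (near_side v S p) + 1) / (card S + 1)) powr \<alpha>
            + \<phi> p * ((card (far_side v S p) + 1) / (card S + 1)) powr \<alpha>)
     \<le> card S * (1 - \<alpha> / 4) + (\<Sum>p\<in>S. \<phi> p)"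
proof -
  let ?m = "real (card S)" and ?n = "\<lambda>p. real (card (near_side v S p))" and ?f = "\<lambda>p. real (card (far_side v S p))"
  have nf: "?n p + ?f p + 1 = ?m" if "p \<in> S" for p
    using sides(5)[OF S(1) that, of v] by (metis of_nat_1 of_nat_add)
  have "(\<Sum>p\<in>S. ((?n p + 1) / (?m + 1)) powr \<alpha> + \<phi> p * ((?f p + 1) / (?m + 1)) powr \<alpha>)
      \<le> (\<Sum>p\<in>S. (1 - \<alpha> * ((?f p + 1) / (?m + 1))) + \<phi> p)"
  proof (intro sum_mono add_mono)
    fix p assume p: "p \<in> S"
    have "(?n p + 1) / (?m + 1) = 1 - (?f p + 1) / (?m + 1)"
      using nf[OF p] by (simp add: field_simps)
    moreover have "((?n p + 1) / (?m + 1)) powr \<alpha> \<le> \<alpha> * ((?n p + 1) / (?m + 1)) + (1 - \<alpha>)"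
      using powr_concave[of "(?n p + 1) / (?m + 1)" 1 \<alpha>] \<alpha> by simp
    ultimately show "((?n p + 1) / (?m + 1)) powr \<alpha> \<le> 1 - \<alpha> * ((?f p + 1) / (?m + 1))"
      by (simp only: right_diff_distrib)
    have "(?f p + 1) / (?m + 1) \<le> 1"
      using nf[OF p] by simp
    then have "((?f p + 1) / (?m + 1)) powr \<alpha> \<le> 1"
      using \<alpha> by (intro powr_le1) auto
    then show "\<phi> p * ((?f p + 1) / (?m + 1)) powr \<alpha> \<le> \<phi> p"
      using \<phi>[of p] by (simp add: mult_left_le)
  qed
  also have "\<dots> = ?m - \<alpha> * ((\<Sum>p\<in>S. ?f p + 1) / (?m + 1)) + (\<Sum>p\<in>S. \<phi> p)"
    by (simp only: sum.distrib sum_subtractf sum_distrib_left[symmetric] sum_divide_distrib[symmetric]) simp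
  also have "\<dots> \<le> ?m - \<alpha> * (?m / 4) + (\<Sum>p\<in>S. \<phi> p)"
  proof -
    have "?m * (?m + 1) / 4 \<le> ?m * (?m + 2) / 4"
      by (simp add: mult_left_mono)
    also have "\<dots> \<le> (\<Sum>p\<in>S. ?f p + 1)"
      using sum_far_ge[OF S(1,2) order_refl] .
    finally have "?m / 4 \<le> (\<Sum>p\<in>S. ?f p + 1) / (?m + 1)"
      by (simp add: field_simps)
    from mult_left_mono[OF this \<alpha>(1)] show ?thesis
      by linarith
  qed
  finally show ?thesis
    by (simp add: algebra_simps)
qed

lemma split_potential_far:
  assumes S: "finite S" "inj_on v S" "S \<noteq> {}" and \<eta>: "0 \<le> \<eta>" "\<eta> \<le> 1"
    and \<phi>: "\<And>p. 0 \<le> \<phi> p" "\<And>p. \<phi> p \<le> 1" "\<And>p. p \<in> A \<Longrightarrow> \<phi> p \<le> 3 / 8" and A: "A \<subseteq> S"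
  shows "(\<Sum>p\<in>S. ((card (near_side v S p) + 1) / (card S + 1)) powr (1 - \<eta>)
            + \<phi> p * ((card (far_side v S p) + 1) / (card S + 1)) powr (1 - \<eta>))
     \<le> card S * (2 powr \<eta> * (\<eta> + (1 - \<eta>) * (1 - 5 / 32 * (card A / card S)\<^sup>2)))"
proof -
  let ?m = "real (card S)" and ?n = "\<lambda>p. real (card (near_side v S p))" and ?f = "\<lambda>p. real (card (far_side v S p))"
  define y where "y p = (?f p + 1) / (?m + 1)" for p
  have mpos: "0 < ?m"
    using S by (simp add: card_gt_0_iff)
  have nf: "?n p + ?f p + 1 = ?m" if "p \<in> S" for p
    using sides(5)[OF S(1) that, of v] by (metis of_nat_1 of_nat_add)
  \<comment> \<open>The tangent at 1/2, where both sides of a cell are equally large. Even without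
    any discount the two sides together lose no more than the factor
    \<open>2 powr \<eta>\<close>.\<close>
  have tangent: "t powr (1 - \<eta>) \<le> 2 powr \<eta> * (\<eta> / 2 + (1 - \<eta>) * t)" if "0 \<le> t" for t
  proof -
    have "t powr (1 - \<eta>) * (1 / 2) powr \<eta> \<le> (1 - \<eta>) * t + \<eta> / 2"
      using powr_concave[of t "1/2" "1 - \<eta>"] that \<eta> by simp
    moreover have "(1 / 2 :: real) powr \<eta> = 1 / 2 powr \<eta>"
      by (simp add: powr_divide)
    ultimately show ?thesis
      by (simp add: field_simps)
  qed
  have y0: "0 \<le> y p" for p
    by (simp add: y_def)
  have "(\<Sum>p\<in>S. ((?n p + 1) / (?m + 1)) powr (1 - \<eta>) + \<phi> p * ((?f p + 1) / (?m + 1)) powr (1 - \<eta>))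
      \<le> (\<Sum>p\<in>S. 2 powr \<eta> * (\<eta> + (1 - \<eta>) * (1 - (1 - \<phi> p) * y p)))"
  proof (rule sum_mono)
    fix p assume p: "p \<in> S"
    have "(?n p + 1) / (?m + 1) = 1 - y p"
      using nf[OF p] by (simp add: y_def field_simps)
    moreover have "y p \<le> 1"
      using nf[OF p] by (simp add: y_def)
    ultimately have "((?n p + 1) / (?m + 1)) powr (1 - \<eta>) \<le> 2 powr \<eta> * (\<eta> / 2 + (1 - \<eta>) * (1 - y p))"
      using tangent[of "1 - y p"] by simp
    moreover have "\<phi> p * ((?f p + 1) / (?m + 1)) powr (1 - \<eta>) \<le> \<phi> p * (2 powr \<eta> * (\<eta> / 2 + (1 - \<eta>) * y p))"
      using tangent[of "y p"] y0 \<phi> by (intro mult_left_mono) (auto simp: y_def)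
    moreover have "\<phi> p * (2 powr \<eta> * (\<eta> / 2)) \<le> 2 powr \<eta> * (\<eta> / 2)"
      using \<phi> \<eta> by (intro mult_left_le_one_le) auto
    ultimately show "((?n p + 1) / (?m + 1)) powr (1 - \<eta>) + \<phi> p * ((?f p + 1) / (?m + 1)) powr (1 - \<eta>)
        \<le> 2 powr \<eta> * (\<eta> + (1 - \<eta>) * (1 - (1 - \<phi> p) * y p))"
      by (simp add: algebra_simps)
  qed
  also have "\<dots> = 2 powr \<eta> * (?m * \<eta> + (1 - \<eta>) * (?m - (\<Sum>p\<in>S. (1 - \<phi> p) * y p)))"
    by (simp add: sum.distrib sum_subtractf flip: sum_distrib_left)
  also have "\<dots> \<le> 2 powr \<eta> * (?m * \<eta> + (1 - \<eta>) * (?m - ?m * (5 / 32 * (card A / ?m)\<^sup>2)))"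
  proof -
    define t where "t = real (card A) / ?m"
    have "card A \<le> card S"
      using A S by (simp add: card_mono)
    then have t: "0 \<le> t" "t \<le> 1" "real (card A) = t * ?m"
      using mpos by (simp_all add: t_def)
    \<comment> \<open>Pivots in \<open>A\<close> save at least \<open>1 - 3 / 8 = 5 / 8\<close> of
      the far side, and the far sides make up a quarter; this gives 5/32.\<close>
    have "?m * (5 / 32 * t\<^sup>2) \<le> 5 / 8 * ((t * ?m) * (t * ?m + 2) / 4 / (?m + 1))"
    proof -
      have "t * (?m + 1) \<le> t * ?m + 2"
        using t by (simp add: algebra_simps)
      then have "t * ?m * (t * (?m + 1)) \<le> t * ?m * (t * ?m + 2)"
        using t mpos by (intro mult_left_mono) auto
      then have le: "t * ?m * t \<le> t * ?m * (t * ?m + 2) / (?m + 1)"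
        using mpos by (simp add: field_simps)
      have "?m * (5 / 32 * t\<^sup>2) = 5 / 32 * (t * ?m * t)"
        by (simp add: power2_eq_square)
      also have "\<dots> \<le> 5 / 32 * (t * ?m * (t * ?m + 2) / (?m + 1))"
        using le by (rule mult_left_mono) simp
      finally show ?thesis
        by simp
    qed
    also have "\<dots> \<le> 5 / 8 * (\<Sum>p\<in>A. y p)"
      using sum_far_ge[OF S(1,2) A] mpos unfolding y_def t(3)[symmetric] sum_divide_distrib[symmetric]
      by (intro mult_left_mono divide_right_mono) auto
    also have "\<dots> \<le> (\<Sum>p\<in>A. (1 - \<phi> p) * y p)"
      unfolding sum_distrib_left using \<phi>(3) y0 by (intro sum_mono mult_right_mono) force+
    also have "\<dots> \<le> (\<Sum>p\<in>S. (1 - \<phi> p) * y p)"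
      using A S \<phi>(2) y0 by (intro sum_mono2) auto
    finally show ?thesis
      using \<eta> unfolding t_def[symmetric] by (intro mult_left_mono add_left_mono diff_left_mono) auto
  qed
  finally show ?thesis
    by (simp add: algebra_simps)
qed

text \<open>Follows a fixed point \<open>t\<close> down the tree, whichever side the query is
  on.\<close>

definition cell_of :: "(nat \<Rightarrow> real) \<Rightarrow> nat set \<Rightarrow> nat \<Rightarrow> nat \<Rightarrow> nat set" where
  "cell_of v S t p = (if v t < v p then {i \<in> S - {p}. v i < v p} else {i \<in> S - {p}. \<not> v i < v p})"

text \<open>The counting argument with \<open>t\<close> as the center in place of the query. The
  pivot \<open>t\<close> counts as 1 although no cell of \<open>t\<close> remains: this adds 0 to a
  sum of logarithms and keeps the estimate in a simple form.\<close>

lemma sum_cell_of_le: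
  assumes S: "finite S" "inj_on v S" and t: "t \<in> S" and m: "2 \<le> card S"
  shows "(\<Sum>p\<in>S. if p = t then 1 else real (card (cell_of v S t p))) \<le> 3 / 4 * (real (card S))\<^sup>2"
proof -
  let ?m = "real (card S)"
  let ?O1 = "{p \<in> S. v t < v p}" and ?O2 = "{p \<in> S. v p < v t}"
  define F where "F p = (if v t < v p then {i \<in> S - {p}. \<not> v i < v p} else {i \<in> S - {p}. v i < v p})" for p
  have cF: "real (card (cell_of v S t p)) = ?m - (real (card (F p)) + 1)" if "p \<in> S" for p
  proof -
    have "finite (cell_of v S t p)" "finite (F p)" "cell_of v S t p \<inter> F p = {}" "cell_of v S t p \<union> F p = S - {p}"
      using S by (auto simp: cell_of_def F_def)
    then have "card (cell_of v S t p) + card (F p) = card S - 1"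
      using card_Un_disjoint[of "cell_of v S t p" "F p"] that S by simp
    then show ?thesis
      using m by linarith
  qed
  have u: "?O1 \<union> ?O2 = S - {t}"
  proof -
    have "v p \<noteq> v t" if "p \<in> S" "p \<noteq> t" for p
      using inj_onD[OF S(2)] that t by blast
    then show ?thesis
      by force
  qed
  have d: "?O1 \<inter> ?O2 = {}"
    by auto
  have c: "real (card ?O1 + card ?O2) = ?m - 1"
    using card_Un_disjoint[of ?O1 ?O2] S u d t m by simp
  have "(?m - 1) * ((?m - 1) + 2) / 4 \<le> (\<Sum>p\<in>S - {t}. real (card (F p)) + 1)"
    unfolding c[symmetric] u[symmetric]
    by (rule sum_outer_ge[OF S]) (use S in \<open>auto simp: F_def\<close>)
  moreover have "(\<Sum>p\<in>S. if p = t then 1 else real (card (cell_of v S t p)))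
      = 1 + (\<Sum>p\<in>S - {t}. ?m - (real (card (F p)) + 1))"
    unfolding sum.remove[OF S(1) t] using cF by (auto intro!: sum.cong)
  moreover have "(\<Sum>p\<in>S - {t}. ?m - (real (card (F p)) + 1)) = (?m - 1) * ?m - (\<Sum>p\<in>S - {t}. real (card (F p)) + 1)"
    using S t m by (simp add: sum_subtractf card_Diff_singleton)
  moreover have "1 + ((?m - 1) * ?m - (?m - 1) * ((?m - 1) + 2) / 4) \<le> 3 / 4 * ?m\<^sup>2"
    using m by (simp add: power2_eq_square field_simps)
  ultimately show ?thesis
    by linarith
qed

lemma cell_of_side:
  assumes "t \<in> S" "t \<noteq> p"
  shows "cell_of v S t p = (if t \<in> near_side v S p then near_side v S p else far_side v S p)"
    "t \<in> cell_of v S t p" "cell_of v S t p \<subseteq> S"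
  using assms by (auto simp: cell_of_def near_side_def far_side_def)

section \<open>The recursive structure of the search costs\<close>

context points
begin

text \<open>The target space is countable, so it is enough to consider the event that the result is
  a given tree.\<close>

lemma measurable_build:
  "finite S \<Longrightarrow> (\<lambda>\<omega>. build L S \<omega>) \<in> measurable random_tape (count_space UNIV)"
proof (induction L arbitrary: S)
  case (Suc L)
  show ?case
  proof (cases "S = {}")
    case False
    note [measurable] = Suc.IH measurable_pivot[OF Suc.prems]
    have [measurable]: "(\<lambda>\<omega>. proj \<omega> p i) \<in> borel_measurable random_tape" for p i
      unfolding proj_def by measurable
    have "Measurable.pred random_tape (\<lambda>\<omega>. build (Suc L) S \<omega> = t)" for t
    proof (cases t)
      case Tip
      then show ?thesis
        using False by (simp add: Let_def)
    next
      case (Node l p r)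
      \<comment> \<open>The set of points on the left is random, but it is one of finitely many
        subsets \<open>B\<close> of \<open>S\<close>. Case distinction over \<open>B\<close> leaves
        recursive calls with fixed arguments.\<close>
      have eqv: "build (Suc L) S \<omega> = t \<longleftrightarrow> pivot S (shift d \<omega>) = p \<and>
          (\<exists>B\<in>Pow S. (\<forall>i\<in>S - {p}. proj \<omega> p i < 0 \<longleftrightarrow> i \<in> B) \<and>
             build L (B - {p}) (next_level \<omega>) = l \<and> build L (S - {p} - B) (next_level \<omega>) = r)" for \<omega>
      proof -
        let ?A = "{i \<in> S - {p}. proj \<omega> p i < 0}"
        have eq: "B - {p} = ?A" "S - {p} - B = {i \<in> S - {p}. \<not> proj \<omega> p i < 0}"
          if "\<forall>i\<in>S - {p}. proj \<omega> p i < 0 \<longleftrightarrow> i \<in> B" "B \<subseteq> S" for B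
          using that by auto
        have A: "?A \<in> Pow S" "\<forall>i\<in>S - {p}. proj \<omega> p i < 0 \<longleftrightarrow> i \<in> ?A"
          by auto
        have "(\<exists>B\<in>Pow S. (\<forall>i\<in>S - {p}. proj \<omega> p i < 0 \<longleftrightarrow> i \<in> B) \<and>
             build L (B - {p}) (next_level \<omega>) = l \<and> build L (S - {p} - B) (next_level \<omega>) = r)
          \<longleftrightarrow> build L ?A (next_level \<omega>) = l \<and> build L {i \<in> S - {p}. \<not> proj \<omega> p i < 0} (next_level \<omega>) = r"
          (is "?P \<longleftrightarrow> ?Q")
        proof
          assume ?P
          then obtain B where "B \<subseteq> S" "\<forall>i\<in>S - {p}. proj \<omega> p i < 0 \<longleftrightarrow> i \<in> B"
            "build L (B - {p}) (next_level \<omega>) = l" "build L (S - {p} - B) (next_level \<omega>) = r"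
            by blast
          then show ?Q
            using eq[of B] by simp
        next
          assume ?Q
          moreover have "?A \<subseteq> S"
            by auto
          ultimately show ?P
            using eq[OF A(2)] A by (intro bexI[OF _ A(1)]) auto
        qed
        moreover have "build (Suc L) S \<omega> = t \<longleftrightarrow> pivot S (shift d \<omega>) = p \<and>
            build L ?A (next_level \<omega>) = l \<and> build L {i \<in> S - {p}. \<not> proj \<omega> p i < 0} (next_level \<omega>) = r"
          using False unfolding Node build.simps Let_def by auto
        ultimately show ?thesis
          by argo
      qed
      have [measurable]: "Measurable.pred random_tape (\<lambda>\<omega>. build L B (next_level \<omega>) = u)" if "finite B" for B u
        using measurable_compose[OF measurable_shift Suc.IH[OF that]] by measurable
      have [measurable]: "Measurable.pred random_tape (\<lambda>\<omega>. pivot S (shift d \<omega>) = p)"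
        by measurable
      show ?thesis
        unfolding eqv using Suc.prems finite_subset[OF _ Suc.prems]
        by (intro pred_intros_logic pred_intros_finite) auto
    qed
    then show ?thesis
      unfolding pred_def
      by (subst measurable_count_space_eq2_countable) (auto simp: vimage_def Collect_conj_eq)
  qed simp
next
  case 0
  have "build 0 S = (\<lambda>_. Tip)" for S
    by auto
  then show ?case
    by simp
qed

end

context query
begin

text \<open>The negative of \<open>gap\<close> for a pivot. With this sign the query is at 0, and
  points are ordered as they are in \<open>build\<close>.\<close>

definition offset :: "(nat \<Rightarrow> real) \<Rightarrow> nat \<Rightarrow> real" where
  "offset \<omega> p = dot d \<omega> (\<lambda>k. x p k - q k)"

lemma gap_eq: "gap \<omega> p = - offset \<omega> p"
  by (simp add: gap_def offset_def dot_def algebra_simps sum_subtractf)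

lemma proj_eq: "proj \<omega> p i = offset \<omega> i - offset \<omega> p"
  by (simp add: proj_def offset_def dot_def algebra_simps sum_subtractf)

lemma measurable_offset [measurable]: "(\<lambda>\<omega>. offset \<omega> p) \<in> borel_measurable random_tape"
  unfolding offset_def by measurable

lemma count_upto_step:
  assumes "S \<noteq> {}"
  shows "count_upto (build (Suc L) S \<omega>) K \<omega> W
    = count_upto (build L (near_side (offset \<omega>) S (pivot S (shift d \<omega>))) (next_level \<omega>)) K (next_level \<omega>) W
      + count_upto (build L (far_side (offset \<omega>) S (pivot S (shift d \<omega>))) (next_level \<omega>))
          (K + offset \<omega> (pivot S (shift d \<omega>)) ^ 16) (next_level \<omega>) W"
  using assms by (auto simp: Let_def lkey_def rkey_def gap_eq proj_eq near_side_def far_side_def)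

lemma measurable_count_upto:
  assumes "finite S"
  shows "(\<lambda>\<omega>. count_upto (build L S \<omega>) K \<omega> W) \<in> measurable random_tape (count_space UNIV)"
proof (rule measurable_compose_countable[OF _ measurable_build[OF assms]])
  have "(\<lambda>\<omega>. count_upto T (k \<omega>) (f \<omega>) W) \<in> measurable random_tape (count_space UNIV)"
    if [measurable]: "k \<in> borel_measurable random_tape" "f \<in> measurable random_tape random_tape" for T k f
    using that
  proof (induction T arbitrary: k f)
    case (Node l p r)
    have [measurable]: "(\<lambda>\<omega>. lkey (f \<omega>) p (k \<omega>)) \<in> borel_measurable random_tape"
      "(\<lambda>\<omega>. rkey (f \<omega>) p (k \<omega>)) \<in> borel_measurable random_tape"
      using Node.prems unfolding lkey_def rkey_def gap_def by measurable
    note [measurable] = Node.IH Node.prems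
    show ?case
      by simp
  qed simp
  then show "(\<lambda>\<omega>. count_upto T K \<omega> W) \<in> measurable random_tape (count_space UNIV)" for T
    by simp
qed

lemma borel_measurable_count_upto:
  "finite S \<Longrightarrow> (\<lambda>\<omega>. ennreal (real (count_upto (build L S \<omega>) K \<omega> W))) \<in> borel_measurable random_tape"
  using measurable_compose[OF measurable_count_upto, of S "\<lambda>k. ennreal (real k)" borel] by simp

lemma node_key_add: "node_key T (a + K) \<omega> i = a + node_key T K \<omega> i"
proof (induction T arbitrary: K \<omega>)
  case (Node l p r)
  have "lkey \<omega> p (a + K) = a + lkey \<omega> p K" "rkey \<omega> p (a + K) = a + rkey \<omega> p K"
    by (simp_all add: lkey_def rkey_def)
  then show ?case
    using Node by simp
qed simp

lemma node_key_ge: "K \<le> node_key T K \<omega> i"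
proof (induction T arbitrary: K \<omega>)
  case (Node l p r)
  show ?case
    using Node(1)[where K = "lkey \<omega> p K" and \<omega> = "next_level \<omega>"]
      Node(2)[where K = "rkey \<omega> p K" and \<omega> = "next_level \<omega>"] key_ge(1)[of K \<omega> p] key_ge(2)[of K \<omega> p]
    by auto
qed simp

lemma measurable_node_key:
  assumes "finite S"
  shows "(\<lambda>\<omega>. node_key (build L S \<omega>) K \<omega> i) \<in> borel_measurable random_tape"
proof (rule measurable_compose_countable[OF _ measurable_build[OF assms]])
  have "(\<lambda>\<omega>. node_key T (k \<omega>) (f \<omega>) i) \<in> borel_measurable random_tape"
    if [measurable]: "k \<in> borel_measurable random_tape" "f \<in> measurable random_tape random_tape" for T k f
    using that
  proof (induction T arbitrary: k f)
    case (Node l p r)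
    have [measurable]: "(\<lambda>\<omega>. lkey (f \<omega>) p (k \<omega>)) \<in> borel_measurable random_tape"
      "(\<lambda>\<omega>. rkey (f \<omega>) p (k \<omega>)) \<in> borel_measurable random_tape"
      using Node.prems unfolding lkey_def rkey_def gap_def by measurable
    note [measurable] = Node.IH Node.prems
    show ?case
      by simp
  qed simp
  then show "(\<lambda>\<omega>. node_key T K \<omega> i) \<in> borel_measurable random_tape" for T
    by simp
qed

text \<open>A point that is lost at the height limit gets key 0; losing it is a failure event with a
  probability estimate of its own.\<close>

definition found_key :: "nat \<Rightarrow> nat \<Rightarrow> nat set \<Rightarrow> (nat \<Rightarrow> real) \<Rightarrow> real" where
  "found_key t L S \<omega> = (if t \<in> nodes (build L S \<omega>) then node_key (build L S \<omega>) 0 \<omega> t else 0)"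

lemma found_key_nonneg: "0 \<le> found_key t L S \<omega>"
  by (simp add: found_key_def node_key_ge)

lemma pred_nodes [measurable]:
  assumes "finite S"
  shows "Measurable.pred random_tape (\<lambda>\<omega>. t \<in> nodes (build L S \<omega>))"
  using measurable_compose[OF measurable_build[OF assms, of L], of "\<lambda>T. t \<in> nodes T" "count_space UNIV"] by simp

lemma measurable_found_key:
  assumes "finite S"
  shows "(\<lambda>\<omega>. found_key t L S \<omega>) \<in> borel_measurable random_tape"
  using assms measurable_node_key[OF assms, of L 0 t] pred_nodes[OF assms, of t L]
  unfolding found_key_def by measurable

lemma nodes_build_step:
  assumes "finite S" "t \<in> S" "pivot S (shift d \<omega>) \<noteq> t"
  shows "t \<in> nodes (build (Suc L) S \<omega>)
    \<longleftrightarrow> t \<in> nodes (build L (cell_of (offset \<omega>) S t (pivot S (shift d \<omega>))) (next_level \<omega>))"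
proof -
  let ?p = "pivot S (shift d \<omega>)"
  have "t \<notin> nodes (build L {i \<in> S - {?p}. offset \<omega> i < offset \<omega> ?p} (next_level \<omega>))" if "\<not> offset \<omega> t < offset \<omega> ?p"
    using nodes_build[of "{i \<in> S - {?p}. offset \<omega> i < offset \<omega> ?p}" L "next_level \<omega>"] that assms(1) by auto
  moreover have "t \<notin> nodes (build L {i \<in> S - {?p}. \<not> offset \<omega> i < offset \<omega> ?p} (next_level \<omega>))" if "offset \<omega> t < offset \<omega> ?p"
    using nodes_build[of "{i \<in> S - {?p}. \<not> offset \<omega> i < offset \<omega> ?p}" L "next_level \<omega>"] that assms(1) by auto
  moreover have "nodes (build (Suc L) S \<omega>) = insert ?p (nodes (build L {i \<in> S - {?p}. offset \<omega> i < offset \<omega> ?p} (next_level \<omega>))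
      \<union> nodes (build L {i \<in> S - {?p}. \<not> offset \<omega> i < offset \<omega> ?p} (next_level \<omega>)))"
    using assms(2) by (auto simp: Let_def proj_eq)
  ultimately show ?thesis
    using assms(3) unfolding cell_of_def by auto
qed

text \<open>The key grows only if the hyperplane separates \<open>t\<close> from the query. The
  offset of the pivot then lies between 0 and the offset of \<open>t\<close>, which is small if
  \<open>t\<close> is near the query.\<close>

lemma found_key_step:
  assumes "finite S" "t \<in> S"
  shows "found_key t (Suc L) S \<omega>
    \<le> (if pivot S (shift d \<omega>) = t then 0
       else (if \<bar>offset \<omega> (pivot S (shift d \<omega>))\<bar> \<le> \<bar>offset \<omega> t\<bar> then offset \<omega> (pivot S (shift d \<omega>)) ^ 16 else 0)
         + found_key t L (cell_of (offset \<omega>) S t (pivot S (shift d \<omega>))) (next_level \<omega>))"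
proof (cases "pivot S (shift d \<omega>) = t")
  case True
  then show ?thesis
    using assms by (auto simp: found_key_def Let_def)
next
  case False
  define p where "p = pivot S (shift d \<omega>)"
  define y where "y = (if \<bar>offset \<omega> p\<bar> \<le> \<bar>offset \<omega> t\<bar> then offset \<omega> p ^ 16 else 0)"
  define C where "C = cell_of (offset \<omega>) S t p"
  have pt: "p \<noteq> t"
    using False by (simp add: p_def)
  have y: "0 \<le> y"
    by (simp add: y_def)
  have "found_key t (Suc L) S \<omega> \<le> y + found_key t L C (next_level \<omega>)"
  proof (cases "t \<in> nodes (build L C (next_level \<omega>))")
    case True
    then have 1: "t \<in> nodes (build (Suc L) S \<omega>)"
      using nodes_build_step[OF assms False, of L] by (simp add: C_def p_def)
    define A where "A = {i \<in> S - {p}. offset \<omega> i < offset \<omega> p}"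
    define B where "B = {i \<in> S - {p}. \<not> offset \<omega> i < offset \<omega> p}"
    have b: "build (Suc L) S \<omega> = Node (build L A (next_level \<omega>)) p (build L B (next_level \<omega>))"
      using assms(2) by (auto simp: Let_def proj_eq A_def B_def p_def)
    have nA: "nodes (build L A (next_level \<omega>)) \<subseteq> A"
      using assms by (intro nodes_build) (auto simp: A_def)
    have "\<exists>K\<le>y. node_key (build (Suc L) S \<omega>) 0 \<omega> t = node_key (build L C (next_level \<omega>)) K (next_level \<omega>) t"
    proof (cases "offset \<omega> t < offset \<omega> p")
      case lt: True
      have "C = A"
        using lt by (auto simp: C_def A_def cell_of_def)
      moreover have "lkey \<omega> p 0 \<le> y"
        using lt by (auto simp: lkey_def y_def gap_eq)
      ultimately show ?thesis
        using True pt unfolding b by auto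
    next
      case ge: False
      have "C = B"
        using ge by (auto simp: C_def B_def cell_of_def)
      moreover have "t \<notin> nodes (build L A (next_level \<omega>))"
        using nA ge by (auto simp: A_def)
      moreover have "rkey \<omega> p 0 \<le> y"
        using ge by (auto simp: rkey_def y_def gap_eq)
      ultimately show ?thesis
        using pt unfolding b by auto
    qed
    then obtain K where "K \<le> y"
      "node_key (build (Suc L) S \<omega>) 0 \<omega> t = node_key (build L C (next_level \<omega>)) K (next_level \<omega>) t"
      by blast
    then show ?thesis
      using 1 True node_key_add[of "build L C (next_level \<omega>)" K 0 "next_level \<omega>" t]
      by (simp add: found_key_def del: build.simps)
  next
    case F: False
    then have "found_key t (Suc L) S \<omega> = 0"
      using nodes_build_step[OF assms False, of L] by (simp add: C_def p_def found_key_def del: build.simps)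
    then show ?thesis
      using y found_key_nonneg[of t L C "next_level \<omega>"] by simp
  qed
  then show ?thesis
    using False by (simp only: p_def[symmetric] y_def C_def if_False)
qed

text \<open>A binary tree has one more tip than nodes.\<close>

lemma count_upto_le: "finite S \<Longrightarrow> count_upto (build L S \<omega>) K \<omega> W \<le> card S + 1"
proof (induction L arbitrary: S K \<omega>)
  case (Suc L)
  show ?case
  proof (cases "S = {}")
    case False
    let ?p = "pivot S (shift d \<omega>)"
    note s = sides[OF Suc.prems pivot_props(1)[OF Suc.prems False, of "shift d \<omega>"], of "offset \<omega>"]
    show ?thesis
      using add_mono[OF Suc.IH[OF s(1), where \<omega> = "next_level \<omega>" and K = K]
        Suc.IH[OF s(2), where \<omega> = "next_level \<omega>" and K = "K + offset \<omega> ?p ^ 16"]] s(5)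
      by (simp only: count_upto_step[OF False])
  qed simp
qed simp

end

section \<open>Expected search costs\<close>

text \<open>By concavity \<open>ln\<close> lies below its tangent at three quarters of the size, the
  bound on the mean cell size. The average decrease is at least \<open>- ln (3 / 4)\<close>, which
  is at least 1/4.\<close>

lemma sum_ln_cell:
  assumes S: "finite S" "inj_on v S" and t: "t \<in> S" and m: "2 \<le> card S"
  shows "(\<Sum>p\<in>S - {t}. ln (real (card (cell_of v S t p)))) \<le> real (card S) * (ln (real (card S)) - 1 / 4)"
proof -
  let ?m = "real (card S)"
  define a where "a = 3 / 4 * ?m"
  have a: "0 < a"
    using m by (simp add: a_def)
  have tangent: "ln c \<le> ln a + (c / a - 1)" if "0 < c" for c :: real
    using ln_le_minus_one[of "c / a"] a that by (simp add: ln_div)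
  define w where "w p = (if p = t then 1 else real (card (cell_of v S t p)))" for p
  have w: "0 < w p" if "p \<in> S" for p
  proof -
    have "0 < card (cell_of v S t p)" if "p \<noteq> t"
    proof -
      have "finite (cell_of v S t p)"
        using S by (auto simp: cell_of_def)
      then show ?thesis
        using cell_of_side(2)[of t S p v] t that by (auto simp: card_gt_0_iff)
    qed
    then show ?thesis
      by (simp add: w_def)
  qed
  have "(\<Sum>p\<in>S - {t}. ln (real (card (cell_of v S t p)))) = (\<Sum>p\<in>S - {t}. ln (w p))"
    by (intro sum.cong) (auto simp: w_def)
  also have "\<dots> = (\<Sum>p\<in>S. ln (w p))"
    using S t by (simp add: sum.remove w_def)
  also have "\<dots> \<le> (\<Sum>p\<in>S. ln a - 1 + w p / a)"
    using tangent w by (intro sum_mono) (simp add: algebra_simps)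
  also have "\<dots> = ?m * (ln a - 1) + (\<Sum>p\<in>S. w p) / a"
    by (simp add: sum.distrib sum_divide_distrib)
  also have "(\<Sum>p\<in>S. w p) / a \<le> (3 / 4 * ?m\<^sup>2) / a"
    using sum_cell_of_le[OF S t m] a unfolding w_def by (intro divide_right_mono) auto
  also have "(3 / 4 * ?m\<^sup>2) / a = ?m"
    using m by (simp add: a_def power2_eq_square)
  also have "ln a = ln (3 / 4) + ln ?m"
    using m unfolding a_def by (subst ln_mult) auto
  also have "?m * (ln (3 / 4) + ln ?m - 1) + ?m = ?m * (ln ?m + ln (3 / 4))"
    by (simp add: algebra_simps)
  also have "\<dots> \<le> ?m * (ln ?m - 1 / 4)"
    using ln_le_minus_one[of "3 / 4"] by (intro mult_left_mono) auto
  finally show ?thesis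
    by simp
qed

text \<open>The Taylor polynomial of degree 3 shows that \<open>sin (25 / 48)\<close> is less than
  \<open>1 / 2 = sin (pi / 6)\<close>. The value 25/8 makes \<open>2 / (25 / 8)\<close> the square
  of 4/5.\<close>

lemma pi_ge: "25 / 8 \<le> pi"
proof -
  define y :: real where "y = 25 / 48"
  have "(\<Sum>m<5. sin_coeff m * y ^ m) = y - y ^ 3 / 6"
  proof -
    have "{..<5 :: nat} = {0, 1, 2, 3, 4}"
      by auto
    then show ?thesis
      by (simp add: sin_coeff_def fact_numeral)
  qed
  with Maclaurin_sin_bound[of y 5] have "\<bar>sin y - (y - y ^ 3 / 6)\<bar> \<le> inverse 120 * \<bar>y\<bar> ^ 5"
    by (simp add: fact_numeral)
  from abs_le_D1[OF this] have "sin y < 1 / 2"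
    by (simp add: y_def power_divide)
  moreover have "1 / 2 \<le> sin y" if "pi / 6 \<le> y"
    using that sin_mono_le_eq[of "pi / 6" y] pi_ge_two by (simp add: y_def sin_30)
  ultimately have "\<not> pi / 6 \<le> y"
    by linarith
  then show ?thesis
    by (simp add: y_def)
qed

lemma sqrt_2_pi_le: "sqrt (2 / pi) \<le> 4 / 5"
proof -
  have "2 / pi \<le> 2 / (25 / 8)"
    using pi_ge by (intro divide_left_mono) auto
  then have "sqrt (2 / pi) \<le> sqrt ((4 / 5)\<^sup>2)"
    by (simp add: power2_eq_square)
  then show ?thesis
    by simp
qed

locale query_scale = query +
  fixes \<rho> :: real
  assumes \<rho>_pos: "0 < \<rho>"
    and separated: "i < n \<Longrightarrow> j < n \<Longrightarrow> i \<noteq> j \<Longrightarrow> 0 < L2_set (\<lambda>k. x i k - x j k) {..<d}"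
begin

definition dst :: "nat \<Rightarrow> real" where
  "dst p = L2_set (\<lambda>k. x p k - q k) {..<d}"

text \<open>Crossing a splitting hyperplane at distance \<open>t\<close> costs \<open>t ^ 16\<close>, and hence a factor
  \<open>exp (- lam * t ^ 16)\<close> in the expected number of tips. The factor is \<open>1 / e\<close> for \<open>t = 9 / 2 * \<rho>\<close>.\<close>

definition lam :: real where
  "lam = (2 / (9 * \<rho>)) ^ 16"

text \<open>From distance \<open>4 * \<rho>\<close> on, an offset is within
  \<open>9 / 2 * \<rho>\<close> with probability at most
  \<open>4 / 5 * (9 / 2) / 4 = 9 / 10\<close>, so a discount by the factor \<open>1 / e\<close> or
  better has a chance of at least 1/10.\<close>

definition close :: "nat set \<Rightarrow> nat set" where
  "close S = {i \<in> S. dst i < 4 * \<rho>}"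

lemma lam_pos: "0 < lam"
  using \<rho>_pos by (simp add: lam_def)

lemma offset_cong: "(\<And>k. k < d \<Longrightarrow> a k = a' k) \<Longrightarrow> offset a = offset a'"
  by (auto simp: offset_def dot_def fun_eq_iff)

lemma AE_inj_offset: "AE a in random_tape. inj_on (offset a) {..<n}"
proof -
  have "AE a in random_tape. \<forall>i\<in>{..<n}. \<forall>j\<in>{..<n}. i \<noteq> j \<longrightarrow> offset a i \<noteq> offset a j"
  proof (intro AE_finite_allI)
    fix i j assume "i \<in> {..<n}" "j \<in> {..<n}"
    show "AE a in random_tape. i \<noteq> j \<longrightarrow> offset a i \<noteq> offset a j"
    proof (cases "i = j")
      case False
      then have "AE a in random_tape. dot d a (\<lambda>k. x i k - x j k) \<noteq> 0"
        using separated \<open>i \<in> {..<n}\<close> \<open>j \<in> {..<n}\<close> by (intro dot_nonzero) auto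
      then show ?thesis
        by eventually_elim (auto simp: offset_def dot_def algebra_simps sum_subtractf)
    qed simp
  qed auto
  then show ?thesis
    by eventually_elim (auto simp: inj_on_def)
qed

lemma offset_small:
  assumes "0 < dst p" "0 \<le> s"
  shows "(\<integral>\<^sup>+ a. indicator {t. \<bar>t\<bar> \<le> s} (offset a p) \<partial>random_tape) \<le> ennreal (4 / 5 * s / dst p)"
proof -
  have "(\<integral>\<^sup>+ a. indicator {t. \<bar>t\<bar> \<le> s} (offset a p) \<partial>random_tape) \<le> ennreal (sqrt (2 / pi) * s / dst p)"
    using dot_small_ball[of "\<lambda>k. x p k - q k" d s] assms unfolding dst_def offset_def by simp
  also have "\<dots> \<le> ennreal (4 / 5 * s / dst p)"
    using assms sqrt_2_pi_le by (intro ennreal_leI divide_right_mono mult_right_mono) auto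
  finally show ?thesis .
qed

text \<open>The sum over all pivots of what the two parts contribute relative to the cell; the far
  part is discounted for its larger key.\<close>

definition potential :: "real \<Rightarrow> nat set \<Rightarrow> (nat \<Rightarrow> real) \<Rightarrow> real" where
  "potential \<alpha> S a = (\<Sum>p\<in>S. ((card (near_side (offset a) S p) + 1) / (card S + 1)) powr \<alpha>
     + exp (- lam * offset a p ^ 16) * ((card (far_side (offset a) S p) + 1) / (card S + 1)) powr \<alpha>)"

text \<open>A power of the size controls cells that are mostly far from the query. The summand with
  \<open>close\<close> accounts for cells with many near points, where no decrease is available; for
  disjoint parts it is additive, so it passes through the recursion.\<close>

definition count_bounded :: "real \<Rightarrow> real \<Rightarrow> nat set \<Rightarrow> bool" where
  "count_bounded B \<alpha> S \<longleftrightarrow> (\<forall>L K W. (\<integral>\<^sup>+ \<omega>. ennreal (real (count_upto (build L S \<omega>) K \<omega> W)) \<partial>random_tape)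
     \<le> ennreal (200 * real (card (close S)) + exp (lam * (W - K)) * B * real (card S + 1) powr \<alpha>))"

text \<open>If the mean of the potential over pivots and directions is at most 1, the bounds for the
  two parts average to the bound for the cell. \<open>G\<close> is a measurable majorant of the
  potential, and it is \<open>G\<close> that gets integrated.\<close>

lemma count_bounded_induct:
  assumes \<alpha>: "0 \<le> \<alpha>" and B: "1 \<le> B"
    and split: "\<And>S. S \<subseteq> {..<n} \<Longrightarrow> S \<noteq> {} \<Longrightarrow> count_bounded B \<alpha> S \<or>
      (\<exists>G. G \<in> borel_measurable random_tape \<and> (AE a in random_tape. potential \<alpha> S a \<le> G a)
         \<and> (\<integral>\<^sup>+ a. ennreal (G a) \<partial>random_tape) \<le> ennreal (real (card S)))"
    and S: "S \<subseteq> {..<n}"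
  shows "count_bounded B \<alpha> S"
proof -
  define R where "R S K W = 200 * real (card (close S)) + exp (lam * (W - K)) * B * real (card S + 1) powr \<alpha>"
    for S :: "nat set" and K W
  have R0: "0 \<le> R S K W" for S K W
    using B by (simp add: R_def)
  have tip: "(\<integral>\<^sup>+ \<omega>. ennreal (real (count_upto Tip K \<omega> W)) \<partial>random_tape) \<le> ennreal (R S K W)" for S K W
  proof -
    have "real (count_upto Tip K \<omega> W) \<le> R S K W" for \<omega>
    proof (cases "K \<le> W")
      case True
      have "1 * 1 * 1 \<le> exp (lam * (W - K)) * B * real (card S + 1) powr \<alpha>"
        using True lam_pos B \<alpha> by (intro mult_mono ge_one_powr_ge_zero) auto
      then show ?thesis
        using True by (simp add: R_def)
    qed (use R0 in simp)
    then have "(\<integral>\<^sup>+ \<omega>. ennreal (real (count_upto Tip K \<omega> W)) \<partial>random_tape) \<le> (\<integral>\<^sup>+ \<omega>. ennreal (R S K W) \<partial>random_tape)"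
      by (intro nn_integral_mono ennreal_leI)
    then show ?thesis
      using tape.P.emeasure_space_1 by simp
  qed
  have "(\<integral>\<^sup>+ \<omega>. ennreal (real (count_upto (build L S \<omega>) K \<omega> W)) \<partial>random_tape) \<le> ennreal (R S K W)" for L K W
    using S
  proof (induction L arbitrary: S K)
    case 0
    show ?case
      using tip by simp
  next
    case (Suc L)
    have fin: "finite S"
      using Suc.prems finite_subset by blast
    show ?case
    proof (cases "S = {}")
      case True
      then show ?thesis
        using tip by simp
    next
      case ne: False
      from split[OF Suc.prems ne] show ?thesis
      proof
        assume "count_bounded B \<alpha> S"
        then show ?thesis
          unfolding count_bounded_def R_def by blast
      next
        assume "\<exists>G. G \<in> borel_measurable random_tape \<and> (AE a in random_tape. potential \<alpha> S a \<le> G a)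
         \<and> (\<integral>\<^sup>+ a. ennreal (G a) \<partial>random_tape) \<le> ennreal (real (card S))"
        then obtain G where [measurable]: "G \<in> borel_measurable random_tape"
          and G: "AE a in random_tape. potential \<alpha> S a \<le> G a" "(\<integral>\<^sup>+ a. ennreal (G a) \<partial>random_tape) \<le> ennreal (real (card S))"
          by blast
        let ?m = "real (card S)"
        have m: "0 < ?m"
          using fin ne by (simp add: card_gt_0_iff)
        define E where "E = exp (lam * (W - K)) * B * real (card S + 1) powr \<alpha>"
        have E0: "0 \<le> E"
          using B by (simp add: E_def)
        let ?n = "\<lambda>a p. near_side (offset a) S p" and ?f = "\<lambda>a p. far_side (offset a) S p"
        let ?c = "\<lambda>S K b. ennreal (real (count_upto (build L S b) K b W))"
        let ?R = "\<lambda>a p. R (?f a p) (K + offset a p ^ 16) W"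
        have "(\<integral>\<^sup>+ \<omega>. ennreal (real (count_upto (build (Suc L) S \<omega>) K \<omega> W)) \<partial>random_tape)
            \<le> (\<integral>\<^sup>+ a. (\<Sum>p\<in>S. (ennreal (R (?n a p) K W) + ennreal (?R a p))
                * ennreal (1 / ?m)) \<partial>random_tape)"
        proof (rule nn_integral_level[OF fin ne Suc.prems, where
              g = "\<lambda>a p b. ?c (?n a p) K b
                + ?c (?f a p) (K + offset a p ^ 16) b"])
          show "(\<lambda>\<omega>. ennreal (real (count_upto (build (Suc L) S \<omega>) K \<omega> W))) \<in> borel_measurable random_tape"
            by (rule borel_measurable_count_upto[OF fin])
          show "ennreal (real (count_upto (build (Suc L) S \<omega>) K \<omega> W))
              \<le> ennreal (real (count_upto (build L (?n \<omega> (pivot S (shift d \<omega>))) (next_level \<omega>)) K (next_level \<omega>) W))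
                + ennreal (real (count_upto (build L (?f \<omega> (pivot S (shift d \<omega>))) (next_level \<omega>))
                    (K + offset \<omega> (pivot S (shift d \<omega>)) ^ 16) (next_level \<omega>) W))" for \<omega>
            unfolding count_upto_step[OF ne] by (simp flip: ennreal_plus)
        next
          fix a a' :: "nat \<Rightarrow> real" and p b
          assume "\<And>k. k < d \<Longrightarrow> a k = a' k"
          then have "offset a = offset a'"
            by (rule offset_cong)
          then show "?c (?n a p) K b
                + ?c (?f a p) (K + offset a p ^ 16) b
              = ?c (?n a' p) K b
                + ?c (?f a' p) (K + offset a' p ^ 16) b"
            by simp
        next
          fix a p assume p: "p \<in> S"
          note s = sides[OF fin p, of "offset a"]
          have sub: "?n a p \<subseteq> {..<n}" "?f a p \<subseteq> {..<n}"
            using s(3,4) Suc.prems by blast+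
          have "(\<integral>\<^sup>+ b. (?c (?n a p) K b
                + ?c (?f a p) (K + offset a p ^ 16) b) \<partial>random_tape)
              = (\<integral>\<^sup>+ b. ?c (?n a p) K b \<partial>random_tape)
                + (\<integral>\<^sup>+ b. ?c (?f a p) (K + offset a p ^ 16) b \<partial>random_tape)"
            using s(1,2) by (intro nn_integral_add borel_measurable_count_upto)
          also have "\<dots> \<le> ennreal (R (?n a p) K W) + ennreal (?R a p)"
            by (intro add_mono Suc.IH sub)
          finally show "(\<integral>\<^sup>+ b. (?c (?n a p) K b
                + ?c (?f a p) (K + offset a p ^ 16) b) \<partial>random_tape)
              \<le> ennreal (R (?n a p) K W) + ennreal (?R a p)" .
        qed
        also have "\<dots> \<le> (\<integral>\<^sup>+ a. (ennreal (200 * real (card (close S))) + ennreal (E / ?m) * ennreal (G a)) \<partial>random_tape)"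
        proof (rule nn_integral_mono_AE)
          show "AE a in random_tape. (\<Sum>p\<in>S. (ennreal (R (?n a p) K W) + ennreal (?R a p))
                * ennreal (1 / ?m)) \<le> ennreal (200 * real (card (close S))) + ennreal (E / ?m) * ennreal (G a)"
            using G(1)
          proof eventually_elim
            case (elim a)
            define u where "u p = ((card (?n a p) + 1) / (card S + 1)) powr \<alpha>
              + exp (- lam * offset a p ^ 16) * ((card (?f a p) + 1) / (card S + 1)) powr \<alpha>" for p
            have G0: "0 \<le> G a"
              using elim by (intro order_trans[OF _ elim]) (auto simp: potential_def intro!: sum_nonneg add_nonneg_nonneg)
            have "R (?n a p) K W + ?R a p \<le> 200 * real (card (close S)) + E * u p"
              if p: "p \<in> S" for p
            proof -
              note s = sides[OF fin p, of "offset a"]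
              have "close (?n a p) \<inter> close (?f a p) = {}" "close (?n a p) \<union> close (?f a p) \<subseteq> close S" "finite (close S)"
                "finite (close (?n a p))" "finite (close (?f a p))"
                using s(1-4,6) fin by (auto simp: close_def)
              then have "card (close (?n a p)) + card (close (?f a p)) \<le> card (close S)"
                by (metis card_Un_disjoint card_mono)
              moreover have "exp (lam * (W - K)) * B * real (card (?n a p) + 1) powr \<alpha>
                  = E * ((card (?n a p) + 1) / (card S + 1)) powr \<alpha>"
                by (simp add: E_def powr_divide)
              moreover have "exp (lam * (W - (K + offset a p ^ 16))) * B * real (card (?f a p) + 1) powr \<alpha>
                  = E * (exp (- lam * offset a p ^ 16) * ((card (?f a p) + 1) / (card S + 1)) powr \<alpha>)"
                by (simp add: E_def powr_divide algebra_simps flip: exp_add)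
              ultimately show ?thesis
                unfolding R_def u_def distrib_left by simp
            qed
            then have "(\<Sum>p\<in>S. (R (?n a p) K W + ?R a p) * (1 / ?m))
                \<le> (\<Sum>p\<in>S. (200 * real (card (close S)) + E * u p) * (1 / ?m))"
              by (intro sum_mono mult_right_mono) auto
            also have "\<dots> = 200 * real (card (close S)) + E / ?m * potential \<alpha> S a"
              using m unfolding potential_def u_def[symmetric] sum_distrib_right[symmetric]
              by (simp only: sum.distrib sum_constant sum_distrib_left[symmetric]) (simp add: field_simps)
            also have "\<dots> \<le> 200 * real (card (close S)) + E / ?m * G a"
              using elim E0 m by (intro add_left_mono mult_left_mono) auto
            finally have "ennreal (\<Sum>p\<in>S. (R (?n a p) K W + ?R a p) * (1 / ?m))
                \<le> ennreal (200 * real (card (close S)) + E / ?m * G a)"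
              by (rule ennreal_leI)
            also have "ennreal (200 * real (card (close S)) + E / ?m * G a)
                = ennreal (200 * real (card (close S))) + ennreal (E / ?m) * ennreal (G a)"
              using E0 G0 by (simp add: ennreal_mult[symmetric] flip: ennreal_plus)
            also have "ennreal (\<Sum>p\<in>S. (R (?n a p) K W + ?R a p) * (1 / ?m))
                = (\<Sum>p\<in>S. (ennreal (R (?n a p) K W) + ennreal (?R a p)) * ennreal (1 / ?m))"
            proof (subst sum_ennreal[symmetric])
              show "0 \<le> (R (?n a p) K W + ?R a p) * (1 / ?m)" for p
                using R0 by simp
              show "(\<Sum>p\<in>S. ennreal ((R (?n a p) K W + ?R a p) * (1 / ?m)))
                = (\<Sum>p\<in>S. (ennreal (R (?n a p) K W) + ennreal (?R a p)) * ennreal (1 / ?m))"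
                using R0 by (intro sum.cong refl) (simp only: ennreal_plus[symmetric], subst ennreal_mult'', simp_all)
            qed
            finally show ?case .
          qed
        qed
        also have "\<dots> = ennreal (200 * real (card (close S))) + ennreal (E / ?m) * (\<integral>\<^sup>+ a. ennreal (G a) \<partial>random_tape)"
          using tape.P.emeasure_space_1 by (subst nn_integral_add) (auto simp: nn_integral_cmult)
        also have "\<dots> \<le> ennreal (200 * real (card (close S))) + ennreal (E / ?m) * ennreal ?m"
          using G(2) by (intro add_left_mono mult_left_mono) auto
        also have "\<dots> = ennreal (R S K W)"
          using E0 m by (simp add: R_def E_def ennreal_mult[symmetric] flip: ennreal_plus)
        finally show ?thesis .
      qed
    qed
  qed
  then show ?thesis
    unfolding count_bounded_def R_def by blast
qed

section \<open>The expected key of a fixed point\<close>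

definition crossing :: "nat \<Rightarrow> (nat \<Rightarrow> real) \<Rightarrow> nat \<Rightarrow> real" where
  "crossing t a p = (if \<bar>offset a p\<bar> \<le> \<bar>offset a t\<bar> then offset a p ^ 16 else 0)"

lemma crossing_nonneg: "0 \<le> crossing t a p"
  by (simp add: crossing_def)

lemma measurable_crossing [measurable]: "(\<lambda>a. crossing t a p) \<in> borel_measurable random_tape"
  unfolding crossing_def by measurable

definition key_bounded :: "nat \<Rightarrow> real \<Rightarrow> real \<Rightarrow> nat set \<Rightarrow> bool" where
  "key_bounded t B \<beta> S \<longleftrightarrow> (\<forall>L. (\<integral>\<^sup>+ \<omega>. ennreal (found_key t L S \<omega>) \<partial>random_tape)
     \<le> ennreal (\<rho> ^ 16 * (B + \<beta> * ln (real (card S)))))"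

lemma cell_of_subset: "cell_of v S t p \<subseteq> S"
  by (auto simp: cell_of_def)

lemma card_ge_2: "finite S \<Longrightarrow> t \<in> S \<Longrightarrow> S \<noteq> {t} \<Longrightarrow> 2 \<le> card S"
  by (metis One_nat_def Suc_leI card_1_singleton_iff card_gt_0_iff empty_iff le_neq_implies_less
      numeral_2_eq_2 singletonD)

text \<open>A split adds at most \<open>\<rho> ^ 16 * (\<beta> / 4)\<close> to the key on average.
  This is paid for by the term \<open>\<beta> * ln (card S)\<close>, which falls by at least
  \<open>\<beta> / 4\<close> on average by \<open>sum_ln_cell\<close>.\<close>

lemma key_bounded_induct:
  assumes \<beta>: "0 \<le> \<beta>" and B: "0 \<le> B"
    and split: "\<And>S. S \<subseteq> {..<n} \<Longrightarrow> t \<in> S \<Longrightarrow> key_bounded t B \<beta> S \<or>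
      (\<integral>\<^sup>+ a. (\<Sum>p\<in>S. ennreal (crossing t a p)) \<partial>random_tape) \<le> ennreal (real (card S) * (\<rho> ^ 16 * (\<beta> / 4)))"
    and S: "S \<subseteq> {..<n}" "t \<in> S"
  shows "key_bounded t B \<beta> S"
proof -
  define R where "R S = \<rho> ^ 16 * (B + \<beta> * ln (real (card S)))" for S :: "nat set"
  have card1: "1 \<le> real (card S)" if "finite S" "t \<in> S" for S
    using card_gt_0_iff[of S] that by fastforce
  have R0: "0 \<le> R S" if "finite S" "t \<in> S" for S
    using card1[OF that] \<rho>_pos B \<beta> by (simp add: R_def)
  have "(\<integral>\<^sup>+ \<omega>. ennreal (found_key t L S \<omega>) \<partial>random_tape) \<le> ennreal (R S)" for L
    using S
  proof (induction L arbitrary: S)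
    case 0
    show ?case
      by (simp add: found_key_def)
  next
    case (Suc L)
    have fin: "finite S" and ne: "S \<noteq> {}"
      using Suc.prems finite_subset by blast+
    show ?case
    proof (cases "S = {t}")
      case True
      have "found_key t (Suc L) S \<omega> \<le> 0" for \<omega>
        using found_key_step[OF fin Suc.prems(2), of L \<omega>] pivot_props(1)[OF fin ne, of "shift d \<omega>"] True by simp
      then show ?thesis
        by (simp add: ennreal_neg)
    next
      case False
      then have m2: "2 \<le> card S"
        using card_ge_2[OF fin Suc.prems(2)] by simp
      from split[OF Suc.prems] show ?thesis
      proof
        assume "key_bounded t B \<beta> S"
        then show ?thesis
          unfolding key_bounded_def R_def by blast
      next
        assume cost: "(\<integral>\<^sup>+ a. (\<Sum>p\<in>S. ennreal (crossing t a p)) \<partial>random_tape) \<le> ennreal (real (card S) * (\<rho> ^ 16 * (\<beta> / 4)))"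
        let ?m = "real (card S)" and ?C = "\<lambda>a p. cell_of (offset a) S t p"
        have "(\<integral>\<^sup>+ \<omega>. ennreal (found_key t (Suc L) S \<omega>) \<partial>random_tape)
            \<le> (\<integral>\<^sup>+ a. (\<Sum>p\<in>S. (if p = t then 0 else ennreal (crossing t a p) + ennreal (R (?C a p)))
                * ennreal (1 / ?m)) \<partial>random_tape)"
        proof (rule nn_integral_level[OF fin ne Suc.prems(1), where
              g = "\<lambda>a p b. if p = t then 0 else ennreal (crossing t a p) + ennreal (found_key t L (?C a p) b)"])
          show "(\<lambda>\<omega>. ennreal (found_key t (Suc L) S \<omega>)) \<in> borel_measurable random_tape"
            using measurable_found_key[OF fin, of t "Suc L"] by measurable
          show "ennreal (found_key t (Suc L) S \<omega>) \<le> (if pivot S (shift d \<omega>) = t then 0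
              else ennreal (crossing t \<omega> (pivot S (shift d \<omega>)))
                + ennreal (found_key t L (?C \<omega> (pivot S (shift d \<omega>))) (next_level \<omega>)))" for \<omega>
          proof (cases "pivot S (shift d \<omega>) = t")
            case True
            then show ?thesis
              using found_key_step[OF fin Suc.prems(2), of L \<omega>] by (simp add: ennreal_neg)
          next
            case False
            then show ?thesis
              using found_key_step[OF fin Suc.prems(2), of L \<omega>] unfolding crossing_def[symmetric]
              by (simp add: found_key_nonneg crossing_nonneg ennreal_leI flip: ennreal_plus)
          qed
        next
          fix a a' :: "nat \<Rightarrow> real" and p b
          assume "\<And>k. k < d \<Longrightarrow> a k = a' k"
          then have "offset a = offset a'"
            by (rule offset_cong)
          then show "(if p = t then 0 else ennreal (crossing t a p) + ennreal (found_key t L (?C a p) b))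
              = (if p = t then 0 else ennreal (crossing t a' p) + ennreal (found_key t L (?C a' p) b))"
            by (simp add: crossing_def)
        next
          fix a p assume p: "p \<in> S"
          show "(\<integral>\<^sup>+ b. (if p = t then 0 else ennreal (crossing t a p) + ennreal (found_key t L (?C a p) b)) \<partial>random_tape)
              \<le> (if p = t then 0 else ennreal (crossing t a p) + ennreal (R (?C a p)))"
          proof (cases "p = t")
            case pt: False
            have C: "?C a p \<subseteq> S" "t \<in> ?C a p" "finite (?C a p)"
              using cell_of_side[OF Suc.prems(2), of p "offset a"] pt fin finite_subset cell_of_subset by blast+
            have [measurable]: "(\<lambda>b. found_key t L (?C a p) b) \<in> borel_measurable random_tape"
              by (rule measurable_found_key[OF C(3)])
            have "(\<integral>\<^sup>+ b. (ennreal (crossing t a p) + ennreal (found_key t L (?C a p) b)) \<partial>random_tape)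
                = ennreal (crossing t a p) + (\<integral>\<^sup>+ b. ennreal (found_key t L (?C a p) b) \<partial>random_tape)"
              using tape.P.emeasure_space_1 by (subst nn_integral_add) auto
            also have "\<dots> \<le> ennreal (crossing t a p) + ennreal (R (?C a p))"
              using C Suc.prems by (intro add_left_mono Suc.IH) auto
            finally show ?thesis
              using pt by simp
          qed simp
        qed
        also have "\<dots> \<le> (\<integral>\<^sup>+ a. (ennreal (1 / ?m) * (\<Sum>p\<in>S. ennreal (crossing t a p))
            + ennreal (\<rho> ^ 16 * (B + \<beta> * (ln ?m - 1 / 4)))) \<partial>random_tape)"
        proof (rule nn_integral_mono_AE)
          show "AE a in random_tape. (\<Sum>p\<in>S. (if p = t then 0 else ennreal (crossing t a p) + ennreal (R (?C a p))) * ennreal (1 / ?m))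
              \<le> ennreal (1 / ?m) * (\<Sum>p\<in>S. ennreal (crossing t a p)) + ennreal (\<rho> ^ 16 * (B + \<beta> * (ln ?m - 1 / 4)))"
            using AE_inj_offset
          proof eventually_elim
            case (elim a)
            have inj: "inj_on (offset a) S"
              using elim Suc.prems(1) inj_on_subset by blast
            have "(\<Sum>p\<in>S. (if p = t then 0 else ennreal (crossing t a p) + ennreal (R (?C a p))) * ennreal (1 / ?m))
                \<le> (\<Sum>p\<in>S. ennreal (crossing t a p) * ennreal (1 / ?m) + (if p = t then 0 else ennreal (R (?C a p) * (1 / ?m))))"
            proof (rule sum_mono)
              fix p
              have "0 \<le> 1 / ?m"
                by simp
              note mult = ennreal_mult''[OF this, of "R (?C a p)"]
              show "(if p = t then 0 else ennreal (crossing t a p) + ennreal (R (?C a p))) * ennreal (1 / ?m)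
                \<le> ennreal (crossing t a p) * ennreal (1 / ?m) + (if p = t then 0 else ennreal (R (?C a p) * (1 / ?m)))"
                unfolding mult by (simp add: distrib_right)
            qed
            also have "\<dots> = ennreal (1 / ?m) * (\<Sum>p\<in>S. ennreal (crossing t a p)) + (\<Sum>p\<in>S - {t}. ennreal (R (?C a p) * (1 / ?m)))"
              using fin Suc.prems(2) by (simp add: sum.distrib sum_distrib_left mult.commute sum.remove distrib_left)
            also have "(\<Sum>p\<in>S - {t}. ennreal (R (?C a p) * (1 / ?m))) \<le> ennreal (\<rho> ^ 16 * (B + \<beta> * (ln ?m - 1 / 4)))"
            proof -
              have "0 \<le> R (?C a p)" if "p \<in> S - {t}" for p
              proof (rule R0)
                show "finite (?C a p)" "t \<in> ?C a p"
                  using that cell_of_side[OF Suc.prems(2), of p "offset a"] fin finite_subset cell_of_subset by blast+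
              qed
              then have "(\<Sum>p\<in>S - {t}. ennreal (R (?C a p) * (1 / ?m))) = ennreal (\<Sum>p\<in>S - {t}. R (?C a p) * (1 / ?m))"
                by (intro sum_ennreal) auto
              also have "(\<Sum>p\<in>S - {t}. R (?C a p) * (1 / ?m))
                  = \<rho> ^ 16 * ((\<Sum>p\<in>S - {t}. B) + \<beta> * (\<Sum>p\<in>S - {t}. ln (real (card (?C a p))))) / ?m"
                unfolding R_def by (simp only: sum.distrib sum_distrib_left[symmetric] sum_distrib_right[symmetric]) simp
              also have "\<dots> \<le> \<rho> ^ 16 * (?m * B + \<beta> * (?m * (ln ?m - 1 / 4))) / ?m"
                using sum_ln_cell[OF fin inj Suc.prems(2) m2] \<rho>_pos \<beta> B m2
                by (intro divide_right_mono mult_left_mono add_mono) (auto simp: card_Diff_singleton_if intro!: mult_right_mono)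
              also have "\<dots> = \<rho> ^ 16 * (B + \<beta> * (ln ?m - 1 / 4))"
                using m2 by (simp add: field_simps)
              finally show ?thesis
                by (simp add: ennreal_leI)
            qed
            finally show ?case
              by (simp add: add_left_mono)
          qed
        qed
        also have "\<dots> = ennreal (1 / ?m) * (\<integral>\<^sup>+ a. (\<Sum>p\<in>S. ennreal (crossing t a p)) \<partial>random_tape)
            + ennreal (\<rho> ^ 16 * (B + \<beta> * (ln ?m - 1 / 4)))"
          using tape.P.emeasure_space_1 by (subst nn_integral_add) (auto simp: nn_integral_cmult)
        also have "\<dots> \<le> ennreal (1 / ?m) * ennreal (?m * (\<rho> ^ 16 * (\<beta> / 4))) + ennreal (\<rho> ^ 16 * (B + \<beta> * (ln ?m - 1 / 4)))"
          using cost by (intro add_right_mono mult_left_mono) auto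
        also have "\<dots> = ennreal (R S)"
        proof -
          have "1 / 4 \<le> ln (2 :: real)"
            using ln_le_minus_one[of "1 / 2 :: real"] by (simp add: ln_div)
          also have "\<dots> \<le> ln ?m"
            using m2 by simp
          finally have "1 / 4 \<le> ln ?m" .
          then have "0 \<le> \<rho> ^ 16 * (B + \<beta> * (ln ?m - 1 / 4))"
            using \<rho>_pos B \<beta> by simp
          moreover have "1 / ?m * (?m * (\<rho> ^ 16 * (\<beta> / 4))) = \<rho> ^ 16 * (\<beta> / 4)"
            using m2 by simp
          ultimately show ?thesis
            using \<beta> \<rho>_pos m2 by (simp add: ennreal_mult[symmetric] R_def algebra_simps flip: ennreal_plus)
        qed
        finally show ?thesis .
      qed
    qed
  qed
  then show ?thesis
    unfolding key_bounded_def R_def by blast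
qed

text \<open>The expected size of the cell of \<open>t\<close> shrinks by the factor 3/4 per level,
  and a cell that still contains \<open>t\<close> has size at least 1.\<close>

lemma prob_not_found:
  assumes "S \<subseteq> {..<n}" "t \<in> S"
  shows "(\<integral>\<^sup>+ \<omega>. indicator {\<omega>. t \<notin> nodes (build L S \<omega>)} \<omega> \<partial>random_tape) \<le> ennreal (real (card S) * (3 / 4) ^ L)"
  using assms
proof (induction L arbitrary: S)
  case 0
  have "finite S"
    using 0 finite_subset by blast
  then have "1 \<le> real (card S)"
    using 0(2) card_gt_0_iff[of S] by fastforce
  then have "(1 :: ennreal) \<le> ennreal (real (card S) * (3 / 4) ^ 0)"
    using ennreal_leI[of 1 "real (card S)"] by simp
  then show ?case
    using tape.P.emeasure_space_1 by simp
next
  case (Suc L)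
  have fin: "finite S" and ne: "S \<noteq> {}"
    using Suc.prems finite_subset by blast+
  show ?case
  proof (cases "S = {t}")
    case True
    have "t \<in> nodes (build (Suc L) S \<omega>)" for \<omega>
      using pivot_props(1)[OF fin ne, of "shift d \<omega>"] True by (simp add: Let_def)
    then show ?thesis
      by simp
  next
    case False
    then have m2: "2 \<le> card S"
      using card_ge_2[OF fin Suc.prems(2)] by simp
    let ?m = "real (card S)" and ?C = "\<lambda>a p. cell_of (offset a) S t p"
    let ?I = "\<lambda>L S \<omega>. indicator {\<omega>. t \<notin> nodes (build L S \<omega>)} \<omega> :: ennreal"
    have meas: "?I L S \<in> borel_measurable random_tape" if "finite S" for L S
    proof -
      have "{\<omega>. t \<in> nodes (build L S \<omega>)} \<in> sets random_tape"
        using pred_nodes[OF that, of t L] by (simp add: pred_def)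
      from sets.compl_sets[OF this] have "{\<omega>. t \<notin> nodes (build L S \<omega>)} \<in> sets random_tape"
        by (simp add: Collect_neg_eq Compl_eq_Diff_UNIV)
      then show ?thesis
        by simp
    qed
    have "(\<integral>\<^sup>+ \<omega>. ?I (Suc L) S \<omega> \<partial>random_tape)
        \<le> (\<integral>\<^sup>+ a. (\<Sum>p\<in>S. (if p = t then 0 else ennreal (real (card (?C a p)) * (3 / 4) ^ L)) * ennreal (1 / ?m)) \<partial>random_tape)"
    proof (rule nn_integral_level[OF fin ne Suc.prems(1), where g = "\<lambda>a p b. if p = t then 0 else ?I L (?C a p) b"])
      show "?I (Suc L) S \<in> borel_measurable random_tape"
        by (rule meas[OF fin])
      show "?I (Suc L) S \<omega> \<le> (if pivot S (shift d \<omega>) = t then 0 else ?I L (?C \<omega> (pivot S (shift d \<omega>))) (next_level \<omega>))" for \<omega>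
      proof (cases "pivot S (shift d \<omega>) = t")
        case True
        then show ?thesis
          using ne by (simp add: Let_def)
      next
        case pt: False
        then show ?thesis
          using nodes_build_step[OF fin Suc.prems(2) pt, of L] by (simp add: indicator_def del: build.simps)
      qed
    next
      fix a a' :: "nat \<Rightarrow> real" and p b
      assume "\<And>k. k < d \<Longrightarrow> a k = a' k"
      then have "offset a = offset a'"
        by (rule offset_cong)
      then show "(if p = t then 0 else ?I L (?C a p) b) = (if p = t then 0 else ?I L (?C a' p) b)"
        by simp
    next
      fix a p assume p: "p \<in> S"
      show "(\<integral>\<^sup>+ b. (if p = t then 0 else ?I L (?C a p) b) \<partial>random_tape)
          \<le> (if p = t then 0 else ennreal (real (card (?C a p)) * (3 / 4) ^ L))"
      proof (cases "p = t")
        case pt: False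
        have "?C a p \<subseteq> {..<n}" "t \<in> ?C a p"
          using cell_of_side[OF Suc.prems(2), of p "offset a"] pt Suc.prems(1) cell_of_subset by blast+
        then show ?thesis
          using Suc.IH[of "?C a p"] pt by simp
      qed simp
    qed
    also have "\<dots> \<le> (\<integral>\<^sup>+ a. ennreal (?m * (3 / 4) ^ Suc L) \<partial>random_tape)"
    proof (rule nn_integral_mono_AE)
      show "AE a in random_tape. (\<Sum>p\<in>S. (if p = t then 0 else ennreal (real (card (?C a p)) * (3 / 4) ^ L)) * ennreal (1 / ?m))
          \<le> ennreal (?m * (3 / 4) ^ Suc L)"
        using AE_inj_offset
      proof eventually_elim
        case (elim a)
        have inj: "inj_on (offset a) S"
          using elim Suc.prems(1) inj_on_subset by blast
        define w where "w p = (if p = t then 1 else real (card (?C a p)))" for p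
        have w0: "0 \<le> w p" for p
          by (simp add: w_def)
        have "(\<Sum>p\<in>S. (if p = t then 0 else ennreal (real (card (?C a p)) * (3 / 4) ^ L)) * ennreal (1 / ?m))
            \<le> (\<Sum>p\<in>S. ennreal (w p * ((3 / 4) ^ L / ?m)))"
          by (intro sum_mono) (auto simp: w_def simp flip: ennreal_mult)
        also have "\<dots> = ennreal (\<Sum>p\<in>S. w p * ((3 / 4) ^ L / ?m))"
          using w0 by (intro sum_ennreal) simp
        also have "(\<Sum>p\<in>S. w p * ((3 / 4) ^ L / ?m)) = (\<Sum>p\<in>S. w p) * ((3 / 4) ^ L / ?m)"
          by (rule sum_distrib_right[symmetric])
        also have "\<dots> \<le> (3 / 4 * ?m\<^sup>2) * ((3 / 4) ^ L / ?m)"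
          using sum_cell_of_le[OF fin inj Suc.prems(2) m2] unfolding w_def by (intro mult_right_mono) auto
        also have "\<dots> = ?m * (3 / 4) ^ Suc L"
          by (simp add: power2_eq_square)
        finally show ?case
          by (simp add: ennreal_leI)
      qed
    qed
    also have "\<dots> = ennreal (?m * (3 / 4) ^ Suc L)"
      using tape.P.emeasure_space_1 by simp
    finally show ?thesis .
  qed
qed

end

section \<open>Bounds under polynomial growth around the query\<close>

text \<open>Halving \<open>\<beta>\<close> in each step multiplies the size from which the next bound is available by the
  constant \<open>exp Y\<close>, so that the total cost is a convergent series. The shift by 38 levels makes up
  for the constants in the bounds for large cells.\<close>

lemma halving_chain:
  fixes X Y \<beta> :: real
  assumes "P 0 \<beta>"
    and "\<And>b j. P b (\<beta> / 2 ^ j) \<Longrightarrow> P (b + \<beta> / 2 ^ Suc j * (X + (real j + 38) * Y)) (\<beta> / 2 ^ Suc j)"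
  shows "P (\<beta> * ((1 - 1 / 2 ^ J) * X + (39 - (real J + 39) / 2 ^ J) * Y)) (\<beta> / 2 ^ J)"
\<comment> \<open>The factor after \<beta> is the sum of
  \<open>(X + (j + 38) * Y) / 2 ^ Suc j\<close> over \<open>j < J\<close>. It tends to
  \<open>X + 39 * Y\<close>, as the numbers \<open>j / 2 ^ Suc j\<close> add up to 1.\<close>
proof (induction J)
  case (Suc J)
  have "\<beta> * ((1 - 1 / 2 ^ J) * X + (39 - (real J + 39) / 2 ^ J) * Y) + \<beta> / 2 ^ Suc J * (X + (real J + 38) * Y)
      = \<beta> * ((1 - 1 / 2 ^ Suc J) * X + (39 - (real (Suc J) + 39) / 2 ^ Suc J) * Y)"
    by (simp add: field_simps)
  then show ?case
    using assms(2)[OF Suc] by simp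
qed (use assms(1) in simp)

locale growth_scale = query_scale +
  fixes c :: real and k :: nat
  assumes c_gt: "1 < c" and k_pos: "1 \<le> k"
    and growth: "real (card {i. i < n \<and> dst i < 2 ^ j * \<rho>}) \<le> c ^ j * real k"
begin

text \<open>By growth at most \<open>c ^ (18 * i) * k\<close> points are within
  \<open>2 ^ (18 * i) * \<rho>\<close>. In a cell with at least \<open>k * D ^ i\<close> points this
  is at most the fraction \<open>1 / 2 ^ i\<close>.\<close>

definition D :: real where
  "D = 2 * c ^ 18"

lemma D_ge: "1 \<le> D" "0 < D" "0 \<le> ln D" "0 \<le> ln (real k)" "0 \<le> ln (2 * real k)"
proof -
  have "1 \<le> c ^ 18"
    using c_gt by (simp add: one_le_power)
  then show "1 \<le> D"
    by (simp add: D_def)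
  then show "0 < D" "0 \<le> ln D"
    by auto
  show "0 \<le> ln (real k)" "0 \<le> ln (2 * real k)"
    using k_pos by auto
qed

lemma sum_far_le:
  assumes S: "S \<subseteq> {..<n}" and m: "real k * D ^ i \<le> real (card S)"
    and b: "0 \<le> b1" "0 \<le> b2"
    and F: "\<And>p. p \<in> S \<Longrightarrow> F p \<le> ennreal b1"
      "\<And>p. p \<in> S \<Longrightarrow> 2 ^ (18 * i) * \<rho> \<le> dst p \<Longrightarrow> F p \<le> ennreal (b2 / 2 ^ i)"
  shows "(\<Sum>p\<in>S. F p) \<le> ennreal (real (card S) * ((b1 + b2) / 2 ^ i))"
proof -
  have fin: "finite S"
    using S finite_subset by blast
  let ?N = "{p \<in> S. dst p < 2 ^ (18 * i) * \<rho>}"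
  have "real (card ?N) \<le> real (card {i'. i' < n \<and> dst i' < 2 ^ (18 * i) * \<rho>})"
    using S by (intro of_nat_mono card_mono) auto
  also have "\<dots> \<le> c ^ (18 * i) * real k"
    by (rule growth)
  also have "\<dots> = real k * D ^ i / 2 ^ i"
    by (simp add: D_def power_mult power_mult_distrib)
  also have "\<dots> \<le> real (card S) / 2 ^ i"
    using m by (intro divide_right_mono) auto
  finally have N: "real (card ?N) \<le> real (card S) / 2 ^ i" .
  have "(\<Sum>p\<in>S. F p) \<le> (\<Sum>p\<in>S. ennreal ((if p \<in> ?N then b1 else 0) + b2 / 2 ^ i))"
  proof (rule sum_mono)
    fix p assume p: "p \<in> S"
    show "F p \<le> ennreal ((if p \<in> ?N then b1 else 0) + b2 / 2 ^ i)"
    proof (cases "p \<in> ?N")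
      case True
      have "ennreal b1 \<le> ennreal (b1 + b2 / 2 ^ i)"
        using b by (intro ennreal_leI) simp
      with F(1)[OF p] True show ?thesis
        by simp
    qed (use F(2)[OF p] p in auto)
  qed
  also have "\<dots> = ennreal (\<Sum>p\<in>S. (if p \<in> ?N then b1 else 0) + b2 / 2 ^ i)"
    using b by (intro sum_ennreal) auto
  also have "(\<Sum>p\<in>S. (if p \<in> ?N then b1 else 0) + b2 / 2 ^ i) = real (card ?N) * b1 + real (card S) * (b2 / 2 ^ i)"
  proof -
    have "S \<inter> {p. p \<in> ?N} = ?N"
      by auto
    then show ?thesis
      using fin by (simp add: sum.distrib sum.If_cases del: mem_Collect_eq)
  qed
  also have "\<dots> \<le> real (card S) / 2 ^ i * b1 + real (card S) * (b2 / 2 ^ i)"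
    using N b by (intro add_right_mono mult_right_mono) auto
  also have "\<dots> = real (card S) * ((b1 + b2) / 2 ^ i)"
    by (simp add: field_simps)
  finally show ?thesis
    by (simp add: ennreal_leI)
qed

lemma offset_small_far:
  assumes "2 ^ (18 * i) * \<rho> \<le> dst p"
  shows "(\<integral>\<^sup>+ a. indicator {t. \<bar>t\<bar> \<le> 2 ^ i * \<rho>} (offset a p) \<partial>random_tape) \<le> ennreal (1 / 2 ^ (17 * i))"
proof -
  have p: "0 < 2 ^ (18 * i) * \<rho>"
    using \<rho>_pos by simp
  have "(\<integral>\<^sup>+ a. indicator {t. \<bar>t\<bar> \<le> 2 ^ i * \<rho>} (offset a p) \<partial>random_tape) \<le> ennreal (4 / 5 * (2 ^ i * \<rho>) / dst p)"
    using less_le_trans[OF p assms] \<rho>_pos by (intro offset_small) auto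
  also have "4 / 5 * (2 ^ i * \<rho>) / dst p \<le> (2 ^ i * \<rho>) / (2 ^ (18 * i) * \<rho>)"
    using assms p \<rho>_pos by (intro frac_le) auto
  also have "\<dots> = 2 ^ i / 2 ^ (17 * i + i)"
    using \<rho>_pos by simp
  also have "\<dots> = 1 / 2 ^ (17 * i)"
    unfolding power_add by simp
  finally show ?thesis
    by (simp add: ennreal_leI)
qed

text \<open>The integral is split at \<open>2 ^ i * \<rho>\<close>. An offset within this width is
  unlikely; beyond it \<open>exp (- y) \<le> 1 / y\<close> applies to the discount, with y of order
  \<open>2 ^ (16 * i)\<close>.\<close>

lemma nn_integral_decay_far:
  assumes "2 ^ (18 * i) * \<rho> \<le> dst p"
  shows "(\<integral>\<^sup>+ a. ennreal (exp (- lam * offset a p ^ 16)) \<partial>random_tape) \<le> ennreal ((1 + (9 / 2) ^ 16) / 2 ^ i)"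
proof -
  let ?T = "2 ^ i * \<rho>" and ?e = "(9 / 2) ^ 16 / 2 ^ i :: real"
  have T: "0 < ?T"
    using \<rho>_pos by simp
  have "(\<integral>\<^sup>+ a. ennreal (exp (- lam * offset a p ^ 16)) \<partial>random_tape)
      \<le> (\<integral>\<^sup>+ a. (indicator {t. \<bar>t\<bar> \<le> ?T} (offset a p) + ennreal ?e) \<partial>random_tape)"
  proof (rule nn_integral_mono)
    fix a
    show "ennreal (exp (- lam * offset a p ^ 16)) \<le> indicator {t. \<bar>t\<bar> \<le> ?T} (offset a p) + ennreal ?e"
    proof (cases "\<bar>offset a p\<bar> \<le> ?T")
      case True
      have "exp (- lam * offset a p ^ 16) \<le> 1"
        using lam_pos by simp
      then have "ennreal (exp (- lam * offset a p ^ 16)) \<le> ennreal 1"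
        by (rule ennreal_leI)
      also have "\<dots> \<le> 1 + ennreal ?e"
        by simp
      finally show ?thesis
        using True by simp
    next
      case False
      let ?y = "lam * ?T ^ 16"
      have y: "?y = (2 / 9) ^ 16 * 2 ^ (16 * i)"
        using \<rho>_pos by (simp add: lam_def power_mult_distrib power_divide power_mult[symmetric] mult.commute)
      have y0: "0 < ?y"
        using mult_pos_pos[OF lam_pos zero_less_power[OF T]] .
      have "?T ^ 16 \<le> \<bar>offset a p\<bar> ^ 16"
        using False T by (intro power_mono) auto
      then have "?y \<le> lam * offset a p ^ 16"
        using lam_pos by (simp add: power_even_abs)
      then have "exp (- lam * offset a p ^ 16) \<le> exp (- ?y)"
        by simp
      also have "\<dots> \<le> 1 / ?y"
      proof -
        have "?y \<le> exp ?y"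
          by (rule order_trans[OF _ exp_ge_add_one_self]) simp
        then show ?thesis
          using y0 unfolding exp_minus inverse_eq_divide by (intro divide_left_mono) auto
      qed
      also have "\<dots> = (9 / 2) ^ 16 / 2 ^ (16 * i)"
        unfolding y by (simp add: power_divide)
      also have "\<dots> \<le> ?e"
        by (intro divide_left_mono power_increasing) auto
      finally show ?thesis
        using False by (simp add: ennreal_leI)
    qed
  qed
  also have "\<dots> = (\<integral>\<^sup>+ a. indicator {t. \<bar>t\<bar> \<le> ?T} (offset a p) \<partial>random_tape) + ennreal ?e"
    using tape.P.emeasure_space_1 by (subst nn_integral_add) auto
  also have "\<dots> \<le> ennreal (1 / 2 ^ i) + ennreal ?e"
  proof (rule add_right_mono)
    have "1 / 2 ^ (17 * i) \<le> (1 / 2 ^ i :: real)"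
      by (intro divide_left_mono power_increasing) auto
    then show "(\<integral>\<^sup>+ a. indicator {t. \<bar>t\<bar> \<le> ?T} (offset a p) \<partial>random_tape) \<le> ennreal (1 / 2 ^ i)"
      using offset_small_far[OF assms] by (meson ennreal_leI order_trans)
  qed
  also have "\<dots> = ennreal ((1 + (9 / 2) ^ 16) / 2 ^ i)"
    by (simp add: add_divide_distrib flip: ennreal_plus)
  finally show ?thesis .
qed

text \<open>There are at most \<open>card S + 1\<close> tips, hence at most
  \<open>2 * card S\<close>, which is at most \<open>200 * card (close S)\<close> here.\<close>

lemma count_bounded_trivial:
  assumes "S \<subseteq> {..<n}" "S \<noteq> {}" "real (card S) \<le> 100 * real (card (close S))" "0 \<le> B"
  shows "count_bounded B \<alpha> S"
  unfolding count_bounded_def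
proof (intro allI)
  fix L K W
  have fin: "finite S"
    using assms finite_subset by blast
  then have "1 \<le> card S"
    using assms(2) by (simp add: Suc_le_eq card_gt_0_iff)
  then have "real (card S + 1) \<le> 200 * real (card (close S))"
    using assms(3) by linarith
  then have "real (count_upto (build L S \<omega>) K \<omega> W)
      \<le> 200 * real (card (close S)) + exp (lam * (W - K)) * B * real (card S + 1) powr \<alpha>" for \<omega>
    using count_upto_le[OF fin, of L \<omega> K W] assms(4) by (smt (verit) mult_nonneg_nonneg exp_ge_zero of_nat_mono powr_ge_zero)
  then have "(\<integral>\<^sup>+ \<omega>. ennreal (real (count_upto (build L S \<omega>) K \<omega> W)) \<partial>random_tape)
      \<le> (\<integral>\<^sup>+ \<omega>. ennreal (200 * real (card (close S)) + exp (lam * (W - K)) * B * real (card S + 1) powr \<alpha>) \<partial>random_tape)"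
    by (intro nn_integral_mono ennreal_leI)
  then show "(\<integral>\<^sup>+ \<omega>. ennreal (real (count_upto (build L S \<omega>) K \<omega> W)) \<partial>random_tape)
      \<le> ennreal (200 * real (card (close S)) + exp (lam * (W - K)) * B * real (card S + 1) powr \<alpha>)"
    using tape.P.emeasure_space_1 by simp
qed

lemma count_bounded_mono:
  assumes "count_bounded B \<alpha> S" "B * real (card S + 1) powr \<alpha> \<le> B' * real (card S + 1) powr \<alpha>'"
  shows "count_bounded B' \<alpha>' S"
  unfolding count_bounded_def
proof (intro allI)
  fix L K W
  have "exp (lam * (W - K)) * (B * real (card S + 1) powr \<alpha>) \<le> exp (lam * (W - K)) * (B' * real (card S + 1) powr \<alpha>')"
    using assms(2) by (intro mult_left_mono) auto
  then have "ennreal (200 * real (card (close S)) + exp (lam * (W - K)) * B * real (card S + 1) powr \<alpha>)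
      \<le> ennreal (200 * real (card (close S)) + exp (lam * (W - K)) * B' * real (card S + 1) powr \<alpha>')"
    by (intro ennreal_leI) (simp add: mult.assoc)
  then show "(\<integral>\<^sup>+ \<omega>. ennreal (real (count_upto (build L S \<omega>) K \<omega> W)) \<partial>random_tape)
      \<le> ennreal (200 * real (card (close S)) + exp (lam * (W - K)) * B' * real (card S + 1) powr \<alpha>')"
    using assms(1) unfolding count_bounded_def by (meson order_trans)
qed

text \<open>A bound for cells of all sizes with a fixed exponent below 1. If more than 99 percent of
  the points have distance at least \<open>4 * \<rho>\<close>, then a fair share of the pivots
  discounts its far side to 3/8, which outweighs the loss due to the exponent.\<close>

lemma count_base:
  assumes "S \<subseteq> {..<n}"
  shows "count_bounded 1 (999 / 1000) S"
proof (rule count_bounded_induct[OF _ _ _ assms])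
  fix S assume S: "S \<subseteq> {..<n}" and ne: "S \<noteq> {}"
  have fin: "finite S"
    using S finite_subset by blast
  let ?m = "real (card S)" and ?s = "2 powr (1 / 1000) :: real" and ?I = "{t. \<bar>t\<bar> \<le> 9 / 2 * \<rho>}"
  have m: "0 < ?m"
    using fin ne by (simp add: card_gt_0_iff)
  show "count_bounded 1 (999 / 1000) S \<or>
      (\<exists>G. G \<in> borel_measurable random_tape \<and> (AE a in random_tape. potential (999 / 1000) S a \<le> G a)
         \<and> (\<integral>\<^sup>+ a. ennreal (G a) \<partial>random_tape) \<le> ennreal ?m)"
  proof (cases "?m \<le> 100 * real (card (close S))")
    case True
    then show ?thesis
      using count_bounded_trivial[OF S ne True] by simp
  next
    case far: False
    \<comment> \<open>\<open>G\<close> is affine in the fraction \<open>u\<close> of offsets within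
      \<open>9 / 2 * \<rho>\<close>: the square of \<open>1 - u\<close> is replaced by its tangent
      at \<open>u = 9 / 10\<close>. Thus only the mean of \<open>u\<close> has to be known.\<close>
    define c0 where "c0 = ?m * (?s * (1 / 1000 + 999 / 1000 * (1 - 5 / 32 * (19 / 100))))"
    define c1 where "c1 = ?s * (999 / 1000 * (5 / 32 * (1 / 5)))"
    define G where "G a = c0 + c1 * (\<Sum>p\<in>S. indicator ?I (offset a p))" for a
    have c: "0 \<le> c0" "0 \<le> c1"
      using m by (simp_all add: c0_def c1_def)
    have G_meas: "G \<in> borel_measurable random_tape"
      unfolding G_def by measurable
    have "AE a in random_tape. potential (999 / 1000) S a \<le> G a"
      using AE_inj_offset
    proof eventually_elim
      case (elim a)
      have inj: "inj_on (offset a) S"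
        using elim S inj_on_subset by blast
      let ?A = "{p \<in> S. \<not> \<bar>offset a p\<bar> \<le> 9 / 2 * \<rho>}"
      define u where "u = (\<Sum>p\<in>S. indicator ?I (offset a p)) / ?m"
      have decay: "exp (- lam * offset a p ^ 16) \<le> 3 / 8" if "p \<in> ?A" for p
      proof -
        have "(9 / 2 * \<rho>) ^ 16 \<le> \<bar>offset a p\<bar> ^ 16"
          using that \<rho>_pos by (intro power_mono) auto
        then have "lam * (9 / 2 * \<rho>) ^ 16 \<le> lam * offset a p ^ 16"
          using lam_pos by (simp add: power_even_abs)
        moreover have "lam * (9 / 2 * \<rho>) ^ 16 = 1"
          using \<rho>_pos by (simp add: lam_def power_mult_distrib[symmetric])
        ultimately have "exp (- lam * offset a p ^ 16) \<le> exp (- 1)"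
          by simp
        also have "\<dots> = 1 / exp 1"
          by (simp add: exp_minus inverse_eq_divide)
        also have "\<dots> \<le> 1 / (8 / 3)"
        proof (intro divide_left_mono)
          \<comment> \<open>\<open>(31 / 30) ^ 30\<close> is about 2.674, slightly more than
            8/3.\<close>
          have "(8 / 3 :: real) \<le> (1 + 1 / real 30) ^ 30"
            by (simp add: power_divide)
          also have "\<dots> \<le> exp 1"
            by (rule exp_ge_one_plus_x_over_n_power_n) auto
          finally show "(8 / 3 :: real) \<le> exp 1" .
        qed auto
        finally show ?thesis
          by simp
      qed
      have "real (card ?A) / ?m = 1 - u"
      proof -
        have "(\<Sum>p\<in>S. indicator ?I (offset a p)) = real (card {p \<in> S. \<bar>offset a p\<bar> \<le> 9 / 2 * \<rho>})"
          using fin by (simp add: indicator_def sum.If_cases Int_def)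
        moreover have "card {p \<in> S. \<bar>offset a p\<bar> \<le> 9 / 2 * \<rho>} + card ?A = card S"
          using fin by (subst card_Un_disjoint[symmetric]) (auto intro!: arg_cong[where f = card])
        ultimately show ?thesis
          using m unfolding u_def by (simp add: field_simps)
      qed
      moreover have "potential (999 / 1000) S a \<le> ?m * (2 powr (1 / 1000) * (1 / 1000 + (1 - 1 / 1000) * (1 - 5 / 32 * (real (card ?A) / ?m)\<^sup>2)))"
        using split_potential_far[OF fin inj ne, of "1 / 1000" "\<lambda>p. exp (- lam * offset a p ^ 16)" ?A] decay lam_pos
        unfolding potential_def by simp
      ultimately have "potential (999 / 1000) S a \<le> ?m * (?s * (1 / 1000 + 999 / 1000 * (1 - 5 / 32 * (1 - u)\<^sup>2)))"
        by simp
      also have "\<dots> \<le> ?m * (?s * (1 / 1000 + 999 / 1000 * (1 - 5 / 32 * (19 / 100 - 1 / 5 * u))))"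
      proof -
        have "0 \<le> (9 / 10 - u)\<^sup>2"
          by simp
        then have "19 / 100 - 1 / 5 * u \<le> (1 - u)\<^sup>2"
          by (simp add: power2_eq_square algebra_simps)
        then show ?thesis
          using m by (intro mult_left_mono add_left_mono diff_left_mono) auto
      qed
      also have "\<dots> = c0 + c1 * (?m * u)"
        by (simp add: c0_def c1_def algebra_simps)
      also have "\<dots> = G a"
        using m by (simp add: G_def u_def)
      finally show ?case .
    qed
    moreover have "(\<integral>\<^sup>+ a. ennreal (G a) \<partial>random_tape) \<le> ennreal ?m"
    proof -
      have "(\<integral>\<^sup>+ a. ennreal (G a) \<partial>random_tape)
          = (\<integral>\<^sup>+ a. (ennreal c0 + ennreal c1 * (\<Sum>p\<in>S. indicator ?I (offset a p))) \<partial>random_tape)"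
      proof (rule nn_integral_cong)
        fix a
        have "(\<Sum>p\<in>S. indicator ?I (offset a p) :: ennreal) = ennreal (\<Sum>p\<in>S. indicator ?I (offset a p))"
          by (simp only: ennreal_indicator[symmetric] sum_ennreal indicator_pos_le)
        then show "ennreal (G a) = ennreal c0 + ennreal c1 * (\<Sum>p\<in>S. indicator ?I (offset a p))"
          using c by (simp add: G_def ennreal_mult sum_nonneg)
      qed
      also have "\<dots> = ennreal c0 + ennreal c1 * (\<Sum>p\<in>S. \<integral>\<^sup>+ a. indicator ?I (offset a p) \<partial>random_tape)"
        using tape.P.emeasure_space_1
        by (subst nn_integral_add; (subst nn_integral_cmult)?; (subst nn_integral_sum)?; simp)
      also have "\<dots> \<le> ennreal c0 + ennreal c1 * (\<Sum>p\<in>S. ennreal ((if p \<in> close S then 1 / 10 else 0) + 9 / 10))"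
      proof (intro add_left_mono mult_left_mono sum_mono)
        fix p assume p: "p \<in> S"
        show "(\<integral>\<^sup>+ a. indicator ?I (offset a p) \<partial>random_tape) \<le> ennreal ((if p \<in> close S then 1 / 10 else 0) + 9 / 10)"
        proof (cases "p \<in> close S")
          case True
          have "(\<integral>\<^sup>+ a. indicator ?I (offset a p) \<partial>random_tape) \<le> (\<integral>\<^sup>+ a. 1 \<partial>random_tape)"
            by (intro nn_integral_mono) (auto simp: indicator_def)
          then show ?thesis
            using True tape.P.emeasure_space_1 by simp
        next
          case False
          then have dp: "4 * \<rho> \<le> dst p"
            using p by (simp add: close_def)
          then have "(\<integral>\<^sup>+ a. indicator ?I (offset a p) \<partial>random_tape) \<le> ennreal (4 / 5 * (9 / 2 * \<rho>) / dst p)"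
            using \<rho>_pos by (intro offset_small) auto
          also have "4 / 5 * (9 / 2 * \<rho>) / dst p \<le> 4 / 5 * (9 / 2 * \<rho>) / (4 * \<rho>)"
            using dp \<rho>_pos by (intro divide_left_mono) auto
          also have "\<dots> = 9 / 10"
            using \<rho>_pos by simp
          finally show ?thesis
            using False by (simp add: ennreal_leI)
        qed
      qed auto
      also have "(\<Sum>p\<in>S. ennreal ((if p \<in> close S then 1 / 10 else 0) + 9 / 10))
          = ennreal (\<Sum>p\<in>S. (if p \<in> close S then 1 / 10 else 0) + 9 / 10)"
        by (intro sum_ennreal) auto
      also have "(\<Sum>p\<in>S. (if p \<in> close S then 1 / 10 else 0) + 9 / 10) = real (card (close S)) / 10 + ?m * (9 / 10)"
      proof -
        have "S \<inter> {p. p \<in> close S} = close S"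
          by (auto simp: close_def)
        then show ?thesis
          using fin by (simp add: sum.distrib sum.If_cases)
      qed
      also have "ennreal c0 + ennreal c1 * ennreal (real (card (close S)) / 10 + ?m * (9 / 10))
          = ennreal (c0 + c1 * (real (card (close S)) / 10 + ?m * (9 / 10)))"
        using c m by (simp add: ennreal_mult)
      also have "\<dots> \<le> ennreal ?m"
      proof (rule ennreal_leI)
        \<comment> \<open>Less than 1/100 of the points is close, so the mean of \<open>u\<close> is
          below 91/100. The tangent there has the value
          \<open>19 / 100 - 182 / 1000 = 8 / 1000\<close>, whose effect just exceeds the loss
          \<open>2 powr (1 / 1000) \<le> 1 + 1 / 1000\<close>.\<close>
        have "c0 + c1 * (real (card (close S)) / 10 + ?m * (9 / 10)) \<le> c0 + c1 * (?m * (91 / 100))"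
          using far c by (intro add_left_mono mult_left_mono) auto
        also have "\<dots> = ?m * (?s * (1 / 1000 + 999 / 1000 * (1 - 5 / 32 * (8 / 1000))))"
          by (simp add: c0_def c1_def algebra_simps)
        also have "\<dots> \<le> ?m * ((1 + 1 / 1000) * (1 / 1000 + 999 / 1000 * (1 - 5 / 32 * (8 / 1000))))"
          using powr_concave[of 2 1 "1 / 1000"] m by (intro mult_left_mono mult_right_mono) auto
        also have "\<dots> \<le> ?m * 1"
          using m by (intro mult_left_mono) auto
        finally show "c0 + c1 * (real (card (close S)) / 10 + ?m * (9 / 10)) \<le> ?m"
          by simp
      qed
      finally show ?thesis .
    qed
    ultimately show ?thesis
      using G_meas by blast
  qed
qed auto

text \<open>In a cell with at least \<open>k * D ^ i\<close> points the mean discount is at most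
  \<open>\<alpha> / 8\<close>, and this is exactly what the exponent \<open>\<alpha> / 2\<close>
  gains in \<open>split_potential_large\<close>. A smaller cell keeps its old bound: one half of the
  power is replaced by its maximal value and moves into the constant.\<close>

lemma count_halve:
  assumes \<alpha>: "0 \<le> \<alpha>" "\<alpha> \<le> 1" and B: "1 \<le> B" and i: "(2 + (9 / 2) ^ 16) / 2 ^ i \<le> \<alpha> / 8"
    and bounded: "\<And>S. S \<subseteq> {..<n} \<Longrightarrow> count_bounded B \<alpha> S" and S: "S \<subseteq> {..<n}"
  shows "count_bounded (B * (2 * real k * D ^ i) powr (\<alpha> / 2)) (\<alpha> / 2) S"
proof (rule count_bounded_induct[OF _ _ _ S])
  let ?M = "real k * D ^ i" and ?B = "B * (2 * real k * D ^ i) powr (\<alpha> / 2)"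
  have "1 * 1 \<le> ?M"
    using k_pos D_ge by (intro mult_mono) (auto simp: one_le_power)
  then have M: "1 \<le> ?M"
    by simp
  have "1 * 1 \<le> B * (2 * ?M) powr (\<alpha> / 2)"
    using B M \<alpha> by (intro mult_mono ge_one_powr_ge_zero) auto
  then show "1 \<le> ?B"
    by (simp add: mult.assoc)
  show "0 \<le> \<alpha> / 2"
    using \<alpha> by simp
  fix S assume S: "S \<subseteq> {..<n}" and ne: "S \<noteq> {}"
  have fin: "finite S"
    using S finite_subset by blast
  let ?m = "real (card S)"
  show "count_bounded ?B (\<alpha> / 2) S \<or>
      (\<exists>G. G \<in> borel_measurable random_tape \<and> (AE a in random_tape. potential (\<alpha> / 2) S a \<le> G a)
         \<and> (\<integral>\<^sup>+ a. ennreal (G a) \<partial>random_tape) \<le> ennreal ?m)"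
  proof (cases "?M \<le> ?m")
    case False
    have "B * real (card S + 1) powr \<alpha> = B * (real (card S + 1) powr (\<alpha> / 2) * real (card S + 1) powr (\<alpha> / 2))"
      by (simp flip: powr_add)
    also have "\<dots> \<le> B * ((2 * ?M) powr (\<alpha> / 2) * real (card S + 1) powr (\<alpha> / 2))"
      using False M B \<alpha> by (intro mult_left_mono mult_right_mono powr_mono2) auto
    finally have "B * real (card S + 1) powr \<alpha> \<le> ?B * real (card S + 1) powr (\<alpha> / 2)"
      by (simp add: mult.assoc)
    then show ?thesis
      using count_bounded_mono[OF bounded[OF S]] by blast
  next
    case True
    define G where "G a = ?m * (1 - \<alpha> / 2 / 4) + (\<Sum>p\<in>S. exp (- lam * offset a p ^ 16))" for a
    have G_meas: "G \<in> borel_measurable random_tape"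
      unfolding G_def by measurable
    have "AE a in random_tape. potential (\<alpha> / 2) S a \<le> G a"
      using AE_inj_offset
    proof eventually_elim
      case (elim a)
      have inj: "inj_on (offset a) S"
        using elim S inj_on_subset by blast
      then show ?case
        using split_potential_large[OF fin inj ne, of "\<alpha> / 2" "\<lambda>p. exp (- lam * offset a p ^ 16)"] \<alpha>
        unfolding potential_def G_def by simp
    qed
    moreover have "(\<integral>\<^sup>+ a. ennreal (G a) \<partial>random_tape) \<le> ennreal ?m"
    proof -
      have c: "0 \<le> ?m * (1 - \<alpha> / 2 / 4)"
        using \<alpha> by simp
      have "(\<integral>\<^sup>+ a. ennreal (G a) \<partial>random_tape)
          = (\<integral>\<^sup>+ a. (ennreal (?m * (1 - \<alpha> / 2 / 4)) + (\<Sum>p\<in>S. ennreal (exp (- lam * offset a p ^ 16)))) \<partial>random_tape)"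
        unfolding G_def using c by (intro nn_integral_cong) (simp add: sum_nonneg)
      also have "\<dots> = ennreal (?m * (1 - \<alpha> / 2 / 4)) + (\<Sum>p\<in>S. \<integral>\<^sup>+ a. ennreal (exp (- lam * offset a p ^ 16)) \<partial>random_tape)"
        using tape.P.emeasure_space_1 by (subst nn_integral_add; (subst nn_integral_sum)?; simp)
      also have "(\<Sum>p\<in>S. \<integral>\<^sup>+ a. ennreal (exp (- lam * offset a p ^ 16)) \<partial>random_tape)
          \<le> ennreal (?m * ((1 + (1 + (9 / 2) ^ 16)) / 2 ^ i))"
      proof (rule sum_far_le[OF S True])
        fix p
        have "(\<integral>\<^sup>+ a. ennreal (exp (- lam * offset a p ^ 16)) \<partial>random_tape) \<le> (\<integral>\<^sup>+ a. ennreal 1 \<partial>random_tape)"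
          using lam_pos by (intro nn_integral_mono ennreal_leI) simp
        then show "(\<integral>\<^sup>+ a. ennreal (exp (- lam * offset a p ^ 16)) \<partial>random_tape) \<le> ennreal 1"
          using tape.P.emeasure_space_1 by simp
      qed (use nn_integral_decay_far in auto)
      also have "?m * ((1 + (1 + (9 / 2) ^ 16)) / 2 ^ i) \<le> ?m * (\<alpha> / 8)"
        using i by (intro mult_left_mono) auto
      also have "ennreal (?m * (1 - \<alpha> / 2 / 4)) + ennreal (?m * (\<alpha> / 8)) = ennreal ?m"
        using c \<alpha> by (subst ennreal_plus[symmetric]) (auto simp: algebra_simps)
      finally show ?thesis
        by (simp add: ennreal_leI add_left_mono)
    qed
    ultimately show ?thesis
      using G_meas by blast
  qed
qed

text \<open>2027025 and 191898783962510625 are the 16th and the 32nd moment of a standard Gaussian.\<close>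

lemma crossing_far:
  assumes t: "dst t \<le> \<rho>" and p: "2 ^ (18 * i) * \<rho> \<le> dst p"
  shows "(\<integral>\<^sup>+ a. ennreal (crossing t a p) \<partial>random_tape) \<le> ennreal ((1 + 191898783962510625) * \<rho> ^ 16 / 2 ^ i)"
proof -
  let ?T = "2 ^ i * \<rho>" and ?M = "191898783962510625 :: real"
  have T: "0 < ?T"
    using \<rho>_pos by simp
  \<comment> \<open>If a pivot with an offset beyond \<open>2 ^ i * \<rho>\<close> separates
    \<open>t\<close> from the query, then the offset of \<open>t\<close> is beyond this width too.
    The 16th power of their quotient is at least 1 and can be inserted as a factor, which leads to
    the 32nd moment.\<close>
  have "(\<integral>\<^sup>+ a. ennreal (crossing t a p) \<partial>random_tape)
      \<le> (\<integral>\<^sup>+ a. (ennreal (?T ^ 16) * indicator {t. \<bar>t\<bar> \<le> ?T} (offset a p) + ennreal (1 / ?T ^ 16) * ennreal (offset a t ^ (2 * 16))) \<partial>random_tape)"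
  proof (rule nn_integral_mono)
    fix a
    show "ennreal (crossing t a p)
        \<le> ennreal (?T ^ 16) * indicator {t. \<bar>t\<bar> \<le> ?T} (offset a p) + ennreal (1 / ?T ^ 16) * ennreal (offset a t ^ (2 * 16))"
    proof (cases "\<bar>offset a p\<bar> \<le> ?T")
      case True
      have "\<bar>offset a p\<bar> ^ 16 \<le> ?T ^ 16"
        using True by (intro power_mono) auto
      then have "crossing t a p \<le> ?T ^ 16"
        using T by (simp add: crossing_def power_even_abs)
      then have "ennreal (crossing t a p) \<le> ennreal (?T ^ 16)"
        by (rule ennreal_leI)
      then show ?thesis
        using True by (simp add: add_increasing2)
    next
      case False
      have "crossing t a p \<le> 1 / ?T ^ 16 * offset a t ^ (2 * 16)"
      proof (cases "\<bar>offset a p\<bar> \<le> \<bar>offset a t\<bar>")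
        case le: True
        have "offset a p ^ 16 * ?T ^ 16 = \<bar>offset a p\<bar> ^ 16 * ?T ^ 16"
          by (simp add: power_even_abs)
        also have "\<dots> \<le> \<bar>offset a t\<bar> ^ 16 * \<bar>offset a t\<bar> ^ 16"
          using False le T by (intro mult_mono power_mono) auto
        also have "\<dots> = offset a t ^ (2 * 16)"
          unfolding power_mult by (simp add: power_even_abs flip: power_add)
        finally have "offset a p ^ 16 \<le> offset a t ^ (2 * 16) / ?T ^ 16"
          using zero_less_power[OF T, of 16] by (simp add: pos_le_divide_eq)
        then show ?thesis
          using le by (simp add: crossing_def)
      qed (use T in \<open>simp add: crossing_def\<close>)
      then have "ennreal (crossing t a p) \<le> ennreal (1 / ?T ^ 16 * offset a t ^ (2 * 16))"
        by (rule ennreal_leI)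
      also have "\<dots> = ennreal (1 / ?T ^ 16) * ennreal (offset a t ^ (2 * 16))"
        using T by (intro ennreal_mult) auto
      finally show ?thesis
        using False by simp
    qed
  qed
  also have "\<dots> = ennreal (?T ^ 16) * (\<integral>\<^sup>+ a. indicator {t. \<bar>t\<bar> \<le> ?T} (offset a p) \<partial>random_tape)
      + ennreal (1 / ?T ^ 16) * (\<integral>\<^sup>+ a. ennreal (offset a t ^ (2 * 16)) \<partial>random_tape)"
    by (simp add: nn_integral_add nn_integral_cmult)
  also have "\<dots> \<le> ennreal (?T ^ 16) * ennreal (1 / 2 ^ (17 * i)) + ennreal (1 / ?T ^ 16) * ennreal (?M * \<rho> ^ 32)"
  proof (intro add_mono mult_left_mono offset_small_far[OF p])
    have "fact 32 / (2 ^ 16 * fact 16) = ?M"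
      by (simp add: fact_numeral)
    then show "(\<integral>\<^sup>+ a. ennreal (offset a t ^ (2 * 16)) \<partial>random_tape) \<le> ennreal (?M * \<rho> ^ 32)"
      using dot_moment[of "\<lambda>k. x t k - q k" d \<rho> 16] t unfolding offset_def dst_def by simp
  qed auto
  also have "\<dots> = ennreal (?T ^ 16 * (1 / 2 ^ (17 * i)) + 1 / ?T ^ 16 * (?M * \<rho> ^ 32))"
  proof -
    have nonneg: "0 \<le> ?T ^ 16" "0 \<le> (1 / 2 ^ (17 * i) :: real)" "0 \<le> 1 / ?T ^ 16" "0 \<le> ?M * \<rho> ^ 32"
      using T \<rho>_pos by auto
    show ?thesis
      unfolding ennreal_plus[OF mult_nonneg_nonneg[OF nonneg(1,2)] mult_nonneg_nonneg[OF nonneg(3,4)]]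
        ennreal_mult[OF nonneg(1,2)] ennreal_mult[OF nonneg(3,4)] ..
  qed
  also have "?T ^ 16 * (1 / 2 ^ (17 * i)) = \<rho> ^ 16 * (1 / 2 ^ i)"
  proof -
    have "(2 :: real) ^ (17 * i) = 2 ^ (16 * i) * 2 ^ i"
      by (simp flip: power_add)
    then show ?thesis
      by (simp add: power_mult_distrib power_mult[symmetric] mult.commute)
  qed
  also have "1 / ?T ^ 16 * (?M * \<rho> ^ 32) = ?M * \<rho> ^ 16 * (1 / 2 ^ (16 * i))"
  proof -
    have "\<rho> ^ 32 = \<rho> ^ 16 * \<rho> ^ 16"
      by (simp flip: power_add)
    then show ?thesis
      unfolding power_mult_distrib power_mult[symmetric] mult.commute[of i 16] using \<rho>_pos by (simp add: field_simps)
  qed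
  also have "\<rho> ^ 16 * (1 / 2 ^ i) + ?M * \<rho> ^ 16 * (1 / 2 ^ (16 * i)) \<le> \<rho> ^ 16 * (1 / 2 ^ i) + ?M * \<rho> ^ 16 * (1 / 2 ^ i)"
    using \<rho>_pos by (intro add_left_mono mult_left_mono divide_left_mono power_increasing) auto
  also have "\<dots> = (1 + ?M) * \<rho> ^ 16 / 2 ^ i"
    by (simp add: field_simps)
  finally show ?thesis
    by (simp add: ennreal_leI)
qed

lemma crossing_moment:
  assumes "dst t \<le> \<rho>"
  shows "(\<integral>\<^sup>+ a. ennreal (crossing t a p) \<partial>random_tape) \<le> ennreal (2027025 * \<rho> ^ 16)"
proof -
  have "(\<integral>\<^sup>+ a. ennreal (crossing t a p) \<partial>random_tape) \<le> (\<integral>\<^sup>+ a. ennreal (offset a t ^ (2 * 8)) \<partial>random_tape)"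
  proof (intro nn_integral_mono ennreal_leI)
    fix a
    show "crossing t a p \<le> offset a t ^ (2 * 8)"
      using power_mono[of "\<bar>offset a p\<bar>" "\<bar>offset a t\<bar>" 16] by (simp add: crossing_def power_even_abs)
  qed
  also have "\<dots> \<le> ennreal (2027025 * \<rho> ^ 16)"
  proof -
    have "fact 16 / (2 ^ 8 * fact 8) = (2027025 :: real)"
      by (simp add: fact_numeral)
    then show ?thesis
      using dot_moment[of "\<lambda>k. x t k - q k" d \<rho> 8] assms unfolding offset_def dst_def by simp
  qed
  finally show ?thesis .
qed

lemma nn_integral_sum_crossing:
  "(\<integral>\<^sup>+ a. (\<Sum>p\<in>S. ennreal (crossing t a p)) \<partial>random_tape) = (\<Sum>p\<in>S. \<integral>\<^sup>+ a. ennreal (crossing t a p) \<partial>random_tape)"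
  by (intro nn_integral_sum) measurable

text \<open>8108100 is four times the 16th moment 2027025, because \<open>key_bounded_induct\<close>
  permits a cost of \<open>\<beta> / 4\<close> per split.\<close>

lemma key_base:
  assumes t: "dst t \<le> \<rho>" and S: "S \<subseteq> {..<n}" "t \<in> S"
  shows "key_bounded t 0 8108100 S"
proof (rule key_bounded_induct[OF _ _ _ S])
  fix S assume S: "S \<subseteq> {..<n}"
  have "(\<Sum>p\<in>S. \<integral>\<^sup>+ a. ennreal (crossing t a p) \<partial>random_tape) \<le> (\<Sum>p\<in>S. ennreal (2027025 * \<rho> ^ 16))"
    by (intro sum_mono crossing_moment[OF t])
  also have "\<dots> = ennreal (real (card S) * (\<rho> ^ 16 * (8108100 / 4)))"
    using \<rho>_pos by (subst sum_ennreal) (auto simp: mult_ac)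
  finally show "key_bounded t 0 8108100 S \<or>
      (\<integral>\<^sup>+ a. (\<Sum>p\<in>S. ennreal (crossing t a p)) \<partial>random_tape) \<le> ennreal (real (card S) * (\<rho> ^ 16 * (8108100 / 4)))"
    unfolding nn_integral_sum_crossing by simp
qed auto

text \<open>In large cells the expected crossing cost is small enough for half the slope. In smaller
  cells half of the logarithm is replaced by its maximal value \<open>ln (k * D ^ i)\<close> and
  moves into the constant.\<close>

lemma key_halve:
  assumes t: "dst t \<le> \<rho>" and \<beta>: "0 \<le> \<beta>" and B: "0 \<le> B"
    and i: "(2027025 + (1 + 191898783962510625)) / 2 ^ i \<le> \<beta> / 8"
    and bounded: "\<And>S. S \<subseteq> {..<n} \<Longrightarrow> t \<in> S \<Longrightarrow> key_bounded t B \<beta> S" and S: "S \<subseteq> {..<n}" "t \<in> S"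
  shows "key_bounded t (B + \<beta> / 2 * ln (real k * D ^ i)) (\<beta> / 2) S"
proof (rule key_bounded_induct[OF _ _ _ S])
  let ?M = "real k * D ^ i"
  have "1 * 1 \<le> ?M"
    using k_pos D_ge by (intro mult_mono) (auto simp: one_le_power)
  then have M: "1 \<le> ?M"
    by simp
  then have "0 \<le> \<beta> / 2 * ln ?M"
    using \<beta> by simp
  then show "0 \<le> B + \<beta> / 2 * ln ?M" "0 \<le> \<beta> / 2"
    using B \<beta> by auto
  fix S assume S: "S \<subseteq> {..<n}" "t \<in> S"
  have fin: "finite S"
    using S finite_subset by blast
  let ?m = "real (card S)"
  have m: "0 < ?m"
    using fin S(2) by (auto simp: card_gt_0_iff)
  show "key_bounded t (B + \<beta> / 2 * ln ?M) (\<beta> / 2) S \<or>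
      (\<integral>\<^sup>+ a. (\<Sum>p\<in>S. ennreal (crossing t a p)) \<partial>random_tape) \<le> ennreal (?m * (\<rho> ^ 16 * (\<beta> / 2 / 4)))"
  proof (cases "?M \<le> ?m")
    case False
    have "ln ?m \<le> ln ?M"
      using False m by simp
    from mult_left_mono[OF this, of "\<beta> / 2"] have "B + \<beta> * ln ?m \<le> B + \<beta> / 2 * ln ?M + \<beta> / 2 * ln ?m"
      using \<beta> by simp
    then have "\<rho> ^ 16 * (B + \<beta> * ln ?m) \<le> \<rho> ^ 16 * (B + \<beta> / 2 * ln ?M + \<beta> / 2 * ln ?m)"
      using \<rho>_pos by (intro mult_left_mono) auto
    then have "key_bounded t (B + \<beta> / 2 * ln ?M) (\<beta> / 2) S"
      using bounded[OF S] unfolding key_bounded_def by (meson ennreal_leI order_trans)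
    then show ?thesis ..
  next
    case True
    have "(\<Sum>p\<in>S. \<integral>\<^sup>+ a. ennreal (crossing t a p) \<partial>random_tape)
        \<le> ennreal (?m * ((2027025 * \<rho> ^ 16 + (1 + 191898783962510625) * \<rho> ^ 16) / 2 ^ i))"
      using \<rho>_pos crossing_moment[OF t] crossing_far[OF t, of i] by (intro sum_far_le[OF S(1) True]) auto
    also have "(2027025 * \<rho> ^ 16 + (1 + 191898783962510625) * \<rho> ^ 16) / 2 ^ i
        = \<rho> ^ 16 * ((2027025 + (1 + 191898783962510625)) / 2 ^ i)"
      by (simp add: field_simps)
    also have "ennreal (?m * (\<rho> ^ 16 * ((2027025 + (1 + 191898783962510625)) / 2 ^ i))) \<le> ennreal (?m * (\<rho> ^ 16 * (\<beta> / 8)))"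
      using i \<rho>_pos by (intro ennreal_leI mult_left_mono) auto
    finally show ?thesis
      unfolding nn_integral_sum_crossing by simp
  qed
qed

lemma ln_size: "ln (real k * D ^ i) = ln (real k) + real i * ln D" "ln (2 * real k * D ^ i) = ln (2 * real k) + real i * ln D"
  using k_pos D_ge(2) by (simp_all add: ln_mult ln_realpow)

text \<open>Once \<open>n < 2 ^ J\<close>, the remaining power of the size is at most
  \<open>exp 1\<close>, so no dependence on \<open>n\<close> is left. The radius
  \<open>4 * \<rho>\<close> of \<open>close\<close> is two doublings of \<rho>, whence the factor
  \<open>c\<^sup>2\<close>.\<close>

lemma expected_count:
  "(\<integral>\<^sup>+ \<omega>. ennreal (real (count_upto (build L {..<n} \<omega>) 0 \<omega> W)) \<partial>random_tape)
    \<le> ennreal (200 * (c\<^sup>2 * real k) + exp (lam * W) * exp (999 / 1000 * (ln (2 * real k) + 39 * ln D)) * 3)"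
proof -
  define P where "P b \<alpha> \<longleftrightarrow> 0 \<le> b \<and> (\<forall>S\<subseteq>{..<n}. count_bounded (exp b) \<alpha> S)" for b \<alpha>
  obtain J where J: "real n < 2 ^ J"
    using real_arch_pow[of 2 "real n"] by auto
  let ?X = "ln (2 * real k)" and ?Y = "ln D"
  have "P (999 / 1000 * ((1 - 1 / 2 ^ J) * ?X + (39 - (real J + 39) / 2 ^ J) * ?Y)) (999 / 1000 / 2 ^ J)"
  proof (rule halving_chain)
    show "P 0 (999 / 1000)"
      using count_base by (simp add: P_def)
  next
    fix b j assume P: "P b (999 / 1000 / 2 ^ j)"
    let ?\<alpha> = "999 / 1000 / 2 ^ j :: real"
    have "?\<alpha> \<le> 999 / 1000 / 1"
      by (intro divide_left_mono) auto
    then have \<alpha>1: "?\<alpha> \<le> 1"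
      by (rule order_trans) simp
    \<comment> \<open>38 is the least possible shift: \<open>(9 / 2) ^ 16\<close> is about 2.83e10,
      and eight times this number lies between \<open>2 ^ 37\<close> and
      \<open>2 ^ 38\<close>.\<close>
    have i: "(2 + (9 / 2) ^ 16) / 2 ^ (j + 38) \<le> ?\<alpha> / 8"
      by (simp add: power_add field_simps)
    have "count_bounded (exp b * (2 * real k * D ^ (j + 38)) powr (?\<alpha> / 2)) (?\<alpha> / 2) S" if "S \<subseteq> {..<n}" for S
      using P \<alpha>1 i that by (intro count_halve) (auto simp: P_def)
    moreover have "exp b * (2 * real k * D ^ (j + 38)) powr (?\<alpha> / 2)
        = exp (b + 999 / 1000 / 2 ^ Suc j * (?X + (real j + 38) * ?Y))"
      using k_pos D_ge(2) ln_size(2)[of "j + 38"] unfolding exp_add powr_def by (simp add: add.commute)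
    ultimately show "P (b + 999 / 1000 / 2 ^ Suc j * (?X + (real j + 38) * ?Y)) (999 / 1000 / 2 ^ Suc j)"
      using P D_ge by (auto simp: P_def mult.commute)
  qed
  then have bnd: "count_bounded (exp (999 / 1000 * ((1 - 1 / 2 ^ J) * ?X + (39 - (real J + 39) / 2 ^ J) * ?Y))) (999 / 1000 / 2 ^ J) {..<n}"
    by (simp add: P_def)
  let ?b = "999 / 1000 * ((1 - 1 / 2 ^ J) * ?X + (39 - (real J + 39) / 2 ^ J) * ?Y)"
  have b: "?b \<le> 999 / 1000 * (?X + 39 * ?Y)"
    using D_ge by (intro mult_left_mono add_mono mult_left_le_one_le mult_right_mono) auto
  have "real (n + 1) powr (999 / 1000 / 2 ^ J) = exp (999 / 1000 / 2 ^ J * ln (1 + real n))"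
    by (simp add: powr_def)
  also have "\<dots> \<le> exp 1"
  proof -
    have "ln (1 + real n) \<le> 2 ^ J"
      using ln_add_one_self_le_self[of "real n"] J by linarith
    moreover have "999 / 1000 / 2 ^ J \<le> (1 / 2 ^ J :: real)"
      by (intro divide_right_mono) auto
    ultimately have "999 / 1000 / 2 ^ J * ln (1 + real n) \<le> 1 / 2 ^ J * 2 ^ J"
      by (intro mult_mono) auto
    then show ?thesis
      by simp
  qed
  also have "\<dots> \<le> 3"
    using exp_le by simp
  finally have pw: "real (n + 1) powr (999 / 1000 / 2 ^ J) \<le> 3" .
  have "{i. i < n \<and> dst i < 2 ^ 2 * \<rho>} = close {..<n}"
    by (auto simp: close_def)
  then have cl: "real (card (close {..<n})) \<le> c\<^sup>2 * real k"
    using growth[of 2] by simp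
  have "200 * real (card (close {..<n})) + exp (lam * (W - 0)) * exp ?b * real (card {..<n} + 1) powr (999 / 1000 / 2 ^ J)
      \<le> 200 * (c\<^sup>2 * real k) + exp (lam * W) * exp (999 / 1000 * (?X + 39 * ?Y)) * 3"
    using cl b pw by (intro add_mono mult_mono) auto
  then show ?thesis
    using bnd unfolding count_bounded_def by (meson ennreal_leI order_trans)
qed

text \<open>After enough halvings the remaining slope times \<open>ln n\<close> is at most 1; this
  is the summand 1 in the bound.\<close>

lemma expected_key:
  assumes t: "dst t \<le> \<rho>" "t < n"
  shows "(\<integral>\<^sup>+ \<omega>. ennreal (found_key t L {..<n} \<omega>) \<partial>random_tape)
    \<le> ennreal (\<rho> ^ 16 * (8108100 * (ln (real k) + 39 * ln D) + 1))"
proof -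
  define P where "P b \<beta> \<longleftrightarrow> 0 \<le> b \<and> (\<forall>S\<subseteq>{..<n}. t \<in> S \<longrightarrow> key_bounded t b \<beta> S)" for b \<beta>
  obtain J where J: "8108100 * real n < 2 ^ J"
    using real_arch_pow[of 2 "8108100 * real n"] by auto
  let ?X = "ln (real k)" and ?Y = "ln D"
  have "P (8108100 * ((1 - 1 / 2 ^ J) * ?X + (39 - (real J + 39) / 2 ^ J) * ?Y)) (8108100 / 2 ^ J)"
  proof (rule halving_chain)
    show "P 0 8108100"
      using key_base[OF t(1)] by (simp add: P_def)
  next
    fix b j assume P: "P b (8108100 / 2 ^ j)"
    let ?\<beta> = "8108100 / 2 ^ j :: real"
    \<comment> \<open>Again 38 is least: the 32nd moment divided by \<open>8108100 / 8\<close> is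
      about 1.89e11, between \<open>2 ^ 37\<close> and \<open>2 ^ 38\<close>.\<close>
    have i: "(2027025 + (1 + 191898783962510625)) / 2 ^ (j + 38) \<le> ?\<beta> / 8"
      by (simp add: power_add field_simps)
    have "key_bounded t (b + ?\<beta> / 2 * ln (real k * D ^ (j + 38))) (?\<beta> / 2) S" if "S \<subseteq> {..<n}" "t \<in> S" for S
      using P i that t by (intro key_halve) (auto simp: P_def)
    then show "P (b + 8108100 / 2 ^ Suc j * (?X + (real j + 38) * ?Y)) (8108100 / 2 ^ Suc j)"
      using P D_ge ln_size(1)[of "j + 38"] by (auto simp: P_def mult.commute)
  qed
  then have bnd: "key_bounded t (8108100 * ((1 - 1 / 2 ^ J) * ?X + (39 - (real J + 39) / 2 ^ J) * ?Y)) (8108100 / 2 ^ J) {..<n}"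
    using t by (simp add: P_def)
  let ?b = "8108100 * ((1 - 1 / 2 ^ J) * ?X + (39 - (real J + 39) / 2 ^ J) * ?Y)"
  have b: "?b \<le> 8108100 * (?X + 39 * ?Y)"
    using D_ge by (intro mult_left_mono add_mono mult_left_le_one_le mult_right_mono) auto
  have "8108100 / 2 ^ J * ln (real n) \<le> 8108100 / 2 ^ J * real n"
    using t ln_bound[of "real n"] by (intro mult_left_mono) auto
  also have "\<dots> \<le> 1"
    using J by (simp add: field_simps)
  finally have "?b + 8108100 / 2 ^ J * ln (real n) \<le> 8108100 * (?X + 39 * ?Y) + 1"
    by (rule add_mono[OF b])
  then have "\<rho> ^ 16 * (?b + 8108100 / 2 ^ J * ln (real (card {..<n}))) \<le> \<rho> ^ 16 * (8108100 * (?X + 39 * ?Y) + 1)"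
    using \<rho>_pos by (simp only: card_lessThan mult_left_mono zero_le_power less_imp_le)
  then show ?thesis
    using bnd unfolding key_bounded_def by (meson ennreal_leI order_trans)
qed

end

section \<open>The probability of success\<close>

lemma tape_markov:
  assumes [measurable]: "f \<in> borel_measurable random_tape"
    and "(\<integral>\<^sup>+ \<omega>. ennreal (f \<omega>) \<partial>random_tape) \<le> ennreal b" "0 < a" "0 \<le> b"
  shows "measure random_tape {\<omega>. a \<le> f \<omega>} \<le> b / a"
proof -
  have "emeasure random_tape {\<omega> \<in> space random_tape. 1 \<le> ennreal (1 / a) * ennreal (f \<omega>)}
      \<le> ennreal (1 / a) * (\<integral>\<^sup>+ \<omega>. ennreal (f \<omega>) * indicator (space random_tape) \<omega> \<partial>random_tape)"
    by (rule nn_integral_Markov_inequality) (use sets.top[of random_tape] in auto)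
  also have "\<dots> \<le> ennreal (1 / a) * ennreal b"
    using assms(2) by (intro mult_left_mono) auto
  also have "\<dots> = ennreal (b / a)"
    using assms(3,4) by (simp add: ennreal_mult[symmetric])
  finally have le: "emeasure random_tape {\<omega> \<in> space random_tape. 1 \<le> ennreal (1 / a) * ennreal (f \<omega>)} \<le> ennreal (b / a)" .
  have "{\<omega>. a \<le> f \<omega>} \<subseteq> {\<omega> \<in> space random_tape. 1 \<le> ennreal (1 / a) * ennreal (f \<omega>)}"
  proof
    fix \<omega> assume "\<omega> \<in> {\<omega>. a \<le> f \<omega>}"
    then have "1 \<le> 1 / a * f \<omega>" "0 \<le> f \<omega>"
      using assms(3) by auto
    then have "ennreal 1 \<le> ennreal (1 / a) * ennreal (f \<omega>)"
      using assms(3) ennreal_leI[of 1 "1 / a * f \<omega>"] by (simp add: ennreal_mult[symmetric])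
    then show "\<omega> \<in> {\<omega> \<in> space random_tape. 1 \<le> ennreal (1 / a) * ennreal (f \<omega>)}"
      by simp
  qed
  moreover have "{\<omega> \<in> space random_tape. 1 \<le> ennreal (1 / a) * ennreal (f \<omega>)} \<in> sets random_tape"
    by measurable
  ultimately have "emeasure random_tape {\<omega>. a \<le> f \<omega>} \<le> ennreal (b / a)"
    using emeasure_mono le by (meson order_trans)
  then show ?thesis
    using assms(3,4) by (simp add: tape.P.emeasure_eq_measure)
qed

text \<open>The analysis produces the exponent \<open>18 * 97461 = 1754298\<close> of
  \<open>c\<close>, and \<open>2 ^ 21\<close> is the least power of two above it.\<close>

definition growth_power :: nat where
  "growth_power = 21"

text \<open>The factor 2 of \<open>2 * c ^ 18\<close>, raised to the power \<open>39 * 2499\<close>. It is a definition in order to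
  keep the simplifier from expanding the numeral.\<close>

definition search_base :: real where
  "search_base = 2 ^ 97461"

text \<open>Here 218 is \<open>200 + 9 * 2\<close>, and 9 is \<open>3 * 3\<close>: one factor 3
  bounds the remaining power of the size, the other one bounds \<open>exp 1\<close>.\<close>

definition search_factor :: real where
  "search_factor = 218 + 9 * search_base"

lemma search_base_pos: "0 < search_base"
  unfolding search_base_def by (rule zero_less_power) simp

lemma search_factor_pos: "0 < search_factor"
  using search_base_pos by (simp add: search_factor_def)

context growth_scale
begin

definition key_limit :: real where
  "key_limit = 2 * (\<rho> ^ 16 * (8108100 * (ln (real k) + 39 * ln D) + 1))"

lemma key_limit_pos: "0 < key_limit"
  using \<rho>_pos D_ge by (simp add: key_limit_def add_nonneg_pos)

text \<open>The slope is \<open>(2 / 9) ^ 16 * 16216200\<close>, about 5.7e-4. This is where the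
  power 16 and the width \<open>9 / 2 * \<rho>\<close> matter: added to 999/1000, the slope has to
  stay below 1.\<close>

lemma lam_key_limit: "lam * key_limit \<le> 6 / 10000 * (ln (2 * real k) + 39 * ln D) + 1"
proof -
  have "lam * key_limit = (2 / 9) ^ 16 * 2 * (8108100 * (ln (real k) + 39 * ln D) + 1)"
    using \<rho>_pos by (simp add: lam_def key_limit_def power_divide power_mult_distrib)
  also have "\<dots> = (2 / 9) ^ 16 * 16216200 * (ln (real k) + 39 * ln D) + (2 / 9) ^ 16 * 2"
    by (simp add: algebra_simps)
  also have "\<dots> \<le> 6 / 10000 * (ln (real k) + 39 * ln D) + 1"
    using D_ge by (intro add_mono mult_right_mono) (simp_all add: power_divide)
  also have "\<dots> \<le> 6 / 10000 * (ln (2 * real k) + 39 * ln D) + 1"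
    using k_pos by simp
  finally show ?thesis .
qed

text \<open>The exponents add up to 2499/2500. The mean inequality with weights 2499/2500 and 1/2500
  separates \<open>k\<close> from \<open>D\<close>: the first summand is linear in \<open>k\<close>,
  while the exponent 39 of \<open>D\<close> grows to \<open>39 * 2499 = 97461\<close>.\<close>

lemma expected_count_at_limit:
  "(\<integral>\<^sup>+ \<omega>. ennreal (real (count_upto (build L {..<n} \<omega>) 0 \<omega> key_limit)) \<partial>random_tape)
    \<le> ennreal (218 * (c\<^sup>2 * real k) + 9 * (search_base * c ^ (2 ^ growth_power)))"
proof -
  let ?Z = "ln (2 * real k) + 39 * ln D"
  have "D ^ 97461 = search_base * (c ^ 18) ^ 97461"
    unfolding D_def search_base_def by (rule power_mult_distrib)
  also have "(c ^ 18) ^ 97461 = c ^ (18 * 97461)"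
    by (rule power_mult[symmetric])
  also have "search_base * \<dots> \<le> search_base * c ^ (2 ^ growth_power)"
    using c_gt search_base_pos unfolding growth_power_def by (intro mult_left_mono power_increasing) auto
  finally have 1: "D ^ 97461 \<le> search_base * c ^ (2 ^ growth_power)" .
  have 2: "2 * real k \<le> 2 * (c\<^sup>2 * real k)"
    using mult_right_mono[of 1 "c\<^sup>2" "real k"] one_le_power[of c 2] c_gt by simp
  have "exp (2499 / 2500 * ?Z) = (2 * real k) powr (2499 / 2500) * (D ^ 97461) powr (1 - 2499 / 2500)"
    using k_pos D_ge by (simp add: powr_def ln_realpow algebra_simps flip: exp_add)
  also have "\<dots> \<le> 2499 / 2500 * (2 * real k) + (1 - 2499 / 2500) * D ^ 97461"
    using D_ge by (intro powr_concave) auto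
  also have "\<dots> \<le> 1 * (2 * real k) + 1 * D ^ 97461"
    using D_ge by (intro add_mono mult_right_mono) auto
  finally have 3: "exp (2499 / 2500 * ?Z) \<le> 2 * real k + D ^ 97461"
    by simp
  have "exp (lam * key_limit) * exp (999 / 1000 * ?Z) * 3 = exp (lam * key_limit + 999 / 1000 * ?Z) * 3"
    by (simp add: exp_add)
  also have "\<dots> \<le> exp (1 + 2499 / 2500 * ?Z) * 3"
  proof -
    have "lam * key_limit + 999 / 1000 * ?Z \<le> 1 + 2499 / 2500 * ?Z"
      using lam_key_limit by linarith
    then show ?thesis
      by simp
  qed
  also have "\<dots> = exp 1 * exp (2499 / 2500 * ?Z) * 3"
    by (simp add: exp_add)
  also have "\<dots> \<le> 3 * exp (2499 / 2500 * ?Z) * 3"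
    using exp_le by simp
  finally have "200 * (c\<^sup>2 * real k) + exp (lam * key_limit) * exp (999 / 1000 * ?Z) * 3
      \<le> 218 * (c\<^sup>2 * real k) + 9 * (search_base * c ^ (2 ^ growth_power))"
    using 1 2 3 by linarith
  then show ?thesis
    using expected_count[of L key_limit] by (meson ennreal_leI order_trans)
qed

text \<open>A union bound over three failures: the point is lost at the height limit (1/10), its key
  reaches twice its expected bound (1/2), or the number of tips reaches a hundred times its expected
  bound (1/100).\<close>

lemma success_probability:
  assumes t: "dst t \<le> \<rho>" "t < n" and \<tau>: "real k \<le> \<tau> + 1" "0 < \<tau>"
    and L: "real n * (3 / 4) ^ L \<le> 1 / 10" and K: "100 * search_factor \<le> real K"
  shows "1 / 4 \<le> measure random_tape {\<omega>. t \<in> nodes (build L {..<n} \<omega>)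
    \<and> node_key (build L {..<n} \<omega>) 0 \<omega> t \<le> key_limit
    \<and> real (count_upto (build L {..<n} \<omega>) 0 \<omega> key_limit) \<le> (c ^ (2 ^ growth_power) + \<tau> * (c * c)) * real K}"
    (is "_ \<le> measure _ ?G")
proof -
  define R where "R = (c ^ (2 ^ growth_power) + \<tau> * (c * c)) * real K"
  let ?A = "{\<omega>. t \<notin> nodes (build L {..<n} \<omega>)}"
  let ?B = "{\<omega>. key_limit \<le> found_key t L {..<n} \<omega>}"
  let ?C = "{\<omega>. R \<le> real (count_upto (build L {..<n} \<omega>) 0 \<omega> key_limit)}"
  have [measurable]: "(\<lambda>\<omega>. found_key t L {..<n} \<omega>) \<in> borel_measurable random_tape"
    by (rule measurable_found_key) simp
  have [measurable]: "(\<lambda>\<omega>. real (count_upto (build L {..<n} \<omega>) 0 \<omega> W)) \<in> borel_measurable random_tape" for W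
    using measurable_compose[OF measurable_count_upto, of "{..<n}" real borel] by simp
  have key_meas: "(\<lambda>\<omega>. node_key (build L {..<n} \<omega>) 0 \<omega> t) \<in> borel_measurable random_tape"
    by (rule measurable_node_key) simp
  note [measurable] = key_meas
  have [measurable]: "Measurable.pred random_tape (\<lambda>\<omega>. t \<in> nodes (build L {..<n} \<omega>))"
    by (rule pred_nodes) simp
  have A_sets: "?A \<in> sets random_tape"
  proof -
    have "{\<omega> \<in> space random_tape. \<not> t \<in> nodes (build L {..<n} \<omega>)} \<in> sets random_tape"
      by measurable
    then show ?thesis
      by simp
  qed
  have B_sets: "?B \<in> sets random_tape"
  proof -
    have "{\<omega> \<in> space random_tape. key_limit \<le> found_key t L {..<n} \<omega>} \<in> sets random_tape"
      by measurable
    then show ?thesis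
      by simp
  qed
  have C_sets: "?C \<in> sets random_tape"
  proof -
    have "{\<omega> \<in> space random_tape. R \<le> real (count_upto (build L {..<n} \<omega>) 0 \<omega> key_limit)} \<in> sets random_tape"
      by measurable
    then show ?thesis
      by simp
  qed
  have G_sets: "?G \<in> sets random_tape"
  proof -
    have "{\<omega> \<in> space random_tape. t \<in> nodes (build L {..<n} \<omega>) \<and> node_key (build L {..<n} \<omega>) 0 \<omega> t \<le> key_limit
      \<and> real (count_upto (build L {..<n} \<omega>) 0 \<omega> key_limit) \<le> R} \<in> sets random_tape"
      by measurable
    then show ?thesis
      by (simp add: R_def)
  qed
  have c1: "1 \<le> c ^ (2 ^ growth_power)" "1 \<le> c * c"
    using c_gt by (simp_all add: one_le_power mult_ge1_I)
  have K0: "0 < real K"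
    using K search_factor_pos by linarith
  have R_pos: "0 < R"
    using c1 \<tau> K0 by (simp add: R_def add_pos_nonneg)
  have "emeasure random_tape ?A = (\<integral>\<^sup>+ \<omega>. indicator ?A \<omega> \<partial>random_tape)"
    using A_sets by simp
  also have "\<dots> \<le> ennreal (real (card {..<n}) * (3 / 4) ^ L)"
    using t by (intro prob_not_found) auto
  also have "\<dots> \<le> ennreal (1 / 10)"
    using L by (intro ennreal_leI) simp
  finally have PA: "measure random_tape ?A \<le> 1 / 10"
    by (simp add: tape.P.emeasure_eq_measure)
  have PB: "measure random_tape ?B \<le> 1 / 2"
  proof -
    have "measure random_tape ?B \<le> (key_limit / 2) / key_limit"
      using expected_key[OF t, of L] key_limit_pos by (intro tape_markov) (auto simp: key_limit_def)
    then show ?thesis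
      using key_limit_pos by simp
  qed
  have PC: "measure random_tape ?C \<le> 1 / 100"
  proof -
    let ?E = "218 * (c\<^sup>2 * real k) + 9 * (search_base * c ^ (2 ^ growth_power))"
    have "c\<^sup>2 * real k \<le> c\<^sup>2 * (\<tau> + 1)"
      using \<tau> by (intro mult_left_mono) auto
    also have "\<dots> = \<tau> * (c * c) + c\<^sup>2"
      by (simp add: algebra_simps power2_eq_square)
    also have "c\<^sup>2 \<le> c ^ (2 ^ growth_power)"
      using c_gt unfolding growth_power_def by (intro power_increasing) auto
    finally have "?E \<le> 218 * (\<tau> * (c * c) + c ^ (2 ^ growth_power)) + 9 * (search_base * c ^ (2 ^ growth_power))"
      by simp
    also have "\<dots> \<le> 218 * (\<tau> * (c * c) + c ^ (2 ^ growth_power))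
        + 9 * (search_base * (\<tau> * (c * c) + c ^ (2 ^ growth_power)))"
      using c1 \<tau> search_base_pos by (intro add_left_mono mult_left_mono) auto
    also have "\<dots> = search_factor * (c ^ (2 ^ growth_power) + \<tau> * (c * c))"
      unfolding search_factor_def by (simp only: distrib_right mult.assoc add.commute)
    also have "\<dots> \<le> (real K / 100) * (c ^ (2 ^ growth_power) + \<tau> * (c * c))"
      using K c1 \<tau> by (intro mult_right_mono) auto
    also have "\<dots> = R / 100"
      by (simp add: R_def)
    finally have E: "?E \<le> R / 100" .
    have "measure random_tape ?C \<le> (R / 100) / R"
    proof (rule tape_markov)
      show "(\<integral>\<^sup>+ \<omega>. ennreal (real (count_upto (build L {..<n} \<omega>) 0 \<omega> key_limit)) \<partial>random_tape) \<le> ennreal (R / 100)"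
        using expected_count_at_limit[of L] E by (meson ennreal_leI order_trans)
    qed (use R_pos in auto)
    then show ?thesis
      using R_pos by simp
  qed
  have "\<omega> \<in> ?G \<union> (?A \<union> (?B \<union> ?C))" for \<omega>
    unfolding R_def by (cases "t \<in> nodes (build L {..<n} \<omega>)") (auto simp: found_key_def)
  then have cover: "?G \<union> (?A \<union> (?B \<union> ?C)) = space random_tape"
    unfolding space_tape by blast
  have "1 = measure random_tape (?G \<union> (?A \<union> (?B \<union> ?C)))"
    unfolding cover by (rule tape.P.prob_space[symmetric])
  also have "\<dots> \<le> measure random_tape ?G + measure random_tape (?A \<union> (?B \<union> ?C))"
    by (intro measure_Un_le G_sets A_sets B_sets C_sets sets.Un)
  also have "\<dots> \<le> measure random_tape ?G + (measure random_tape ?A + measure random_tape (?B \<union> ?C))"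
    by (intro add_left_mono measure_Un_le A_sets B_sets C_sets sets.Un)
  also have "\<dots> \<le> measure random_tape ?G + (measure random_tape ?A + (measure random_tape ?B + measure random_tape ?C))"
    by (intro add_left_mono measure_Un_le B_sets C_sets)
  finally show ?thesis
    using PA PB PC by linarith
qed

end

section \<open>Running times\<close>

lemma lg_bounds:
  assumes "2 \<le> n"
  shows "lg n \<le> n" "real (lg n) \<le> 2 * log 2 (real n)" "1 \<le> log 2 (real n)"
proof -
  show "lg n \<le> n"
    using assms by (intro lg_le) simp
  show 1: "1 \<le> log 2 (real n)"
    using assms by (simp add: le_log_iff)
  show "real (lg n) \<le> 2 * log 2 (real n)"
  proof (cases "lg n")
    case 0
    then show ?thesis
      using 1 by simp
  next
    case (Suc l)
    then have "2 ^ l < n"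
      using lg_less[of l n] by simp
    then have "2 powr real l \<le> real n"
      by (simp add: powr_realpow less_imp_le)
    then have "real l \<le> log 2 (real n)"
      using assms by (simp add: le_log_iff)
    then show ?thesis
      using 1 Suc by simp
  qed
qed

lemma depth_fails: "real n * (3 / 4) ^ points.depth n \<le> 1 / 10"
proof -
  have "real n \<le> 2 ^ lg n"
    using lg_ge[of n] by (metis of_nat_le_iff of_nat_numeral of_nat_power)
  then have "real n * (3 / 4) ^ (10 + 3 * lg n) \<le> 2 ^ lg n * (3 / 4) ^ (10 + 3 * lg n)"
    by (intro mult_right_mono) auto
  also have "\<dots> = (3 / 4) ^ 10 * (2 * (3 / 4) ^ 3) ^ lg n"
    by (simp only: power_add power_mult power_mult_distrib) (simp only: mult_ac)
  also have "\<dots> \<le> (3 / 4) ^ 10 * 1"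
    by (intro mult_left_mono power_le_one) (auto simp: power_divide)
  also have "\<dots> \<le> 1 / 10"
    by (simp add: power_divide)
  finally show ?thesis
    unfolding points.depth_def .
qed

text \<open>From \<open>ln (1 / u) \<le> 1 / u - 1\<close> it follows that
  \<open>u * ln u \<ge> u - 1\<close>, which is more than -1.\<close>

lemma mult_log_ge:
  assumes "0 < (u :: real)"
  shows "- 2 \<le> u * log 2 u"
proof -
  have "ln (1 / u) \<le> 1 / u - 1"
    using assms by (intro ln_le_minus_one) simp
  then have "u * (- ln u) \<le> u * (1 / u - 1)"
    using assms by (intro mult_left_mono) (auto simp: ln_div)
  also have "\<dots> \<le> 1"
    using assms by (simp add: algebra_simps)
  finally have "- 1 \<le> u * ln u"
    by simp
  moreover have "1 / 2 \<le> ln (2 :: real)"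
    using ln_le_minus_one[of "1 / 2 :: real"] by (simp add: ln_div)
  ultimately have "- 2 * ln 2 \<le> u * ln u"
    by linarith
  then show ?thesis
    by (simp add: log_def pos_le_divide_eq)
qed

text \<open>Since \<open>\<epsilon> \<le> 1 / 2\<close>, the exponent of the budget is at least
  \<open>1 + log 2 u\<close>. For \<open>c\<close> near 1 this lower bound is negative; the second
  claim keeps the budget away from 0 nevertheless, so that additive constants can be
  absorbed.\<close>

lemma power_le_budget:
  assumes "1 < c" "0 < \<epsilon>" "\<epsilon> \<le> 1 / 2"
  shows "c ^ A \<le> 2 powr (2 ^ A * real A + 2) * c powr log 2 (log 2 c / \<epsilon>)"
    "1 / 4 \<le> c powr log 2 (log 2 c / \<epsilon>)"
proof -
  define u where "u = log 2 c"
  have u: "0 < u"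
    using assms by (simp add: u_def)
  have c: "c = 2 powr u"
    using assms by (simp add: u_def)
  have "1 + log 2 u = log 2 (2 * u)"
    using u by (simp add: log_mult)
  also have "\<dots> \<le> log 2 (u / \<epsilon>)"
  proof -
    have "u * (2 * \<epsilon>) \<le> u * 1"
      using assms u by (intro mult_left_mono) auto
    then have "2 * u \<le> u / \<epsilon>"
      using assms by (simp add: pos_le_divide_eq mult_ac)
    then show ?thesis
      using u assms by (subst log_le_cancel_iff) auto
  qed
  finally have "c powr (1 + log 2 u) \<le> c powr log 2 (log 2 c / \<epsilon>)"
    using assms unfolding u_def by (intro powr_mono) auto
  then have budget: "2 powr (u * (1 + log 2 u)) \<le> c powr log 2 (log 2 c / \<epsilon>)"
    unfolding c powr_powr by (simp flip: c)
  have ul: "- 2 \<le> u * log 2 u"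
    by (rule mult_log_ge[OF u])
  have "(1 / 4 :: real) = 2 powr (- 2)"
    by (simp add: powr_minus)
  also have "\<dots> \<le> 2 powr (u * (1 + log 2 u))"
    using ul u by (intro powr_mono) (auto simp: distrib_left)
  finally show "1 / 4 \<le> c powr log 2 (log 2 c / \<epsilon>)"
    using budget by linarith
  have "u * real A \<le> 2 ^ A * real A + 2 + u * (1 + log 2 u)"
  \<comment> \<open>For large \<open>u\<close> the exponent \<open>1 + log 2 u\<close> exceeds
    \<open>A\<close>; otherwise \<open>u * A\<close> is covered by the constant
    \<open>2 ^ A * A\<close>.\<close>
  proof (cases "u \<le> 2 ^ A")
    case True
    then have "u * real A \<le> 2 ^ A * real A"
      by (intro mult_right_mono) auto
    then show ?thesis
      using ul u by (simp add: distrib_left)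
  next
    case False
    then have "real A \<le> log 2 u"
      using u by (simp add: le_log_iff powr_realpow)
    then have "u * real A \<le> u * (1 + log 2 u)"
      using u by (intro mult_left_mono) auto
    moreover have "0 \<le> 2 ^ A * real A + 2"
      by simp
    ultimately show ?thesis
      by linarith
  qed
  then have "2 powr (u * real A) \<le> 2 powr (2 ^ A * real A + 2 + u * (1 + log 2 u))"
    by (intro powr_mono) auto
  also have "\<dots> = 2 powr (2 ^ A * real A + 2) * 2 powr (u * (1 + log 2 u))"
    by (rule powr_add)
  also have "\<dots> \<le> 2 powr (2 ^ A * real A + 2) * c powr log 2 (log 2 c / \<epsilon>)"
    using budget by (intro mult_left_mono) auto
  also have "2 powr (u * real A) = c ^ A"
    using assms by (simp add: c powr_powr[symmetric] powr_realpow)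
  finally show "c ^ A \<le> 2 powr (2 ^ A * real A + 2) * c powr log 2 (log 2 c / \<epsilon>)" .
qed

section \<open>Resource bounds and success of the two programs\<close>

context query_run
begin

abbreviation "prep_program \<equiv> assemble 0 prep_code"
abbreviation "query_program \<equiv> assemble 0 (query_code K m)"

lemma root: "T \<noteq> Tip"
proof -
  obtain L where "depth = Suc L"
    unfolding depth_def by simp
  moreover have "{..<n} \<noteq> {}"
    using n_ge by (auto simp: lessThan_empty_iff)
  ultimately show ?thesis
    by (simp add: Let_def)
qed

lemma prep_runs:
  assumes "real prep_time \<le> T'"
  shows "runs_within prep_program inp \<omega> (prep_start d n) T' S \<and>
    (\<exists>s. prepared s \<and> fits S s \<and> preprocessed prep_program d n \<epsilon> \<tau> c x \<omega> = s\<lparr>pc := clen prep_code\<rparr>)"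
  unfolding preprocessed_def
proof (rule hoare_run[OF prep_correct])
  have "d \<le> S" "n \<le> S" "2 \<le> S"
  proof -
    have "d \<le> n * d"
      using n_ge by simp
    then show "d \<le> S" "n \<le> S" "2 \<le> S"
      using bounds(1,4,5) by linarith+
  qed
  then show "fits S (prep_start d n)"
    by (auto simp: fits_def prep_start_def)
qed (use assms in \<open>auto simp: prep_start_def\<close>)

lemma query_runs:
  assumes "real query_time \<le> T'"
  shows "runs_within query_program q \<omega> (query_start (preprocessed prep_program d n \<epsilon> \<tau> c x \<omega>)) T' S \<and>
    (\<exists>s. answered s \<and> query_answer query_program q \<omega> (preprocessed prep_program d n \<epsilon> \<tau> c x \<omega>) = words s 0)"
proof -
  obtain s where s: "prepared s" "fits S s" "preprocessed prep_program d n \<epsilon> \<tau> c x \<omega> = s\<lparr>pc := clen prep_code\<rparr>"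
    using prep_runs[of "real prep_time"] by auto
  let ?s = "query_start (preprocessed prep_program d n \<epsilon> \<tau> c x \<omega>)"
  have "prepared ?s" "fits S ?s" "pc ?s = 0"
    using s by (auto simp: query_start_def prepared_def fits_def)
  from hoare_run[OF query_correct[OF root] this assms]
  obtain s' where "runs_within query_program q \<omega> ?s T' S" "answered s'"
    "final query_program q \<omega> ?s = s'\<lparr>pc := clen (query_code K m)\<rparr>"
    by blast
  then show ?thesis
    by (auto simp: query_answer_def)
qed

lemma succeeds:
  assumes "t \<in> nodes T" "node_key T 0 \<omega> t \<le> W" "real (count_upto T 0 \<omega> W) \<le> rounds"
    and nearest: "\<And>i. i < n \<Longrightarrow> l2_dist d q (x t) \<le> l2_dist d q (x i)" and a: "1 \<le> a"
  shows "prep_succeeds prep_program query_program d n \<epsilon> \<tau> c x a q \<omega>"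
proof -
  obtain s where s: "answered s" "query_answer query_program q \<omega> (preprocessed prep_program d n \<epsilon> \<tau> c x \<omega>) = words s 0"
    using query_runs[of "real query_time"] by auto
  have "count_upto T 0 \<omega> W \<le> n_rounds"
    using assms(3) by linarith
  from answered_nearest[OF s(1) this assms(1,2)]
  have w: "words s 0 < n" "l2_dist d q (x (words s 0)) \<le> l2_dist d q (x t)"
    by auto
  have "l2_dist d q (x (words s 0)) \<le> a * l2_dist d q (x i)" if "i < n" for i
  proof -
    have "0 \<le> l2_dist d q (x i)"
      by (rule l2_dist_nonneg)
    then have "1 * l2_dist d q (x i) \<le> a * l2_dist d q (x i)"
      using a by (intro mult_right_mono)
    then show ?thesis
      using w(2) nearest[OF that] by linarith
  qed
  then show ?thesis
    using w(1) s(2) by (auto simp: prep_succeeds_def approx_nn_def Let_def)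
qed

lemma prep_time_le: "real prep_time \<le> 1100 * (real d * real n * log 2 (real n))"
proof -
  let ?l = "log 2 (real n)" and ?d = "real d" and ?n = "real n"
  have b: "1 \<le> ?d" "1 \<le> ?n" "1 \<le> ?l" "real (lg n) \<le> 2 * ?l"
    using d_pos n_ge lg_bounds[OF n_ge] by auto
  have dn: "1 \<le> ?d * ?n" "?d \<le> ?d * ?n" "?n \<le> ?d * ?n"
    using mult_mono[of 1 ?d 1 ?n] mult_left_mono[of 1 ?n ?d] mult_right_mono[of 1 ?d ?n] b by auto
  have dnl: "?d * ?n \<le> ?d * ?n * ?l" "?l \<le> ?d * ?n * ?l"
    using mult_left_mono[of 1 ?l "?d * ?n"] mult_right_mono[of 1 "?d * ?n" ?l] b dn by auto
  have lev: "real level_time + 2 \<le> 60 * (?d * ?n)"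
    using dn by (simp add: algebra_simps)
  have dep: "real depth \<le> 16 * ?l"
  proof -
    have "real depth = 10 + 3 * real (lg n)"
      by (simp add: depth_def)
    then show ?thesis
      using b by linarith
  qed
  have "real depth * (real level_time + 2) \<le> 16 * ?l * (60 * (?d * ?n))"
    using dep lev b by (intro mult_mono) auto
  then have "real depth * (real level_time + 2) \<le> 960 * (?d * ?n * ?l)"
    by (simp add: mult_ac)
  moreover have "real prep_time = 22 + 4 * real (lg n) + (6 * (?d * ?n) + 7 * ?n) + real depth * (real level_time + 2)"
    by (simp add: algebra_simps)
  ultimately show ?thesis
    using b dn dnl by linarith
qed

text \<open>The number of rounds is rounded up, and the initialisation takes constant time; as
  \<open>B\<close> is at least 1/4, both are bounded by multiples of \<open>B\<close>.\<close>

lemma query_time_le: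
  assumes B: "rounds \<le> C * B" "1 / 4 \<le> B" "0 \<le> C" and m: "m \<le> 21"
  shows "real query_time \<le> (5000 + 1200 * C) * (B * real d * log 2 (real n))"
proof -
  let ?l = "log 2 (real n)" and ?d = "real d"
  have b: "1 \<le> ?d" "1 \<le> ?l" "real (lg n) \<le> 2 * ?l"
    using d_pos lg_bounds[OF n_ge] by auto
  have dl: "1 \<le> ?d * ?l" "?l \<le> ?d * ?l"
    using mult_mono[of 1 ?d 1 ?l] mult_right_mono[of 1 ?d ?l] b by auto
  have dep: "real depth \<le> 16 * ?l"
  proof -
    have "real depth = 10 + 3 * real (lg n)"
      by (simp add: depth_def)
    then show ?thesis
      using b by linarith
  qed
  have "real depth * (real d * 13 + 60) \<le> 16 * ?l * (73 * ?d)"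
    using dep b by (intro mult_mono) auto
  then have rt: "real round_time + 2 \<le> 1200 * (?d * ?l)"
    using dl by (simp add: algebra_simps)
  have "real n_rounds \<le> C * B + 1"
  proof -
    have "0 \<le> C * B"
      using B by simp
    then show ?thesis
      using B(1) by linarith
  qed
  also have "\<dots> \<le> (C + 4) * B"
    using B(2) by (simp add: algebra_simps)
  finally have nr: "real n_rounds \<le> (C + 4) * B" .
  have "real n_rounds * (real round_time + 2) \<le> (C + 4) * B * (1200 * (?d * ?l))"
    using nr rt B by (intro mult_mono) auto
  then have 1: "real n_rounds * (real round_time + 2) \<le> (4800 + 1200 * C) * (B * ?d * ?l)"
    by (simp add: algebra_simps)
  have "1 / 4 * 1 \<le> B * (?d * ?l)"
    using B dl by (intro mult_mono) auto
  then have "36 \<le> 200 * (B * ?d * ?l)"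
    by (simp add: mult.assoc)
  moreover have "real m + 15 \<le> 36"
    using m by simp
  moreover have "real query_time = real m + 15 + real n_rounds * (real round_time + 2)"
    by simp
  moreover have "(5000 + 1200 * C) * (B * ?d * ?l) = (4800 + 1200 * C) * (B * ?d * ?l) + 200 * (B * ?d * ?l)"
    by (simp add: algebra_simps)
  ultimately show ?thesis
    using 1 by linarith
qed

end

text \<open>57 = 40 + 1 + 3 + 10 + 3: registers, coordinates, record headers and the two parts of
  the directions, each estimated by a multiple of \<open>d * n\<close>.\<close>

lemma space_bound:
  assumes "1 \<le> d" "2 \<le> n" "57 \<le> K"
  shows "points.addr d n + points.depth n * d \<le> K * (d * n)"
proof -
  have "lg n * d \<le> n * d"
    using lg_bounds(1)[OF assms(2)] by (rule mult_le_mono1)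
  moreover have "1 \<le> d * n" "n \<le> d * n" "d \<le> d * n"
    using assms by auto
  moreover have "57 * (d * n) \<le> K * (d * n)"
    using assms(3) by (rule mult_le_mono1)
  moreover have "points.addr d n + points.depth n * d = 40 + (d * n + 3 * n) + (10 * d + 3 * (lg n * d))"
    by (simp add: points.addr_def points.depth_def algebra_simps)
  ultimately show ?thesis
    by (simp only: mult.commute[of n d])
qed

theorem theorem14:
  shows "\<exists>(prep :: program) (qry :: program) (K :: nat) (\<delta> :: real).
    deterministic qry \<and> 0 < \<delta> \<and>
    (\<forall>(d :: nat) (n :: nat) (x :: nat \<Rightarrow> nat \<Rightarrow> real) (\<epsilon> :: real) (\<tau> :: real) (c :: real).
       0 < \<epsilon> \<and> \<epsilon> \<le> 1 / 2 \<and> 1 < c \<and> 2 \<le> n \<and>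
       inj_on x {..<n} \<and> x ` {..<n} \<subseteq> l2_space d \<and>
       expansion_rate (l2_space d) (l2_dist d) (x ` {..<n}) \<tau> c \<longrightarrow>
         (\<forall>\<omega>. runs_within prep (prep_input d \<epsilon> \<tau> c x) \<omega> (prep_start d n)
                (real K * (real d * real n * log 2 (real n))) (K * (d * n))) \<and>
         (\<forall>q \<in> l2_space d.
            (\<forall>\<omega>. runs_within qry q \<omega> (query_start (preprocessed prep d n \<epsilon> \<tau> c x \<omega>))
                (real K * ((c powr log 2 (log 2 c / \<epsilon>) + \<tau> * c\<^sup>2) * real d * log 2 (real n)))
                (K * (d * n))) \<and>
            measure random_tape
              {\<omega> \<in> space random_tape. prep_succeeds prep qry d n \<epsilon> \<tau> c x ((1 + \<epsilon>) ^ 3) q \<omega>} \<ge> \<delta>))"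
proof -
  let ?m = growth_power
  obtain R :: nat where R: "100 * search_factor \<le> real R"
    using real_arch_simple by blast
  \<comment> \<open>\<open>A\<close> is a fixed number, so the constant \<open>a\<close> is huge but
    independent of the input.\<close>
  define A :: nat where "A = 2 ^ ?m"
  define a :: real where "a = 2 powr (2 ^ A * real A + 2)"
  define C where "C = real R * (a + 1)"
  obtain K0 :: nat where K0: "5000 + 1200 * C \<le> real K0"
    using real_arch_simple by blast
  define K where "K = 1100 + R + K0"
  let ?prep = "assemble 0 prep_code" and ?qry = "assemble 0 (query_code R ?m)"
  have a0: "0 \<le> a" and C0: "0 \<le> C"
    by (simp_all add: a_def C_def)
  have main: "(\<forall>\<omega>. runs_within ?prep (prep_input d \<epsilon> \<tau> c x) \<omega> (prep_start d n)
                (real K * (real d * real n * log 2 (real n))) (K * (d * n))) \<and>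
         (\<forall>q \<in> l2_space d.
            (\<forall>\<omega>. runs_within ?qry q \<omega> (query_start (preprocessed ?prep d n \<epsilon> \<tau> c x \<omega>))
                (real K * ((c powr log 2 (log 2 c / \<epsilon>) + \<tau> * c\<^sup>2) * real d * log 2 (real n)))
                (K * (d * n))) \<and>
            measure random_tape
              {\<omega> \<in> space random_tape. prep_succeeds ?prep ?qry d n \<epsilon> \<tau> c x ((1 + \<epsilon>) ^ 3) q \<omega>} \<ge> 1 / 4)"
    if h: "0 < \<epsilon>" "\<epsilon> \<le> 1 / 2" "1 < c" "2 \<le> n" "inj_on x {..<n}" "x ` {..<n} \<subseteq> l2_space d"
      "expansion_rate (l2_space d) (l2_dist d) (x ` {..<n}) \<tau> c"
    for d n :: nat and x :: "nat \<Rightarrow> nat \<Rightarrow> real" and \<epsilon> \<tau> c :: real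
  proof -
    interpret E: expanding d n x \<tau> c
      using h by unfold_locales
    let ?S = "K * (d * n)" and ?l = "log 2 (real n)"
    have l: "1 \<le> ?l"
      using lg_bounds(3)[OF h(4)] .
    have run: "query_run d n ?S R"
    proof unfold_locales
      show "1 \<le> d" "2 \<le> n"
        using E.d_ge h(4) by auto
      show "points.addr d n + points.depth n * d \<le> ?S"
        using E.d_ge h(4) by (intro space_bound) (auto simp: K_def)
      have "R * 1 \<le> K * (d * n)"
        using E.d_ge h(4) by (intro mult_le_mono) (auto simp: K_def)
      then show "R \<le> ?S"
        by simp
    qed
    define B where "B = c powr log 2 (log 2 c / \<epsilon>) + \<tau> * c\<^sup>2"
    have \<tau>c: "0 \<le> \<tau> * c\<^sup>2"
      using E.\<tau>_pos by simp
    have B: "1 / 4 \<le> B"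
      using power_le_budget(2)[OF h(3,1,2)] \<tau>c by (simp add: B_def)
    have rounds: "(c ^ (2 ^ ?m) + \<tau> * (c * c)) * real R \<le> C * B"
    proof -
      have "c ^ A + \<tau> * c\<^sup>2 \<le> a * c powr log 2 (log 2 c / \<epsilon>) + \<tau> * c\<^sup>2"
        using power_le_budget(1)[OF h(3,1,2), of A] by (simp add: a_def)
      also have "\<dots> \<le> (a + 1) * c powr log 2 (log 2 c / \<epsilon>) + (a + 1) * (\<tau> * c\<^sup>2)"
        using a0 \<tau>c mult_right_mono[of 1 "a + 1" "\<tau> * c\<^sup>2"] by (intro add_mono mult_right_mono) auto
      also have "\<dots> = (a + 1) * B"
        by (simp add: B_def algebra_simps)
      finally have "(c ^ A + \<tau> * c\<^sup>2) * real R \<le> (a + 1) * B * real R"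
        by (rule mult_right_mono) simp
      then show ?thesis
        by (simp add: A_def C_def power2_eq_square mult_ac)
    qed
    have "runs_within ?prep (prep_input d \<epsilon> \<tau> c x) \<omega> (prep_start d n) (real K * (real d * real n * ?l)) ?S" for \<omega>
    proof -
      \<comment> \<open>Preprocessing does not see the query, so an arbitrary point instantiates the
        locale.\<close>
      interpret Q: query_run d n x \<epsilon> \<tau> c \<omega> ?S "\<lambda>_. 0" R ?m
        by (rule run)
      have "1100 * (real d * real n * ?l) \<le> real K * (real d * real n * ?l)"
        using l by (intro mult_right_mono) (auto simp: K_def)
      then show ?thesis
        using Q.prep_runs Q.prep_time_le by (meson order_trans)
    qed
    moreover have "runs_within ?qry q \<omega> (query_start (preprocessed ?prep d n \<epsilon> \<tau> c x \<omega>))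
        (real K * ((c powr log 2 (log 2 c / \<epsilon>) + \<tau> * c\<^sup>2) * real d * ?l)) ?S" for q \<omega>
    proof -
      interpret Q: query_run d n x \<epsilon> \<tau> c \<omega> ?S q R ?m
        by (rule run)
      have "Q.rounds \<le> C * B"
        using rounds unfolding Q.rounds_def .
      then have "real Q.query_time \<le> (5000 + 1200 * C) * (B * real d * ?l)"
        by (rule Q.query_time_le[OF _ B C0]) (simp add: growth_power_def)
      also have "\<dots> \<le> real K * (B * real d * ?l)"
        using K0 B l by (intro mult_right_mono) (auto simp: K_def)
      finally show ?thesis
        using Q.query_runs unfolding B_def by blast
    qed
    moreover have "1 / 4 \<le> measure random_tape {\<omega> \<in> space random_tape. prep_succeeds ?prep ?qry d n \<epsilon> \<tau> c x ((1 + \<epsilon>) ^ 3) q \<omega>}"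
      if q: "q \<in> l2_space d" for q
    proof -
      obtain \<rho> k t where g: "0 < \<rho>" "1 \<le> k" "real k \<le> \<tau> + 1" "t < n" "l2_dist d q (x t) \<le> \<rho>"
        "\<And>i. i < n \<Longrightarrow> l2_dist d q (x t) \<le> l2_dist d q (x i)"
        "\<And>j. real (card {i. i < n \<and> l2_dist d q (x i) < 2 ^ j * \<rho>}) \<le> c ^ j * real k"
        using E.growth_exists[OF q] by blast
      interpret Qs: query_scale d n x q \<rho>
        using g(1) E.x_separated by unfold_locales
      have dst: "Qs.dst i = l2_dist d q (x i)" for i
        unfolding Qs.dst_def l2_dist_commute[of d q] by (simp add: l2_dist_def)
      interpret G: growth_scale d n x q \<rho> c k
        using g(2,7) h(3) by unfold_locales (auto simp: dst)
      let ?L = "points.depth n"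
      let ?G = "{\<omega>. t \<in> nodes (points.build d n x ?L {..<n} \<omega>)
        \<and> query.node_key d n x q (points.build d n x ?L {..<n} \<omega>) 0 \<omega> t \<le> G.key_limit
        \<and> real (query.count_upto d n x q (points.build d n x ?L {..<n} \<omega>) 0 \<omega> G.key_limit)
            \<le> (c ^ (2 ^ ?m) + \<tau> * (c * c)) * real R}"
      have "1 / 4 \<le> measure random_tape ?G"
        using g(3,4,5) E.\<tau>_pos depth_fails[of n] R by (intro G.success_probability) (auto simp: dst)
      also have "\<dots> \<le> measure random_tape {\<omega> \<in> space random_tape. prep_succeeds ?prep ?qry d n \<epsilon> \<tau> c x ((1 + \<epsilon>) ^ 3) q \<omega>}"
      proof (rule tape.P.finite_measure_mono)
        show "?G \<subseteq> {\<omega> \<in> space random_tape. prep_succeeds ?prep ?qry d n \<epsilon> \<tau> c x ((1 + \<epsilon>) ^ 3) q \<omega>}"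
        proof
          fix \<omega> assume w: "\<omega> \<in> ?G"
          interpret Q: query_run d n x \<epsilon> \<tau> c \<omega> ?S q R ?m
            by (rule run)
          have "prep_succeeds ?prep ?qry d n \<epsilon> \<tau> c x ((1 + \<epsilon>) ^ 3) q \<omega>"
            using w g(6) h(1) by (intro Q.succeeds[where t = t and W = G.key_limit]) (auto simp: Q.rounds_def one_le_power)
          then show "\<omega> \<in> {\<omega> \<in> space random_tape. prep_succeeds ?prep ?qry d n \<epsilon> \<tau> c x ((1 + \<epsilon>) ^ 3) q \<omega>}"
            by simp
        qed
      qed (rule sets_prep_succeeds)
      finally show ?thesis .
    qed
    ultimately show ?thesis
      by blast
  qed
  show ?thesis
    by (rule exI[of _ ?prep], rule exI[of _ ?qry], rule exI[of _ K], rule exI[of _ "1 / 4"], rule conjI,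
        rule deterministic_assemble[OF query_randomness_free], rule conjI, simp, (rule allI)+, rule impI,
        (erule conjE)+, rule main; assumption)
qed

end
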